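(* Let $(K_j)$ be a sequence of abelian number fields whose conductors $m_{K_j}$ tend to $+\infty$, and let $d_K$ denote the discriminant of $K$. Then $$\frac{|Po(K_j)|}{\sqrt{|d_{K_j}|}}\to 0\quad\text{as } m_{K_j}\to+\infty.$$
   Context: The conductor $m_K$ of an abelian number field $K$ is the smallest positive integer $m$ with $K\subseteq\mathbb{Q}(\zeta_m)$. For a number field $K$ and a positive integer $q$, let $I_K^q$ be the product of all prime ideals of $\mathcal{O}_K$ of absolute norm $q$ (with $I_K^q=\mathcal{O}_K$ if there is none). The Pólya group $Po(K)$ is the subgroup of $Cl(K)$ generated by the classes of the ideals $I_K^q$; for $K/\mathbb{Q}$ Galois it is the subgroup generated by the classes of ambiguous ideals. *)

theory Defs
  imports
    Complex_Main
    "HOL-Algebra.Algebra"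
    "HOL-Algebra.Algebraic_Closure_Type"
    "HOL-Computational_Algebra.Polynomial"
    "Jordan_Normal_Form.Determinant"
begin

text \<open>
  Number fields are taken inside the field of complex numbers; every number field has an
  isomorphic copy there, and all invariants below depend only on the isomorphism class.
\<close>

abbreviation complex_ring :: "complex ring" where
  "complex_ring \<equiv> ring_of_type_algebra"

definition number_field :: "complex set \<Rightarrow> bool" where
  "number_field K \<longleftrightarrow>
     subfield K complex_ring \<and> ring.finite_dimension complex_ring \<rat> K"

abbreviation field_ring :: "complex set \<Rightarrow> complex ring" where
  "field_ring K \<equiv> complex_ring\<lparr>carrier := K\<rparr>"

definition galois_group :: "complex set \<Rightarrow> (complex \<Rightarrow> complex) monoid" where
  "galois_group K = BijGroup K
     \<lparr>carrier := {\<sigma> \<in> Bij K. \<sigma> \<in> Ring.ring_hom (field_ring K) (field_ring K) \<and> (\<forall>x\<in>\<rat>. \<sigma> x = x)}\<rparr>"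

definition galois_number_field :: "complex set \<Rightarrow> bool" where
  "galois_number_field K \<longleftrightarrow>
     number_field K \<and> {x \<in> K. \<forall>\<sigma> \<in> carrier (galois_group K). \<sigma> x = x} = \<rat>"

definition abelian_number_field :: "complex set \<Rightarrow> bool" where
  "abelian_number_field K \<longleftrightarrow> galois_number_field K \<and> comm_group (galois_group K)"

definition cyclotomic_field :: "nat \<Rightarrow> complex set" where
  "cyclotomic_field m = generate_field complex_ring (\<rat> \<union> {cis (2 * pi / real m)})"

definition conductor :: "complex set \<Rightarrow> nat" where
  "conductor K = (LEAST m. 0 < m \<and> K \<subseteq> cyclotomic_field m)"

definition integer_ring :: "complex set \<Rightarrow> complex ring" where
  "integer_ring K = complex_ring\<lparr>carrier := {x \<in> K. algebraic_int x}\<rparr>"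

definition integral_basis :: "complex set \<Rightarrow> complex list \<Rightarrow> bool" where
  "integral_basis K ws \<longleftrightarrow>
     set ws \<subseteq> carrier (integer_ring K) \<and>
     (\<forall>x \<in> carrier (integer_ring K).
        \<exists>!cs :: int list. length cs = length ws \<and> x = (\<Sum>i<length ws. of_int (cs ! i) * ws ! i))"

text \<open>Embeddings are made extensional so that distinct functions are distinct embeddings.\<close>

definition embeddings :: "complex set \<Rightarrow> (complex \<Rightarrow> complex) set" where
  "embeddings K = Ring.ring_hom (field_ring K) complex_ring \<inter> extensional K"

text \<open>
  The discriminant is $\det(\sigma_i(\omega_j))^2$, which is a rational integer independent of the
  integral basis and of the enumeration of the embeddings.
\<close>

definition discriminant :: "complex set \<Rightarrow> int" where
  "discriminant K = (THE d. \<exists>ws \<sigma>s.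
     integral_basis K ws \<and> distinct \<sigma>s \<and> set \<sigma>s = embeddings K \<and>
     of_int d = (det (mat (length \<sigma>s) (length ws) (\<lambda>(i, j). (\<sigma>s ! i) (ws ! j))))\<^sup>2)"

text \<open>
  The product of two fractional ideals is formed with the library's ideal product, computed in the
  ambient ring: it consists of the nonempty finite sums of products.
\<close>

definition fractional_ideal_group :: "complex set \<Rightarrow> complex set monoid" where
  "fractional_ideal_group K =
     \<lparr>carrier = {I. I \<noteq> {0} \<and>
        (\<exists>d \<in> carrier (integer_ring K) - {0}. ideal ((\<lambda>x. d * x) ` I) (integer_ring K))},
      monoid.mult = ideal_prod complex_ring,
      one = carrier (integer_ring K)\<rparr>"

definition principal_fractional_ideals :: "complex set \<Rightarrow> complex set set" where
  "principal_fractional_ideals K = {(\<lambda>x. a * x) ` carrier (integer_ring K) | a. a \<in> K - {0}}"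

definition class_group :: "complex set \<Rightarrow> complex set set monoid" where
  "class_group K = fractional_ideal_group K Mod principal_fractional_ideals K"

definition ideal_class :: "complex set \<Rightarrow> complex set \<Rightarrow> complex set set" where
  "ideal_class K I = principal_fractional_ideals K #>\<^bsub>fractional_ideal_group K\<^esub> I"

text \<open>The absolute norm of the zero ideal comes out as 0, the cardinality of an infinite set.\<close>

definition absolute_norm :: "complex set \<Rightarrow> complex set \<Rightarrow> nat" where
  "absolute_norm K I = card (carrier (integer_ring K Quot I))"

definition norm_ideal :: "complex set \<Rightarrow> nat \<Rightarrow> complex set" where
  "norm_ideal K q = finprod (ideals_set (integer_ring K)) (\<lambda>P. P)
     {P. primeideal P (integer_ring K) \<and> absolute_norm K P = q}"

definition polya_group :: "complex set \<Rightarrow> complex set set set" where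
  "polya_group K = generate (class_group K) {ideal_class K (norm_ideal K q) | q. 0 < q}"

end

theory Submission
  imports Defs "Jordan_Normal_Form.Char_Poly" "HOL-Number_Theory.Cong" "HOL-Real_Asymp.Real_Asymp"
begin

text \<open>
  For a rational prime \<open>p\<close> let \<open>J\<close> be the radical of \<open>p O\<close>, where \<open>O\<close> is the ring of integers of a
  Galois number field \<open>K\<close>. A proper Galois-stable ideal containing \<open>p\<close> lies in \<open>J\<close>; hence \<open>J\<close> is
  invertible and \<open>J ^ e = p O\<close> for some \<open>e\<close>. The primes above \<open>p\<close> are conjugate, so their product is
  \<open>J\<close>, and the Polya group is generated by the classes of the ideals \<open>J\<close>, whose orders are at most \<open>e\<close>.
  Traces of elements of \<open>J\<close> are divisible by \<open>p\<close>, so the index of \<open>p O\<close> in \<open>J\<close>, which is at least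
  \<open>2 ^ (e - 1)\<close>, is bounded by the \<open>p\<close>-part of the discriminant \<open>d\<close>. Thus the order of the Polya group
  is at most the product of \<open>1 + log 2 q\<close> over the prime powers \<open>q\<close> exactly dividing \<open>d\<close>, which is
  smaller than any power of \<open>d\<close>.

  It remains to see that \<open>d\<close> tends to infinity. If \<open>p\<close> divides the conductor \<open>m\<close>, some automorphism
  of the cyclotomic field that fixes the roots of unity of order \<open>m / p\<close> is nontrivial on \<open>K\<close>. It acts
  trivially modulo \<open>J\<close>, so \<open>p\<close> ramifies: then \<open>p\<close> divides \<open>d\<close> and the degree \<open>n\<close> is bounded in terms of
  \<open>d\<close>. Powers of the automorphism \<open>zeta \<mapsto> zeta ^ (1 + m' p ^ j)\<close> show that \<open>m\<close> divides \<open>d n\<^sup>2\<close>.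
\<close>

section \<open>Algebraic integers\<close>

text \<open>The ideals \<open>I_K^q\<close> of a Galois field are stable under the group, so
  \<open>J\<close> serves as a uniformizer for \<open>p\<close>: stable ideals are compared with its
  powers as in a discrete valuation ring. Its inverse comes from the determinant trick, by which an
  element that multiplies \<open>J\<close> into itself is integral. Indices are counted on
  \<open>p ^ n\<close> representatives of \<open>O\<close> modulo \<open>p O\<close>, where
  \<open>n\<close> is the degree; each strict step down the chain from \<open>J\<close> to
  \<open>J ^ e\<close> costs a factor 2, and there are \<open>e - 1\<close> steps.

  The obstacle in the second half is that the degree may grow along the sequence. When
  \<open>p\<close> ramifies, the \<open>p ^ n\<close> residues act on the at most \<bar>d\<bar>
  elements of \<open>J\<close> modulo \<open>p O\<close>, and residues with the same action differ
  by an element of \<open>J\<close>; hence \<open>p ^ n\<close> is at most \<bar>d\<bar> to the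
  power \<bar>d\<bar> + 1. This is crude, but only the divergence of \<open>d\<close> is wanted, not
  its rate. Likewise the exponent of \<open>p\<close> in \<open>m\<close> is merely bounded by twice
  its exponent in \<open>n\<close> plus one, and the factor \<open>p\<close> of \<open>d\<close>
  accounts for the one.\<close>

definition int_span :: "complex set \<Rightarrow> complex set" where
  "int_span B = {x. \<exists>c :: complex \<Rightarrow> int. x = (\<Sum>b\<in>B. of_int (c b) * b)}"

lemma int_span_add: "x \<in> int_span B \<Longrightarrow> y \<in> int_span B \<Longrightarrow> x + y \<in> int_span B"
proof -
  assume "x \<in> int_span B" "y \<in> int_span B"
  then obtain c d :: "complex \<Rightarrow> int" where "x = (\<Sum>b\<in>B. of_int (c b) * b)" "y = (\<Sum>b\<in>B. of_int (d b) * b)"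
    by (auto simp: int_span_def)
  then have "x + y = (\<Sum>b\<in>B. of_int (c b + d b) * b)"
    by (simp add: sum.distrib algebra_simps)
  then show ?thesis unfolding int_span_def by (intro CollectI exI)
qed

lemma int_span_mult_int: "x \<in> int_span B \<Longrightarrow> of_int k * x \<in> int_span B"
proof -
  assume "x \<in> int_span B"
  then obtain c :: "complex \<Rightarrow> int" where "x = (\<Sum>b\<in>B. of_int (c b) * b)"
    by (auto simp: int_span_def)
  then have "of_int k * x = (\<Sum>b\<in>B. of_int (k * c b) * b)"
    by (simp add: sum_distrib_left algebra_simps)
  then show ?thesis unfolding int_span_def by (intro CollectI exI)
qed

lemma int_span_0 [simp]: "0 \<in> int_span B"
  unfolding int_span_def by (intro CollectI exI[of _ "\<lambda>_. 0"]) auto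

lemma int_span_sum: "(\<And>a. a \<in> A \<Longrightarrow> f a \<in> int_span B) \<Longrightarrow> (\<Sum>a\<in>A. f a) \<in> int_span B"
  by (induction A rule: infinite_finite_induct) (auto intro: int_span_add)

lemma int_span_base: "finite B \<Longrightarrow> b \<in> B \<Longrightarrow> b \<in> int_span B"
proof -
  assume "finite B" "b \<in> B"
  then have "b = (\<Sum>b'\<in>B. of_int (if b' = b then 1 else 0) * b')"
    by (simp add: if_distrib[of of_int] if_distrib[of "\<lambda>z. z * _"] cong: if_cong)
  then show ?thesis unfolding int_span_def by (intro CollectI exI)
qed

lemma int_span_stable:
  assumes "\<And>b. b \<in> B \<Longrightarrow> x * b \<in> int_span B" and "y \<in> int_span B"
  shows "x * y \<in> int_span B"
proof -
  from assms(2) obtain c :: "complex \<Rightarrow> int" where "y = (\<Sum>b\<in>B. of_int (c b) * b)"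
    by (auto simp: int_span_def)
  then have "x * y = (\<Sum>b\<in>B. of_int (c b) * (x * b))"
    by (simp add: sum_distrib_left algebra_simps)
  also have "\<dots> \<in> int_span B"
    by (intro int_span_sum int_span_mult_int assms(1))
  finally show ?thesis .
qed

text \<open>The determinant trick: \<open>x\<close> is an eigenvalue of an integer matrix.\<close>

lemma algebraic_int_of_stable_span:
  assumes fin: "finite B" and nz: "\<exists>b\<in>B. b \<noteq> 0"
    and st: "\<And>b. b \<in> B \<Longrightarrow> x * b \<in> int_span B"
  shows "algebraic_int x"
proof -
  obtain xs where xs: "set xs = B" "distinct xs"
    using finite_distinct_list[OF fin] by blast
  define N where "N = length xs"
  have "\<exists>c. \<forall>b\<in>B. x * b = (\<Sum>b'\<in>B. of_int (c b b' :: int) * b')"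
    using st unfolding int_span_def by (intro bchoice) auto
  then obtain c where c: "\<And>b. b \<in> B \<Longrightarrow> x * b = (\<Sum>b'\<in>B. of_int (c b b' :: int) * b')" by blast
  define A :: "int mat" where "A = mat N N (\<lambda>(i, j). c (xs ! i) (xs ! j))"
  define v where "v = vec N (\<lambda>i. xs ! i)"
  have A: "A \<in> carrier_mat N N" by (simp add: A_def)
  have mA: "(map_mat of_int A :: complex mat) \<in> carrier_mat N N" by (simp add: A_def)
  have bij: "bij_betw (\<lambda>i. xs ! i) {0..<N} B"
    using bij_betw_nth[OF xs(2), of "{..<length xs}" B] xs by (simp add: N_def lessThan_atLeast0)
  have "map_mat of_int A *\<^sub>v v = x \<cdot>\<^sub>v v"
  proof (rule eq_vecI)
    fix i assume "i < dim_vec (x \<cdot>\<^sub>v v)"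
    then have i: "i < N" by (simp add: v_def)
    then have "xs ! i \<in> B" using xs by (auto simp: N_def)
    have "(map_mat of_int A *\<^sub>v v) $ i = (\<Sum>j = 0..<N. of_int (c (xs ! i) (xs ! j)) * xs ! j)"
      using i by (simp add: A_def v_def scalar_prod_def)
    also have "\<dots> = (\<Sum>b'\<in>B. of_int (c (xs ! i) b') * b')"
      by (rule sum.reindex_bij_betw[OF bij])
    also have "\<dots> = x * xs ! i" using c[OF \<open>xs ! i \<in> B\<close>] by simp
    finally show "(map_mat of_int A *\<^sub>v v) $ i = (x \<cdot>\<^sub>v v) $ i"
      using i by (simp add: v_def)
  qed (simp add: A_def v_def)
  moreover have "v \<noteq> 0\<^sub>v N"
  proof
    assume "v = 0\<^sub>v N"
    obtain i where "i < N" "xs ! i \<noteq> 0"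
      using nz xs by (metis N_def in_set_conv_nth)
    then show False using \<open>v = 0\<^sub>v N\<close> by (metis v_def index_vec index_zero_vec(1))
  qed
  ultimately have "eigenvalue (map_mat of_int A) x"
    unfolding eigenvalue_def eigenvector_def using mA by (intro exI[of _ v]) (auto simp: v_def)
  then have "poly (char_poly (map_mat of_int A)) x = 0"
    using eigenvalue_root_char_poly[OF mA] by simp
  then have "poly (map_poly of_int (char_poly A)) x = 0"
    by (simp add: of_int_hom.char_poly_hom[OF A])
  moreover have "lead_coeff (char_poly A) = 1"
    using degree_monic_char_poly[OF A] by simp
  ultimately show ?thesis unfolding algebraic_int_altdef_ipoly by blast
qed

text \<open>A monic integer equation read as a rewriting rule: every power of \<open>x\<close>
  reduces to an integer combination of the \<open>x ^ i\<close> with \<open>i < n\<close>.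
  Positivity of \<open>n\<close> puts \<open>1\<close> among these powers.\<close>

lemma algebraic_int_power_reduce:
  fixes x :: complex
  assumes "algebraic_int x"
  obtains n and c :: "nat \<Rightarrow> int" where "0 < n" "x ^ n = (\<Sum>i<n. of_int (c i) * x ^ i)"
proof -
  from assms obtain p where p: "poly (map_poly of_int p) x = 0" "lead_coeff p = 1"
    unfolding algebraic_int_altdef_ipoly by blast
  define n where "n = degree p"
  have dn: "degree (map_poly of_int p :: complex poly) = n"
    by (simp add: n_def degree_map_poly)
  have "(\<Sum>i\<le>n. of_int (coeff p i) * x ^ i) = 0"
    using p(1) unfolding poly_altdef dn by (simp add: coeff_map_poly)
  moreover have "{..n} = insert n {..<n}" by auto
  ultimately have eq: "x ^ n + (\<Sum>i<n. of_int (coeff p i) * x ^ i) = 0"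
    using p(2) by (simp add: n_def)
  have "n \<noteq> 0"
  proof
    assume "n = 0" then show False using eq by simp
  qed
  moreover have "x ^ n = (\<Sum>i<n. of_int (- coeff p i) * x ^ i)"
    using eq by (simp only: of_int_minus mult_minus_left sum_negf eq_neg_iff_add_eq_0)
  ultimately show thesis using that[of n "\<lambda>i. - coeff p i"] by simp
qed

text \<open>The monomials \<open>x ^ i * y ^ j\<close> with \<open>i < n\<close> and
  \<open>j < m\<close> span a group stable under multiplication by \<open>x\<close> and by
  \<open>y\<close>, hence by their sum and their product; the determinant trick then applies to
  both.\<close>

lemma
  fixes x y :: complex
  assumes "algebraic_int x" "algebraic_int y"
  shows algebraic_int_add: "algebraic_int (x + y)"
    and algebraic_int_mult: "algebraic_int (x * y)"
proof -
  obtain n and c :: "nat \<Rightarrow> int" where n: "0 < n" "x ^ n = (\<Sum>i<n. of_int (c i) * x ^ i)"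
    using algebraic_int_power_reduce[OF assms(1)] .
  obtain m and d :: "nat \<Rightarrow> int" where m: "0 < m" "y ^ m = (\<Sum>i<m. of_int (d i) * y ^ i)"
    using algebraic_int_power_reduce[OF assms(2)] .
  define B where "B = (\<lambda>(i, j). x ^ i * y ^ j) ` ({..<n} \<times> {..<m})"
  have fin: "finite B" by (simp add: B_def)
  have "(\<lambda>(i, j). x ^ i * y ^ j) (0, 0) \<in> B" unfolding B_def using n m by (intro imageI) auto
  then have "1 \<in> B" by simp
  then have nz: "\<exists>b\<in>B. b \<noteq> 0" by (intro bexI[of _ 1]) auto
  have mem: "x ^ i * y ^ j \<in> int_span B" if "i < n" "j < m" for i j
    using that by (intro int_span_base[OF fin]) (auto simp: B_def)
  have sx: "x * b \<in> int_span B" if "b \<in> B" for b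
  proof -
    from that obtain i j where ij: "i < n" "j < m" "b = x ^ i * y ^ j" by (auto simp: B_def)
    show ?thesis
    proof (cases "Suc i < n")
      case True
      then show ?thesis using mem[of "Suc i" j] ij by (simp add: mult.assoc)
    next
      case False
      then have "Suc i = n" using ij by simp
      then have "x * b = x ^ n * y ^ j" using ij by (auto simp: mult.assoc)
      also have "\<dots> = (\<Sum>i<n. of_int (c i) * (x ^ i * y ^ j))"
        unfolding n(2) by (simp add: sum_distrib_right mult.assoc)
      also have "\<dots> \<in> int_span B"
        using ij by (intro int_span_sum int_span_mult_int mem) auto
      finally show ?thesis .
    qed
  qed
  have sy: "y * b \<in> int_span B" if "b \<in> B" for b
  proof -
    from that obtain i j where ij: "i < n" "j < m" "b = x ^ i * y ^ j" by (auto simp: B_def)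
    show ?thesis
    proof (cases "Suc j < m")
      case True
      then show ?thesis using mem[of i "Suc j"] ij by (simp add: algebra_simps)
    next
      case False
      then have "Suc j = m" using ij by simp
      then have "y * b = x ^ i * y ^ m" using ij by (auto simp: algebra_simps)
      also have "\<dots> = (\<Sum>j<m. of_int (d j) * (x ^ i * y ^ j))"
        unfolding m(2) by (simp add: sum_distrib_left algebra_simps)
      also have "\<dots> \<in> int_span B"
        using ij by (intro int_span_sum int_span_mult_int mem) auto
      finally show ?thesis .
    qed
  qed
  show "algebraic_int (x + y)"
    by (rule algebraic_int_of_stable_span[OF fin nz]) (auto simp: distrib_right intro: int_span_add sx sy)
  show "algebraic_int (x * y)"
    by (rule algebraic_int_of_stable_span[OF fin nz])
      (auto simp: mult.assoc intro: int_span_stable[OF sx] sy)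
qed

lemma algebraic_int_diff:
  fixes x y :: complex
  shows "algebraic_int x \<Longrightarrow> algebraic_int y \<Longrightarrow> algebraic_int (x - y)"
  using algebraic_int_add[of x "-y"] by auto

lemma algebraic_int_power:
  fixes x :: complex
  shows "algebraic_int x \<Longrightarrow> algebraic_int (x ^ n)"
  by (induction n) (auto intro: algebraic_int_mult)

lemma algebraic_int_sum:
  fixes f :: "'a \<Rightarrow> complex"
  shows "(\<And>a. a \<in> A \<Longrightarrow> algebraic_int (f a)) \<Longrightarrow> algebraic_int (\<Sum>a\<in>A. f a)"
  by (induction A rule: infinite_finite_induct) (auto intro: algebraic_int_add)

lemma algebraic_int_prod:
  fixes f :: "'a \<Rightarrow> complex"
  shows "(\<And>a. a \<in> A \<Longrightarrow> algebraic_int (f a)) \<Longrightarrow> algebraic_int (\<Prod>a\<in>A. f a)"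
  by (induction A rule: infinite_finite_induct) (auto intro: algebraic_int_mult)

text \<open>The set \<open>S\<close> is kept abstract because products of linear factors are needed
  both with coefficients in \<open>K\<close> and with coefficients in \<open>O_K\<close>.\<close>

lemma coeff_prod_closed:
  fixes f :: "'a \<Rightarrow> complex poly"
  assumes S: "0 \<in> S" "1 \<in> S" "\<And>x y. x \<in> S \<Longrightarrow> y \<in> S \<Longrightarrow> x + y \<in> S" "\<And>x y. x \<in> S \<Longrightarrow> y \<in> S \<Longrightarrow> x * y \<in> S"
    and f: "\<And>a i. a \<in> A \<Longrightarrow> coeff (f a) i \<in> S"
  shows "coeff (\<Prod>a\<in>A. f a) i \<in> S"
proof -
  have sum: "(\<Sum>j\<in>I. h j) \<in> S" if "\<And>j. j \<in> I \<Longrightarrow> h j \<in> S" for I :: "nat set" and h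
    using that by (induction I rule: infinite_finite_induct) (auto simp: S)
  show ?thesis using f
  proof (induction A arbitrary: i rule: infinite_finite_induct)
    case (insert a A)
    then show ?case by (auto simp: coeff_mult intro!: sum S(4))
  qed (use S in \<open>auto simp: coeff_1\<close>)
qed

section \<open>Lagrange interpolation and simultaneous avoidance of zeros\<close>

definition lagrange_poly :: "complex set \<Rightarrow> (complex \<Rightarrow> complex) \<Rightarrow> complex poly" where
  "lagrange_poly C v = (\<Sum>c\<in>C. smult (v c / (\<Prod>c'\<in>C - {c}. c - c')) (\<Prod>c'\<in>C - {c}. [:- c', 1:]))"

lemma poly_lagrange_poly:
  assumes "finite C" "c \<in> C"
  shows "poly (lagrange_poly C v) c = v c"
proof -
  have "poly (lagrange_poly C v) c =
    (\<Sum>a\<in>C. v a / (\<Prod>c'\<in>C - {a}. a - c') * (\<Prod>c'\<in>C - {a}. c - c'))"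
    by (simp add: lagrange_poly_def poly_sum poly_prod)
  also have "\<dots> = (\<Sum>a\<in>C. if a = c then v c else 0)"
  proof (rule sum.cong)
    fix a assume "a \<in> C"
    show "v a / (\<Prod>c'\<in>C - {a}. a - c') * (\<Prod>c'\<in>C - {a}. c - c') = (if a = c then v c else 0)"
    proof (cases "a = c")
      case True
      have "(\<Prod>c'\<in>C - {a}. a - c') \<noteq> 0" using assms by auto
      then show ?thesis using True by simp
    next
      case False
      then have "(\<Prod>c'\<in>C - {a}. c - c') = 0" using assms by auto
      then show ?thesis using False by simp
    qed
  qed simp
  also have "\<dots> = v c" using assms by simp
  finally show ?thesis .
qed

lemma degree_lagrange_poly:
  assumes "finite C" "C \<noteq> {}"
  shows "degree (lagrange_poly C v) < card C"
proof -
  have "degree (smult (v c / (\<Prod>c'\<in>C - {c}. c - c')) (\<Prod>c'\<in>C - {c}. [:- c', 1:])) \<le> card C - 1"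
    if "c \<in> C" for c
  proof -
    have "degree (\<Prod>c'\<in>C - {c}. [:- c', 1:]) \<le> (\<Sum>c'\<in>C - {c}. degree [:- c', 1:])"
      using degree_prod_sum_le[of "C - {c}" "\<lambda>c'. [:- c', 1:]"] assms by simp
    also have "\<dots> = card C - 1" using that assms by simp
    finally show ?thesis by (meson degree_smult_le order_trans)
  qed
  then have "degree (lagrange_poly C v) \<le> card C - 1"
    unfolding lagrange_poly_def using assms by (intro degree_sum_le) auto
  moreover have "card C > 0" using assms by (simp add: card_gt_0_iff)
  ultimately show ?thesis by linarith
qed

text \<open>Move along \<open>\<theta> + c * y\<close> with natural \<open>c\<close>, where
  \<open>y\<close> is not a zero of the new map: each map vanishes for at most one \<open>c\<close>,
  and for none if it kills \<open>y\<close>, since then it does not kill \<open>\<theta>\<close>.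
  Applied to differences of automorphisms, this yields primitive elements.\<close>

lemma ex_avoiding_zeros:
  fixes F :: "(complex \<Rightarrow> complex) set" and K :: "complex set"
  assumes "finite F" "0 \<in> K" and K: "\<And>x y. x \<in> K \<Longrightarrow> y \<in> K \<Longrightarrow> x + y \<in> K"
    and add: "\<And>h x y. h \<in> F \<Longrightarrow> x \<in> K \<Longrightarrow> y \<in> K \<Longrightarrow> h (x + y) = h x + (h y :: complex)"
    and nz: "\<And>h. h \<in> F \<Longrightarrow> \<exists>x\<in>K. h x \<noteq> 0"
  shows "\<exists>\<theta>\<in>K. \<forall>h\<in>F. h \<theta> \<noteq> 0"
  using assms(1) add nz
proof (induction F rule: finite_induct)
  case empty
  then show ?case using assms(2) by auto
next
  case (insert h F)
  then obtain \<theta> where \<theta>: "\<theta> \<in> K" "\<forall>h\<in>F. h \<theta> \<noteq> 0" by auto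
  obtain y where y: "y \<in> K" "h y \<noteq> 0" using insert.prems(2)[of h] by auto
  have mK: "of_nat c * y \<in> K" for c :: nat
    by (induction c) (auto simp: algebra_simps assms(2) y intro: K)
  have hm: "g (of_nat c * y) = of_nat c * g y" if "g \<in> insert h F" for g and c :: nat
  proof (induction c)
    case 0
    have "g (0 + 0) = g 0 + g 0" using insert.prems(1)[OF that] assms(2) by blast
    then show ?case by simp
  next
    case (Suc c)
    have "g (of_nat c * y + y) = g (of_nat c * y) + g y"
      using insert.prems(1)[OF that mK y(1)] by simp
    then show ?case using Suc by (simp add: algebra_simps)
  qed
  have ha: "g (\<theta> + of_nat c * y) = g \<theta> + of_nat c * g y" if "g \<in> insert h F" for g and c :: nat
    using insert.prems(1)[OF that \<theta>(1) mK] hm[OF that] by simp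
  have fin1: "finite {c :: nat. g \<theta> + of_nat c * g y = 0}" if "g \<in> insert h F" for g
  proof (cases "g y = 0")
    case True
    then have "g \<theta> \<noteq> 0" using that y \<theta> by auto
    then show ?thesis using True by simp
  next
    case False
    have "{c :: nat. g \<theta> + of_nat c * g y = 0} \<subseteq> {c. (of_nat c :: complex) = - g \<theta> / g y}"
      using False by (auto simp: field_simps add_eq_0_iff)
    moreover have "finite {c :: nat. (of_nat c :: complex) = z}" for z
    proof (cases "\<exists>c. of_nat c = z")
      case True
      then obtain c0 where "of_nat c0 = z" by blast
      then have "{c :: nat. (of_nat c :: complex) = z} \<subseteq> {c0}" by auto
      then show ?thesis by (meson finite.emptyI finite.insertI finite_subset)
    qed auto
    ultimately show ?thesis by (meson finite_subset)
  qed
  have "finite (\<Union>g\<in>insert h F. {c :: nat. g \<theta> + of_nat c * g y = 0})"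
    using insert.hyps(1) fin1 by blast
  then obtain c :: nat where "c \<notin> (\<Union>g\<in>insert h F. {c :: nat. g \<theta> + of_nat c * g y = 0})"
    using ex_new_if_finite[OF infinite_UNIV_nat] by blast
  then have "\<forall>g\<in>insert h F. g (\<theta> + of_nat c * y) \<noteq> 0" using ha by auto
  then show ?case using K[OF \<theta>(1) mK] by blast
qed

section \<open>Galois number fields\<close>

abbreviation gal :: "complex set \<Rightarrow> (complex \<Rightarrow> complex) set" where
  "gal K \<equiv> carrier (galois_group K)"

lemma gal_iff:
  "\<sigma> \<in> gal K \<longleftrightarrow> \<sigma> \<in> extensional K \<and> bij_betw \<sigma> K K \<and> \<sigma> 1 = 1 \<and> (\<forall>x\<in>\<rat>. \<sigma> x = x) \<and>
     (\<forall>x\<in>K. \<forall>y\<in>K. \<sigma> (x + y) = \<sigma> x + \<sigma> y \<and> \<sigma> (x * y) = \<sigma> x * \<sigma> y)"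
proof -
  have "\<sigma> \<in> Ring.ring_hom (field_ring K) (field_ring K) \<longleftrightarrow> \<sigma> \<in> K \<rightarrow> K \<and> \<sigma> 1 = 1 \<and>
     (\<forall>x\<in>K. \<forall>y\<in>K. \<sigma> (x + y) = \<sigma> x + \<sigma> y \<and> \<sigma> (x * y) = \<sigma> x * \<sigma> y)"
    unfolding Ring.ring_hom_def by (auto simp: ring_of_type_algebra_def)
  then show ?thesis
    by (auto simp: galois_group_def BijGroup_def Bij_def bij_betw_def)
qed

lemma common_denominator:
  assumes "finite A" "\<And>a. a \<in> A \<Longrightarrow> q a \<in> (\<rat> :: complex set)"
  shows "\<exists>D :: int. D \<noteq> 0 \<and> (\<forall>a\<in>A. of_int D * q a \<in> \<int>)"
  using assms
proof (induction A rule: finite_induct)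
  case empty
  then show ?case by (intro exI[of _ 1]) auto
next
  case (insert b A)
  then obtain D :: int where D: "D \<noteq> 0" "\<forall>a\<in>A. of_int D * q a \<in> \<int>" by auto
  obtain m n where mn: "n > 0" "q b = of_int m / of_int n"
    using insert.prems[OF insertI1] by (elim Rats_cases') auto
  have "of_int (n * D) * q a \<in> \<int>" if "a \<in> A" for a
    using D that Ints_mult[OF Ints_of_int, of "of_int D * q a" n] by (simp add: mult.assoc)
  moreover have "of_int (n * D) * q b = of_int (D * m)" using mn by simp
  then have "of_int (n * D) * q b \<in> \<int>" by (metis Ints_of_int)
  ultimately show ?case using D mn by (intro exI[of _ "n * D"]) auto
qed

text \<open>Artin's description of a finite Galois extension: a finite group of automorphisms with
  fixed field \<rat>. The degree enters as the order of the group, and the characteristic polynomial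
  makes every element algebraic. The locale serves the given field and the cyclotomic fields
  alike.\<close>

locale galois_ext =
  fixes K :: "complex set"
  assumes K_0 [simp]: "0 \<in> K" and K_1 [simp]: "1 \<in> K"
    and K_add: "x \<in> K \<Longrightarrow> y \<in> K \<Longrightarrow> x + y \<in> K"
    and K_mult: "x \<in> K \<Longrightarrow> y \<in> K \<Longrightarrow> x * y \<in> K"
    and K_minus: "x \<in> K \<Longrightarrow> - x \<in> K"
    and K_inverse: "x \<in> K \<Longrightarrow> inverse x \<in> K"
    and finite_gal [simp]: "finite (gal K)"
    and fixed_Rats: "x \<in> K \<Longrightarrow> (\<And>g. g \<in> gal K \<Longrightarrow> g x = x) \<Longrightarrow> x \<in> \<rat>"
begin

lemma K_diff: "x \<in> K \<Longrightarrow> y \<in> K \<Longrightarrow> x - y \<in> K"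
  using K_add[of x "-y"] K_minus[of y] by simp

lemma K_divide: "x \<in> K \<Longrightarrow> y \<in> K \<Longrightarrow> x / y \<in> K"
  using K_mult[of x "inverse y"] K_inverse[of y] by (simp add: divide_inverse)

lemma K_power: "x \<in> K \<Longrightarrow> x ^ n \<in> K"
  by (induction n) (auto intro: K_mult)

lemma K_sum: "(\<And>a. a \<in> A \<Longrightarrow> f a \<in> K) \<Longrightarrow> (\<Sum>a\<in>A. f a) \<in> K"
  by (induction A rule: infinite_finite_induct) (auto intro: K_add)

lemma K_prod: "(\<And>a. a \<in> A \<Longrightarrow> f a \<in> K) \<Longrightarrow> (\<Prod>a\<in>A. f a) \<in> K"
  by (induction A rule: infinite_finite_induct) (auto intro: K_mult)

lemma K_of_nat [simp]: "of_nat n \<in> K"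
  by (induction n) (auto intro: K_add)

lemma K_of_int [simp]: "of_int n \<in> K"
  by (cases n rule: int_cases2) (auto intro: K_minus)

lemma K_Rats: "x \<in> \<rat> \<Longrightarrow> x \<in> K"
  by (elim Rats_cases') (auto intro: K_divide)

lemmas K_intros = K_add K_mult K_minus K_diff K_divide K_power K_sum K_prod

context
  fixes g assumes g: "g \<in> gal K"
begin

lemma g_in: "x \<in> K \<Longrightarrow> g x \<in> K"
  using g unfolding gal_iff by (auto simp: bij_betw_def)

lemma g_add: "x \<in> K \<Longrightarrow> y \<in> K \<Longrightarrow> g (x + y) = g x + g y"
  using g unfolding gal_iff by auto

lemma g_mult: "x \<in> K \<Longrightarrow> y \<in> K \<Longrightarrow> g (x * y) = g x * g y"
  using g unfolding gal_iff by auto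

lemma g_Rats: "x \<in> \<rat> \<Longrightarrow> g x = x"
  using g unfolding gal_iff by auto

lemma g_0 [simp]: "g 0 = 0" by (rule g_Rats) auto
lemma g_1 [simp]: "g 1 = 1" by (rule g_Rats) auto
lemma g_of_int [simp]: "g (of_int k) = of_int k" by (rule g_Rats) auto
lemma g_of_nat [simp]: "g (of_nat k) = of_nat k" by (rule g_Rats) auto

lemma g_inj: "x \<in> K \<Longrightarrow> y \<in> K \<Longrightarrow> g x = g y \<longleftrightarrow> x = y"
  using g unfolding gal_iff by (auto simp: bij_betw_def inj_on_def)

lemma g_eq_0: "x \<in> K \<Longrightarrow> g x = 0 \<longleftrightarrow> x = 0"
  using g_inj[of x 0] by simp

lemma g_minus: "x \<in> K \<Longrightarrow> g (- x) = - g x"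
proof -
  assume x: "x \<in> K"
  have "g (- x) + g x = g (- x + x)" by (subst g_add) (auto simp: x K_minus)
  also have "\<dots> = 0" by simp
  finally show ?thesis by (simp add: add_eq_0_iff2)
qed

lemma g_diff: "x \<in> K \<Longrightarrow> y \<in> K \<Longrightarrow> g (x - y) = g x - g y"
  using g_add[of x "-y"] g_minus[of y] K_minus[of y] by simp

lemma g_power: "x \<in> K \<Longrightarrow> g (x ^ n) = g x ^ n"
  by (induction n) (auto simp: g_mult K_power)

lemma g_sum: "(\<And>a. a \<in> A \<Longrightarrow> f a \<in> K) \<Longrightarrow> g (\<Sum>a\<in>A. f a) = (\<Sum>a\<in>A. g (f a))"
  by (induction A rule: infinite_finite_induct) (auto simp: g_add K_sum)

lemma g_prod: "(\<And>a. a \<in> A \<Longrightarrow> f a \<in> K) \<Longrightarrow> g (\<Prod>a\<in>A. f a) = (\<Prod>a\<in>A. g (f a))"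
  by (induction A rule: infinite_finite_induct) (auto simp: g_mult K_prod)

lemma g_poly:
  assumes "\<And>i. coeff p i \<in> K" "x \<in> K"
  shows "poly p x \<in> K" "g (poly p x) = poly (map_poly g p) (g x)"
proof -
  show "poly p x \<in> K" unfolding poly_altdef by (intro K_intros assms)
  have "g (poly p x) = (\<Sum>i\<le>degree p. g (coeff p i) * g x ^ i)"
    unfolding poly_altdef using assms by (simp add: g_sum K_mult K_power g_mult g_power)
  also have "\<dots> = poly (map_poly g p) (g x)"
    using assms by (simp add: poly_altdef degree_map_poly coeff_map_poly g_eq_0)
  finally show "g (poly p x) = poly (map_poly g p) (g x)" .
qed

lemma g_poly_Rats:
  assumes "\<And>i. coeff p i \<in> \<rat>" "x \<in> K"
  shows "g (poly p x) = poly p (g x)"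
proof -
  have "map_poly g p = p" by (rule poly_eqI) (simp add: coeff_map_poly g_Rats assms)
  then show ?thesis using g_poly(2)[of p x] K_Rats assms by auto
qed

end

lemma K_poly: "(\<And>i. coeff p i \<in> K) \<Longrightarrow> x \<in> K \<Longrightarrow> poly p x \<in> K"
  unfolding poly_altdef by (intro K_intros)

section \<open>Translations in the Galois group\<close>

lemma gal_id: "restrict (\<lambda>x. x) K \<in> gal K"
  unfolding gal_iff by (auto simp: K_Rats K_add K_mult bij_betw_def inj_on_def)

lemma gal_eqI: "g \<in> gal K \<Longrightarrow> h \<in> gal K \<Longrightarrow> (\<And>x. x \<in> K \<Longrightarrow> g x = h x) \<Longrightarrow> g = h"
  by (meson extensionalityI gal_iff)

lemma gal_compose: "g \<in> gal K \<Longrightarrow> h \<in> gal K \<Longrightarrow> compose K g h \<in> gal K"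
proof -
  assume gh: "g \<in> gal K" "h \<in> gal K"
  have "bij_betw (compose K g h) K K"
    using gh unfolding gal_iff by (intro bij_betw_compose) auto
  then show ?thesis using gh unfolding gal_iff[of "compose K g h"]
    by (auto simp: compose_def K_Rats K_add K_mult g_add g_mult g_in g_Rats)
qed

lemma compose_apply [simp]: "x \<in> K \<Longrightarrow> compose K g h x = g (h x)"
  by (simp add: compose_def)

text \<open>An injective self-map of the finite group is onto; the inverses of automorphisms are
  obtained from this surjectivity.\<close>

lemma bij_left: "h \<in> gal K \<Longrightarrow> bij_betw (\<lambda>g. compose K h g) (gal K) (gal K)"
proof -
  assume h: "h \<in> gal K"
  have "inj_on (\<lambda>g. compose K h g) (gal K)"
  proof
    fix g g' assume gg: "g \<in> gal K" "g' \<in> gal K" "compose K h g = compose K h g'"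
    show "g = g'"
    proof (rule gal_eqI[OF gg(1,2)])
      fix x assume x: "x \<in> K"
      then have "h (g x) = h (g' x)" using gg(3) by (metis compose_apply)
      then show "g x = g' x" using g_inj[OF h] g_in gg x by blast
    qed
  qed
  then show ?thesis
    using h gal_compose by (simp add: bij_betw_def endo_inj_surj image_subset_iff)
qed

lemma gal_inverse_ex: "h \<in> gal K \<Longrightarrow> \<exists>k\<in>gal K. \<forall>x\<in>K. h (k x) = x \<and> k (h x) = x"
proof -
  assume h: "h \<in> gal K"
  then obtain k where k: "k \<in> gal K" "compose K h k = restrict (\<lambda>x. x) K"
    using bij_left[OF h] gal_id unfolding bij_betw_def by (metis imageE)
  have 1: "h (k x) = x" if "x \<in> K" for x
    using k(2) that by (metis compose_apply restrict_apply')
  moreover have "k (h x) = x" if "x \<in> K" for x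
  proof -
    have "h (k (h x)) = h x" using 1 g_in[OF h] that by auto
    then show ?thesis using g_inj[OF h] g_in[OF h] g_in[OF k(1)] that by auto
  qed
  ultimately show ?thesis using k by blast
qed

text \<open>Reindexing by a left translation. This lemma and its multiplicative twin make traces,
  norms and characteristic polynomials invariant under the group.\<close>

lemma sum_gal_shift:
  assumes "h \<in> gal K" "x \<in> K" shows "(\<Sum>g\<in>gal K. f (h (g x))) = (\<Sum>g\<in>gal K. f (g x))"
  using sum.reindex_bij_betw[OF bij_left[OF assms(1)], of "\<lambda>g. f (g x)"] assms(2) by simp

lemma prod_gal_shift:
  assumes "h \<in> gal K" "x \<in> K" shows "(\<Prod>g\<in>gal K. f (h (g x))) = (\<Prod>g\<in>gal K. f (g x))"
  using prod.reindex_bij_betw[OF bij_left[OF assms(1)], of "\<lambda>g. f (g x)"] assms(2) by simp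

lemma card_gal_pos: "card (gal K) > 0"
  using gal_id by (auto simp: card_gt_0_iff)

section \<open>The ring of integers, traces and norms\<close>

definition O_K :: "complex set" where "O_K = {x \<in> K. algebraic_int x}"

lemma carrier_integer_ring: "carrier (integer_ring K) = O_K"
  by (simp add: integer_ring_def O_K_def)

lemma O_K_sub: "x \<in> O_K \<Longrightarrow> x \<in> K" by (simp add: O_K_def)
lemma O_0 [simp]: "0 \<in> O_K" by (simp add: O_K_def)
lemma O_1 [simp]: "1 \<in> O_K" by (simp add: O_K_def)
lemma O_of_int [simp]: "of_int k \<in> O_K" by (simp add: O_K_def)
lemma O_of_nat [simp]: "of_nat k \<in> O_K" by (simp add: O_K_def)
lemma O_add: "x \<in> O_K \<Longrightarrow> y \<in> O_K \<Longrightarrow> x + y \<in> O_K"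
  by (simp add: O_K_def K_add algebraic_int_add)
lemma O_mult: "x \<in> O_K \<Longrightarrow> y \<in> O_K \<Longrightarrow> x * y \<in> O_K"
  by (simp add: O_K_def K_mult algebraic_int_mult)
lemma O_minus: "x \<in> O_K \<Longrightarrow> - x \<in> O_K"
  by (simp add: O_K_def K_minus)
lemma O_diff: "x \<in> O_K \<Longrightarrow> y \<in> O_K \<Longrightarrow> x - y \<in> O_K"
  by (simp add: O_K_def K_diff algebraic_int_diff)
lemma O_power: "x \<in> O_K \<Longrightarrow> x ^ n \<in> O_K"
  by (simp add: O_K_def K_power algebraic_int_power)
lemma O_sum: "(\<And>a. a \<in> A \<Longrightarrow> f a \<in> O_K) \<Longrightarrow> (\<Sum>a\<in>A. f a) \<in> O_K"
  by (simp add: O_K_def K_sum algebraic_int_sum)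
lemma O_prod: "(\<And>a. a \<in> A \<Longrightarrow> f a \<in> O_K) \<Longrightarrow> (\<Prod>a\<in>A. f a) \<in> O_K"
  by (simp add: O_K_def K_prod algebraic_int_prod)

lemma O_Rats: "x \<in> O_K \<Longrightarrow> x \<in> \<rat> \<Longrightarrow> x \<in> \<int>"
  using rational_algebraic_int_is_int by (auto simp: O_K_def)

lemma g_O: "g \<in> gal K \<Longrightarrow> x \<in> O_K \<Longrightarrow> g x \<in> O_K"
proof -
  assume g: "g \<in> gal K" and x: "x \<in> O_K"
  then obtain p where p: "lead_coeff p = 1" "\<forall>i. coeff p i \<in> \<int>" "poly p x = 0"
    by (auto simp: O_K_def algebraic_int.simps)
  have "poly p (g x) = g (poly p x)"
    using p(2) O_K_sub[OF x] Ints_subset_Rats by (intro g_poly_Rats[OF g, symmetric]) auto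
  then have "poly p (g x) = 0" using p g by simp
  then show ?thesis using p x g g_in by (auto simp: O_K_def algebraic_int.simps)
qed

lemma fixed_Ints: "x \<in> O_K \<Longrightarrow> (\<And>g. g \<in> gal K \<Longrightarrow> g x = x) \<Longrightarrow> x \<in> \<int>"
  using O_Rats fixed_Rats O_K_sub by blast

lemma trace_Ints: "x \<in> O_K \<Longrightarrow> (\<Sum>g\<in>gal K. g x) \<in> \<int>"
proof (rule fixed_Ints)
  assume x: "x \<in> O_K"
  show "(\<Sum>g\<in>gal K. g x) \<in> O_K" by (rule O_sum) (rule g_O[OF _ x])
  fix h assume h: "h \<in> gal K"
  have "h (\<Sum>g\<in>gal K. g x) = (\<Sum>g\<in>gal K. h (g x))"
    by (rule g_sum[OF h]) (rule g_in[OF _ O_K_sub[OF x]])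
  then show "h (\<Sum>g\<in>gal K. g x) = (\<Sum>g\<in>gal K. g x)"
    using sum_gal_shift[OF h, of x "\<lambda>x. x"] x O_K_sub by simp
qed

lemma norm_Ints: "x \<in> O_K \<Longrightarrow> (\<Prod>g\<in>gal K. g x) \<in> \<int>"
proof (rule fixed_Ints)
  assume x: "x \<in> O_K"
  show "(\<Prod>g\<in>gal K. g x) \<in> O_K" by (rule O_prod) (rule g_O[OF _ x])
  fix h assume h: "h \<in> gal K"
  have "h (\<Prod>g\<in>gal K. g x) = (\<Prod>g\<in>gal K. h (g x))"
    by (rule g_prod[OF h]) (rule g_in[OF _ O_K_sub[OF x]])
  then show "h (\<Prod>g\<in>gal K. g x) = (\<Prod>g\<in>gal K. g x)"
    using prod_gal_shift[OF h, of x "\<lambda>x. x"] x O_K_sub by simp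
qed

text \<open>The characteristic polynomial of multiplication by \<open>x\<close>, a power of the
  minimal polynomial; unlike the latter it has the same degree for every \<open>x\<close>.\<close>

definition char_pol :: "complex \<Rightarrow> complex poly" where
  "char_pol x = (\<Prod>g\<in>gal K. [:- g x, 1:])"

lemma char_pol_root: "x \<in> K \<Longrightarrow> poly (char_pol x) y = 0 \<longleftrightarrow> (\<exists>g\<in>gal K. y = g x)"
  by (auto simp: char_pol_def poly_prod)

lemma char_pol_self: "x \<in> K \<Longrightarrow> poly (char_pol x) x = 0"
  using char_pol_root gal_id by (metis restrict_apply')

lemma degree_char_pol: "degree (char_pol x) = card (gal K)" "lead_coeff (char_pol x) = 1"
proof -
  show "degree (char_pol x) = card (gal K)"
    unfolding char_pol_def by (subst degree_prod_eq_sum_degree) auto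
  show "lead_coeff (char_pol x) = 1"
    unfolding char_pol_def by (subst lead_coeff_prod) auto
qed

lemma map_poly_char_pol:
  assumes h: "h \<in> gal K" and x: "x \<in> K"
  shows "map_poly h (char_pol x) = char_pol x"
proof -
  have lin: "coeff [:- c, 1:] i \<in> K" if "c \<in> K" for c i
    using that by (auto simp: coeff_pCons K_minus split: nat.splits)
  have mult: "map_poly h (p * q) = map_poly h p * map_poly h q"
    if "\<And>i. coeff p i \<in> K" "\<And>i. coeff q i \<in> K" for p q
    by (rule poly_eqI)
      (simp add: coeff_map_poly coeff_mult g_0[OF h] g_sum[OF h] that K_mult g_mult[OF h])
  \<comment> \<open>Membership of the coefficients in \<open>K\<close> is carried along because
    \<open>h\<close> is multiplicative only there.\<close>
  have "map_poly h (\<Prod>g\<in>A. [:- g x, 1:]) = (\<Prod>g\<in>A. [:- h (g x), 1:]) \<and>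
     (\<forall>i. coeff (\<Prod>g\<in>A. [:- g x, 1:]) i \<in> K)" if "finite A" "A \<subseteq> gal K" for A
    using that
  proof (induction A rule: finite_induct)
    case empty
    then show ?case by (auto simp: coeff_1 map_poly_1 g_0[OF h] g_1[OF h])
  next
    case (insert g A)
    have gK: "g x \<in> K" using insert x g_in by auto
    have 1: "map_poly h [:- g x, 1:] = [:- h (g x), 1:]"
      using gK by (intro poly_eqI) (auto simp: coeff_map_poly g_0[OF h] coeff_pCons g_minus[OF h] g_1[OF h] split: nat.splits)
    have 2: "coeff ([:- g x, 1:] * (\<Prod>g\<in>A. [:- g x, 1:])) i \<in> K" for i
      unfolding coeff_mult by (rule K_sum) (use insert in \<open>auto intro!: K_mult lin[OF gK]\<close>)
    have "map_poly h ([:- g x, 1:] * (\<Prod>g\<in>A. [:- g x, 1:])) =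
       map_poly h [:- g x, 1:] * map_poly h (\<Prod>g\<in>A. [:- g x, 1:])"
      using insert lin[OF gK] by (intro mult) auto
    then show ?case using insert 1 2 by (auto simp del: mult_pCons_left)
  qed
  then have "map_poly h (char_pol x) = (\<Prod>g\<in>gal K. [:- h (g x), 1:])"
    unfolding char_pol_def using finite_gal by blast
  then show ?thesis
    using prod_gal_shift[OF h x, of "\<lambda>z. [:- z, 1:]"] by (simp add: char_pol_def)
qed

lemma coeff_char_pol_K: assumes x: "x \<in> K" shows "coeff (char_pol x) i \<in> K"
  unfolding char_pol_def
  by (rule coeff_prod_closed) (auto simp: coeff_pCons K_add K_mult K_minus g_in[OF _ x] split: nat.splits)

lemma coeff_char_pol_Rats: "x \<in> K \<Longrightarrow> coeff (char_pol x) i \<in> \<rat>"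
proof (rule fixed_Rats)
  assume x: "x \<in> K"
  then show "coeff (char_pol x) i \<in> K" by (rule coeff_char_pol_K)
  fix h assume h: "h \<in> gal K"
  have "coeff (map_poly h (char_pol x)) i = h (coeff (char_pol x) i)"
    by (simp add: coeff_map_poly g_0[OF h])
  then show "h (coeff (char_pol x) i) = coeff (char_pol x) i"
    using map_poly_char_pol[OF h x] by simp
qed

lemma coeff_char_pol_O: assumes x: "x \<in> O_K" shows "coeff (char_pol x) i \<in> O_K"
  unfolding char_pol_def
  by (rule coeff_prod_closed) (auto simp: coeff_pCons O_add O_mult O_minus g_O[OF _ x] split: nat.splits)

lemma coeff_char_pol_Ints: "x \<in> O_K \<Longrightarrow> coeff (char_pol x) i \<in> \<int>"
  using coeff_char_pol_O coeff_char_pol_Rats O_Rats O_K_sub by blast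

text \<open>The map sends roots of the rational polynomial \<open>char_pol x\<close> to roots, hence \<open>K\<close> into itself.\<close>

lemma hom_root:
  assumes f: "\<And>x y. x \<in> K \<Longrightarrow> y \<in> K \<Longrightarrow> f (x + y) = f x + f y"
      "\<And>x y. x \<in> K \<Longrightarrow> y \<in> K \<Longrightarrow> f (x * y) = f x * (f y :: complex)" "\<And>q. q \<in> \<rat> \<Longrightarrow> f q = q"
    and x: "x \<in> K"
  shows "\<exists>g\<in>gal K. f x = g x"
proof -
  have f0: "f 0 = 0" by (rule f(3)) auto
  have f1: "f 1 = 1" by (rule f(3)) auto
  have pw: "f (x ^ n) = f x ^ n" for n
    by (induction n) (auto simp: f1 f(2) x K_power)
  have sm: "f (\<Sum>i\<in>A. h i) = (\<Sum>i\<in>A. f (h i))" if "\<And>i. i \<in> A \<Longrightarrow> h i \<in> K" for A :: "nat set" and h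
    using that
  proof (induction A rule: infinite_finite_induct)
    case (insert a A)
    have "f (h a + (\<Sum>i\<in>A. h i)) = f (h a) + f (\<Sum>i\<in>A. h i)"
      using insert.prems by (intro f(1) K_sum) auto
    then show ?case using insert by simp
  qed (auto simp: f0)
  have cK: "coeff (char_pol x) i \<in> K" "coeff (char_pol x) i \<in> \<rat>" for i
    using coeff_char_pol_Rats[OF x] K_Rats by auto
  have "f (poly (char_pol x) x) = (\<Sum>i\<le>degree (char_pol x). f (coeff (char_pol x) i * x ^ i))"
    unfolding poly_altdef using cK x by (intro sm) (auto intro: K_mult K_power)
  also have "\<dots> = poly (char_pol x) (f x)"
    unfolding poly_altdef by (rule sum.cong) (auto simp: f(2) cK x K_power pw f(3))
  finally have "poly (char_pol x) (f x) = 0" using char_pol_self[OF x] f0 by simp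
  then show ?thesis using char_pol_root[OF x] by auto
qed

lemma hom_restrict_gal:
  assumes f: "\<And>x y. x \<in> K \<Longrightarrow> y \<in> K \<Longrightarrow> f (x + y) = f x + f y"
      "\<And>x y. x \<in> K \<Longrightarrow> y \<in> K \<Longrightarrow> f (x * y) = f x * (f y :: complex)" "\<And>q. q \<in> \<rat> \<Longrightarrow> f q = q"
  shows "restrict f K \<in> gal K"
proof -
  have fK: "f x \<in> K" if "x \<in> K" for x
    using hom_root[of f x] f that g_in by metis
  have f0: "f x = 0 \<longleftrightarrow> x = 0" if x: "x \<in> K" for x
  proof
    assume "f x = 0"
    then show "x = 0" using hom_root[of f x] f x g_eq_0 by metis
  qed (use f(3)[of 0] in auto)
  have inj: "inj_on f K"
  proof
    fix x y assume xy: "x \<in> K" "y \<in> K" "f x = f y"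
    have "f x = f (x - y) + f y" using f(1)[of "x - y" y] xy K_diff by simp
    then have "f (x - y) = 0" using xy by simp
    then show "x = y" using f0[of "x - y"] xy K_diff by simp
  qed
  have surj: "x \<in> f ` K" if x: "x \<in> K" for x
  proof -
    \<comment> \<open>An injective map that sends the finite orbit of \<open>x\<close> into itself
      permutes it, so \<open>x\<close> is a value.\<close>
    define R where "R = (\<lambda>g. g x) ` gal K"
    have RK: "R \<subseteq> K" using x g_in by (auto simp: R_def)
    have fR: "f ` R \<subseteq> R"
    proof
      fix z assume "z \<in> f ` R"
      then obtain g where g: "g \<in> gal K" "z = f (g x)" by (auto simp: R_def)
      then obtain h where h: "h \<in> gal K" "z = h (g x)"
        using hom_root[of f "g x"] f g_in[OF g(1) x] by metis
      then have "z = compose K h g x" using x by simp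
      then show "z \<in> R" using gal_compose[OF h(1) g(1)] unfolding R_def by blast
    qed
    have "finite R" by (simp add: R_def)
    then have "f ` R = R" using fR inj inj_on_subset[OF _ RK] endo_inj_surj by blast
    moreover have "x \<in> R" unfolding R_def using gal_id x by (intro image_eqI[of _ _ "restrict (\<lambda>x. x) K"]) auto
    ultimately show ?thesis using RK by blast
  qed
  have "bij_betw (restrict f K) K K"
    unfolding bij_betw_def using inj surj fK by (auto simp: inj_on_restrict_eq)
  then show ?thesis unfolding gal_iff
    by (auto simp: f K_add K_mult K_Rats)
qed

text \<open>Normality of \<open>K\<close>: a ring homomorphism fixes \<rat> and by
  \<open>hom_root\<close> sends each element to a conjugate. The discriminant, defined through
  embeddings, thereby becomes a determinant indexed by the Galois group.\<close>

lemma embeddings_eq_gal: "embeddings K = gal K"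
proof (intro equalityI subsetI)
  fix f assume "f \<in> embeddings K"
  then have f: "f \<in> extensional K" "f 1 = 1" "\<And>x y. x \<in> K \<Longrightarrow> y \<in> K \<Longrightarrow> f (x + y) = f x + f y"
      "\<And>x y. x \<in> K \<Longrightarrow> y \<in> K \<Longrightarrow> f (x * y) = f x * f y"
    by (auto simp: embeddings_def Ring.ring_hom_def ring_of_type_algebra_def)
  have "f (0 + 0) = f 0 + f 0" by (rule f(3)) auto
  then have f0: "f 0 = 0" by simp
  have fn: "f (of_nat n) = of_nat n" for n
    by (induction n) (auto simp: f0 f)
  have fm: "f (- x) = - f x" if "x \<in> K" for x
    using f(3)[of x "-x"] that f0 K_minus by (simp add: add_eq_0_iff)
  have fi: "f (of_int n) = of_int n" for n
    by (cases n rule: int_cases2) (auto simp: fn fm)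
  have "f q = q" if "q \<in> \<rat>" for q
  proof -
    from that obtain a b where ab: "b > 0" "q = of_int a / of_int b" by (elim Rats_cases') auto
    then have "f (q * of_int b) = of_int a" by (simp add: fi)
    moreover have "f (q * of_int b) = f q * of_int b" using f(4)[of q "of_int b"] that K_Rats fi by simp
    ultimately have "f q * of_int b = q * of_int b" using ab by simp
    moreover have "(of_int b :: complex) \<noteq> 0" using ab(1) by simp
    ultimately show ?thesis by (metis mult_right_cancel)
  qed
  then have "restrict f K \<in> gal K" using f by (intro hom_restrict_gal) auto
  then show "f \<in> gal K" using f(1) by (simp add: extensional_restrict)
next
  fix g assume g: "g \<in> gal K"
  then show "g \<in> embeddings K"
    by (auto simp: embeddings_def Ring.ring_hom_def ring_of_type_algebra_def g_add[OF g] g_mult[OF g]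
          g_1[OF g] gal_iff[of g])
qed

definition conjugates :: "complex \<Rightarrow> complex set" where
  "conjugates \<theta> = (\<lambda>g. g \<theta>) ` gal K"

lemma finite_conjugates [simp]: "finite (conjugates \<theta>)"
  by (simp add: conjugates_def)

lemma self_conjugate: "\<theta> \<in> K \<Longrightarrow> \<theta> \<in> conjugates \<theta>"
  unfolding conjugates_def using gal_id by (intro image_eqI[of _ _ "restrict (\<lambda>x. x) K"]) auto

text \<open>The Galois correspondence for the field generated by \<open>\<theta>\<close>: if the
  stabilizer of \<open>\<theta>\<close> fixes \<open>x\<close>, then
  \<open>g \<theta> \<mapsto> g x\<close> is well defined, and its interpolation polynomial is
  invariant by uniqueness, hence rational. The values \<open>v\<close> are exposed because their
  integrality bounds the denominators of the coefficients in \<open>ex_zbasis\<close>.\<close>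

lemma interpolation:
  assumes \<theta>: "\<theta> \<in> K" and x: "x \<in> K" and fixed: "\<And>g. g \<in> gal K \<Longrightarrow> g \<theta> = \<theta> \<Longrightarrow> g x = x"
  shows "\<exists>v. (\<forall>g\<in>gal K. v (g \<theta>) = g x) \<and> poly (lagrange_poly (conjugates \<theta>) v) \<theta> = x \<and>
     (\<forall>i. coeff (lagrange_poly (conjugates \<theta>) v) i \<in> \<rat>)"
proof -
  define v where "v c = (SOME g. g \<in> gal K \<and> g \<theta> = c) x" for c
  have v: "v (g \<theta>) = g x" if g: "g \<in> gal K" for g
  proof -
    define h where "h = (SOME h. h \<in> gal K \<and> h \<theta> = g \<theta>)"
    have h: "h \<in> gal K" "h \<theta> = g \<theta>"
      unfolding h_def using someI[of "\<lambda>h. h \<in> gal K \<and> h \<theta> = g \<theta>" g] g by auto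
    obtain k where k: "k \<in> gal K" "\<And>x. x \<in> K \<Longrightarrow> g (k x) = x \<and> k (g x) = x"
      using gal_inverse_ex[OF g] by blast
    have "compose K k h \<theta> = \<theta>" using h k \<theta> by simp
    then have "compose K k h x = x" using fixed gal_compose k h by blast
    then have "k (h x) = x" using x by simp
    then have "h x = g x" using k(2)[of "h x"] g_in[OF h(1) x] by simp
    then show ?thesis by (simp add: v_def h_def)
  qed
  let ?C = "conjugates \<theta>"
  define P where "P = lagrange_poly ?C v"
  have CK: "c \<in> K" if "c \<in> ?C" for c using that \<theta> g_in by (auto simp: conjugates_def)
  have vK: "v c \<in> K" if "c \<in> ?C" for c using that v x g_in by (auto simp: conjugates_def)
  have cK: "coeff P i \<in> K" for i
  proof -
    have "coeff (\<Prod>c'\<in>?C - {c}. [:- c', 1:]) i \<in> K" for c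
      by (rule coeff_prod_closed) (auto simp: coeff_pCons K_add K_mult K_minus CK split: nat.splits)
    moreover have "(\<Prod>c'\<in>?C - {c}. c - c') \<in> K" if "c \<in> ?C" for c
      by (rule K_prod) (use that in \<open>auto simp: K_diff CK\<close>)
    ultimately show ?thesis
      unfolding P_def lagrange_poly_def coeff_sum coeff_smult
      by (intro K_sum K_mult K_divide) (auto simp: vK)
  qed
  have ne: "?C \<noteq> {}" using self_conjugate[OF \<theta>] by auto
  have Pv: "poly P c = v c" if "c \<in> ?C" for c
    using that unfolding P_def by (intro poly_lagrange_poly) auto
  have deg: "degree P < card ?C" unfolding P_def by (rule degree_lagrange_poly[OF _ ne]) simp
  have "coeff P i \<in> \<rat>" for i
  proof (rule fixed_Rats[OF cK])
    fix h assume h: "h \<in> gal K"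
    \<comment> \<open>Both sides have degree below the number of conjugates and agree at all of
      them, because \<open>h\<close> permutes the conjugates along with the prescribed
      values.\<close>
    have "map_poly h P = P"
    proof (rule poly_eqI_degree[of ?C])
      fix c assume "c \<in> ?C"
      then obtain g where g: "g \<in> gal K" "c = g \<theta>" by (auto simp: conjugates_def)
      obtain k where k: "k \<in> gal K" "compose K h k = g"
        using bij_left[OF h] g(1) unfolding bij_betw_def by (metis imageE)
      then have hk: "h (k y) = g y" if "y \<in> K" for y using that by auto
      have kC: "k \<theta> \<in> ?C" using k by (auto simp: conjugates_def)
      have "poly (map_poly h P) c = poly (map_poly h P) (h (k \<theta>))" using hk \<theta> g by simp
      also have "\<dots> = h (poly P (k \<theta>))"
        using g_poly(2)[OF h, of P "k \<theta>"] cK CK[OF kC] by simp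
      also have "\<dots> = h (k x)" using Pv[OF kC] v[OF k(1)] by simp
      also have "\<dots> = v c" using hk x g v by simp
      also have "\<dots> = poly P c" using Pv \<open>c \<in> ?C\<close> by simp
      finally show "poly (map_poly h P) c = poly P c" .
    next
      show "degree P < card ?C" by (rule deg)
      then show "degree (map_poly h P) < card ?C"
        using degree_map_poly_le[of h P] by linarith
    qed
    moreover have "coeff (map_poly h P) i = h (coeff P i)"
      by (simp add: coeff_map_poly g_0[OF h])
    ultimately show "h (coeff P i) = coeff P i" by simp
  qed
  moreover have "poly P \<theta> = x"
  proof -
    have "poly P \<theta> = v (restrict (\<lambda>x. x) K \<theta>)" using Pv self_conjugate[OF \<theta>] \<theta> by simp
    also have "\<dots> = x" using v[OF gal_id] x by simp
    finally show ?thesis .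
  qed
  ultimately show ?thesis using v P_def by blast
qed

lemma integral_multiple:
  assumes x: "x \<in> K"
  obtains D :: int where "D \<noteq> 0" "of_int D * x \<in> O_K"
proof -
  define n where "n = card (gal K)"
  define q where "q = coeff (char_pol x)"
  have qn: "q n = 1" using degree_char_pol[of x] by (simp add: q_def n_def)
  obtain D :: int where D: "D \<noteq> 0" "\<And>i. i \<le> n \<Longrightarrow> of_int D * q i \<in> \<int>"
    using common_denominator[of "{..n}" q] coeff_char_pol_Rats[OF x] by (auto simp: q_def)
  \<comment> \<open>\<open>Q\<close> is \<open>D ^ n\<close> times the characteristic polynomial
    with \<open>X / D\<close> substituted: the leading coefficient stays 1 and every other one
    receives at least one factor \<open>D\<close>.\<close>
  define Q where "Q = (\<Sum>i\<le>n. monom (of_int D ^ (n - i) * q i) i)"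
  have cQ: "coeff Q i = (if i \<le> n then of_int D ^ (n - i) * q i else 0)" for i
    by (simp add: Q_def coeff_sum)
  have "degree Q = n"
    by (intro antisym degree_le le_degree) (auto simp: cQ qn)
  then have "lead_coeff Q = 1" by (simp add: cQ qn)
  moreover have "\<forall>i. coeff Q i \<in> \<int>"
  proof
    fix i
    show "coeff Q i \<in> \<int>"
    proof (cases "i < n")
      case True
      then have "coeff Q i = of_int (D ^ (n - i - 1)) * (of_int D * q i)"
        by (simp add: cQ flip: power_Suc2 mult.assoc add: Suc_diff_Suc)
      then show ?thesis using D(2)[of i] True by (metis Ints_mult Ints_of_int less_imp_le)
    qed (auto simp: cQ qn)
  qed
  moreover have "poly Q (of_int D * x) = of_int D ^ n * poly (char_pol x) x"
  proof -
    have "poly Q (of_int D * x) = (\<Sum>i\<le>n. of_int D ^ n * (q i * x ^ i))"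
      unfolding poly_altdef \<open>degree Q = n\<close>
    proof (rule sum.cong)
      fix i assume "i \<in> {..n}"
      then have "(of_int D :: complex) ^ n = of_int D ^ (n - i) * of_int D ^ i" by (simp flip: power_add)
      then show "coeff Q i * (of_int D * x) ^ i = of_int D ^ n * (q i * x ^ i)"
        using \<open>i \<in> {..n}\<close> by (simp add: cQ power_mult_distrib)
    qed simp
    also have "\<dots> = of_int D ^ n * poly (char_pol x) x"
      unfolding poly_altdef degree_char_pol by (simp add: n_def q_def sum_distrib_left)
    finally show ?thesis .
  qed
  then have "poly Q (of_int D * x) = 0" using char_pol_self[OF x] by simp
  ultimately have "algebraic_int (of_int D * x)" by (auto simp: algebraic_int.simps)
  then show thesis using D x that by (auto simp: O_K_def K_mult)
qed

lemma primitive_element: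
  obtains \<theta> where "\<theta> \<in> O_K" "inj_on (\<lambda>g. g \<theta>) (gal K)"
proof -
  define F where "F = (\<lambda>(g, h) x. g x - h x) ` {(g, h) \<in> gal K \<times> gal K. g \<noteq> h}"
  have "finite F" unfolding F_def
    by (intro finite_imageI finite_subset[OF _ finite_cartesian_product[OF finite_gal finite_gal]]) auto
  moreover have "f (x + y) = f x + f y" if "f \<in> F" "x \<in> K" "y \<in> K" for f x y
    using that by (auto simp: F_def g_add)
  moreover have "\<exists>x\<in>K. f x \<noteq> 0" if "f \<in> F" for f
  proof -
    from that obtain g h where gh: "g \<in> gal K" "h \<in> gal K" "g \<noteq> h" "f = (\<lambda>x. g x - h x)"
      by (auto simp: F_def)
    then obtain x where "x \<in> K" "g x \<noteq> h x" using gal_eqI[OF gh(1,2)] by blast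
    then show ?thesis using gh(4) by auto
  qed
  ultimately obtain \<theta> where \<theta>: "\<theta> \<in> K" "\<forall>f\<in>F. f \<theta> \<noteq> 0"
    using ex_avoiding_zeros[of F K] K_add by auto
  have inj: "inj_on (\<lambda>g. g \<theta>) (gal K)"
  proof (rule inj_onI, rule ccontr)
    fix g h assume "g \<in> gal K" "h \<in> gal K" "g \<theta> = h \<theta>" "g \<noteq> h"
    then have "(\<lambda>x. g x - h x) \<in> F" by (auto simp: F_def intro!: image_eqI[of _ _ "(g, h)"])
    then show False using \<theta> \<open>g \<theta> = h \<theta>\<close> by auto
  qed
  obtain D :: int where D: "D \<noteq> 0" "of_int D * \<theta> \<in> O_K"
    using integral_multiple[OF \<theta>(1)] by blast
  have "inj_on (\<lambda>g. g (of_int D * \<theta>)) (gal K)"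
    using inj D \<theta> by (auto simp: inj_on_def g_mult)
  then show thesis using D that by blast
qed

end

section \<open>Integral bases and the discriminant\<close>

text \<open>A basis of \<open>A\<close> as a free abelian group, indexed by the numbers below
  \<open>n\<close>. A function instead of a list allows a single member to be exchanged by function
  update.\<close>

definition zbasis :: "complex set \<Rightarrow> nat \<Rightarrow> (nat \<Rightarrow> complex) \<Rightarrow> bool" where
  "zbasis A n w \<longleftrightarrow> (\<forall>i<n. w i \<in> A) \<and>
     (\<forall>x\<in>A. \<exists>c :: nat \<Rightarrow> int. x = (\<Sum>i<n. of_int (c i) * w i)) \<and>
     (\<forall>c :: nat \<Rightarrow> int. (\<Sum>i<n. of_int (c i) * w i) = 0 \<longrightarrow> (\<forall>i<n. c i = 0))"

lemma zbasis_in: "zbasis A n w \<Longrightarrow> i < n \<Longrightarrow> w i \<in> A"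
  by (simp add: zbasis_def)

lemma zbasis_repr:
  assumes "zbasis A n w" "x \<in> A"
  obtains c :: "nat \<Rightarrow> int" where "x = (\<Sum>i<n. of_int (c i) * w i)"
  using assms by (auto simp: zbasis_def)

lemma zbasis_indep:
  fixes c :: "nat \<Rightarrow> int"
  assumes "zbasis A n w" "(\<Sum>i<n. of_int (c i) * w i) = 0" "i < n"
  shows "c i = 0"
  using assms by (simp add: zbasis_def)

text \<open>\<open>A\<close> lies between the lattice spanned by \<open>th\<close> and its multiple
  by \<open>1 / D\<close>. As for the Hermite normal form, induct on the rank: take an element
  \<open>w\<close> whose last coordinate is the least positive one; subtracting multiples of it
  moves every element of \<open>A\<close> into the part \<open>A'\<close> with last coordinate zero.
  Coordinates are those of \<open>D * x\<close>, so that they are integers.\<close>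

lemma zbasis_ex_lattice:
  fixes th :: "nat \<Rightarrow> complex" and D :: int
  assumes "D \<noteq> 0" "0 \<in> A" "\<And>x y. x \<in> A \<Longrightarrow> y \<in> A \<Longrightarrow> x - y \<in> A" "\<And>i. i < n \<Longrightarrow> th i \<in> A"
    and "\<And>x. x \<in> A \<Longrightarrow> \<exists>c :: nat \<Rightarrow> int. of_int D * x = (\<Sum>i<n. of_int (c i) * th i)"
    and "\<And>c :: nat \<Rightarrow> int. (\<Sum>i<n. of_int (c i) * th i) = 0 \<Longrightarrow> \<forall>i<n. c i = 0"
  shows "\<exists>w. zbasis A n w"
  using assms(2-)
proof (induction n arbitrary: A)
  case 0
  then have "A \<subseteq> {0}" using assms(1) by auto
  then show ?case by (auto simp: zbasis_def)
next
  case (Suc n)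
  note diff = Suc.prems(2)
  have minus: "- x \<in> A" if "x \<in> A" for x using diff[OF Suc.prems(1) that] by simp
  have add: "x + y \<in> A" if "x \<in> A" "y \<in> A" for x y using diff[OF that(1) minus[OF that(2)]] by simp
  have nmult: "of_nat k * x \<in> A" if "x \<in> A" for k :: nat and x
    by (induction k) (auto simp: Suc.prems(1) distrib_right intro: add that)
  have imult: "of_int k * x \<in> A" if "x \<in> A" for k :: int and x
    using nmult[OF that] minus[OF nmult[OF that]] by (cases k rule: int_cases2) auto
  define rep where "rep x c \<longleftrightarrow> of_int D * x = (\<Sum>i<Suc n. of_int (c i :: int) * th i)" for x c
  have rep_ex: "\<exists>c. rep x c" if "x \<in> A" for x using Suc.prems(4)[OF that] by (simp add: rep_def)
  have rep_comb: "rep (x - of_int q * y) (\<lambda>i. c i - q * d i)" if "rep x c" "rep y d" for x y c d q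
  proof -
    have "of_int D * (x - of_int q * y) = of_int D * x - of_int q * (of_int D * y)"
      by (simp add: algebra_simps)
    also have "\<dots> = (\<Sum>i<Suc n. of_int (c i) * th i) - of_int q * (\<Sum>i<Suc n. of_int (d i) * th i)"
      using that by (simp only: rep_def)
    also have "\<dots> = (\<Sum>i<Suc n. of_int (c i - q * d i) * th i)"
      by (simp add: left_diff_distrib sum_subtractf sum_distrib_left mult.assoc del: sum.lessThan_Suc)
    finally show ?thesis by (simp only: rep_def)
  qed
  define pos where "pos k \<longleftrightarrow> 0 < k \<and> (\<exists>x\<in>A. \<exists>c. rep x c \<and> c n = int k)" for k
  have "rep (th n) (\<lambda>i. if i = n then D else 0)"
    by (simp add: rep_def)
  moreover from this have "rep (- th n) (\<lambda>i. if i = n then - D else 0)"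
    by (simp add: rep_def)
  moreover have "th n \<in> A" using Suc.prems(3) by simp
  \<comment> \<open>The last coordinate of \<open>th n\<close> is \<open>D\<close>, because
    coordinates refer to \<open>D * x\<close>; the sign of \<open>D\<close> decides between
    \<open>th n\<close> and its negative.\<close>
  ultimately have "pos (nat \<bar>D\<bar>)"
    unfolding pos_def using assms(1) minus
    apply (cases "D > 0")
    subgoal by (auto intro!: bexI[of _ "th n"] exI[of _ "\<lambda>i. if i = n then D else 0"])
    subgoal by (auto intro!: bexI[of _ "- th n"] exI[of _ "\<lambda>i. if i = n then - D else 0"])
    done
  then have "pos (LEAST k. pos k)" by (rule LeastI)
  moreover define k0 where "k0 = (LEAST k. pos k)"
  ultimately obtain w c0 where k0: "0 < k0" "w \<in> A" "rep w c0" "c0 n = int k0" by (auto simp: pos_def)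
  have k0_min: "\<not> pos k" if "k < k0" for k using that not_less_Least k0_def by blast
  define A' where "A' = {x \<in> A. \<exists>c. of_int D * x = (\<Sum>i<n. of_int (c i :: int) * th i)}"
  have split: "\<exists>q. x - of_int q * w \<in> A'" if x: "x \<in> A" for x
  proof -
    obtain c where c: "rep x c" using rep_ex[OF x] by blast
    define q where "q = c n div int k0"
    define y where "y = x - of_int q * w"
    define d where "d = (\<lambda>i. c i - q * c0 i)"
    have y: "y \<in> A" "rep y d" using rep_comb[OF c k0(3)] x k0(2) imult diff by (auto simp: y_def d_def)
    have dn: "d n = c n mod int k0" using k0(4) by (simp add: d_def q_def minus_div_mult_eq_mod)
    have "d n = 0"
    proof (rule ccontr)
      assume "d n \<noteq> 0"
      moreover have "0 \<le> d n" "d n < int k0" using k0(1) by (auto simp: dn)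
      ultimately have "pos (nat (d n))" "nat (d n) < k0" unfolding pos_def using y by auto
      then show False using k0_min by blast
    qed
    then have "of_int D * y = (\<Sum>i<n. of_int (d i) * th i)" using y(2) by (simp add: rep_def)
    then show ?thesis using y(1) by (auto simp: A'_def y_def)
  qed
  have "\<exists>w'. zbasis A' n w'"
  proof (rule Suc.IH)
    show "0 \<in> A'" using Suc.prems(1) by (auto simp: A'_def intro!: exI[of _ "\<lambda>_. 0"])
    show "x - y \<in> A'" if xy: "x \<in> A'" "y \<in> A'" for x y
    proof -
      obtain c d where "of_int D * x = (\<Sum>i<n. of_int (c i :: int) * th i)"
          "of_int D * y = (\<Sum>i<n. of_int (d i :: int) * th i)" using xy by (auto simp: A'_def)
      then have "of_int D * (x - y) = (\<Sum>i<n. of_int (c i - d i) * th i)"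
        by (simp add: algebra_simps sum_subtractf)
      moreover have "x - y \<in> A" using xy diff by (simp add: A'_def)
      ultimately show ?thesis unfolding A'_def by (intro CollectI conjI exI)
    qed
    show "th i \<in> A'" if "i < n" for i
    proof -
      have "of_int D * th i = (\<Sum>j<n. of_int (if j = i then D else 0) * th j)"
        using that by (simp add: if_distrib[of of_int] if_distrib[of "\<lambda>z. z * _"] cong: if_cong)
      then show ?thesis using Suc.prems(3)[of i] that unfolding A'_def by (intro CollectI conjI exI) auto
    qed
    show "\<exists>c :: nat \<Rightarrow> int. of_int D * x = (\<Sum>i<n. of_int (c i) * th i)" if "x \<in> A'" for x
      using that by (auto simp: A'_def)
    show "\<forall>i<n. c i = 0" if "(\<Sum>i<n. of_int (c i) * th i) = 0" for c :: "nat \<Rightarrow> int"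
    proof (intro allI impI)
      fix i assume "i < n"
      have "(\<Sum>i<Suc n. of_int ((c(n := 0)) i) * th i) = 0" using that by simp
      then have "\<forall>i<Suc n. (c(n := 0)) i = 0" by (rule Suc.prems(5))
      then have "(c(n := 0)) i = 0" using \<open>i < n\<close> less_SucI by blast
      then show "c i = 0" using \<open>i < n\<close> by simp
    qed
  qed
  then obtain w' where w': "zbasis A' n w'" by blast
  have "zbasis A (Suc n) (w'(n := w))"
    unfolding zbasis_def
  proof (intro conjI allI ballI impI)
    fix i assume "i < Suc n"
    then show "(w'(n := w)) i \<in> A" using w' k0(2) by (auto simp: zbasis_def A'_def less_Suc_eq)
  next
    fix x assume "x \<in> A"
    then obtain q where "x - of_int q * w \<in> A'" using split by blast
    then obtain c :: "nat \<Rightarrow> int" where "x - of_int q * w = (\<Sum>i<n. of_int (c i) * w' i)"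
      using w' by (auto simp: zbasis_def)
    then have "x = (\<Sum>i<Suc n. of_int ((c(n := q)) i) * (w'(n := w)) i)"
      by (simp add: algebra_simps)
    then show "\<exists>c :: nat \<Rightarrow> int. x = (\<Sum>i<Suc n. of_int (c i) * (w'(n := w)) i)" by blast
  next
    fix c :: "nat \<Rightarrow> int" and i
    assume "(\<Sum>i<Suc n. of_int (c i) * (w'(n := w)) i) = 0" and i: "i < Suc n"
    then have eq: "(\<Sum>i<n. of_int (c i) * w' i) + of_int (c n) * w = 0" by simp
    define y where "y = (\<Sum>i<n. of_int (c i) * w' i)"
    have "\<exists>e. \<forall>i<n. of_int D * w' i = (\<Sum>j<n. of_int (e i j :: int) * th j)"
    proof -
      have "\<forall>i. \<exists>e. i < n \<longrightarrow> of_int D * w' i = (\<Sum>j<n. of_int (e j :: int) * th j)"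
        using w' by (auto simp: zbasis_def A'_def)
      then show ?thesis by (rule choice)
    qed
    then obtain e where e: "\<And>i. i < n \<Longrightarrow> of_int D * w' i = (\<Sum>j<n. of_int (e i j :: int) * th j)" by blast
    have "of_int D * y = (\<Sum>i<n. of_int (c i) * (of_int D * w' i))"
      by (simp add: y_def sum_distrib_left algebra_simps)
    also have "\<dots> = (\<Sum>i<n. \<Sum>j<n. of_int (c i * e i j) * th j)"
      by (intro sum.cong) (auto simp: e sum_distrib_left mult.assoc)
    also have "\<dots> = (\<Sum>j<n. of_int (\<Sum>i<n. c i * e i j) * th j)"
      by (subst sum.swap) (simp add: sum_distrib_right)
    finally have "of_int D * y = (\<Sum>j<n. of_int (\<Sum>i<n. c i * e i j) * th j)" .
    moreover define E where "E j = (\<Sum>i<n. c i * e i j)" for j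
    ultimately have Dy: "of_int D * y = (\<Sum>j<n. of_int (E j) * th j)" by simp
    \<comment> \<open>Compare last coordinates: only \<open>w\<close> contributes to them, with
      \<open>c0 n > 0\<close>, so \<open>c n\<close> vanishes and the relation descends to
      \<open>A'\<close>.\<close>
    have "0 = of_int D * (y + of_int (c n) * w)" using eq by (simp add: y_def)
    also have "\<dots> = of_int D * y + of_int (c n) * (of_int D * w)" by (simp add: algebra_simps)
    also have "\<dots> = (\<Sum>j<n. of_int (E j) * th j) + of_int (c n) * (\<Sum>j<Suc n. of_int (c0 j) * th j)"
      using k0(3) by (simp only: Dy rep_def)
    also have "\<dots> = (\<Sum>j<n. of_int (E j + c n * c0 j) * th j) + of_int (c n * c0 n) * th n"
      by (simp add: distrib_right distrib_left sum.distrib sum_distrib_left mult.assoc)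
    also have "\<dots> = (\<Sum>j<Suc n. of_int ((\<lambda>j. if j < n then E j + c n * c0 j else c n * c0 n) j) * th j)"
      by simp
    finally have "(\<Sum>j<Suc n. of_int ((\<lambda>j. if j < n then E j + c n * c0 j else c n * c0 n) j) * th j) = 0" by simp
    then have "\<forall>j<Suc n. (\<lambda>j. if j < n then E j + c n * c0 j else c n * c0 n) j = 0" by (rule Suc.prems(5))
    then have "c n * c0 n = 0" by auto
    then have "c n = 0" using k0 by simp
    then have "\<forall>i<n. c i = 0" using w' eq by (simp add: zbasis_def)
    then show "c i = 0" using i \<open>c n = 0\<close> by (auto simp: less_Suc_eq)
  qed
  then show ?case by blast
qed

text \<open>Count \<open>A\<close> modulo \<open>2 A\<close>: a basis of length \<open>m\<close>
  gives \<open>2 ^ m\<close> classes, and the coordinates modulo 2 in the other basis separate at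
  most \<open>2 ^ n\<close> of them. The definition of the discriminant admits integral bases of any
  length, so the length has to be pinned down.\<close>

lemma zbasis_card_le:
  assumes w: "zbasis A m w" and w': "zbasis A n w'"
  shows "m \<le> n"
proof -
  have "\<exists>c. \<forall>i<m. w i = (\<Sum>j<n. of_int (c i j :: int) * w' j)"
  proof -
    have "\<forall>i. \<exists>c. i < m \<longrightarrow> w i = (\<Sum>j<n. of_int (c j :: int) * w' j)"
      using w w' by (auto simp: zbasis_def)
    then show ?thesis by (rule choice)
  qed
  then obtain c where c: "\<And>i. i < m \<Longrightarrow> w i = (\<Sum>j<n. of_int (c i j :: int) * w' j)" by blast
  have "\<exists>c. \<forall>i<n. w' i = (\<Sum>j<m. of_int (c i j :: int) * w j)"
  proof -
    have "\<forall>i. \<exists>c. i < n \<longrightarrow> w' i = (\<Sum>j<m. of_int (c j :: int) * w j)"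
      using w w' by (auto simp: zbasis_def)
    then show ?thesis by (rule choice)
  qed
  then obtain e where e: "\<And>i. i < n \<Longrightarrow> w' i = (\<Sum>j<m. of_int (e i j :: int) * w j)" by blast
  \<comment> \<open>\<open>F a\<close> lists the coordinates modulo 2, in the basis
    \<open>w'\<close>, of the combination of \<open>w\<close> with coefficients
    \<open>a\<close>.\<close>
  define F where "F a = restrict (\<lambda>j. (\<Sum>i<m. a i * c i j) mod 2) {..<n}" for a :: "nat \<Rightarrow> int"
  have "inj_on F (PiE {..<m} (\<lambda>_. {0, 1}))"
  proof (rule inj_onI)
    fix a b assume a: "a \<in> PiE {..<m} (\<lambda>_. {0, 1})" and b: "b \<in> PiE {..<m} (\<lambda>_. {0, 1})" and ab: "F a = F b"
    have "2 dvd (\<Sum>i<m. a i * c i j) - (\<Sum>i<m. b i * c i j)" if "j < n" for j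
    proof -
      have "F a j = F b j" using ab by simp
      then show ?thesis using that by (simp add: F_def mod_eq_dvd_iff)
    qed
    then have "\<forall>j. \<exists>u. j < n \<longrightarrow> (\<Sum>i<m. (a i - b i) * c i j) = 2 * u"
      by (auto simp: dvd_def sum_subtractf algebra_simps)
    then obtain u where u: "\<And>j. j < n \<Longrightarrow> (\<Sum>i<m. (a i - b i) * c i j) = 2 * u j" by metis
    have "(\<Sum>i<m. of_int (a i - b i) * w i) = (\<Sum>i<m. \<Sum>j<n. of_int ((a i - b i) * c i j) * w' j)"
      by (intro sum.cong) (auto simp: c sum_distrib_left mult.assoc)
    also have "\<dots> = (\<Sum>j<n. of_int (\<Sum>i<m. (a i - b i) * c i j) * w' j)"
      by (subst sum.swap) (simp add: sum_distrib_right)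
    also have "\<dots> = (\<Sum>j<n. \<Sum>i<m. of_int (2 * u j * e j i) * w i)"
      by (intro sum.cong) (auto simp: u e sum_distrib_left mult.assoc)
    also have "\<dots> = (\<Sum>i<m. of_int (2 * (\<Sum>j<n. u j * e j i)) * w i)"
      by (subst sum.swap) (simp add: sum_distrib_right sum_distrib_left mult.assoc)
    finally have "(\<Sum>i<m. of_int (a i - b i - 2 * (\<Sum>j<n. u j * e j i)) * w i) = 0"
      by (simp only: of_int_diff left_diff_distrib sum_subtractf) simp
    then have z: "\<forall>i<m. a i - b i - 2 * (\<Sum>j<n. u j * e j i) = 0"
      by (intro allI impI zbasis_indep[OF w])
    have "a i = b i" if "i < m" for i
    proof -
      define k where "k = (\<Sum>j<n. u j * e j i)"
      have "a i - b i = 2 * k" using z that by (simp add: k_def)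
      moreover have "a i = 0 \<or> a i = 1" "b i = 0 \<or> b i = 1" using a b that by auto
      ultimately show ?thesis by presburger
    qed
    then show "a = b" by (intro PiE_ext[OF a b]) simp
  qed
  moreover have "F a \<in> PiE {..<n} (\<lambda>_. {0, 1})" for a
    unfolding F_def by (rule restrict_PiE_iff[THEN iffD2]) (simp add: mod2_eq_if)
  then have "F ` PiE {..<m} (\<lambda>_. {0, 1}) \<subseteq> PiE {..<n} (\<lambda>_. {0, 1})" by blast
  ultimately have "card (PiE {..<m} (\<lambda>_. {0, 1 :: int})) \<le> card (PiE {..<n} (\<lambda>_. {0, 1 :: int}))"
    by (meson card_inj_on_le finite.emptyI finite.insertI finite_PiE finite_lessThan)
  then show ?thesis by (simp add: card_PiE numeral_2_eq_2)
qed

lemma zbasis_card: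
  assumes "zbasis A m w" and "zbasis A n w'"
  shows "m = n"
  using zbasis_card_le[of A m w n w'] zbasis_card_le[of A n w' m w] assms by (intro antisym) auto

context galois_ext
begin

lemma integral_basis_iff: "integral_basis K ws \<longleftrightarrow> zbasis O_K (length ws) ((!) ws)"
proof
  assume ib: "integral_basis K ws"
  then have sub: "set ws \<subseteq> O_K" and ex: "\<And>x. x \<in> O_K \<Longrightarrow> \<exists>!cs :: int list. length cs = length ws \<and>
     x = (\<Sum>i<length ws. of_int (cs ! i) * ws ! i)"
    unfolding integral_basis_def carrier_integer_ring by auto
  show "zbasis O_K (length ws) ((!) ws)" unfolding zbasis_def
  proof (intro conjI allI ballI impI)
    fix x assume "x \<in> O_K"
    then obtain cs :: "int list" where "x = (\<Sum>i<length ws. of_int (cs ! i) * ws ! i)" using ex by blast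
    then show "\<exists>c :: nat \<Rightarrow> int. x = (\<Sum>i<length ws. of_int (c i) * ws ! i)" by blast
  next
    fix c :: "nat \<Rightarrow> int" and i
    assume c: "(\<Sum>i<length ws. of_int (c i) * ws ! i) = 0" and i: "i < length ws"
    define l1 where "l1 = map c [0..<length ws]"
    define l2 where "l2 = map (\<lambda>_. 0 :: int) [0..<length ws]"
    have "l1 = l2"
    proof -
      have "length l1 = length ws \<and> 0 = (\<Sum>i<length ws. of_int (l1 ! i) * ws ! i)"
        using c by (simp add: l1_def)
      moreover have "length l2 = length ws \<and> 0 = (\<Sum>i<length ws. of_int (l2 ! i) * ws ! i)"
        by (simp add: l2_def)
      ultimately show ?thesis using ex[OF O_0] by blast
    qed
    then have "l1 ! i = l2 ! i" by simp
    then show "c i = 0" using i by (simp add: l1_def l2_def)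
  qed (use sub in auto)
next
  assume z: "zbasis O_K (length ws) ((!) ws)"
  show "integral_basis K ws" unfolding integral_basis_def carrier_integer_ring
  proof (intro conjI ballI)
    show "set ws \<subseteq> O_K" using z by (auto simp: zbasis_def in_set_conv_nth)
    fix x assume "x \<in> O_K"
    then obtain c :: "nat \<Rightarrow> int" where c: "x = (\<Sum>i<length ws. of_int (c i) * ws ! i)"
      using z by (auto simp: zbasis_def)
    show "\<exists>!cs :: int list. length cs = length ws \<and> x = (\<Sum>i<length ws. of_int (cs ! i) * ws ! i)"
    proof (rule ex1I)
      show "length (map c [0..<length ws]) = length ws \<and>
         x = (\<Sum>i<length ws. of_int (map c [0..<length ws] ! i) * ws ! i)" using c by simp
      fix cs :: "int list"
      assume cs: "length cs = length ws \<and> x = (\<Sum>i<length ws. of_int (cs ! i) * ws ! i)"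
      then have "(\<Sum>i<length ws. of_int (cs ! i - c i) * ws ! i) = 0"
        using c by (simp add: left_diff_distrib sum_subtractf)
      then have "\<forall>i<length ws. cs ! i - c i = 0"
        by (intro allI impI zbasis_indep[OF z])
      then show "cs = map c [0..<length ws]" using cs by (intro nth_equalityI) auto
    qed
  qed
qed

definition deg :: nat where "deg = card (gal K)"

lemma deg_pos: "deg > 0" using card_gal_pos by (simp add: deg_def)

lemma card_conjugates_primitive: "inj_on (\<lambda>g. g \<theta>) (gal K) \<Longrightarrow> card (conjugates \<theta>) = deg"
  by (simp add: conjugates_def deg_def card_image)

text \<open>Nonvanishing of the Vandermonde determinant of the conjugates, in terms of the roots of
  a polynomial of degree below \<open>deg\<close>. Complex coefficients are allowed so that the
  lemma also applies to kernel vectors of \<open>emb_mat\<close>.\<close>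

lemma primitive_powers_independent:
  fixes a :: "nat \<Rightarrow> complex"
  assumes inj: "inj_on (\<lambda>g. g \<theta>) (gal K)" and a: "\<And>g. g \<in> gal K \<Longrightarrow> (\<Sum>i<deg. a i * g \<theta> ^ i) = 0"
  shows "\<forall>i<deg. a i = 0"
proof -
  define p where "p = (\<Sum>i<deg. monom (a i) i)"
  have cp: "coeff p i = (if i < deg then a i else 0)" for i
    by (simp add: p_def coeff_sum)
  have "degree p < deg"
    using deg_pos by (intro degree_lessI) (auto simp: cp)
  moreover have "poly p c = 0" if "c \<in> conjugates \<theta>" for c
    using that a by (auto simp: p_def poly_sum poly_monom conjugates_def)
  ultimately have "p = 0"
    using deg_pos card_conjugates_primitive[OF inj] by (intro poly_eqI_degree[of "conjugates \<theta>"]) auto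
  then show ?thesis using cp by (metis coeff_0)
qed

text \<open>Interpolation at the conjugates of an integral primitive element writes each
  \<open>x\<close> in \<open>O_K\<close> as a rational combination of powers of
  \<open>\<theta>\<close>; the only denominators are the \<open>f c\<close>, which divide
  \<open>D\<close>. So \<open>D\<close> times each coefficient is both integral and rational, and
  the lattice lemma applies.\<close>

lemma ex_zbasis: "\<exists>w. zbasis O_K deg w"
proof -
  obtain \<theta> where \<theta>: "\<theta> \<in> O_K" "inj_on (\<lambda>g. g \<theta>) (gal K)" by (rule primitive_element)
  let ?C = "conjugates \<theta>"
  have CO: "c \<in> O_K" if "c \<in> ?C" for c using that g_O[OF _ \<theta>(1)] by (auto simp: conjugates_def)
  define f where "f c = (\<Prod>c'\<in>?C - {c}. c - c')" for c
  have fO: "f c \<in> O_K" if "c \<in> ?C" for c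
    unfolding f_def by (rule O_prod) (use that CO O_diff in auto)
  define D0 where "D0 = (\<Prod>c\<in>?C. f c)"
  have D0O: "D0 \<in> O_K" unfolding D0_def by (rule O_prod) (rule fO)
  have D0nz: "D0 \<noteq> 0" by (auto simp: D0_def f_def)
  \<comment> \<open>The norm of the product of all \<open>f c\<close> is a rational integer that
    every \<open>f c\<close> still divides.\<close>
  obtain D :: int where D: "of_int D = (\<Prod>g\<in>gal K. g D0)" using norm_Ints[OF D0O] by (metis Ints_cases)
  have Dnz: "D \<noteq> 0"
  proof
    assume "D = 0"
    then have "(\<Prod>g\<in>gal K. g D0) = 0" using D by simp
    then show False using D0nz g_eq_0 O_K_sub[OF D0O] by auto
  qed
  have quot: "of_int D / f c \<in> O_K" if c: "c \<in> ?C" for c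
  proof -
    let ?id = "restrict (\<lambda>x. x) K"
    have "of_int D = ?id D0 * (\<Prod>g\<in>gal K - {?id}. g D0)"
      unfolding D by (rule prod.remove[OF finite_gal gal_id])
    also have "?id D0 = f c * (\<Prod>c\<in>?C - {c}. f c)"
      unfolding D0_def[symmetric] using O_K_sub[OF D0O] c by (simp add: D0_def prod.remove)
    finally have "of_int D = f c * ((\<Prod>c\<in>?C - {c}. f c) * (\<Prod>g\<in>gal K - {?id}. g D0))"
      by (simp only: mult.assoc)
    moreover have "f c \<noteq> 0" by (auto simp: f_def)
    ultimately have "of_int D / f c = (\<Prod>c\<in>?C - {c}. f c) * (\<Prod>g\<in>gal K - {?id}. g D0)"
      by (simp only: nonzero_mult_div_cancel_left not_False_eq_True)
    also have "\<dots> \<in> O_K"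
      by (intro O_mult O_prod) (use fO g_O[OF _ D0O] in auto)
    finally show ?thesis .
  qed
  show ?thesis
  proof (rule zbasis_ex_lattice[OF Dnz, of _ _ "\<lambda>i. \<theta> ^ i"])
    show "\<exists>c :: nat \<Rightarrow> int. of_int D * x = (\<Sum>i<deg. of_int (c i) * \<theta> ^ i)" if x: "x \<in> O_K" for x
    proof -
      have fix_x: "g x = x" if "g \<in> gal K" "g \<theta> = \<theta>" for g
      proof -
        have "g = restrict (\<lambda>x. x) K"
          using \<theta> that gal_id O_K_sub by (auto simp: inj_on_def)
        then show ?thesis using x O_K_sub by simp
      qed
      have "\<exists>v. (\<forall>g\<in>gal K. v (g \<theta>) = g x) \<and> poly (lagrange_poly ?C v) \<theta> = x \<and>
         (\<forall>i. coeff (lagrange_poly ?C v) i \<in> \<rat>)"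
        by (rule interpolation[OF O_K_sub[OF \<theta>(1)] O_K_sub[OF x]]) (rule fix_x)
      then obtain v where
        v: "\<And>g. g \<in> gal K \<Longrightarrow> v (g \<theta>) = g x" and Px: "poly (lagrange_poly ?C v) \<theta> = x"
        and Pc: "\<And>i. coeff (lagrange_poly ?C v) i \<in> \<rat>" by blast
      define P where "P = lagrange_poly ?C v"
      have "coeff (\<Prod>c'\<in>?C - {c}. [:- c', 1:]) i \<in> O_K" for c i
        by (rule coeff_prod_closed) (auto simp: coeff_pCons O_add O_mult O_minus CO split: nat.splits)
      moreover have "v c \<in> O_K" if "c \<in> ?C" for c
        using that v g_O[OF _ x] by (auto simp: conjugates_def)
      moreover have "of_int D * coeff P i = (\<Sum>c\<in>?C. v c * (of_int D / f c) * coeff (\<Prod>c'\<in>?C - {c}. [:- c', 1:]) i)" for i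
        unfolding P_def lagrange_poly_def coeff_sum coeff_smult f_def[symmetric]
        by (simp add: sum_distrib_left mult_ac)
      ultimately have "of_int D * coeff P i \<in> O_K" for i
        by (simp only:) (intro O_sum O_mult quot; simp)
      moreover have "of_int D * coeff P i \<in> \<rat>" for i using Pc by (simp add: P_def)
      ultimately have "of_int D * coeff P i \<in> \<int>" for i using O_Rats by blast
      then have "\<forall>i. \<exists>k :: int. of_int D * coeff P i = of_int k" by (auto elim: Ints_cases)
      then obtain k :: "nat \<Rightarrow> int" where k: "\<And>i. of_int D * coeff P i = of_int (k i)" by metis
      have "degree P < deg"
        using degree_lagrange_poly[of ?C v] self_conjugate O_K_sub \<theta>(1)
        card_conjugates_primitive[OF \<theta>(2)] by (auto simp: P_def)
      then have "x = (\<Sum>i<deg. coeff P i * \<theta> ^ i)"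
        unfolding Px[symmetric] P_def[symmetric] poly_altdef
        by (intro sum.mono_neutral_left) (auto simp: coeff_eq_0)
      then have "of_int D * x = (\<Sum>i<deg. of_int (k i) * \<theta> ^ i)"
        by (simp add: sum_distrib_left k[symmetric] mult.assoc)
      then show ?thesis by blast
    qed
    show "\<forall>i<deg. c i = 0" if c: "(\<Sum>i<deg. of_int (c i) * \<theta> ^ i) = 0" for c :: "nat \<Rightarrow> int"
    proof -
      have "(\<Sum>i<deg. of_int (c i) * g \<theta> ^ i) = 0" if g: "g \<in> gal K" for g
      proof -
        have "g (\<Sum>i<deg. of_int (c i) * \<theta> ^ i) = (\<Sum>i<deg. of_int (c i) * g \<theta> ^ i)"
          using O_K_sub[OF \<theta>(1)]
          by (simp add: g_sum[OF g] g_mult[OF g] g_power[OF g] K_mult K_power g_of_int[OF g])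
        then show ?thesis using c g_0[OF g] by simp
      qed
      then show ?thesis using primitive_powers_independent[OF \<theta>(2), of "\<lambda>i. of_int (c i)"] by simp
    qed
  qed (use \<theta> in \<open>auto intro: O_diff O_power\<close>)
qed

section \<open>The trace form and the discriminant\<close>

definition tr :: "complex \<Rightarrow> int" where "tr x = \<lfloor>Re (\<Sum>g\<in>gal K. g x)\<rfloor>"

text \<open>The floor of the real part in \<open>tr\<close> only names the rational integer that the
  trace of an algebraic integer is.\<close>

lemma of_int_tr: "x \<in> O_K \<Longrightarrow> of_int (tr x) = (\<Sum>g\<in>gal K. g x)"
proof -
  assume "x \<in> O_K"
  then obtain k :: int where k: "(\<Sum>g\<in>gal K. g x) = of_int k" using trace_Ints by (metis Ints_cases)
  then show ?thesis by (simp add: tr_def)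
qed

definition tr_mat :: "(nat \<Rightarrow> complex) \<Rightarrow> int mat" where
  "tr_mat w = mat deg deg (\<lambda>(i, j). tr (w i * w j))"

definition emb_mat :: "(complex \<Rightarrow> complex) list \<Rightarrow> (nat \<Rightarrow> complex) \<Rightarrow> complex mat" where
  "emb_mat \<sigma>s w = mat deg deg (\<lambda>(i, j). (\<sigma>s ! i) (w j))"

lemma length_enum_gal: "distinct \<sigma>s \<Longrightarrow> set \<sigma>s = gal K \<Longrightarrow> length \<sigma>s = deg"
  by (metis deg_def distinct_card)

text \<open>With \<open>E\<close> the matrix of embeddings, the transpose of \<open>E\<close> times
  \<open>E\<close> is the trace matrix. Divisibility of the discriminant by powers of
  \<open>p\<close> is later read off from the integer rows of the latter.\<close>

lemma det_emb_mat_square: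
  assumes \<sigma>: "distinct \<sigma>s" "set \<sigma>s = gal K" and w: "\<And>i. i < deg \<Longrightarrow> w i \<in> O_K"
  shows "(det (emb_mat \<sigma>s w))\<^sup>2 = of_int (det (tr_mat w))"
proof -
  have E: "emb_mat \<sigma>s w \<in> carrier_mat deg deg" by (simp add: emb_mat_def)
  have bij: "bij_betw (\<lambda>i. \<sigma>s ! i) {0..<deg} (gal K)"
    using bij_betw_nth[OF \<sigma>(1), of "{..<length \<sigma>s}" "gal K"] \<sigma> length_enum_gal[OF \<sigma>] by (simp add: lessThan_atLeast0)
  have "transpose_mat (emb_mat \<sigma>s w) * emb_mat \<sigma>s w = map_mat of_int (tr_mat w)"
  proof (rule eq_matI)
    fix i j assume "i < dim_row (map_mat of_int (tr_mat w))" "j < dim_col (map_mat of_int (tr_mat w))"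
    then have ij: "i < deg" "j < deg" by (auto simp: tr_mat_def)
    have "(transpose_mat (emb_mat \<sigma>s w) * emb_mat \<sigma>s w) $$ (i, j) = (\<Sum>k = 0..<deg. (\<sigma>s ! k) (w i) * (\<sigma>s ! k) (w j))"
      using ij E by (simp add: emb_mat_def scalar_prod_def)
    also have "\<dots> = (\<Sum>g\<in>gal K. g (w i) * g (w j))"
      by (rule sum.reindex_bij_betw[OF bij])
    also have "\<dots> = (\<Sum>g\<in>gal K. g (w i * w j))"
      using w ij O_K_sub by (intro sum.cong) (auto simp: g_mult)
    also have "\<dots> = of_int (tr (w i * w j))" using w ij by (simp add: of_int_tr O_mult)
    finally show "(transpose_mat (emb_mat \<sigma>s w) * emb_mat \<sigma>s w) $$ (i, j) = map_mat of_int (tr_mat w) $$ (i, j)"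
      using ij by (simp add: tr_mat_def)
  qed (auto simp: tr_mat_def emb_mat_def)
  then have "det (transpose_mat (emb_mat \<sigma>s w)) * det (emb_mat \<sigma>s w) = det (map_mat of_int (tr_mat w))"
    using det_mult[of "transpose_mat (emb_mat \<sigma>s w)" deg "emb_mat \<sigma>s w"] E by simp
  then show ?thesis using det_transpose[OF E] by (simp add: power2_eq_square)
qed

lemma emb_mat_change:
  assumes \<sigma>: "set \<sigma>s = gal K" "length \<sigma>s = deg" and w: "\<And>i. i < deg \<Longrightarrow> w i \<in> K"
    and w': "\<And>j. j < deg \<Longrightarrow> w' j = (\<Sum>i<deg. of_int (c i j :: int) * w i)"
  shows "det (emb_mat \<sigma>s w') = det (emb_mat \<sigma>s w) * of_int (det (mat deg deg (\<lambda>(i, j). c i j)))"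
proof -
  have "emb_mat \<sigma>s w' = emb_mat \<sigma>s w * map_mat of_int (mat deg deg (\<lambda>(i, j). c i j))"
  proof (rule eq_matI, goal_cases)
    case (1 i j)
    then have ij: "i < deg" "j < deg" by (auto simp: emb_mat_def)
    have g: "\<sigma>s ! i \<in> gal K" using ij \<sigma> by (metis nth_mem)
    have "(\<sigma>s ! i) (w' j) = (\<Sum>k<deg. (\<sigma>s ! i) (of_int (c k j) * w k))"
      unfolding w'[OF ij(2)] using w by (intro g_sum[OF g] K_mult) auto
    also have "\<dots> = (\<Sum>k<deg. of_int (c k j) * (\<sigma>s ! i) (w k))"
      using w by (intro sum.cong) (auto simp: g_mult[OF g] g_of_int[OF g])
    finally show ?case using ij by (simp add: emb_mat_def scalar_prod_def lessThan_atLeast0 mult.commute)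
  qed (auto simp: emb_mat_def)
  then show ?thesis
    using det_mult[of "emb_mat \<sigma>s w" deg "map_mat of_int (mat deg deg (\<lambda>(i, j). c i j))"]
    by (simp add: emb_mat_def)
qed

text \<open>The powers of a primitive element are integer combinations of \<open>w\<close>, so a
  vanishing determinant would pass to their Vandermonde matrix, whose kernel is trivial.\<close>

lemma det_emb_mat_nonzero:
  assumes \<sigma>: "distinct \<sigma>s" "set \<sigma>s = gal K" and w: "zbasis O_K deg w"
  shows "det (emb_mat \<sigma>s w) \<noteq> 0"
proof
  assume 0: "det (emb_mat \<sigma>s w) = 0"
  obtain \<theta> where \<theta>: "\<theta> \<in> O_K" "inj_on (\<lambda>g. g \<theta>) (gal K)" by (rule primitive_element)
  have "\<forall>j. \<exists>c. \<theta> ^ j = (\<Sum>i<deg. of_int (c i :: int) * w i)"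
    using w \<theta> O_power by (auto simp: zbasis_def)
  then obtain c where c: "\<And>j. \<theta> ^ j = (\<Sum>i<deg. of_int (c j i :: int) * w i)" by metis
  have "det (emb_mat \<sigma>s (\<lambda>j. \<theta> ^ j)) = det (emb_mat \<sigma>s w) * of_int (det (mat deg deg (\<lambda>(i, j). c j i)))"
    by (rule emb_mat_change[OF \<sigma>(2) length_enum_gal[OF \<sigma>]]) (use w c O_K_sub in \<open>auto simp: zbasis_def\<close>)
  then have "det (emb_mat \<sigma>s (\<lambda>j. \<theta> ^ j)) = 0" using 0 by simp
  moreover have E: "emb_mat \<sigma>s (\<lambda>j. \<theta> ^ j) \<in> carrier_mat deg deg" by (simp add: emb_mat_def)
  ultimately obtain v where v: "v \<in> carrier_vec deg" "v \<noteq> 0\<^sub>v deg" "emb_mat \<sigma>s (\<lambda>j. \<theta> ^ j) *\<^sub>v v = 0\<^sub>v deg"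
    using det_0_iff_vec_prod_zero[OF E] by blast
  have "(\<Sum>i<deg. v $ i * g \<theta> ^ i) = 0" if "g \<in> gal K" for g
  proof -
    have "g \<in> set \<sigma>s" using that \<sigma> by simp
    then obtain k where k: "k < deg" "g = \<sigma>s ! k"
      using length_enum_gal[OF \<sigma>] by (auto simp: in_set_conv_nth)
    have "(emb_mat \<sigma>s (\<lambda>j. \<theta> ^ j) *\<^sub>v v) $ k = 0" using v k by simp
    then have "(\<Sum>i<deg. g (\<theta> ^ i) * v $ i) = 0"
      using k v(1) by (simp add: emb_mat_def scalar_prod_def lessThan_atLeast0)
    then show ?thesis using g_power[OF that O_K_sub[OF \<theta>(1)]] by (simp add: mult.commute)
  qed
  then have "\<forall>i<deg. v $ i = 0" using primitive_powers_independent[OF \<theta>(2)] by blast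
  then show False using v(1,2) by (auto simp: vec_eq_iff)
qed

lemma ex_enum_gal: "\<exists>\<sigma>s. distinct \<sigma>s \<and> set \<sigma>s = gal K"
  using finite_distinct_list[OF finite_gal] by blast

lemma det_tr_mat_nonzero: "zbasis O_K deg w \<Longrightarrow> det (tr_mat w) \<noteq> 0"
proof
  assume w: "zbasis O_K deg w" and 0: "det (tr_mat w) = 0"
  obtain \<sigma>s where \<sigma>: "distinct \<sigma>s" "set \<sigma>s = gal K" using ex_enum_gal by blast
  have "(det (emb_mat \<sigma>s w))\<^sup>2 = 0"
    using det_emb_mat_square[OF \<sigma>, of w] w 0 by (simp add: zbasis_def)
  then show False using det_emb_mat_nonzero[OF \<sigma> w] by simp
qed

text \<open>Both base changes are integer matrices, with determinants \<open>k\<close> and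
  \<open>l\<close>; cancelling the nonzero determinant gives \<open>k * l = 1\<close>, and the
  discriminant changes by the factor \<open>k\<^sup>2 = 1\<close>.\<close>

lemma det_tr_mat_unique:
  assumes w: "zbasis O_K deg w" and w': "zbasis O_K deg w'"
  shows "det (tr_mat w) = det (tr_mat w')"
proof -
  obtain \<sigma>s where \<sigma>: "distinct \<sigma>s" "set \<sigma>s = gal K" using ex_enum_gal by blast
  have change: "\<exists>k :: int. det (emb_mat \<sigma>s w') = det (emb_mat \<sigma>s w) * of_int k"
    if w: "zbasis O_K deg w" and w': "zbasis O_K deg w'" for w w'
  proof -
    have "\<forall>j. \<exists>c. j < deg \<longrightarrow> w' j = (\<Sum>i<deg. of_int (c i :: int) * w i)"
      using w w' by (auto simp: zbasis_def)
    then obtain c where c: "\<And>j. j < deg \<Longrightarrow> w' j = (\<Sum>i<deg. of_int (c j i :: int) * w i)" by metis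
    have "det (emb_mat \<sigma>s w') = det (emb_mat \<sigma>s w) * of_int (det (mat deg deg (\<lambda>(i, j). c j i)))"
      by (rule emb_mat_change[OF \<sigma>(2) length_enum_gal[OF \<sigma>]]) (use w c O_K_sub in \<open>auto simp: zbasis_def\<close>)
    then show ?thesis by blast
  qed
  obtain k :: int where k: "det (emb_mat \<sigma>s w') = det (emb_mat \<sigma>s w) * of_int k" using change[OF w w'] by blast
  obtain l :: int where l: "det (emb_mat \<sigma>s w) = det (emb_mat \<sigma>s w') * of_int l" using change[OF w' w] by blast
  have "det (emb_mat \<sigma>s w) * of_int (k * l) = det (emb_mat \<sigma>s w) * of_int k * of_int l" by simp
  also have "\<dots> = det (emb_mat \<sigma>s w) * 1" by (simp only: k[symmetric] l[symmetric] mult_1_right)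
  finally have "det (emb_mat \<sigma>s w) * of_int (k * l) = det (emb_mat \<sigma>s w) * 1" .
  then have "of_int (k * l) = (1 :: complex)" using det_emb_mat_nonzero[OF \<sigma> w] by (metis mult_left_cancel)
  then have "k * l = 1" by (metis of_int_1 of_int_eq_iff)
  then have "k = 1 \<or> k = - 1" by (auto simp: zmult_eq_1_iff)
  then have "k\<^sup>2 = 1" by auto
  have "of_int (det (tr_mat w')) = (of_int (det (tr_mat w)) * of_int (k\<^sup>2) :: complex)"
    using det_emb_mat_square[OF \<sigma>, of w] det_emb_mat_square[OF \<sigma>, of w'] w w' k
    by (simp add: zbasis_def power_mult_distrib)
  then show ?thesis using \<open>k\<^sup>2 = 1\<close> by simp
qed

lemma zbasis_O_deg: "zbasis O_K m w \<Longrightarrow> m = deg"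
  using zbasis_card[of O_K m w deg] ex_zbasis by blast

lemma discriminant_eq:
  assumes w: "zbasis O_K deg w"
  shows "discriminant K = det (tr_mat w)"
  unfolding discriminant_def
proof (rule the_equality)
  obtain \<sigma>s where \<sigma>: "distinct \<sigma>s" "set \<sigma>s = gal K" using ex_enum_gal by blast
  define ws where "ws = map w [0..<deg]"
  have wsi: "ws ! i = w i" if "i < deg" for i using that by (simp add: ws_def)
  have "zbasis O_K (length ws) ((!) ws)"
    using w unfolding zbasis_def by (simp add: ws_def)
  then have "integral_basis K ws" by (simp add: integral_basis_iff)
  moreover have "mat (length \<sigma>s) (length ws) (\<lambda>(i, j). (\<sigma>s ! i) (ws ! j)) = emb_mat \<sigma>s w"
    using length_enum_gal[OF \<sigma>] by (auto simp: emb_mat_def ws_def intro!: eq_matI)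
  moreover have "of_int (det (tr_mat w)) = (det (emb_mat \<sigma>s w))\<^sup>2"
    using det_emb_mat_square[OF \<sigma>, of w] w by (simp add: zbasis_def)
  ultimately show "\<exists>ws \<sigma>s. integral_basis K ws \<and> distinct \<sigma>s \<and> set \<sigma>s = embeddings K \<and>
     of_int (det (tr_mat w)) = (det (mat (length \<sigma>s) (length ws) (\<lambda>(i, j). (\<sigma>s ! i) (ws ! j))))\<^sup>2"
    using \<sigma> embeddings_eq_gal by metis
next
  fix d :: int
  assume "\<exists>ws \<sigma>s. integral_basis K ws \<and> distinct \<sigma>s \<and> set \<sigma>s = embeddings K \<and>
     of_int d = (det (mat (length \<sigma>s) (length ws) (\<lambda>(i, j). (\<sigma>s ! i) (ws ! j))))\<^sup>2"
  then obtain ws \<sigma>s where ib: "integral_basis K ws" and \<sigma>: "distinct \<sigma>s" "set \<sigma>s = gal K" and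
     d: "of_int d = (det (mat (length \<sigma>s) (length ws) (\<lambda>(i, j). (\<sigma>s ! i) (ws ! j))))\<^sup>2"
    unfolding embeddings_eq_gal by blast
  have z: "zbasis O_K (length ws) ((!) ws)" using ib by (simp add: integral_basis_iff)
  then have l: "length ws = deg" by (rule zbasis_O_deg)
  have "mat (length \<sigma>s) (length ws) (\<lambda>(i, j). (\<sigma>s ! i) (ws ! j)) = emb_mat \<sigma>s ((!) ws)"
    by (simp add: emb_mat_def l length_enum_gal[OF \<sigma>])
  then have "(of_int d :: complex) = of_int (det (tr_mat ((!) ws)))"
    using d det_emb_mat_square[OF \<sigma>, of "(!) ws"] z l by (simp add: zbasis_def)
  then have "d = det (tr_mat ((!) ws))" by simp
  then show "d = det (tr_mat w)" using det_tr_mat_unique[OF w, of "(!) ws"] z l by simp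
qed

lemma discriminant_nonzero: "discriminant K \<noteq> 0"
  using ex_zbasis discriminant_eq det_tr_mat_nonzero by metis

end

section \<open>The radical of a rational prime\<close>

abbreviation prd :: "complex set \<Rightarrow> complex set \<Rightarrow> complex set" where
  "prd I J \<equiv> ideal_prod complex_ring I J"

lemma prd_prod: "x \<in> I \<Longrightarrow> y \<in> J \<Longrightarrow> x * y \<in> prd I J"
  using ideal_prod.prod[of x I y J complex_ring] by (simp add: ring_of_type_algebra_def)

lemma prd_sum: "x \<in> prd I J \<Longrightarrow> y \<in> prd I J \<Longrightarrow> x + y \<in> prd I J"
  using ideal_prod.sum[of x complex_ring I J y] by (simp add: ring_of_type_algebra_def)

lemma prd_subset:
  assumes "\<And>x y. x \<in> I \<Longrightarrow> y \<in> J \<Longrightarrow> x * y \<in> S" "\<And>x y. x \<in> S \<Longrightarrow> y \<in> S \<Longrightarrow> x + y \<in> S"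
  shows "prd I J \<subseteq> S"
proof
  fix x assume "x \<in> prd I J"
  then show "x \<in> S"
    by (induction rule: ideal_prod.induct) (use assms in \<open>auto simp: ring_of_type_algebra_def\<close>)
qed

lemma prd_commute: "prd I J = prd J I"
proof -
  have "prd A B \<subseteq> prd B A" for A B
    by (rule prd_subset) (metis mult.commute prd_prod, rule prd_sum)
  then show ?thesis by blast
qed

lemma prd_mult:
  assumes "\<And>y. y \<in> J \<Longrightarrow> a * y \<in> J'" "x \<in> prd I J"
  shows "a * x \<in> prd I J'"
proof -
  have "prd I J \<subseteq> {x. a * x \<in> prd I J'}"
    using assms(1) by (intro prd_subset) (auto simp: distrib_left mult.left_commute[of a] intro: prd_prod prd_sum)
  then show ?thesis using assms(2) by auto
qed

lemma prd_assoc: "prd (prd I J) L = prd I (prd J L)"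
proof
  have "x * y \<in> prd I (prd J L)" if x: "x \<in> prd I J" and y: "y \<in> L" for x y
  proof -
    have "prd I J \<subseteq> {x. x * y \<in> prd I (prd J L)}"
      using y by (intro prd_subset) (auto simp: distrib_right mult.assoc intro: prd_prod prd_sum)
    then show ?thesis using x by auto
  qed
  then show "prd (prd I J) L \<subseteq> prd I (prd J L)" by (intro prd_subset prd_sum)
  have "x * y \<in> prd (prd I J) L" if x: "x \<in> I" and y: "y \<in> prd J L" for x y
  proof -
    have "prd J L \<subseteq> {y. x * y \<in> prd (prd I J) L}"
      using x by (intro prd_subset) (auto simp: distrib_left mult.assoc[symmetric] intro: prd_prod prd_sum)
    then show ?thesis using y by auto
  qed
  then show "prd I (prd J L) \<subseteq> prd (prd I J) L" by (intro prd_subset prd_sum)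
qed

lemma prd_mono: "I \<subseteq> I' \<Longrightarrow> J \<subseteq> J' \<Longrightarrow> prd I J \<subseteq> prd I' J'"
  by (intro prd_subset prd_sum) (auto intro: prd_prod)

context galois_ext
begin

text \<open>Submodules of \<open>K\<close> over \<open>O_K\<close>, integral or not, so that ideals
  and inverse ideals are treated alike; conditions on size and denominators are added only in
  \<open>frac\<close>.\<close>

definition omod :: "complex set \<Rightarrow> bool" where
  "omod I \<longleftrightarrow> I \<subseteq> K \<and> 0 \<in> I \<and> (\<forall>x\<in>I. \<forall>y\<in>I. x + y \<in> I) \<and> (\<forall>a\<in>O_K. \<forall>x\<in>I. a * x \<in> I)"

definition gstable :: "complex set \<Rightarrow> bool" where
  "gstable I \<longleftrightarrow> (\<forall>g\<in>gal K. \<forall>x\<in>I. g x \<in> I)"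

lemma omod_add: "omod I \<Longrightarrow> x \<in> I \<Longrightarrow> y \<in> I \<Longrightarrow> x + y \<in> I" by (simp add: omod_def)
lemma omod_0: "omod I \<Longrightarrow> 0 \<in> I" by (simp add: omod_def)
lemma omod_K: "omod I \<Longrightarrow> x \<in> I \<Longrightarrow> x \<in> K" by (auto simp: omod_def)
lemma omod_mult: "omod I \<Longrightarrow> a \<in> O_K \<Longrightarrow> x \<in> I \<Longrightarrow> a * x \<in> I" by (simp add: omod_def)
lemma omod_mult': "omod I \<Longrightarrow> a \<in> O_K \<Longrightarrow> x \<in> I \<Longrightarrow> x * a \<in> I" by (simp add: omod_def mult.commute)
lemma omod_minus: "omod I \<Longrightarrow> x \<in> I \<Longrightarrow> - x \<in> I"
  using omod_mult[of I "-1" x] O_minus[OF O_1] by simp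
lemma omod_diff: "omod I \<Longrightarrow> x \<in> I \<Longrightarrow> y \<in> I \<Longrightarrow> x - y \<in> I"
  using omod_add[of I x "-y"] omod_minus[of I y] by simp
lemma omod_sum: "omod I \<Longrightarrow> (\<And>a. a \<in> A \<Longrightarrow> f a \<in> I) \<Longrightarrow> (\<Sum>a\<in>A. f a) \<in> I"
  by (induction A rule: infinite_finite_induct) (auto intro: omod_add omod_0)

lemma omod_O: "omod O_K"
  by (auto simp: omod_def O_K_sub O_add O_mult)

lemma omod_eq_O: "omod I \<Longrightarrow> I \<subseteq> O_K \<Longrightarrow> 1 \<in> I \<Longrightarrow> I = O_K"
  using omod_mult'[of I _ 1] by auto

lemma omod_prd: "omod I \<Longrightarrow> omod J \<Longrightarrow> omod (prd I J)"
  unfolding omod_def[of "prd I J"]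
proof (intro conjI ballI)
  assume I: "omod I" and J: "omod J"
  show "prd I J \<subseteq> K" using I J by (intro prd_subset K_mult K_add) (auto intro: omod_K)
  show "0 \<in> prd I J" using prd_prod[OF omod_0[OF I] omod_0[OF J]] by simp
  show "a * x \<in> prd I J" if "a \<in> O_K" "x \<in> prd I J" for a x
    using prd_mult[OF _ that(2)] omod_mult[OF J that(1)] by blast
qed (rule prd_sum)

lemma gstable_prd: 
  assumes "omod I" "omod J" "gstable I" "gstable J" shows "gstable (prd I J)"
  unfolding gstable_def
proof (intro ballI)
  fix g x assume g: "g \<in> gal K" and x: "x \<in> prd I J"
  have "prd I J \<subseteq> {x \<in> K. g x \<in> prd I J}"
  proof (rule prd_subset)
    fix x y assume "x \<in> I" "y \<in> J"
    then show "x * y \<in> {x \<in> K. g x \<in> prd I J}"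
      using assms g by (auto simp: g_mult[OF g] omod_K K_mult gstable_def intro: prd_prod)
  qed (auto simp: g_add[OF g] K_add intro: prd_sum)
  then show "g x \<in> prd I J" using x by auto
qed

lemma prd_O: "omod I \<Longrightarrow> prd O_K I = I"
proof
  assume I: "omod I"
  show "prd O_K I \<subseteq> I" using I by (intro prd_subset) (auto intro: omod_mult omod_add)
  show "I \<subseteq> prd O_K I" using prd_prod[OF O_1, of _ I] by auto
qed

lemma omod_scale: "a \<in> K \<Longrightarrow> omod I \<Longrightarrow> omod ((\<lambda>x. a * x) ` I)"
  unfolding omod_def[of "(\<lambda>x. a * x) ` I"]
proof (intro conjI ballI)
  assume a: "a \<in> K" and I: "omod I"
  show "(\<lambda>x. a * x) ` I \<subseteq> K" using a I by (auto intro: K_mult omod_K)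
  show "0 \<in> (\<lambda>x. a * x) ` I" using omod_0[OF I] by (intro image_eqI[of _ _ 0]) auto
  show "x + y \<in> (\<lambda>x. a * x) ` I" if xy: "x \<in> (\<lambda>x. a * x) ` I" "y \<in> (\<lambda>x. a * x) ` I" for x y
  proof -
    obtain u v where "u \<in> I" "v \<in> I" "x = a * u" "y = a * v" using xy by auto
    then show ?thesis using omod_add[OF I] by (intro image_eqI[of _ _ "u + v"]) (auto simp: distrib_left)
  qed
  show "c * x \<in> (\<lambda>x. a * x) ` I" if c: "c \<in> O_K" "x \<in> (\<lambda>x. a * x) ` I" for c x
  proof -
    obtain u where "u \<in> I" "x = a * u" using c by auto
    then show ?thesis using omod_mult[OF I c(1)] by (intro image_eqI[of _ _ "c * u"]) auto
  qed
qed

end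

section \<open>The ring of integers modulo p and its nilradical\<close>

locale galois_prime = galois_ext +
  fixes p :: nat
  assumes p: "Factorial_Ring.prime p"
begin

lemma p_pos [simp]: "0 < p" using p by (rule prime_gt_0_nat)
lemma p_nz: "(of_nat p :: complex) \<noteq> 0" by simp
lemma p_gt1: "1 < p" using p by (rule prime_gt_1_nat)

definition PO :: "complex set" where "PO = (\<lambda>x. of_nat p * x) ` O_K"

lemma PO_iff: "x \<in> PO \<longleftrightarrow> x / of_nat p \<in> O_K"
proof
  assume "x / of_nat p \<in> O_K"
  then have "of_nat p * (x / of_nat p) \<in> PO" unfolding PO_def by (rule imageI)
  then show "x \<in> PO" by simp
qed (auto simp: PO_def)

lemma omod_PO: "omod PO" unfolding PO_def by (intro omod_scale omod_O) simp
lemma PO_O: "x \<in> PO \<Longrightarrow> x \<in> O_K" by (auto simp: PO_def O_mult)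
lemma p_in_PO: "of_nat p \<in> PO" by (simp add: PO_iff)

lemma PO_Ints: "of_int k \<in> PO \<longleftrightarrow> int p dvd k"
proof
  assume "of_int k \<in> PO"
  then have "of_int k / of_nat p \<in> O_K" by (simp add: PO_iff)
  moreover have "(of_int k / of_nat p :: complex) \<in> \<rat>" by auto
  ultimately have "(of_int k / of_nat p :: complex) \<in> \<int>" using O_Rats by blast
  then obtain l :: int where "of_int k / of_nat p = (of_int l :: complex)" by (elim Ints_cases)
  then have "of_int k = (of_int (l * int p) :: complex)" by (simp add: divide_eq_eq)
  then have "k = l * int p" by (simp only: of_int_eq_iff)
  then show "int p dvd k" by simp
qed (auto simp: PO_iff elim!: dvdE)

lemma one_notin_PO: "1 \<notin> PO"
  using PO_Ints[of 1] p_gt1 by auto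

lemma gstable_PO: "gstable PO"
  unfolding gstable_def PO_def
  using O_K_sub g_O g_of_nat by (auto simp: g_mult)

text \<open>Defined by nilpotency modulo \<open>p\<close>, without reference to prime ideals, which
  appear only when the Polya group is treated. The exponent 0 never counts, since \<open>1\<close>
  is not in \<open>PO\<close>.\<close>

definition rad :: "complex set" where "rad = {x \<in> O_K. \<exists>k. x ^ k \<in> PO}"

lemma rad_O: "x \<in> rad \<Longrightarrow> x \<in> O_K" by (simp add: rad_def)
lemma PO_rad: "PO \<subseteq> rad" by (auto simp: rad_def PO_O intro: exI[of _ 1])
lemma one_notin_rad: "1 \<notin> rad" using one_notin_PO by (auto simp: rad_def)

lemma PO_power_ge: "x \<in> O_K \<Longrightarrow> x ^ k \<in> PO \<Longrightarrow> k \<le> l \<Longrightarrow> x ^ l \<in> PO"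
  using omod_mult[OF omod_PO O_power[of x "l - k"], of "x ^ k"] by (simp flip: power_add)

lemma omod_rad: "omod rad"
  unfolding omod_def
proof (intro conjI ballI)
  show "rad \<subseteq> K" using O_K_sub by (auto simp: rad_def)
  show "0 \<in> rad" using omod_0[OF omod_PO] PO_rad by auto
  show "a * x \<in> rad" if ax: "a \<in> O_K" "x \<in> rad" for a x
  proof -
    obtain k where "x ^ k \<in> PO" using ax by (auto simp: rad_def)
    then have "(a * x) ^ k \<in> PO"
      using omod_mult[OF omod_PO O_power[OF ax(1)]] by (simp add: power_mult_distrib)
    then show ?thesis using ax by (auto simp: rad_def O_mult)
  qed
  show "x + y \<in> rad" if xy: "x \<in> rad" "y \<in> rad" for x y
  proof -
    obtain k l where kl: "x ^ k \<in> PO" "y ^ l \<in> PO" using xy by (auto simp: rad_def)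
    have xyO: "x \<in> O_K" "y \<in> O_K" using xy by (auto simp: rad_def)
    \<comment> \<open>In each binomial term either the exponent of \<open>x\<close> is at least
      \<open>k\<close> or that of \<open>y\<close> is at least \<open>l\<close>.\<close>
    have t: "of_nat c * x ^ i * y ^ (k + l - i) \<in> PO" for c i
    proof (cases "k \<le> i")
      case True
      then have "x ^ i \<in> PO" using PO_power_ge xyO kl by blast
      then show ?thesis
        by (intro omod_mult[OF omod_PO] omod_mult'[OF omod_PO] O_power xyO) simp_all
    next
      case False
      then have "y ^ (k + l - i) \<in> PO" using PO_power_ge[OF xyO(2) kl(2)] by simp
      then show ?thesis by (intro omod_mult[OF omod_PO] O_mult O_power xyO) simp_all
    qed
    have "(x + y) ^ (k + l) \<in> PO"
      unfolding binomial_ring by (intro omod_sum[OF omod_PO] t)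
    then show ?thesis using xyO by (auto simp: rad_def O_add)
  qed
qed

lemma gstable_rad: "gstable rad"
  unfolding gstable_def
proof (intro ballI)
  fix g x assume g: "g \<in> gal K" and x: "x \<in> rad"
  then obtain k where "x ^ k \<in> PO" "x \<in> O_K" by (auto simp: rad_def)
  then have "g (x ^ k) \<in> PO" using gstable_PO g by (auto simp: gstable_def)
  then show "g x \<in> rad"
    using g_O[OF g \<open>x \<in> O_K\<close>] g_power[OF g O_K_sub[OF \<open>x \<in> O_K\<close>]] by (auto simp: rad_def)
qed

text \<open>The coordinates in an integral basis, reduced modulo \<open>p\<close>, represent
  \<open>O_K\<close> modulo \<open>PO\<close>. A fixed finite set of representatives replaces the
  quotient ring, so that indices of modules become cardinalities of sets of complex numbers.\<close>

lemma ex_residues: "\<exists>Res. finite Res \<and> Res \<subseteq> O_K \<and> card Res = p ^ deg \<and> (\<forall>x\<in>O_K. \<exists>!y. y \<in> Res \<and> x - y \<in> PO)"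
proof -
  obtain w where w: "zbasis O_K deg w" using ex_zbasis by blast
  define C where "C = PiE {..<deg} (\<lambda>_. {0..<int p})"
  define b where "b c = (\<Sum>i<deg. of_int (c i) * w i)" for c :: "nat \<Rightarrow> int"
  have bO: "b c \<in> O_K" for c unfolding b_def using zbasis_in[OF w] by (intro O_sum O_mult) auto
  have uniq: "\<forall>i<deg. int p dvd c i - d i" if cd: "b c - b d \<in> PO" for c d
  proof (intro allI impI)
    fix i assume i: "i < deg"
    obtain y where y: "y \<in> O_K" "b c - b d = of_nat p * y" using cd by (auto simp: PO_def)
    obtain e :: "nat \<Rightarrow> int" where e: "y = (\<Sum>i<deg. of_int (e i) * w i)" using zbasis_repr[OF w y(1)] by blast
    have "b c - b d - of_nat p * y = 0" using y by simp
    then have "(\<Sum>i<deg. of_int (c i - d i - int p * e i) * w i) = 0"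
      unfolding b_def e sum_distrib_left sum_subtractf[symmetric]
      by (simp add: left_diff_distrib mult.assoc)
    then have "c i - d i - int p * e i = 0" by (rule zbasis_indep[OF w _ i])
    then have "c i - d i = int p * e i" by simp
    then show "int p dvd c i - d i" by simp
  qed
  have uC: "c = d" if "c \<in> C" "d \<in> C" "b c - b d \<in> PO" for c d
  proof -
    have "c i = d i" if i: "i < deg" for i
    proof -
      have "int p dvd c i - d i" using uniq \<open>b c - b d \<in> PO\<close> i by blast
      moreover have "0 \<le> c i" "c i < int p" "0 \<le> d i" "d i < int p"
        using \<open>c \<in> C\<close> \<open>d \<in> C\<close> i unfolding C_def PiE_def Pi_def by auto
      ultimately show ?thesis by (metis mod_eq_dvd_iff mod_pos_pos_trivial)
    qed
    then show ?thesis using that(1,2) unfolding C_def by (intro PiE_ext) auto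
  qed
  have injb: "inj_on b C" by (rule inj_onI) (auto intro: uC simp: omod_0[OF omod_PO])
  have "finite C" by (simp add: C_def finite_PiE)
  moreover have "card C = p ^ deg" by (simp add: C_def card_PiE)
  moreover have "\<exists>!y. y \<in> b ` C \<and> x - y \<in> PO" if x: "x \<in> O_K" for x
  proof -
    obtain e :: "nat \<Rightarrow> int" where e: "x = (\<Sum>i<deg. of_int (e i) * w i)" using zbasis_repr[OF w x] by blast
    define c where "c = restrict (\<lambda>i. e i mod int p) {..<deg}"
    have c: "c \<in> C" using p_gt1 by (simp add: c_def C_def)
    have "x - b c = of_nat p * (\<Sum>i<deg. of_int (e i div int p) * w i)"
      unfolding e b_def sum_distrib_left sum_subtractf[symmetric]
    proof (rule sum.cong)
      fix i assume i: "i \<in> {..<deg}"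
      have "e i = int p * (e i div int p) + c i" using i by (simp add: c_def)
      then have "of_int (e i) = of_nat p * of_int (e i div int p) + (of_int (c i) :: complex)"
        by (metis of_int_add of_int_mult of_int_of_nat_eq)
      then show "of_int (e i) * w i - of_int (c i) * w i = of_nat p * (of_int (e i div int p) * w i)"
        by (simp add: algebra_simps)
    qed simp
    moreover have "(\<Sum>i<deg. of_int (e i div int p) * w i) \<in> O_K" using bO[of "\<lambda>i. e i div int p"] by (simp add: b_def)
    ultimately have xc: "x - b c \<in> PO" unfolding PO_def by (rule image_eqI)
    show ?thesis
    proof (rule ex1I[of _ "b c"])
      show "b c \<in> b ` C \<and> x - b c \<in> PO" using c xc by blast
      fix y assume y: "y \<in> b ` C \<and> x - y \<in> PO"
      then obtain d where d: "d \<in> C" "y = b d" by blast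
      have "(x - b c) - (x - y) \<in> PO" using omod_diff[OF omod_PO xc] y by blast
      then have "b d - b c \<in> PO" using d by simp
      then show "y = b c" using uC[OF d(1) c] d by simp
    qed
  qed
  ultimately show ?thesis
    using injb bO by (intro exI[of _ "b ` C"]) (auto simp: card_image)
qed

definition Res :: "complex set" where
  "Res = (SOME Res. finite Res \<and> Res \<subseteq> O_K \<and> card Res = p ^ deg \<and> (\<forall>x\<in>O_K. \<exists>!y. y \<in> Res \<and> x - y \<in> PO))"

lemma finite_Res [simp]: "finite Res" and Res_O: "x \<in> Res \<Longrightarrow> x \<in> O_K" and card_Res: "card Res = p ^ deg"
  and Res_ex1: "x \<in> O_K \<Longrightarrow> \<exists>!y. y \<in> Res \<and> x - y \<in> PO"
  using someI_ex[OF ex_residues] unfolding Res_def[symmetric] by auto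

definition red :: "complex \<Rightarrow> complex" where "red x = (THE y. y \<in> Res \<and> x - y \<in> PO)"

lemma red_Res: "x \<in> O_K \<Longrightarrow> red x \<in> Res" and red_PO: "x \<in> O_K \<Longrightarrow> x - red x \<in> PO"
  using theI'[OF Res_ex1] unfolding red_def by auto

lemma Res_unique: "x \<in> Res \<Longrightarrow> y \<in> Res \<Longrightarrow> x - y \<in> PO \<Longrightarrow> x = y"
  using Res_ex1[OF Res_O, of x] omod_0[OF omod_PO] by (metis diff_self)

lemma red_eq_iff: "x \<in> O_K \<Longrightarrow> y \<in> O_K \<Longrightarrow> red x = red y \<longleftrightarrow> x - y \<in> PO"
proof
  assume xy: "x \<in> O_K" "y \<in> O_K"
  { assume "red x = red y"
    then have "(x - red x) - (y - red y) = x - y" by simp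
    then show "x - y \<in> PO" using omod_diff[OF omod_PO red_PO[OF xy(1)] red_PO[OF xy(2)]] by simp }
  { assume "x - y \<in> PO"
    then have "(x - y) - (x - red x) + (y - red y) \<in> PO"
      using omod_add[OF omod_PO omod_diff[OF omod_PO _ red_PO] red_PO] xy by blast
    then have "red x - red y \<in> PO" by simp
    then show "red x = red y" using Res_unique red_Res xy by blast }
qed

lemma red_in: "omod I \<Longrightarrow> PO \<subseteq> I \<Longrightarrow> x \<in> O_K \<Longrightarrow> red x \<in> I \<longleftrightarrow> x \<in> I"
proof -
  assume I: "omod I" "PO \<subseteq> I" and x: "x \<in> O_K"
  have d: "x - red x \<in> I" using red_PO[OF x] I by blast
  show ?thesis
  proof
    assume "red x \<in> I"
    then show "x \<in> I" using omod_add[OF I(1) d, of "red x"] by simp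
  next
    assume "x \<in> I"
    then show "red x \<in> I" using omod_diff[OF I(1) _ d, of x] by simp
  qed
qed

text \<open>\<open>nu I\<close> is the index of \<open>p O\<close> in \<open>I\<close>, counted by residues.\<close>

definition nu :: "complex set \<Rightarrow> nat" where "nu I = card (I \<inter> Res)"

lemma nu_pos: "omod I \<Longrightarrow> PO \<subseteq> I \<Longrightarrow> nu I \<ge> 1"
proof -
  assume I: "omod I" "PO \<subseteq> I"
  have "red 0 \<in> I \<inter> Res" using red_in[OF I O_0] red_Res[OF O_0] omod_0[OF I(1)] by simp
  then show ?thesis by (auto simp: nu_def Suc_le_eq card_gt_0_iff)
qed

lemma nu_O: "nu O_K = p ^ deg"
proof -
  have "O_K \<inter> Res = Res" using Res_O by auto
  then show ?thesis by (simp add: nu_def card_Res)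
qed

text \<open>For \<open>c\<close> in \<open>J\<close> outside \<open>I\<close>, the cosets
  \<open>I\<close> and \<open>I + c\<close> are disjoint parts of \<open>J\<close> with equally many
  residues.\<close>

lemma nu_strict:
  assumes I: "omod I" "PO \<subseteq> I" and J: "omod J" "J \<subseteq> O_K" and IJ: "I \<subset> J"
  shows "2 * nu I \<le> nu J"
proof -
  obtain c where c: "c \<in> J" "c \<notin> I" using IJ by blast
  have IO: "x \<in> O_K" if "x \<in> I" for x using that IJ J by auto
  have cO: "c \<in> O_K" using c J by auto
  have "inj_on (\<lambda>x. red (x + c)) (I \<inter> Res)"
    by (rule inj_onI) (auto simp: red_eq_iff IO cO O_add intro: Res_unique)
  moreover have "red (x + c) \<in> J \<inter> Res - I" if x: "x \<in> I \<inter> Res" for x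
  proof -
    have "x + c \<in> J" using x IJ c omod_add[OF J(1)] by blast
    moreover have "x + c \<notin> I" using omod_diff[OF I(1), of "x + c" x] x c by auto
    ultimately show ?thesis
      using red_in[OF I] red_in[OF J(1)] I IJ red_Res J by auto
  qed
  ultimately have "card (I \<inter> Res) \<le> card (J \<inter> Res - I)"
    by (intro card_inj_on_le[of "\<lambda>x. red (x + c)"]) auto
  moreover have "card (J \<inter> Res) = card (I \<inter> Res) + card (J \<inter> Res - I)"
  proof -
    have "J \<inter> Res = (I \<inter> Res) \<union> (J \<inter> Res - I)" using IJ by auto
    then show ?thesis by (metis (no_types, lifting) card_Un_disjoint finite_Diff finite_Int finite_Res Diff_disjoint Int_Diff Int_commute inf_left_commute Int_empty_left inf_bot_right)
  qed
  ultimately show ?thesis by (simp add: nu_def)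
qed

text \<open>The lower coefficients of \<open>char_pol x\<close> lie in the intersection of \<open>I\<close> with the integers, which is
  generated by \<open>p\<close>.\<close>

lemma gstable_ideal_in_rad:
  assumes I: "omod I" "I \<subseteq> O_K" "gstable I" and pI: "of_nat p \<in> I" and one: "1 \<notin> I"
  shows "I \<subseteq> rad"
proof
  fix x assume x: "x \<in> I"
  then have xO: "x \<in> O_K" using I by auto
  have "coeff (\<Prod>g\<in>A. [:- g x, 1:]) i \<in> I" if "finite A" "A \<subseteq> gal K" "i < card A" for A i
    using that
  proof (induction A arbitrary: i rule: finite_induct)
    case (insert g A)
    have gx: "- g x \<in> I" using insert.prems I(3) x omod_minus[OF I(1)] by (auto simp: gstable_def)
    have cO: "coeff (\<Prod>g\<in>A. [:- g x, 1:]) i \<in> O_K" for i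
      by (rule coeff_prod_closed)
        (use insert.prems in \<open>auto simp: coeff_pCons O_add O_mult O_minus g_O[OF _ xO] subset_iff split: nat.splits\<close>)
    have "coeff ([:- g x, 1:] * (\<Prod>g\<in>A. [:- g x, 1:])) i =
       - g x * coeff (\<Prod>g\<in>A. [:- g x, 1:]) i + (case i of 0 \<Rightarrow> 0 | Suc j \<Rightarrow> coeff (\<Prod>g\<in>A. [:- g x, 1:]) j)"
      by (simp add: mult_pCons_left coeff_pCons split: nat.splits)
    moreover have "(case i of 0 \<Rightarrow> 0 | Suc j \<Rightarrow> coeff (\<Prod>g\<in>A. [:- g x, 1:]) j) \<in> I"
      using insert by (auto split: nat.splits simp: omod_0[OF I(1)])
    ultimately have "coeff ([:- g x, 1:] * (\<Prod>g\<in>A. [:- g x, 1:])) i \<in> I"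
      using omod_add[OF I(1) omod_mult'[OF I(1) cO gx]] by (metis )
    then show ?case using insert.hyps by (simp only: prod.insert not_False_eq_True)
  qed simp
  then have "coeff (char_pol x) i \<in> I" if "i < deg" for i
    using that unfolding char_pol_def deg_def by simp
  moreover have IZ: "of_int k \<in> PO" if k: "of_int k \<in> I" for k
  proof (rule ccontr)
    assume "of_int k \<notin> PO"
    then have "\<not> int p dvd k" by (simp add: PO_Ints)
    then have "Rings.coprime (int p) k" using p by (simp add: prime_imp_coprime)
    then obtain a b where "a * int p + b * k = 1" using bezout_int by (metis coprime_imp_gcd_eq_1)
    then have "of_int a * of_nat p + of_int b * of_int k = (1 :: complex)"
      by (metis of_int_1 of_int_add of_int_mult of_int_of_nat_eq)
    moreover have "of_int a * of_nat p + of_int b * of_int k \<in> I"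
      by (intro omod_add[OF I(1)] omod_mult[OF I(1)] pI k) simp_all
    ultimately show False using one by simp
  qed
  ultimately have cP: "coeff (char_pol x) i \<in> PO" if "i < deg" for i
    using coeff_char_pol_Ints[OF xO, of i] that by (metis Ints_cases)
  have "0 = (\<Sum>i\<le>deg. coeff (char_pol x) i * x ^ i)"
    using char_pol_self[OF O_K_sub[OF xO]] degree_char_pol(1)[of x] by (simp add: poly_altdef deg_def)
  also have "{..deg} = insert deg {..<deg}" by auto
  finally have "x ^ deg = - (\<Sum>i<deg. coeff (char_pol x) i * x ^ i)"
    using degree_char_pol[of x] by (simp add: deg_def eq_neg_iff_add_eq_0)
  also have "\<dots> \<in> PO"
    by (intro omod_minus[OF omod_PO] omod_sum[OF omod_PO] omod_mult'[OF omod_PO] O_power xO cP) simp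
  finally show "x \<in> rad" using xO by (auto simp: rad_def)
qed

text \<open>Elements of \<open>rad\<close> are nilpotent modulo \<open>p\<close>: multiply
  \<open>b\<close> by the last power of \<open>j\<close> that keeps it outside \<open>PO\<close>.
  Repeating this for finitely many \<open>j\<close> is enough, because \<open>rad\<close> has
  finitely many residues.\<close>

lemma ex_annihilator: "\<exists>b\<in>O_K. b \<notin> PO \<and> (\<forall>j\<in>rad. b * j \<in> PO)"
proof -
  have "\<exists>b\<in>O_K. b \<notin> PO \<and> (\<forall>j\<in>F. b * j \<in> PO)" if "finite F" "F \<subseteq> rad" for F
    using that
  proof (induction F rule: finite_induct)
    case empty
    then show ?case using one_notin_PO by (intro bexI[of _ 1]) auto
  next
    case (insert j F)
    then obtain b where b: "b \<in> O_K" "b \<notin> PO" "\<forall>j\<in>F. b * j \<in> PO" by auto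
    obtain k where "j ^ k \<in> PO" "j \<in> O_K" using insert.prems by (auto simp: rad_def)
    then have k: "b * j ^ k \<in> PO" using omod_mult[OF omod_PO b(1)] by blast
    define l where "l = (LEAST k. b * j ^ k \<in> PO)"
    have l: "b * j ^ l \<in> PO" unfolding l_def using k by (rule LeastI)
    have "l \<noteq> 0" using l b(2) by (intro notI) simp
    then obtain l' where l': "l = Suc l'" by (cases l) auto
    have "b * j ^ l' \<notin> PO" using not_less_Least[of l' "\<lambda>k. b * j ^ k \<in> PO"] l' by (simp add: l_def)
    moreover have "b * j ^ l' * j \<in> PO" using l l' by (simp add: mult_ac)
    moreover have "b * j ^ l' * i \<in> PO" if "i \<in> F" for i
      using omod_mult[OF omod_PO O_power[OF \<open>j \<in> O_K\<close>], of "b * i" l'] b that by (simp add: mult_ac)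
    ultimately show ?case
      using b \<open>j \<in> O_K\<close> by (intro bexI[of _ "b * j ^ l'"]) (auto intro: O_mult O_power)
  qed
  from this[of "rad \<inter> Res"] obtain b where b: "b \<in> O_K" "b \<notin> PO" "\<forall>j\<in>rad \<inter> Res. b * j \<in> PO" by auto
  have "b * j \<in> PO" if j: "j \<in> rad" for j
  proof -
    have "red j \<in> rad \<inter> Res" using red_in[OF omod_rad PO_rad] red_Res rad_O j by auto
    then have "b * red j + b * (j - red j) \<in> PO"
      using omod_add[OF omod_PO bspec[OF b(3)] omod_mult[OF omod_PO b(1) red_PO[OF rad_O[OF j]]]] by blast
    then show ?thesis by (simp add: algebra_simps)
  qed
  then show ?thesis using b by blast
qed

text \<open>The determinant trick for \<open>rad\<close>, which is finitely generated as a group: by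
  its residues together with \<open>p\<close> times an integral basis.\<close>

lemma rad_stable_algebraic_int:
  assumes "\<And>j. j \<in> rad \<Longrightarrow> x * j \<in> rad" shows "algebraic_int x"
proof -
  obtain w where w: "zbasis O_K deg w" using ex_zbasis by blast
  define B where "B = insert (of_nat p) ((rad \<inter> Res) \<union> (\<lambda>i. of_nat p * w i) ` {..<deg})"
  have finB: "finite B" by (simp add: B_def)
  have Brad: "B \<subseteq> rad"
    using PO_rad p_in_PO zbasis_in[OF w] by (auto simp: B_def PO_def)
  have span: "y \<in> int_span B" if y: "y \<in> rad" for y
  proof -
    have "red y \<in> B" using red_in[OF omod_rad PO_rad] red_Res rad_O y by (auto simp: B_def)
    obtain z where z: "z \<in> O_K" "y - red y = of_nat p * z" using red_PO[OF rad_O[OF y]] by (auto simp: PO_def)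
    obtain c :: "nat \<Rightarrow> int" where c: "z = (\<Sum>i<deg. of_int (c i) * w i)" using zbasis_repr[OF w z(1)] by blast
    have "y = red y + (\<Sum>i<deg. of_int (c i) * (of_nat p * w i))"
      using z(2) by (simp add: c sum_distrib_left algebra_simps)
    also have "\<dots> \<in> int_span B"
      by (intro int_span_add int_span_sum int_span_mult_int int_span_base[OF finB] \<open>red y \<in> B\<close>)
        (auto simp: B_def)
    finally show ?thesis .
  qed
  show ?thesis
  proof (rule algebraic_int_of_stable_span[OF finB])
    show "\<exists>b\<in>B. b \<noteq> 0" by (intro bexI[of _ "of_nat p"]) (auto simp: B_def)
    show "x * b \<in> int_span B" if "b \<in> B" for b using span assms that Brad by auto
  qed
qed

text \<open>The largest subset of \<open>K\<close> whose product with \<open>rad\<close> is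
  integral, hence the only candidate for an inverse.\<close>

definition radinv :: "complex set" where "radinv = {x \<in> K. \<forall>j\<in>rad. x * j \<in> O_K}"

lemma omod_radinv: "omod radinv"
  unfolding omod_def radinv_def
  by (auto simp: O_K_sub K_add K_mult distrib_right mult.assoc O_add O_mult)

lemma gstable_radinv: "gstable radinv"
  unfolding gstable_def
proof (intro ballI)
  fix g x assume g: "g \<in> gal K" and x: "x \<in> radinv"
  obtain k where k: "k \<in> gal K" "\<And>x. x \<in> K \<Longrightarrow> g (k x) = x"
    using gal_inverse_ex[OF g] by blast
  have xK: "x \<in> K" using x by (simp add: radinv_def)
  have "g x * j \<in> O_K" if j: "j \<in> rad" for j
  proof -
    have kj: "k j \<in> rad" using gstable_rad k j by (auto simp: gstable_def)
    then have "x * k j \<in> O_K" using x by (simp add: radinv_def)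
    then have "g (x * k j) \<in> O_K" by (rule g_O[OF g])
    then show ?thesis using g_mult[OF g xK, of "k j"] k(2) kj j rad_O O_K_sub by simp
  qed
  then show "g x \<in> radinv" using g_in[OF g xK] by (simp add: radinv_def)
qed

lemma one_in_radinv: "1 \<in> radinv" using rad_O by (simp add: radinv_def)

text \<open>The product is a stable ideal containing \<open>rad\<close>. Were it proper, it would
  lie in \<open>rad\<close>; then \<open>b / p\<close>, with \<open>b\<close> from
  \<open>ex_annihilator\<close>, belongs to \<open>radinv\<close> and multiplies \<open>rad\<close>
  into itself, so it is integral and \<open>b\<close> lies in \<open>PO\<close>, a
  contradiction.\<close>

lemma prd_rad_radinv: "prd rad radinv = O_K"
proof -
  define I where "I = prd rad radinv"
  have I: "omod I" unfolding I_def by (intro omod_prd omod_rad omod_radinv)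
  have IO: "I \<subseteq> O_K" unfolding I_def by (rule prd_subset) (auto simp: radinv_def mult.commute O_add)
  have gI: "gstable I" unfolding I_def by (intro gstable_prd omod_rad omod_radinv gstable_rad gstable_radinv)
  have radI: "rad \<subseteq> I" unfolding I_def using prd_prod[OF _ one_in_radinv, of _ rad] by auto
  have "1 \<in> I"
  proof (rule ccontr)
    assume "1 \<notin> I"
    then have "I \<subseteq> rad" using gstable_ideal_in_rad[OF I IO gI] radI PO_rad p_in_PO by blast
    obtain b where b: "b \<in> O_K" "b \<notin> PO" "\<forall>j\<in>rad. b * j \<in> PO" using ex_annihilator by blast
    have bK: "b / of_nat p \<in> K" by (rule K_divide[OF O_K_sub[OF b(1)] K_of_nat])
    have bi: "b / of_nat p \<in> radinv"
      using b bK by (auto simp: radinv_def PO_iff)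
    have "b / of_nat p * j \<in> rad" if "j \<in> rad" for j
      using prd_prod[OF that bi] \<open>I \<subseteq> rad\<close> by (auto simp: I_def mult.commute)
    then have "algebraic_int (b / of_nat p)" by (rule rad_stable_algebraic_int)
    then have "b / of_nat p \<in> O_K" using bK by (simp add: O_K_def)
    then show False using b(2) by (simp add: PO_iff)
  qed
  then show ?thesis using omod_eq_O[OF I IO] by (simp add: I_def)
qed

lemma prd_rad_radinv_cancel: "omod I \<Longrightarrow> prd rad (prd radinv I) = I" "omod I \<Longrightarrow> prd radinv (prd rad I) = I"
  by (simp_all add: prd_rad_radinv prd_O flip: prd_assoc)
    (simp add: prd_commute[of radinv rad] prd_rad_radinv prd_O)

definition rpow :: "nat \<Rightarrow> complex set" where "rpow i = (prd rad ^^ i) O_K"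

lemma rpow_0 [simp]: "rpow 0 = O_K" and rpow_Suc: "rpow (Suc i) = prd rad (rpow i)"
  by (simp_all add: rpow_def)

lemma rpow_1: "rpow (Suc 0) = rad"
  by (simp add: rpow_Suc prd_commute[of rad] prd_O omod_rad)

lemma omod_rpow: "omod (rpow i)"
  by (induction i) (auto simp: rpow_Suc omod_O intro: omod_prd omod_rad)

lemma rpow_Suc_subset: "rpow (Suc i) \<subseteq> rpow i"
  unfolding rpow_Suc using prd_subset[of rad "rpow i" "rpow i"] omod_rpow[of i] rad_O
  by (auto intro: omod_mult omod_add)

lemma rpow_subset_O: "rpow i \<subseteq> O_K"
  by (induction i) (use rpow_Suc_subset in auto)

text \<open>Equality of two consecutive powers could be cancelled down to \<open>rad = O_K\<close>
  by multiplying with \<open>radinv\<close>.\<close>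

lemma rpow_Suc_strict: "rpow (Suc i) \<subset> rpow i"
proof -
  have "\<not> rpow i \<subseteq> rpow (Suc i)"
  proof (induction i)
    case 0
    have "1 \<in> rpow 0" "1 \<notin> rpow (Suc 0)" using one_notin_rad by (simp_all add: rpow_1)
    then show ?case by blast
  next
    case (Suc i)
    show ?case
    proof
      assume "rpow (Suc i) \<subseteq> rpow (Suc (Suc i))"
      then have "prd radinv (rpow (Suc i)) \<subseteq> prd radinv (rpow (Suc (Suc i)))" by (intro prd_mono) auto
      then have "rpow i \<subseteq> rpow (Suc i)"
        by (simp add: rpow_Suc[of i] rpow_Suc[of "Suc i"] prd_rad_radinv_cancel omod_rpow omod_prd omod_rad)
      then show False using Suc by blast
    qed
  qed
  then show ?thesis using rpow_Suc_subset by blast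
qed

lemma nu_rpow:
  assumes "PO \<subseteq> rpow (i + k)" shows "2 ^ k * nu (rpow (i + k)) \<le> nu (rpow i)"
  using assms
proof (induction k)
  case (Suc k)
  have P: "PO \<subseteq> rpow (i + k)" using Suc.prems rpow_Suc_subset[of "i + k"] by auto
  have "2 * nu (rpow (Suc (i + k))) \<le> nu (rpow (i + k))"
    using Suc.prems by (intro nu_strict omod_rpow rpow_Suc_strict rpow_subset_O) auto
  then have "2 ^ Suc k * nu (rpow (i + Suc k)) \<le> 2 ^ k * nu (rpow (i + k))" by simp
  also have "\<dots> \<le> nu (rpow i)" using Suc.IH[OF P] .
  finally show ?case .
qed simp

text \<open>Take \<open>e\<close> maximal with \<open>PO\<close> inside \<open>rpow e\<close>.
  Dividing \<open>PO\<close> by \<open>rad\<close> that many times leaves a stable integral ideal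
  \<open>I e\<close>; if it were proper, it would lie in \<open>rad\<close>, and multiplying back
  would put \<open>PO\<close> into \<open>rpow (Suc e)\<close>.\<close>

lemma ex_ramification_index: "\<exists>e. 0 < e \<and> rpow e = PO"
proof -
  define P where "P i \<longleftrightarrow> PO \<subseteq> rpow i" for i
  \<comment> \<open>Each of the \<open>i\<close> strict inclusions between \<open>rpow i\<close> and
    \<open>O_K\<close> costs a factor 2 of the total index \<open>p ^ deg\<close>, so a greatest
    exponent exists.\<close>
  have bound: "i \<le> p ^ deg" if "P i" for i
  proof -
    have "2 ^ i * nu (rpow i) \<le> p ^ deg" using nu_rpow[of 0 i] that nu_O by (simp add: P_def)
    moreover have "1 \<le> nu (rpow i)" using nu_pos omod_rpow that by (simp add: P_def)
    ultimately have "2 ^ i \<le> p ^ deg" using le_trans[of "2 ^ i" "2 ^ i * nu (rpow i)"] by simp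
    then show ?thesis using less_exp[of i] by linarith
  qed
  have P1: "P 1" using PO_rad by (simp add: P_def rpow_1)
  define e where "e = (GREATEST i. P i)"
  have Pe: "P e" unfolding e_def using GreatestI_nat[of P 1, OF P1] bound by blast
  have e1: "1 \<le> e" unfolding e_def using Greatest_le_nat[of P 1, OF P1] bound by blast
  have nP: "\<not> P (Suc e)"
  proof
    assume "P (Suc e)"
    then have "Suc e \<le> e" using Greatest_le_nat[of P "Suc e"] bound unfolding e_def by blast
    then show False by simp
  qed
  define I where "I i = (prd radinv ^^ i) PO" for i
  have I: "omod (I i) \<and> gstable (I i) \<and> PO \<subseteq> I i \<and> (prd rad ^^ i) (I i) = PO" for i
  proof (induction i)
    case 0
    then show ?case by (simp add: I_def omod_PO gstable_PO)
  next
    case (Suc i)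
    have IS: "I (Suc i) = prd radinv (I i)" by (simp add: I_def)
    have "I i \<subseteq> I (Suc i)" unfolding IS using prd_prod[OF one_in_radinv, of _ "I i"] by auto
    moreover have "(prd rad ^^ Suc i) (I (Suc i)) = (prd rad ^^ i) (I i)"
      unfolding IS funpow_Suc_right using Suc by (simp add: prd_rad_radinv_cancel)
    ultimately show ?case using Suc
      by (auto simp: IS intro!: omod_prd omod_radinv gstable_prd gstable_radinv)
  qed
  have mono: "(prd rad ^^ i) A \<subseteq> (prd rad ^^ i) B" if "A \<subseteq> B" for A B i
    using that by (induction i) (simp_all add: prd_mono)
  have IO: "I e \<subseteq> O_K"
  proof -
    have cancel: "(prd radinv ^^ i) (rpow i) = O_K" for i
    proof (induction i)
      case (Suc i)
      then show ?case
        unfolding funpow_Suc_right by (simp add: rpow_Suc prd_rad_radinv_cancel omod_rpow)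
    qed simp
    have "(prd radinv ^^ i) A \<subseteq> (prd radinv ^^ i) B" if "A \<subseteq> B" for A B i
      using that by (induction i) (simp_all add: prd_mono)
    then show ?thesis using Pe cancel[of e] unfolding I_def P_def by blast
  qed
  have "1 \<in> I e"
  proof (rule ccontr)
    assume "1 \<notin> I e"
    then have "I e \<subseteq> rad" using gstable_ideal_in_rad[of "I e"] I[of e] IO p_in_PO by blast
    then have "PO \<subseteq> (prd rad ^^ e) rad" using mono I[of e] by metis
    also have "(prd rad ^^ e) rad = rpow (Suc e)"
      unfolding rpow_def funpow_Suc_right using rpow_1 by (simp add: rpow_def)
    finally show False using nP by (simp add: P_def)
  qed
  then have "I e = O_K" using omod_eq_O[of "I e"] I[of e] IO by blast
  then have "rpow e = PO" using I[of e] by (simp add: rpow_def)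
  then show ?thesis using e1 by (intro exI[of _ e]) auto
qed

definition ram :: nat where "ram = (SOME e. 0 < e \<and> rpow e = PO)"

lemma ram_pos: "0 < ram" and rpow_ram: "rpow ram = PO"
  using someI_ex[OF ex_ramification_index] unfolding ram_def by auto

lemma ram_eq_1_iff: "ram = 1 \<longleftrightarrow> rad = PO"
proof
  assume "ram = 1"
  then show "rad = PO" using rpow_ram rpow_1 by simp
next
  assume "rad = PO"
  show "ram = 1"
  proof (rule ccontr)
    assume "ram \<noteq> 1"
    then obtain k where k: "ram = Suc (Suc k)" using ram_pos by (metis One_nat_def not0_implies_Suc less_nat_zero_code)
    have sub: "rpow (Suc (Suc j)) \<subseteq> rpow (Suc (Suc 0))" for j
      by (induction j) (use rpow_Suc_subset in auto)
    then show False using rpow_Suc_strict[of "Suc 0"] k rpow_ram \<open>rad = PO\<close> rpow_1 sub[of k] by auto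
  qed
qed

text \<open>From \<open>rad\<close> down to \<open>rpow ram = PO\<close> there are
  \<open>ram - 1\<close> strict inclusions, each doubling the index.\<close>

lemma ram_le_nu: "2 ^ (ram - 1) \<le> nu rad"
proof -
  have "2 ^ (ram - 1) * nu (rpow (1 + (ram - 1))) \<le> nu (rpow 1)"
    by (rule nu_rpow) (use ram_pos rpow_ram in auto)
  moreover have "1 \<le> nu (rpow (1 + (ram - 1)))"
    using ram_pos rpow_ram nu_pos[OF omod_PO] by simp
  ultimately show ?thesis using rpow_1 le_trans[of "2 ^ (ram - 1)" "2 ^ (ram - 1) * nu (rpow (1 + (ram - 1)))"]
    by simp
qed

text \<open>The ring of integers acts on the quotient of \<open>rad\<close> by \<open>p O\<close>; when \<open>p\<close> ramifies, the kernel of this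
  action lies in \<open>rad\<close>.\<close>

lemma deg_bound_nu:
  assumes "rad \<noteq> PO" shows "p ^ deg \<le> nu rad ^ nu rad * nu rad"
proof -
  define Y where "Y = rad \<inter> Res"
  define F where "F x = restrict (\<lambda>y. red (x * y)) Y" for x
  have YO: "y \<in> O_K" if "y \<in> Y" for y using that Res_O by (auto simp: Y_def)
  have FY: "F x \<in> PiE Y (\<lambda>_. Y)" if x: "x \<in> Res" for x
  proof -
    have "red (x * y) \<in> Y" if y: "y \<in> Y" for y
      using red_in[OF omod_rad PO_rad, of "x * y"] omod_mult[OF omod_rad, of x y] x y Res_O red_Res O_mult YO
      by (auto simp: Y_def)
    then show ?thesis by (auto simp: F_def)
  qed
  have ker: "x - y \<in> rad" if x: "x \<in> Res" and y: "y \<in> Res" and xy: "F x = F y" for x y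
  proof -
    have 1: "(x - y) * j \<in> PO" if j: "j \<in> rad" for j
    proof -
      have rj: "red j \<in> Y" using red_in[OF omod_rad PO_rad] red_Res rad_O j by (auto simp: Y_def)
      have "F x (red j) = F y (red j)" using xy by simp
      then have "red (x * red j) = red (y * red j)" using rj by (simp add: F_def)
      then have "x * red j - y * red j \<in> PO" using red_eq_iff O_mult Res_O x y YO[OF rj] by blast
      moreover have "(x - y) * (j - red j) \<in> PO"
        by (rule omod_mult[OF omod_PO O_diff[OF Res_O[OF x] Res_O[OF y]] red_PO[OF rad_O[OF j]]])
      ultimately have "x * red j - y * red j + (x - y) * (j - red j) \<in> PO" by (rule omod_add[OF omod_PO])
      then show ?thesis by (simp add: algebra_simps)
    qed
    \<comment> \<open>An element that kills \<open>rad\<close> modulo \<open>p\<close> lies in the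
      product of \<open>radinv\<close> and \<open>PO\<close>, which is \<open>rad\<close> to the
      power \<open>ram - 1\<close>. Ramification makes this exponent positive, so the element lies
      in \<open>rad\<close>.\<close>
    obtain k where k: "ram = Suc (Suc k)"
      using ram_pos ram_eq_1_iff assms by (metis One_nat_def not0_implies_Suc less_nat_zero_code)
    have "prd radinv PO = rpow (Suc k)"
      using rpow_ram k by (simp add: rpow_Suc[of "Suc k"] prd_rad_radinv_cancel omod_rpow flip: rpow_ram)
    moreover have "rpow (Suc k) \<subseteq> rad"
      by (induction k) (use rpow_1 rpow_Suc_subset in auto)
    moreover have "x - y \<in> prd radinv PO"
    proof -
      have "prd radinv rad \<subseteq> {z. (x - y) * z \<in> prd radinv PO}"
      proof (rule prd_subset)
        fix a j assume "a \<in> radinv" "j \<in> rad"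
        then have "a * ((x - y) * j) \<in> prd radinv PO" using 1 by (intro prd_prod) auto
        then show "a * j \<in> {z. (x - y) * z \<in> prd radinv PO}" by (simp add: algebra_simps)
      qed (auto simp: distrib_left intro: prd_sum)
      then have "O_K \<subseteq> {z. (x - y) * z \<in> prd radinv PO}"
        using prd_rad_radinv by (simp add: prd_commute[of radinv])
      then have "1 \<in> {z. (x - y) * z \<in> prd radinv PO}" using O_1 by blast
      then show ?thesis by simp
    qed
    ultimately show ?thesis by auto
  qed
  \<comment> \<open>Residues with the same action differ by an element of \<open>rad\<close>, so at
    most \<open>nu rad\<close> of them share a value of \<open>F\<close>, and \<open>F\<close> has
    at most \<open>nu rad ^ nu rad\<close> values.\<close>
  have "card Res \<le> card (F ` Res) * nu rad"
  proof -
    have fib: "card {x \<in> Res. F x = f} \<le> nu rad" if f: "f \<in> F ` Res" for f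
    proof -
      obtain y where y: "y \<in> Res" "f = F y" using f by blast
      have "inj_on (\<lambda>x. red (x - y)) {x \<in> Res. F x = f}"
        by (rule inj_onI) (auto simp: red_eq_iff Res_O y O_diff intro: Res_unique)
      moreover have "(\<lambda>x. red (x - y)) ` {x \<in> Res. F x = f} \<subseteq> rad \<inter> Res"
        using red_in[OF omod_rad PO_rad] ker y Res_O O_diff red_Res by auto
      ultimately show ?thesis unfolding nu_def by (intro card_inj_on_le) auto
    qed
    have "card Res = (\<Sum>f\<in>F ` Res. card {x \<in> Res. F x = f})"
      using card_eq_sum sum.image_gen[of Res "\<lambda>_. 1 :: nat" F] by simp
    also have "\<dots> \<le> (\<Sum>f\<in>F ` Res. nu rad)" by (intro sum_mono fib)
    finally show ?thesis by simp
  qed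
  also have "card (F ` Res) \<le> card (PiE Y (\<lambda>_. Y))"
    using FY by (intro card_mono finite_PiE) (auto simp: Y_def)
  also have "card (PiE Y (\<lambda>_. Y)) = nu rad ^ nu rad"
    by (simp add: card_PiE Y_def nu_def)
  finally show ?thesis by (simp add: card_Res)
qed

end

section \<open>The p-part of the discriminant\<close>

context galois_ext
begin

text \<open>The replacement is unimodular because the coefficient of \<open>w i0\<close> in the new
  member is 1.\<close>

lemma zbasis_replace:
  fixes c :: "nat \<Rightarrow> int"
  assumes w: "zbasis O_K n w" and i0: "i0 < n" and c0: "c i0 = 1"
  shows "zbasis O_K n (w(i0 := \<Sum>i<n. of_int (c i) * w i))"
proof -
  define w' where "w' = w(i0 := \<Sum>i<n. of_int (c i) * w i)"
  have rem: "(\<Sum>i<n. h i) = h i0 + (\<Sum>i\<in>{..<n} - {i0}. h i)" for h :: "nat \<Rightarrow> complex"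
    using i0 by (intro sum.remove) auto
  have w0: "w' i0 = w i0 + (\<Sum>i\<in>{..<n} - {i0}. of_int (c i) * w i)"
    using c0 by (simp add: w'_def rem)
  have expand: "(\<Sum>i<n. of_int (e i) * w' i) =
     (\<Sum>i<n. of_int (if i = i0 then e i0 else e i + e i0 * c i) * w i)" for e :: "nat \<Rightarrow> int"
  proof -
    have "(\<Sum>i\<in>{..<n} - {i0}. of_int (e i) * w' i) = (\<Sum>i\<in>{..<n} - {i0}. of_int (e i) * w i)"
      by (rule sum.cong) (auto simp: w'_def)
    moreover have "(\<Sum>i\<in>{..<n} - {i0}. of_int (if i = i0 then e i0 else e i + e i0 * c i) * w i) =
        (\<Sum>i\<in>{..<n} - {i0}. of_int (e i) * w i) + of_int (e i0) * (\<Sum>i\<in>{..<n} - {i0}. of_int (c i) * w i)"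
      unfolding sum_distrib_left sum.distrib[symmetric]
      by (rule sum.cong) (auto simp: algebra_simps)
    ultimately show ?thesis unfolding rem by (simp add: w0 algebra_simps)
  qed
  show ?thesis unfolding w'_def[symmetric] zbasis_def
  proof (intro conjI allI ballI impI)
    fix i assume "i < n"
    then show "w' i \<in> O_K"
      using zbasis_in[OF w] by (auto simp: w'_def intro!: O_sum O_mult)
  next
    fix x assume "x \<in> O_K"
    then obtain d :: "nat \<Rightarrow> int" where d: "x = (\<Sum>i<n. of_int (d i) * w i)" using zbasis_repr[OF w] by blast
    have "(\<Sum>i<n. of_int ((\<lambda>i. if i = i0 then d i0 else d i - d i0 * c i) i) * w' i) = x"
      unfolding expand d by (rule sum.cong) auto
    then show "\<exists>c :: nat \<Rightarrow> int. x = (\<Sum>i<n. of_int (c i) * w' i)" by metis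
  next
    fix e :: "nat \<Rightarrow> int" and i assume e: "(\<Sum>i<n. of_int (e i) * w' i) = 0" and i: "i < n"
    have z: "(if i = i0 then e i0 else e i + e i0 * c i) = 0" if "i < n" for i
      by (rule zbasis_indep[OF w _ that, of "\<lambda>i. if i = i0 then e i0 else e i + e i0 * c i"])
        (use e expand in simp)
    have "e i0 = 0" using z[OF i0] by simp
    then show "e i = 0" using z[OF i] by (simp split: if_splits)
  qed
qed

end

text \<open>In the Leibniz expansion every summand picks one entry from each row in
  \<open>H\<close>.\<close>

lemma prime_power_dvd_det:
  fixes A :: "int mat"
  assumes A: "A \<in> carrier_mat n n" and H: "H \<subseteq> {0..<n}"
    and dv: "\<And>i j. i \<in> H \<Longrightarrow> j < n \<Longrightarrow> q dvd A $$ (i, j)"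
  shows "q ^ card H dvd det A"
  unfolding det_def'[OF A]
proof (rule dvd_sum)
  fix \<pi> assume "\<pi> \<in> {\<pi>. \<pi> permutes {0..<n}}"
  then have \<pi>: "\<pi> i < n" if "i < n" for i using that permutes_in_image[of \<pi> "{0..<n}" i] by simp
  have fin: "finite H" using H finite_subset by blast
  have "q ^ card H = (\<Prod>i\<in>H. q)" by simp
  also have "\<dots> dvd (\<Prod>i\<in>H. A $$ (i, \<pi> i))" using H \<pi> dv by (intro prod_dvd_prod) auto
  also have "\<dots> dvd (\<Prod>i = 0..<n. A $$ (i, \<pi> i))" using H by (intro prod_dvd_prod_subset) auto
  finally show "q ^ card H dvd signof \<pi> * (\<Prod>i = 0..<n. A $$ (i, \<pi> i))" by (rule dvd_mult)
qed

context galois_prime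
begin

text \<open>All conjugates of \<open>x\<close> lie in the stable ideal \<open>rad\<close>, hence so
  does the trace; and a rational integer with a power divisible by \<open>p\<close> is itself
  divisible by \<open>p\<close>.\<close>

lemma tr_rad: "x \<in> rad \<Longrightarrow> int p dvd tr x"
proof -
  assume x: "x \<in> rad"
  have "(\<Sum>g\<in>gal K. g x) \<in> rad"
    by (rule omod_sum[OF omod_rad]) (use gstable_rad x in \<open>auto simp: gstable_def\<close>)
  then have "of_int (tr x) \<in> rad" by (simp add: of_int_tr rad_O[OF x])
  then obtain k where "of_int (tr x) ^ k \<in> PO" by (auto simp: rad_def)
  then have "of_int (tr x ^ k) \<in> PO" by simp
  then have "int p dvd tr x ^ k" unfolding PO_Ints .
  then show ?thesis using p prime_dvd_power[of "int p"] by auto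
qed

text \<open>Take an integral basis with as many elements in \<open>rad\<close> as possible: the others are independent modulo
  \<open>rad\<close>, and the rows of the trace matrix that belong to \<open>rad\<close> are divisible by \<open>p\<close>.\<close>

lemma nu_rad_dvd: "\<exists>h. nu rad \<le> p ^ h \<and> int p ^ h dvd discriminant K"
proof -
  define Hs where "Hs w = {i. i < deg \<and> w i \<in> rad}" for w
  define Q where "Q h \<longleftrightarrow> (\<exists>w. zbasis O_K deg w \<and> card (Hs w) = h)" for h
  have finH: "finite (Hs w)" for w by (simp add: Hs_def)
  have bd: "h \<le> deg" if "Q h" for h
  proof -
    from that obtain w where "card (Hs w) = h" by (auto simp: Q_def)
    moreover have "card (Hs w) \<le> card {..<deg}" by (intro card_mono) (auto simp: Hs_def)
    ultimately show ?thesis by simp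
  qed
  obtain w0 where "zbasis O_K deg w0" using ex_zbasis by blast
  then have "Q (card (Hs w0))" by (auto simp: Q_def)
  then have "Q (GREATEST h. Q h)" using GreatestI_nat[of Q _ deg] bd by blast
  then obtain w where w: "zbasis O_K deg w" "card (Hs w) = (GREATEST h. Q h)" by (auto simp: Q_def)
  have max: "card (Hs w') \<le> card (Hs w)" if "zbasis O_K deg w'" for w'
  proof -
    have "Q (card (Hs w'))" using that by (auto simp: Q_def)
    then show ?thesis using Greatest_le_nat[of Q "card (Hs w')" deg] bd w(2) by simp
  qed
  define S where "S = {i. i < deg \<and> w i \<notin> rad}"
  have finS: "finite S" by (simp add: S_def)
  have wO: "w i \<in> O_K" if "i < deg" for i using zbasis_in[OF w(1) that] .
  \<comment> \<open>With \<open>a\<close> inverse to \<open>c i0\<close> modulo \<open>p\<close>,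
    multiplying the relation by \<open>a\<close> and correcting by a multiple of
    \<open>p * w i0\<close>, which lies in \<open>rad\<close>, gives an element of
    \<open>rad\<close> with coefficient 1 at \<open>i0\<close>. Exchanging \<open>w i0\<close> for
    it would contradict maximality.\<close>
  have indep: "int p dvd c i0" if c: "(\<Sum>i\<in>S. of_int (c i) * w i) \<in> rad" and i0: "i0 \<in> S" for c :: "nat \<Rightarrow> int" and i0
  proof (rule ccontr)
    assume nd: "\<not> int p dvd c i0"
    then have "Rings.coprime (int p) (c i0)" using p by (simp add: prime_imp_coprime)
    then obtain b a where ab: "b * int p + a * c i0 = 1" using bezout_int by (metis coprime_imp_gcd_eq_1)
    define c' where "c' i = (if i = i0 then 1 else if i \<in> S then a * c i else 0)" for i
    have i0d: "i0 < deg" using i0 by (simp add: S_def)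
    define v where "v = (\<Sum>i<deg. of_int (c' i) * w i)"
    have "v = (\<Sum>i\<in>S. of_int (c' i) * w i)"
      unfolding v_def using i0 by (intro sum.mono_neutral_right) (auto simp: S_def c'_def)
    also have "\<dots> = of_int (c' i0) * w i0 + (\<Sum>i\<in>S - {i0}. of_int (c' i) * w i)"
      by (rule sum.remove[OF finS i0])
    also have "(\<Sum>i\<in>S - {i0}. of_int (c' i) * w i) = (\<Sum>i\<in>S - {i0}. of_int a * (of_int (c i) * w i))"
      by (rule sum.cong) (auto simp: c'_def)
    also have "\<dots> = of_int a * ((\<Sum>i\<in>S. of_int (c i) * w i) - of_int (c i0) * w i0)"
      by (simp add: sum_distrib_left sum.remove[OF finS i0])
    also have "of_int (c' i0) * w i0 = of_int (b * int p + a * c i0) * w i0" by (simp add: c'_def ab)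
    finally have "v = of_int a * (\<Sum>i\<in>S. of_int (c i) * w i) + (of_int b * w i0) * of_nat p"
      by (simp add: algebra_simps)
    moreover have "of_nat p \<in> rad" using PO_rad p_in_PO by blast
    ultimately have "v \<in> rad"
      using omod_add[OF omod_rad omod_mult[OF omod_rad O_of_int c] omod_mult[OF omod_rad O_mult[OF O_of_int wO[OF i0d]]]]
      by simp
    then have "insert i0 (Hs w) \<subseteq> Hs (w(i0 := v))" using i0d by (auto simp: Hs_def)
    then have "card (insert i0 (Hs w)) \<le> card (Hs (w(i0 := v)))" by (intro card_mono finH)
    moreover have "i0 \<notin> Hs w" using i0 by (simp add: S_def Hs_def)
    ultimately have "card (Hs w) < card (Hs (w(i0 := v)))" using finH by simp
    moreover have "zbasis O_K deg (w(i0 := v))"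
      unfolding v_def by (rule zbasis_replace[OF w(1) i0d]) (simp add: c'_def)
    ultimately show False using max by fastforce
  qed
  define C where "C = PiE S (\<lambda>_. {0..<int p})"
  define s where "s c = (\<Sum>i\<in>S. of_int (c i) * w i)" for c :: "nat \<Rightarrow> int"
  have sO: "s c \<in> O_K" for c unfolding s_def using wO by (intro O_sum O_mult) (auto simp: S_def)
  \<comment> \<open>The residues in \<open>rad\<close>, combined with the digit combinations of the
    basis members outside \<open>rad\<close>, embed into all residues; comparing cardinalities gives
    \<open>nu rad \<le> p ^ card (Hs w)\<close>.\<close>
  have inj: "inj_on (\<lambda>(j, c). red (j + s c)) ((rad \<inter> Res) \<times> C)"
  proof (rule inj_onI, clarify)
    fix j c j' c'
    assume j: "j \<in> rad" "j \<in> Res" "j' \<in> rad" "j' \<in> Res" and c: "c \<in> C" "c' \<in> C"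
      and eq: "red (j + s c) = red (j' + s c')"
    have jO: "j \<in> O_K" "j' \<in> O_K" using j rad_O by auto
    have P: "(j + s c) - (j' + s c') \<in> PO" using eq red_eq_iff[of "j + s c" "j' + s c'"] jO sO O_add by blast
    have "(j + s c) - (j' + s c') - (j - j') \<in> rad"
      by (rule omod_diff[OF omod_rad subsetD[OF PO_rad P] omod_diff[OF omod_rad j(1) j(3)]])
    then have "(\<Sum>i\<in>S. of_int (c i - c' i) * w i) \<in> rad"
      by (simp add: s_def left_diff_distrib sum_subtractf)
    then have d: "int p dvd c i - c' i" if "i \<in> S" for i by (rule indep[OF _ that])
    have cc: "c i = c' i" if i: "i \<in> S" for i
    proof -
      have "0 \<le> c i" "c i < int p" "0 \<le> c' i" "c' i < int p"
        using c i unfolding C_def PiE_def Pi_def by auto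
      then show ?thesis using d[OF i] by (metis mod_eq_dvd_iff mod_pos_pos_trivial)
    qed
    have ceq: "c = c'" using c unfolding C_def by (intro PiE_ext[of c S _ c']) (auto simp: cc)
    then have "j - j' \<in> PO" using P by simp
    then show "j = j' \<and> c = c'" using Res_unique j ceq by blast
  qed
  have "card ((rad \<inter> Res) \<times> C) \<le> card Res"
    by (rule card_inj_on_le[OF inj]) (auto intro!: red_Res O_add sO simp: rad_O)
  then have le: "nu rad * p ^ card S \<le> p ^ deg"
    by (simp add: nu_def card_cartesian_product C_def card_PiE finS card_Res)
  have "card (Hs w) + card S = deg"
  proof -
    have "Hs w \<union> S = {..<deg}" "Hs w \<inter> S = {}" by (auto simp: Hs_def S_def)
    then show ?thesis by (metis card_Un_disjoint card_lessThan finH finS)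
  qed
  then have "nu rad * p ^ card S \<le> p ^ card (Hs w) * p ^ card S" using le by (simp flip: power_add)
  then have "nu rad \<le> p ^ card (Hs w)" by simp
  moreover have "int p ^ card (Hs w) dvd det (tr_mat w)"
  proof (rule prime_power_dvd_det[of _ deg])
    show "tr_mat w \<in> carrier_mat deg deg" by (simp add: tr_mat_def)
    show "Hs w \<subseteq> {0..<deg}" by (auto simp: Hs_def)
    fix i j assume "i \<in> Hs w" "j < deg"
    then show "int p dvd tr_mat w $$ (i, j)"
      by (auto simp: tr_mat_def Hs_def intro!: tr_rad omod_mult'[OF omod_rad] wO)
  qed
  ultimately show ?thesis using discriminant_eq[OF w(1)] by auto
qed

lemma nu_rad_le: "nu rad \<le> p ^ multiplicity (int p) (discriminant K)"
proof -
  obtain h where h: "nu rad \<le> p ^ h" "int p ^ h dvd discriminant K" using nu_rad_dvd by blast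
  have "h \<le> multiplicity (int p) (discriminant K)"
    using h(2) discriminant_nonzero p_gt1 by (intro multiplicity_geI) auto
  then have "p ^ h \<le> p ^ multiplicity (int p) (discriminant K)" using p_gt1 by (intro power_increasing) auto
  then show ?thesis using h(1) by linarith
qed

lemma ram_bound: "2 ^ (ram - 1) \<le> p ^ multiplicity (int p) (discriminant K)"
  using ram_le_nu nu_rad_le by linarith

end

section \<open>Ideal classes\<close>

text \<open>Products of powers of the generators with exponents below \<open>e q\<close> are closed
  under multiplication and contain inverses, because each generator has finite order. The ambient
  structure is a commutative monoid on purpose: invertibility is read off these relations instead of
  being proved for all fractional ideals.\<close>

lemma generate_subset_finite:
  fixes M (structure)
  assumes M: "comm_monoid M" and fin: "finite P" and x: "\<And>q. q \<in> P \<Longrightarrow> x q \<in> carrier M"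
    and e: "\<And>q. q \<in> P \<Longrightarrow> 0 < e q \<and> x q [^]\<^bsub>M\<^esub> (e q :: nat) = \<one>\<^bsub>M\<^esub>"
    and S: "S \<subseteq> insert \<one>\<^bsub>M\<^esub> (x ` P)"
  shows "card (generate M S) \<le> (\<Prod>q\<in>P. e q)"
proof -
  interpret comm_monoid M by fact
  have "\<exists>T. finite T \<and> card T \<le> (\<Prod>q\<in>P. e q) \<and> T \<subseteq> carrier M \<and> insert \<one> (x ` P) \<subseteq> T \<and>
    (\<forall>s\<in>T. \<forall>t\<in>T. s \<otimes> t \<in> T) \<and> (\<forall>s\<in>T. \<exists>t\<in>T. s \<otimes> t = \<one>)"
    using fin x e
  proof (induction P rule: finite_induct)
    case empty
    then show ?case by (intro exI[of _ "{\<one>}"]) auto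
  next
    case (insert a P)
      have IH: "\<exists>T. finite T \<and> card T \<le> (\<Prod>q\<in>P. e q) \<and> T \<subseteq> carrier M \<and> insert \<one> (x ` P) \<subseteq> T \<and>
      (\<forall>s\<in>T. \<forall>t\<in>T. s \<otimes> t \<in> T) \<and> (\<forall>s\<in>T. \<exists>t\<in>T. s \<otimes> t = \<one>)"
      by (rule insert.IH) (use insert.prems in auto)
    then obtain T where "finite T \<and> card T \<le> (\<Prod>q\<in>P. e q) \<and> T \<subseteq> carrier M \<and> insert \<one> (x ` P) \<subseteq> T \<and>
      (\<forall>s\<in>T. \<forall>t\<in>T. s \<otimes> t \<in> T) \<and> (\<forall>s\<in>T. \<exists>t\<in>T. s \<otimes> t = \<one>)" by (erule exE)
    then have T: "finite T" "card T \<le> (\<Prod>q\<in>P. e q)" "T \<subseteq> carrier M" "insert \<one> (x ` P) \<subseteq> T"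
      "\<forall>s\<in>T. \<forall>t\<in>T. s \<otimes> t \<in> T" "\<forall>s\<in>T. \<exists>t\<in>T. s \<otimes> t = \<one>" by - (elim conjE, assumption)+
    define y where "y = x a"
    define n where "n = e a"
    have y: "y \<in> carrier M" "0 < n" "y [^] n = \<one>" using insert.prems by (auto simp: y_def n_def)
    have ymod: "y [^] i = y [^] (i mod n)" for i :: nat
    proof -
      have "y [^] i = y [^] (n * (i div n) + i mod n)" by simp
      also have "\<dots> = (y [^] n) [^] (i div n) \<otimes> y [^] (i mod n)"
        unfolding nat_pow_mult[OF y(1), symmetric] nat_pow_pow[OF y(1), symmetric] ..
      finally show ?thesis using y by simp
    qed
    define T' where "T' = (\<lambda>(i, t). y [^] (i :: nat) \<otimes> t) ` ({..<n} \<times> T)"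
    have mem: "y [^] i \<otimes> t \<in> T'" if "t \<in> T" for i :: nat and t
    proof -
      have "(\<lambda>(i, t). y [^] i \<otimes> t) (i mod n, t) \<in> T'"
        unfolding T'_def using that y by (intro imageI) auto
      then show ?thesis using ymod[of i] by simp
    qed
    have T1: "\<one> \<in> T" using T(4) by auto
    have "finite T'" using T(1) by (simp add: T'_def)
    moreover have "card T' \<le> (\<Prod>q\<in>insert a P. e q)"
    proof -
      have "card T' \<le> n * card T" unfolding T'_def
        using card_image_le[of "{..<n} \<times> T"] T(1) by (simp add: card_cartesian_product)
      also have "\<dots> \<le> n * (\<Prod>q\<in>P. e q)" using T(2) by simp
      finally show ?thesis using insert.hyps by (simp add: n_def)
    qed
    moreover have "T' \<subseteq> carrier M" using T(3) y by (auto simp: T'_def)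
    moreover have "insert \<one> (x ` insert a P) \<subseteq> T'"
    proof -
      have tT: "t \<in> T'" if "t \<in> T" for t
        using mem[OF that, of 0] T(3) that by auto
      moreover have "x a \<in> T'" using mem[OF T1, of 1] y by (simp add: y_def)
      ultimately show ?thesis using T(4) by auto
    qed
    moreover have "s \<otimes> t \<in> T'" if st: "s \<in> T'" "t \<in> T'" for s t
    proof -
      obtain i j u v where "s = y [^] (i :: nat) \<otimes> u" "t = y [^] (j :: nat) \<otimes> v" and uv: "u \<in> T" "v \<in> T"
        using st by (auto simp: T'_def)
      then have "s \<otimes> t = y [^] (i + j) \<otimes> (u \<otimes> v)"
        using y(1) T(3) by (simp add: nat_pow_mult[symmetric] m_ac subsetD)
      then show ?thesis using mem T(5) uv by simp
    qed
    moreover have "\<exists>t\<in>T'. s \<otimes> t = \<one>" if s: "s \<in> T'" for s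
    proof -
      obtain i u where iu: "s = y [^] (i :: nat) \<otimes> u" "i < n" "u \<in> T" using s by (auto simp: T'_def)
      obtain v where v: "v \<in> T" "u \<otimes> v = \<one>" using T(6) iu by blast
      have uvc: "u \<in> carrier M" "v \<in> carrier M" using iu v T(3) by auto
      have "s \<otimes> (y [^] (n - i) \<otimes> v) = (y [^] i \<otimes> y [^] (n - i)) \<otimes> (u \<otimes> v)"
        using y(1) uvc iu by (simp add: m_ac)
      also have "\<dots> = \<one>" using y iu v by (simp add: nat_pow_mult)
      finally show ?thesis using mem[OF v(1)] by blast
    qed
    ultimately show ?case by (intro exI[of _ T'] conjI ballI)
  qed
  then obtain T where "finite T \<and> card T \<le> (\<Prod>q\<in>P. e q) \<and> T \<subseteq> carrier M \<and> insert \<one> (x ` P) \<subseteq> T \<and>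
    (\<forall>s\<in>T. \<forall>t\<in>T. s \<otimes> t \<in> T) \<and> (\<forall>s\<in>T. \<exists>t\<in>T. s \<otimes> t = \<one>)" by (erule exE)
  then have T: "finite T" "card T \<le> (\<Prod>q\<in>P. e q)" "T \<subseteq> carrier M" "insert \<one> (x ` P) \<subseteq> T"
      "\<forall>s\<in>T. \<forall>t\<in>T. s \<otimes> t \<in> T" "\<forall>s\<in>T. \<exists>t\<in>T. s \<otimes> t = \<one>" by - (elim conjE, assumption)+
  have "generate M S \<subseteq> T"
  proof
    fix z assume "z \<in> generate M S"
    then show "z \<in> T"
    proof (induction rule: generate.induct)
      case (inv h)
      then have h: "h \<in> T" using S T(4) by auto
      then obtain t where t: "t \<in> T" "h \<otimes> t = \<one>" using T(6) by blast
      then have "inv h = t" using comm_inv_char h T(3) by (metis subsetD)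
      then show ?case using t by simp
    qed (use subset_trans[OF S T(4)] T(4,5) in auto)
  qed
  then show ?thesis using T(1,2) card_mono le_trans by blast
qed

section \<open>The integer ring, fractional ideals and their classes\<close>

context galois_ext
begin

lemma integer_ring_ops:
  "x \<oplus>\<^bsub>integer_ring K\<^esub> y = x + y" "x \<otimes>\<^bsub>integer_ring K\<^esub> y = x * y"
  "\<zero>\<^bsub>integer_ring K\<^esub> = 0" "\<one>\<^bsub>integer_ring K\<^esub> = 1"
  by (simp_all add: integer_ring_def ring_of_type_algebra_def)

lemma cring_integer_ring: "cring (integer_ring K)"
proof (rule cringI)
  show "abelian_group (integer_ring K)"
  proof (rule abelian_groupI)
    fix x assume "x \<in> carrier (integer_ring K)"
    then show "\<exists>y\<in>carrier (integer_ring K). y \<oplus>\<^bsub>integer_ring K\<^esub> x = \<zero>\<^bsub>integer_ring K\<^esub>"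
      using O_minus by (intro bexI[of _ "- x"]) (auto simp: carrier_integer_ring integer_ring_ops)
  qed (simp_all add: carrier_integer_ring integer_ring_ops O_add)
  show "comm_monoid (integer_ring K)"
    by (rule comm_monoidI) (simp_all add: carrier_integer_ring integer_ring_ops O_mult)
qed (simp add: integer_ring_ops distrib_right)

lemma ideal_iff: "ideal I (integer_ring K) \<longleftrightarrow> omod I \<and> I \<subseteq> O_K"
proof
  assume I: "ideal I (integer_ring K)"
  interpret ideal I "integer_ring K" by fact
  have "I \<subseteq> O_K" using a_subset by (simp add: carrier_integer_ring)
  moreover have "omod I" unfolding omod_def
    using additive_subgroup.a_closed[OF ideal.axioms(1)[OF I]] I_l_closed
      additive_subgroup.zero_closed[OF ideal.axioms(1)[OF I]] \<open>I \<subseteq> O_K\<close> O_K_sub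
    by (auto simp: integer_ring_ops carrier_integer_ring)
  ultimately show "omod I \<and> I \<subseteq> O_K" by blast
next
  assume I: "omod I \<and> I \<subseteq> O_K"
  interpret cring "integer_ring K" by (rule cring_integer_ring)
  show "ideal I (integer_ring K)"
  proof (rule idealI)
    show "ring (integer_ring K)" by (rule ring_axioms)
    show "subgroup I (add_monoid (integer_ring K))"
    proof (rule group.subgroupI)
      show "Group.group (add_monoid (integer_ring K))" by (rule add.group_axioms)
      show "I \<subseteq> carrier (add_monoid (integer_ring K))" using I by (simp add: carrier_integer_ring)
      show "I \<noteq> {}" using I omod_0 by auto
      fix a assume a: "a \<in> I"
      have "inv\<^bsub>add_monoid (integer_ring K)\<^esub> a = - a"
        unfolding a_inv_def[symmetric]
        using a I omod_minus[of I a] by (intro minus_equality) (auto simp: integer_ring_ops carrier_integer_ring)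
      then show "inv\<^bsub>add_monoid (integer_ring K)\<^esub> a \<in> I" using a I omod_minus by simp
      fix b assume "b \<in> I"
      then show "a \<otimes>\<^bsub>add_monoid (integer_ring K)\<^esub> b \<in> I" using a I omod_add by (simp add: integer_ring_ops)
    qed
  qed (use I omod_mult omod_mult' in \<open>auto simp: integer_ring_ops carrier_integer_ring\<close>)
qed

definition frac :: "complex set \<Rightarrow> bool" where
  "frac I \<longleftrightarrow> omod I \<and> I \<noteq> {0} \<and> (\<exists>d\<in>O_K. d \<noteq> 0 \<and> (\<forall>x\<in>I. d * x \<in> O_K))"

lemma carrier_frac: "carrier (fractional_ideal_group K) = {I. frac I}"
proof -
  have "(I \<noteq> {0} \<and> (\<exists>d \<in> O_K - {0}. ideal ((\<lambda>x. d * x) ` I) (integer_ring K))) \<longleftrightarrow> frac I" for I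
  proof
    assume "I \<noteq> {0} \<and> (\<exists>d \<in> O_K - {0}. ideal ((\<lambda>x. d * x) ` I) (integer_ring K))"
    then obtain d where d: "I \<noteq> {0}" "d \<in> O_K" "d \<noteq> 0" "omod ((\<lambda>x. d * x) ` I)" "(\<lambda>x. d * x) ` I \<subseteq> O_K"
      by (auto simp: ideal_iff)
    have "omod ((\<lambda>x. (1 / d) * x) ` ((\<lambda>x. d * x) ` I))"
      by (rule omod_scale[OF K_divide[OF K_1 O_K_sub[OF d(2)]] d(4)])
    moreover have "(\<lambda>x. (1 / d) * x) ` ((\<lambda>x. d * x) ` I) = I" using d(3) by (simp add: image_image)
    ultimately have "omod I" by (simp only:)
    then show "frac I" using d unfolding frac_def by (intro conjI bexI[of _ d]) auto
  next
    assume I: "frac I"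
    then obtain d where "d \<in> O_K" "d \<noteq> 0" "\<forall>x\<in>I. d * x \<in> O_K" by (auto simp: frac_def)
    then show "I \<noteq> {0} \<and> (\<exists>d \<in> O_K - {0}. ideal ((\<lambda>x. d * x) ` I) (integer_ring K))"
      using I omod_scale[of d I] O_K_sub by (auto simp: ideal_iff frac_def)
  qed
  then show ?thesis by (auto simp: fractional_ideal_group_def carrier_integer_ring)
qed

lemma frac_omod: "frac I \<Longrightarrow> omod I" by (simp add: frac_def)

lemma frac_nonzero: "frac I \<Longrightarrow> \<exists>x\<in>I. x \<noteq> 0"
  using omod_0 by (auto simp: frac_def)

lemma frac_O: "frac O_K"
  unfolding frac_def
proof (intro conjI bexI[of _ 1])
  show "O_K \<noteq> {0}" using O_1 by (metis singletonD zero_neq_one)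
qed (simp_all add: omod_O)

lemma frac_ideal: "omod I \<Longrightarrow> I \<subseteq> O_K \<Longrightarrow> I \<noteq> {0} \<Longrightarrow> frac I"
  unfolding frac_def by (auto intro!: bexI[of _ 1])

lemma frac_prd: "frac I \<Longrightarrow> frac J \<Longrightarrow> frac (prd I J)"
proof -
  assume I: "frac I" and J: "frac J"
  obtain x y where "x \<in> I" "x \<noteq> 0" "y \<in> J" "y \<noteq> 0" using frac_nonzero I J by blast
  then have "x * y \<in> prd I J" "x * y \<noteq> 0" by (auto intro: prd_prod)
  then have ne: "prd I J \<noteq> {0}" by (metis singletonD)
  obtain d d' where d: "d \<in> O_K" "d \<noteq> 0" "\<forall>x\<in>I. d * x \<in> O_K" "d' \<in> O_K" "d' \<noteq> 0" "\<forall>x\<in>J. d' * x \<in> O_K"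
    using I J by (auto simp: frac_def)
  have "prd I J \<subseteq> {z. (d * d') * z \<in> O_K}"
  proof (rule prd_subset)
    fix x y assume "x \<in> I" "y \<in> J"
    then have "(d * x) * (d' * y) \<in> O_K" using O_mult[OF bspec[OF d(3)] bspec[OF d(6)]] by blast
    then show "x * y \<in> {z. (d * d') * z \<in> O_K}" by (simp add: mult_ac)
  qed (auto simp: distrib_left O_add)
  moreover have "d * d' \<in> O_K" "d * d' \<noteq> 0" using d by (auto intro: O_mult)
  moreover have "omod (prd I J)" by (rule omod_prd[OF frac_omod[OF I] frac_omod[OF J]])
  ultimately show ?thesis using ne unfolding frac_def by blast
qed

lemma prd_scale: "prd ((\<lambda>x. a * x) ` I) J = (\<lambda>x. a * x) ` prd I J"
proof
  show "prd ((\<lambda>x. a * x) ` I) J \<subseteq> (\<lambda>x. a * x) ` prd I J"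
  proof (rule prd_subset)
    fix x y assume "x \<in> (\<lambda>x. a * x) ` I" "y \<in> J"
    then obtain u where "u \<in> I" "x = a * u" by blast
    then show "x * y \<in> (\<lambda>x. a * x) ` prd I J"
      using \<open>y \<in> J\<close> by (intro image_eqI[of _ _ "u * y"]) (auto intro: prd_prod)
  next
    fix x y assume "x \<in> (\<lambda>x. a * x) ` prd I J" "y \<in> (\<lambda>x. a * x) ` prd I J"
    then obtain u v where "u \<in> prd I J" "v \<in> prd I J" "x = a * u" "y = a * v" by blast
    then show "x + y \<in> (\<lambda>x. a * x) ` prd I J"
      by (intro image_eqI[of _ _ "u + v"]) (auto intro: prd_sum simp: distrib_left)
  qed
  have "prd I J \<subseteq> {z. a * z \<in> prd ((\<lambda>x. a * x) ` I) J}"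
  proof (rule prd_subset)
    fix x y assume "x \<in> I" "y \<in> J"
    then have "(a * x) * y \<in> prd ((\<lambda>x. a * x) ` I) J" by (intro prd_prod) auto
    then show "x * y \<in> {z. a * z \<in> prd ((\<lambda>x. a * x) ` I) J}" by (simp add: mult.assoc)
  qed (auto simp: distrib_left intro: prd_sum)
  then show "(\<lambda>x. a * x) ` prd I J \<subseteq> prd ((\<lambda>x. a * x) ` I) J" by auto
qed

lemma prd_principal: "omod I \<Longrightarrow> prd ((\<lambda>x. a * x) ` O_K) I = (\<lambda>x. a * x) ` I"
  by (simp add: prd_scale prd_O)

text \<open>The coset of \<open>I\<close> modulo the principal fractional ideals, spelled out as the
  set of its multiples; products of cosets then reduce to \<open>prd\<close>.\<close>

definition cls :: "complex set \<Rightarrow> complex set set" where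
  "cls I = {(\<lambda>x. a * x) ` I | a. a \<in> K - {0}}"

lemma principal_eq_cls: "principal_fractional_ideals K = cls O_K"
  by (simp add: principal_fractional_ideals_def cls_def carrier_integer_ring)

lemma frac_group_mult: "I \<otimes>\<^bsub>fractional_ideal_group K\<^esub> J = prd I J"
  by (simp add: fractional_ideal_group_def)

lemma ideal_class_eq_cls: "omod I \<Longrightarrow> ideal_class K I = cls I"
  unfolding ideal_class_def r_coset_def principal_eq_cls frac_group_mult
  by (auto simp: cls_def prd_principal)

lemma cls_mult: "cls I <#>\<^bsub>fractional_ideal_group K\<^esub> cls J = cls (prd I J)"
proof -
  have eq: "prd ((\<lambda>x. a * x) ` I) ((\<lambda>x. b * x) ` J) = (\<lambda>x. (a * b) * x) ` prd I J" for a b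
  proof -
    have "prd ((\<lambda>x. a * x) ` I) ((\<lambda>x. b * x) ` J) = (\<lambda>x. a * x) ` prd ((\<lambda>x. b * x) ` J) I"
      by (simp add: prd_scale prd_commute[of I])
    also have "\<dots> = (\<lambda>x. (a * b) * x) ` prd I J"
      by (simp add: prd_scale image_image mult.assoc prd_commute[of J])
    finally show ?thesis .
  qed
  show ?thesis
  proof (intro equalityI subsetI)
    fix z assume "z \<in> cls I <#>\<^bsub>fractional_ideal_group K\<^esub> cls J"
    then obtain a b where "a \<in> K - {0}" "b \<in> K - {0}" "z = prd ((\<lambda>x. a * x) ` I) ((\<lambda>x. b * x) ` J)"
      by (auto simp: set_mult_def frac_group_mult cls_def)
    then show "z \<in> cls (prd I J)" unfolding eq cls_def using K_mult by (auto intro!: exI[of _ "a * b"])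
  next
    fix z assume "z \<in> cls (prd I J)"
    then obtain a where a: "a \<in> K - {0}" "z = (\<lambda>x. a * x) ` prd I J" by (auto simp: cls_def)
    then have "z = prd ((\<lambda>x. a * x) ` I) ((\<lambda>x. 1 * x) ` J)" unfolding eq by simp
    moreover have "(\<lambda>x. a * x) ` I \<in> cls I" "(\<lambda>x. 1 * x) ` J \<in> cls J"
      using a unfolding cls_def by (blast, intro CollectI exI[of _ 1]) auto
    ultimately show "z \<in> cls I <#>\<^bsub>fractional_ideal_group K\<^esub> cls J"
      unfolding set_mult_def frac_group_mult by blast
  qed
qed

lemma class_group_carrier: "carrier (class_group K) = cls ` {I. frac I}"
proof -
  have "principal_fractional_ideals K #>\<^bsub>fractional_ideal_group K\<^esub> I = cls I" if "frac I" for I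
    using ideal_class_eq_cls[OF frac_omod[OF that]] by (simp add: ideal_class_def)
  then show ?thesis
    unfolding class_group_def FactGroup_def RCOSETS_def carrier_frac by (auto simp: image_iff)
qed

lemma class_group_mult: "cls I \<otimes>\<^bsub>class_group K\<^esub> cls J = cls (prd I J)"
  by (simp add: class_group_def FactGroup_def cls_mult)

lemma class_group_one: "\<one>\<^bsub>class_group K\<^esub> = cls O_K"
  by (simp add: class_group_def FactGroup_def principal_eq_cls)

lemma comm_monoid_class_group: "comm_monoid (class_group K)"
proof (rule comm_monoidI)
  show "\<one>\<^bsub>class_group K\<^esub> \<in> carrier (class_group K)"
    using frac_O by (auto simp: class_group_one class_group_carrier)
next
  fix x y assume "x \<in> carrier (class_group K)" "y \<in> carrier (class_group K)"
  then show "x \<otimes>\<^bsub>class_group K\<^esub> y \<in> carrier (class_group K)" "x \<otimes>\<^bsub>class_group K\<^esub> y = y \<otimes>\<^bsub>class_group K\<^esub> x"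
    by (auto simp: class_group_carrier class_group_mult frac_prd prd_commute)
next
  fix x y z assume "x \<in> carrier (class_group K)" "y \<in> carrier (class_group K)" "z \<in> carrier (class_group K)"
  then show "x \<otimes>\<^bsub>class_group K\<^esub> y \<otimes>\<^bsub>class_group K\<^esub> z = x \<otimes>\<^bsub>class_group K\<^esub> (y \<otimes>\<^bsub>class_group K\<^esub> z)"
    by (auto simp: class_group_carrier class_group_mult prd_assoc)
next
  fix x assume "x \<in> carrier (class_group K)"
  then show "\<one>\<^bsub>class_group K\<^esub> \<otimes>\<^bsub>class_group K\<^esub> x = x"
    by (auto simp: class_group_carrier class_group_mult class_group_one prd_O frac_omod)
qed

lemma cls_principal: "a \<in> K \<Longrightarrow> a \<noteq> 0 \<Longrightarrow> cls ((\<lambda>x. a * x) ` O_K) = cls O_K"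
proof -
  assume a: "a \<in> K" "a \<noteq> 0"
  have "cls ((\<lambda>x. a * x) ` O_K) = {(\<lambda>x. (b * a) * x) ` O_K | b. b \<in> K - {0}}"
    by (simp add: cls_def image_image mult.assoc)
  also have "\<dots> = cls O_K"
  proof (intro equalityI subsetI)
    fix z assume "z \<in> cls O_K"
    then obtain c where c: "c \<in> K - {0}" "z = (\<lambda>x. c * x) ` O_K" by (auto simp: cls_def)
    then show "z \<in> {(\<lambda>x. (b * a) * x) ` O_K | b. b \<in> K - {0}}"
      using a K_divide[of c a] by (intro CollectI exI[of _ "c / a"]) auto
  qed (use a K_mult in \<open>auto simp: cls_def\<close>)
  finally show ?thesis .
qed

end

context galois_prime
begin

lemma frac_rpow: "frac (rpow i)"
proof (induction i)
  case (Suc i)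
  have "of_nat p \<in> rad" using PO_rad p_in_PO by blast
  then have "rad \<noteq> {0}" using p_nz by (metis singletonD)
  then have "frac rad" using omod_rad rad_O by (intro frac_ideal) auto
  then show ?case using Suc by (simp add: rpow_Suc frac_prd)
qed (simp add: frac_O)

lemma cls_rad_pow: "cls rad [^]\<^bsub>class_group K\<^esub> (i :: nat) = cls (rpow i)"
proof (induction i)
  case (Suc i)
  then show ?case by (simp add: rpow_Suc class_group_mult prd_commute)
qed (simp add: class_group_one)

lemma cls_rad_carrier: "cls rad \<in> carrier (class_group K)"
  using frac_rpow[of "Suc 0"] by (auto simp: class_group_carrier rpow_1)

text \<open>The power \<open>rpow ram\<close> is \<open>PO\<close>, the principal ideal generated by
  \<open>p\<close>.\<close>

lemma cls_rad_order: "cls rad [^]\<^bsub>class_group K\<^esub> ram = \<one>\<^bsub>class_group K\<^esub>"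
  using cls_principal[of "of_nat p"] by (simp add: cls_rad_pow rpow_ram PO_def class_group_one)

end

section \<open>The Polya group\<close>

context galois_ext
begin

text \<open>The zero ideal is prime in this sense; it is excluded only through its absolute norm,
  which is 0.\<close>

definition prime_id :: "complex set \<Rightarrow> bool" where
  "prime_id P \<longleftrightarrow> omod P \<and> P \<subseteq> O_K \<and> 1 \<notin> P \<and>
     (\<forall>a\<in>O_K. \<forall>b\<in>O_K. a * b \<in> P \<longrightarrow> a \<in> P \<or> b \<in> P)"

lemma prime_id_iff: "primeideal P (integer_ring K) \<longleftrightarrow> prime_id P"
proof
  assume P: "primeideal P (integer_ring K)"
  interpret primeideal P "integer_ring K" by fact
  have "omod P \<and> P \<subseteq> O_K" using ideal_axioms by (simp add: ideal_iff)
  moreover have "1 \<notin> P" using I_notcarr omod_eq_O[of P] calculation by (auto simp: carrier_integer_ring)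
  ultimately show "prime_id P" unfolding prime_id_def
    using I_prime by (auto simp: carrier_integer_ring integer_ring_ops)
next
  assume P: "prime_id P"
  interpret cring "integer_ring K" by (rule cring_integer_ring)
  show "primeideal P (integer_ring K)"
  proof (rule primeidealI)
    show "ideal P (integer_ring K)" using P by (simp add: ideal_iff prime_id_def)
    show "cring (integer_ring K)" by (rule cring_integer_ring)
    show "carrier (integer_ring K) \<noteq> P" using P O_1 unfolding prime_id_def carrier_integer_ring by metis
  qed (use P in \<open>auto simp: prime_id_def carrier_integer_ring integer_ring_ops\<close>)
qed

definition cosets :: "complex set \<Rightarrow> complex set set" where
  "cosets P = (\<lambda>a. (\<lambda>h. h + a) ` P) ` O_K"

lemma absolute_norm_eq: "absolute_norm K P = card (cosets P)"
proof -
  have "carrier (integer_ring K Quot P) = cosets P"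
    unfolding FactRing_def A_RCOSETS_def RCOSETS_def r_coset_def cosets_def
    by (auto simp: carrier_integer_ring integer_ring_ops)
  then show ?thesis by (simp add: absolute_norm_def)
qed

lemma coset_eq_iff:
  assumes "omod P" shows "(\<lambda>h. h + a) ` P = (\<lambda>h. h + b) ` P \<longleftrightarrow> a - b \<in> P"
proof
  assume "(\<lambda>h. h + a) ` P = (\<lambda>h. h + b) ` P"
  moreover have "0 + a \<in> (\<lambda>h. h + a) ` P" using omod_0[OF assms] by (rule imageI)
  ultimately obtain h where "h \<in> P" "0 + a = h + b" by blast
  then show "a - b \<in> P" by (simp add: diff_eq_eq)
next
  assume ab: "a - b \<in> P"
  have "(\<lambda>h. h + a) ` P \<subseteq> (\<lambda>h. h + b) ` P" if "a - b \<in> P" for a b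
  proof
    fix x assume "x \<in> (\<lambda>h. h + a) ` P"
    then obtain h where "h \<in> P" "x = h + a" by blast
    then show "x \<in> (\<lambda>h. h + b) ` P"
      using omod_add[OF assms _ that] by (intro image_eqI[of _ _ "h + (a - b)"]) auto
  qed
  from this[OF ab] this[of b a] omod_minus[OF assms ab]
  show "(\<lambda>h. h + a) ` P = (\<lambda>h. h + b) ` P" by auto
qed

lemma prime_id_prod:
  assumes P: "prime_id P" and fin: "finite A" and f: "\<And>a. a \<in> A \<Longrightarrow> f a \<in> O_K" "(\<Prod>a\<in>A. f a) \<in> P"
  shows "\<exists>a\<in>A. f a \<in> P"
  using fin f
proof (induction A rule: finite_induct)
  case empty
  then show ?case using P by (simp add: prime_id_def)
next
  case (insert a A)
  have "f a * (\<Prod>a\<in>A. f a) \<in> P" using insert by simp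
  moreover have "(\<Prod>a\<in>A. f a) \<in> O_K" by (rule O_prod) (use insert in auto)
  ultimately have "f a \<in> P \<or> (\<Prod>a\<in>A. f a) \<in> P" using P insert.prems unfolding prime_id_def by blast
  then show ?case using insert by auto
qed

text \<open>A nonzero absolute norm says that there are finitely many cosets, so \<open>P\<close> is
  not the zero ideal. The norm of a nonzero element is then a nonzero integer in \<open>P\<close>,
  and primality passes to one of its prime factors.\<close>

lemma prime_id_contains_prime:
  assumes P: "prime_id P" and q: "absolute_norm K P \<noteq> 0"
  shows "\<exists>p. Factorial_Ring.prime p \<and> of_nat p \<in> P"
proof -
  have om: "omod P" using P by (simp add: prime_id_def)
  have "P \<noteq> {0}"
  proof
    assume P0: "P = {0}"
    have "inj_on (\<lambda>a. (\<lambda>h. h + a) ` P) O_K" by (rule inj_onI) (simp add: P0)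
    moreover have "infinite O_K"
    proof
      assume "finite O_K"
      then have "finite (range (of_nat :: nat \<Rightarrow> complex))" by (rule finite_subset[rotated]) auto
      moreover have "inj (of_nat :: nat \<Rightarrow> complex)" by (simp add: inj_on_def)
      ultimately show False using finite_imageD infinite_UNIV_nat by blast
    qed
    ultimately have "infinite (cosets P)" unfolding cosets_def using finite_image_iff by blast
    then show False using q by (simp add: absolute_norm_eq)
  qed
  then obtain x where x: "x \<in> P" "x \<noteq> 0" using omod_0[OF om] by blast
  have xO: "x \<in> O_K" using x P by (auto simp: prime_id_def)
  obtain N :: int where N: "of_int N = (\<Prod>g\<in>gal K. g x)" using norm_Ints[OF xO] by (metis Ints_cases)
  have "of_int N \<noteq> (0 :: complex)"
    unfolding N using x(2) g_eq_0[OF _ O_K_sub[OF xO]] by simp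
  then have N0: "N \<noteq> 0" by simp
  have "of_int N \<in> P"
  proof -
    let ?id = "restrict (\<lambda>x. x) K"
    have "of_int N = ?id x * (\<Prod>g\<in>gal K - {?id}. g x)"
      unfolding N by (rule prod.remove[OF finite_gal gal_id])
    moreover have "?id x = x" using O_K_sub[OF xO] by simp
    moreover have "(\<Prod>g\<in>gal K - {?id}. g x) \<in> O_K" by (rule O_prod) (use g_O[OF _ xO] in blast)
    ultimately show ?thesis using omod_mult'[OF om _ x(1)] by simp
  qed
  then have "of_int (sgn N) * of_int N \<in> P" by (intro omod_mult[OF om]) simp_all
  then have "of_int \<bar>N\<bar> \<in> P" by (simp add: abs_sgn mult.commute)
  then have n: "of_nat (nat \<bar>N\<bar>) \<in> P" by (metis abs_ge_zero int_nat_eq of_int_of_nat_eq)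
  have "\<exists>p. Factorial_Ring.prime p \<and> of_nat p \<in> P" if "of_nat n \<in> P" "n > 0" for n
    using that
  proof (induction n rule: less_induct)
    case (less n)
    have "n \<noteq> 1" using less.prems P by (auto simp: prime_id_def)
    then obtain r where r: "Factorial_Ring.prime r" "r dvd n" using prime_factor_nat by blast
    then obtain m where m: "n = r * m" by (elim dvdE)
    then have "of_nat r * of_nat m \<in> P" using less.prems by simp
    then have "of_nat r \<in> P \<or> of_nat m \<in> P" using P unfolding prime_id_def by (meson O_of_nat)
    moreover have "0 < m" "m < n" using m less.prems prime_gt_1_nat[OF r(1)] by auto
    ultimately show ?case using less.IH[of m] r by blast
  qed
  from this[OF n] N0 show ?thesis by simp
qed

text \<open>The conjugate is written as a preimage, so that primality is immediate; the automorphism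
  \<open>g\<close> carries its cosets bijectively onto those of \<open>P\<close>.\<close>

lemma prime_id_conj:
  assumes P: "prime_id P" and g: "g \<in> gal K"
  shows "prime_id {x \<in> O_K. g x \<in> P}" "absolute_norm K {x \<in> O_K. g x \<in> P} = absolute_norm K P"
proof -
  let ?Q = "{x \<in> O_K. g x \<in> P}"
  have om: "omod P" "P \<subseteq> O_K" using P by (auto simp: prime_id_def)
  have omQ: "omod ?Q" unfolding omod_def
  proof (intro conjI ballI)
    show "a * x \<in> ?Q" if ax: "a \<in> O_K" "x \<in> ?Q" for a x
    proof -
      have "g (a * x) = g a * g x" using ax O_K_sub by (intro g_mult[OF g]) auto
      moreover have "g a * g x \<in> P" using ax by (intro omod_mult[OF om(1)] g_O[OF g]) auto
      ultimately show ?thesis using ax O_mult by auto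
    qed
    show "x + y \<in> ?Q" if xy: "x \<in> ?Q" "y \<in> ?Q" for x y
    proof -
      have "g (x + y) = g x + g y" using xy O_K_sub by (intro g_add[OF g]) auto
      then show ?thesis using xy O_add omod_add[OF om(1)] by auto
    qed
  qed (use O_K_sub omod_0[OF om(1)] g_0[OF g] in auto)
  show "prime_id ?Q" unfolding prime_id_def
  proof (intro conjI ballI impI)
    fix a b assume ab: "a \<in> O_K" "b \<in> O_K" "a * b \<in> ?Q"
    then have "g a * g b \<in> P" using g_mult[OF g O_K_sub O_K_sub] by simp
    then show "a \<in> ?Q \<or> b \<in> ?Q" using P g_O[OF g] ab unfolding prime_id_def by blast
  qed (use omQ P g_1[OF g] in \<open>auto simp: prime_id_def\<close>)
  obtain k where k: "k \<in> gal K" "\<And>x. x \<in> K \<Longrightarrow> g (k x) = x" using gal_inverse_ex[OF g] by blast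
  have QP: "g ` ?Q = P"
  proof (intro equalityI subsetI)
    fix x assume x: "x \<in> P"
    then have xO: "x \<in> O_K" using om by auto
    then have "g (k x) = x" "k x \<in> O_K" using k g_O O_K_sub by auto
    then show "x \<in> g ` ?Q" using x by (intro image_eqI[of _ _ "k x"]) auto
  qed auto
  have QK: "?Q \<subseteq> K" using O_K_sub by auto
  have gc: "g ` ((\<lambda>h. h + a) ` ?Q) = (\<lambda>h. h + g a) ` P" if a: "a \<in> O_K" for a
  proof -
    have "g ` ((\<lambda>h. h + a) ` ?Q) = (\<lambda>h. g h + g a) ` ?Q"
      unfolding image_image using QK O_K_sub[OF a] by (intro image_cong) (auto simp: g_add[OF g])
    also have "\<dots> = (\<lambda>h. h + g a) ` (g ` ?Q)" by (simp add: image_image)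
    finally show ?thesis by (simp only: QP)
  qed
  have "bij_betw (\<lambda>C. g ` C) (cosets ?Q) (cosets P)"
    unfolding bij_betw_def
  proof
    show "inj_on (\<lambda>C. g ` C) (cosets ?Q)"
    proof (rule inj_on_image)
      have "\<Union> (cosets ?Q) \<subseteq> K" using QK O_K_sub K_add by (auto simp: cosets_def)
      moreover have "inj_on g K" using g_inj[OF g] by (auto simp: inj_on_def)
      ultimately show "inj_on g (\<Union> (cosets ?Q))" by (rule inj_on_subset[rotated])
    qed
    show "(\<lambda>C. g ` C) ` cosets ?Q = cosets P"
    proof (intro equalityI subsetI)
      fix C assume "C \<in> (\<lambda>C. g ` C) ` cosets ?Q"
      then obtain a where "a \<in> O_K" "C = g ` ((\<lambda>h. h + a) ` ?Q)" by (auto simp: cosets_def)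
      then show "C \<in> cosets P" using gc g_O[OF g] by (auto simp: cosets_def)
    next
      fix C assume "C \<in> cosets P"
      then obtain a where a: "a \<in> O_K" "C = (\<lambda>h. h + a) ` P" by (auto simp: cosets_def)
      have "k a \<in> O_K" "g (k a) = a" using a k g_O O_K_sub by auto
      then have "C = g ` ((\<lambda>h. h + k a) ` ?Q)" using gc[of "k a"] a by simp
      then show "C \<in> (\<lambda>C. g ` C) ` cosets ?Q" using \<open>k a \<in> O_K\<close> unfolding cosets_def by blast
    qed
  qed
  then show "absolute_norm K ?Q = absolute_norm K P" unfolding absolute_norm_eq by (rule bij_betw_same_card)
qed

end

section \<open>Prime ideals above p\<close>

context galois_prime
begin

lemma prime_id_PO: assumes "prime_id P" "of_nat p \<in> P" shows "PO \<subseteq> P" "rad \<subseteq> P"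
proof -
  show 1: "PO \<subseteq> P" using assms by (auto simp: PO_def prime_id_def intro: omod_mult')
  show "rad \<subseteq> P"
  proof
    fix x assume "x \<in> rad"
    then obtain k where x: "x \<in> O_K" "x ^ k \<in> PO" by (auto simp: rad_def)
    have "(\<Prod>i<k. x) \<in> P" using x 1 by auto
    then show "x \<in> P" using prime_id_prod[OF assms(1), of "{..<k}" "\<lambda>_. x"] x by auto
  qed
qed

text \<open>The powers of \<open>x\<close> repeat modulo \<open>p\<close>, since there are finitely
  many residues. So \<open>x ^ i * (1 - x ^ (j - i))\<close> lies in \<open>P\<close> for some
  \<open>i < j\<close>, and primality removes the first factor.\<close>

lemma prime_id_maximal:
  assumes P: "prime_id P" "of_nat p \<in> P" and x: "x \<in> O_K" "x \<notin> P"
  shows "\<exists>y\<in>O_K. 1 - x * y \<in> P"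
proof -
  have "\<not> inj_on (\<lambda>i. red (x ^ i)) (UNIV :: nat set)"
  proof
    assume "inj_on (\<lambda>i. red (x ^ i)) (UNIV :: nat set)"
    moreover have "range (\<lambda>i. red (x ^ i)) \<subseteq> Res" using red_Res O_power x by auto
    ultimately show False using finite_Res by (meson finite_imageD finite_subset infinite_UNIV_nat)
  qed
  then obtain i j where ij: "i < j" "red (x ^ i) = red (x ^ j)"
    by (metis (mono_tags, lifting) inj_onI linorder_neqE_nat)
  then have "x ^ i - x ^ j \<in> P" using red_eq_iff O_power x prime_id_PO(1)[OF P] by blast
  moreover have "x ^ j = x ^ i * (x * x ^ (j - i - 1))"
    using ij(1) by (simp flip: power_Suc power_add)
  ultimately have "x ^ i * (1 - x * x ^ (j - i - 1)) \<in> P" by (simp add: right_diff_distrib)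
  moreover have "x ^ i \<notin> P"
  proof
    assume "x ^ i \<in> P"
    then have "(\<Prod>l<i. x) \<in> P" by simp
    then show False using prime_id_prod[OF P(1), of "{..<i}" "\<lambda>_. x"] x by auto
  qed
  ultimately have "1 - x * x ^ (j - i - 1) \<in> P"
    using P(1) x O_power[of x] O_mult O_diff[OF O_1] unfolding prime_id_def by blast
  then show ?thesis using O_power x by blast
qed

lemma prime_id_subset_eq:
  assumes P: "prime_id P" "of_nat p \<in> P" and Q: "prime_id Q" and PQ: "P \<subseteq> Q"
  shows "P = Q"
proof (rule ccontr)
  assume "P \<noteq> Q"
  then obtain x where x: "x \<in> Q" "x \<notin> P" using PQ by blast
  then have xO: "x \<in> O_K" using Q by (auto simp: prime_id_def)
  obtain y where y: "y \<in> O_K" "1 - x * y \<in> P" using prime_id_maximal[OF P xO x(2)] by blast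
  have oQ: "omod Q" using Q by (simp add: prime_id_def)
  have "(1 - x * y) + x * y \<in> Q" using y PQ x by (intro omod_add[OF oQ] omod_mult'[OF oQ]) auto
  then show False using Q by (simp add: prime_id_def)
qed

text \<open>The intersection of all conjugates of \<open>P\<close> is a proper stable ideal
  containing \<open>p\<close>.\<close>

lemma conj_Inter_rad:
  assumes P: "prime_id P" "of_nat p \<in> P"
  shows "{x \<in> O_K. \<forall>g\<in>gal K. g x \<in> P} \<subseteq> rad"
proof (rule gstable_ideal_in_rad)
  let ?I = "{x \<in> O_K. \<forall>g\<in>gal K. g x \<in> P}"
  have om: "omod P" using P by (simp add: prime_id_def)
  show "omod ?I" unfolding omod_def
  proof (intro conjI ballI)
    show "a * x \<in> ?I" if ax: "a \<in> O_K" "x \<in> ?I" for a x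
    proof -
      have "g (a * x) \<in> P" if g: "g \<in> gal K" for g
      proof -
        have "g (a * x) = g a * g x" using ax O_K_sub by (intro g_mult[OF g]) auto
        moreover have "g a * g x \<in> P" using ax g by (intro omod_mult[OF om(1)] g_O[OF g]) auto
        ultimately show ?thesis by simp
      qed
      then show ?thesis using ax O_mult by auto
    qed
    show "x + y \<in> ?I" if xy: "x \<in> ?I" "y \<in> ?I" for x y
    proof -
      have "g (x + y) \<in> P" if g: "g \<in> gal K" for g
      proof -
        have "g (x + y) = g x + g y" using xy O_K_sub by (intro g_add[OF g]) auto
        then show ?thesis using xy g omod_add[OF om(1)] by auto
      qed
      then show ?thesis using xy O_add by auto
    qed
  qed (use O_K_sub omod_0[OF om(1)] g_0 in auto)
  show "gstable ?I" unfolding gstable_def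
  proof (intro ballI)
    fix h x assume h: "h \<in> gal K" and x: "x \<in> ?I"
    have "g (h x) \<in> P" if g: "g \<in> gal K" for g
    proof -
      have "compose K g h x \<in> P" using x gal_compose[OF g h] by blast
      then show ?thesis using x O_K_sub by simp
    qed
    then show "h x \<in> ?I" using g_O[OF h] x by auto
  qed
  show "of_nat p \<in> ?I" using P g_of_nat by auto
  show "1 \<notin> ?I" using P g_1 gal_id by (auto simp: prime_id_def)
qed auto

text \<open>If no conjugate of \<open>P\<close> lay in \<open>Q\<close>, choose from each an element
  outside \<open>Q\<close>. Their product lies in all conjugates, hence in \<open>rad\<close> and in
  \<open>Q\<close>, against primality. The inclusion so obtained is an equality by
  maximality.\<close>

lemma prime_ids_conjugate:
  assumes P: "prime_id P" "of_nat p \<in> P" and Q: "prime_id Q" "of_nat p \<in> Q"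
  shows "\<exists>g\<in>gal K. Q = {x \<in> O_K. g x \<in> P}"
proof -
  have "\<exists>g\<in>gal K. {x \<in> O_K. g x \<in> P} \<subseteq> Q"
  proof (rule ccontr)
    assume "\<not> ?thesis"
    then have "\<forall>g\<in>gal K. \<exists>x. x \<in> O_K \<and> g x \<in> P \<and> x \<notin> Q" by blast
    then obtain f where f: "\<And>g. g \<in> gal K \<Longrightarrow> f g \<in> O_K \<and> g (f g) \<in> P \<and> f g \<notin> Q" by metis
    have om: "omod P" using P by (simp add: prime_id_def)
    have "(\<Prod>g\<in>gal K. f g) \<in> {x \<in> O_K. \<forall>g\<in>gal K. g x \<in> P}"
    proof (intro CollectI conjI ballI)
      show "(\<Prod>g\<in>gal K. f g) \<in> O_K" by (rule O_prod) (use f in blast)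
      fix h assume h: "h \<in> gal K"
      have "h (\<Prod>g\<in>gal K. f g) = (\<Prod>g\<in>gal K. h (f g))"
        by (rule g_prod[OF h]) (use f O_K_sub in blast)
      also have "\<dots> = h (f h) * (\<Prod>g\<in>gal K - {h}. h (f g))" by (rule prod.remove[OF finite_gal h])
      also have "\<dots> \<in> P"
      proof (rule omod_mult'[OF om])
        show "(\<Prod>g\<in>gal K - {h}. h (f g)) \<in> O_K" by (rule O_prod, rule g_O[OF h]) (use f in blast)
      qed (use f[OF h] in blast)
      finally show "h (\<Prod>g\<in>gal K. f g) \<in> P" .
    qed
    then have "(\<Prod>g\<in>gal K. f g) \<in> Q" using conj_Inter_rad[OF P] prime_id_PO(2)[OF Q] by blast
    then show False using prime_id_prod[OF Q(1) finite_gal, of f] f by blast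
  qed
  then obtain g where g: "g \<in> gal K" "{x \<in> O_K. g x \<in> P} \<subseteq> Q" by blast
  have "of_nat p \<in> {x \<in> O_K. g x \<in> P}" using P g_of_nat[OF g(1)] by simp
  then have "{x \<in> O_K. g x \<in> P} = Q"
    using prime_id_subset_eq[OF prime_id_conj(1)[OF P(1) g(1)] _ Q(1) g(2)] by blast
  then show ?thesis using g by blast
qed

text \<open>Every coset of \<open>P\<close> contains the same number \<open>nu P\<close> of
  residues, so the norm times \<open>nu P\<close> is \<open>p ^ deg\<close>. The norm of a prime
  ideal thus determines the prime number below it.\<close>

lemma norm_dvd_power:
  assumes P: "prime_id P" "of_nat p \<in> P"
  shows "absolute_norm K P dvd p ^ deg" "absolute_norm K P \<noteq> 1"
proof -
  have om: "omod P" using P by (simp add: prime_id_def)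
  have POP: "PO \<subseteq> P" by (rule prime_id_PO(1)[OF P])
  define F where "F a = (\<lambda>h. h + a) ` P" for a
  have F: "F a = F b \<longleftrightarrow> a - b \<in> P" for a b unfolding F_def by (rule coset_eq_iff[OF om])
  have img: "F ` Res = cosets P"
  proof (intro equalityI subsetI)
    fix C assume "C \<in> F ` Res" then show "C \<in> cosets P" using Res_O by (auto simp: cosets_def F_def)
  next
    fix C assume "C \<in> cosets P"
    then obtain a where a: "a \<in> O_K" "C = F a" by (auto simp: cosets_def F_def)
    then have "C = F (red a)" using F[of a "red a"] red_PO POP by blast
    then show "C \<in> F ` Res" using red_Res a by blast
  qed
  have fib: "card {x \<in> Res. F x = C} = nu P" if C: "C \<in> cosets P" for C
  proof -
    obtain a where a: "a \<in> O_K" "C = F a" using C by (auto simp: cosets_def F_def)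
    have PO_P: "y \<in> O_K" if "y \<in> P" for y using that P by (auto simp: prime_id_def)
    have "bij_betw (\<lambda>y. red (y + a)) (P \<inter> Res) {x \<in> Res. F x = C}"
      unfolding bij_betw_def
    proof
      show "inj_on (\<lambda>y. red (y + a)) (P \<inter> Res)"
        by (rule inj_onI) (auto simp: red_eq_iff a O_add PO_P intro: Res_unique)
      show "(\<lambda>y. red (y + a)) ` (P \<inter> Res) = {x \<in> Res. F x = C}"
      proof (intro equalityI subsetI)
        fix x assume "x \<in> (\<lambda>y. red (y + a)) ` (P \<inter> Res)"
        then obtain y where y: "y \<in> P" "x = red (y + a)" by blast
        have yO: "y + a \<in> O_K" using y a PO_P O_add by blast
        have "y - (y + a - red (y + a)) \<in> P" using omod_diff[OF om y(1)] red_PO[OF yO] POP by blast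
        then have "F x = F a" using y F by simp
        then show "x \<in> {x \<in> Res. F x = C}" using y a red_Res[OF yO] by simp
      next
        fix x assume "x \<in> {x \<in> Res. F x = C}"
        then have x: "x \<in> Res" "x - a \<in> P" using a F by auto
        have xO: "x - a \<in> O_K" using PO_P x by blast
        have "red (x - a) \<in> P \<inter> Res" using red_in[OF om POP xO] red_Res[OF xO] x by blast
        moreover have "red (red (x - a) + a) = x"
        proof -
          have rO: "red (x - a) + a \<in> O_K" using Res_O red_Res[OF xO] a O_add by blast
          have "x - (red (x - a) + a) \<in> PO" using red_PO[OF xO] by (simp add: algebra_simps)
          moreover have "(red (x - a) + a) - red (red (x - a) + a) \<in> PO" using red_PO[OF rO] .
          ultimately have "(x - (red (x - a) + a)) + ((red (x - a) + a) - red (red (x - a) + a)) \<in> PO"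
            by (rule omod_add[OF omod_PO])
          then have "x - red (red (x - a) + a) \<in> PO" by simp
          then show ?thesis using Res_unique[OF x(1) red_Res[OF rO]] by simp
        qed
        ultimately show "x \<in> (\<lambda>y. red (y + a)) ` (P \<inter> Res)" by (metis imageI)
      qed
    qed
    then show ?thesis unfolding nu_def by (metis bij_betw_same_card)
  qed
  have "card Res = (\<Sum>C\<in>F ` Res. card {x \<in> Res. F x = C})"
    using card_eq_sum sum.image_gen[of Res "\<lambda>_. 1 :: nat" F] by simp
  also have "\<dots> = card (cosets P) * nu P" unfolding img using fib by simp
  finally show "absolute_norm K P dvd p ^ deg" by (simp add: card_Res absolute_norm_eq)
  show "absolute_norm K P \<noteq> 1"
  proof
    assume "absolute_norm K P = 1"
    then obtain C where "cosets P = {C}" unfolding absolute_norm_eq by (metis card_1_singletonE)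
    moreover have "F 1 \<in> cosets P" "F 0 \<in> cosets P" unfolding cosets_def F_def by (rule imageI[OF O_1], rule imageI[OF O_0])
    ultimately have "F 1 = F 0" by simp
    then show False using F[of 1 0] P by (simp add: prime_id_def)
  qed
qed

lemma finite_prime_ids: "finite {P. prime_id P \<and> of_nat p \<in> P}"
proof -
  have "inj_on (\<lambda>P. P \<inter> Res) {P. prime_id P \<and> of_nat p \<in> P}"
  proof (rule inj_onI)
    fix P Q assume PQ: "P \<in> {P. prime_id P \<and> of_nat p \<in> P}" "Q \<in> {P. prime_id P \<and> of_nat p \<in> P}" "P \<inter> Res = Q \<inter> Res"
    have sub: "P \<subseteq> Q" if PQ: "prime_id P" "of_nat p \<in> P" "prime_id Q" "of_nat p \<in> Q" "P \<inter> Res = Q \<inter> Res" for P Q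
    proof
      fix x assume x: "x \<in> P"
      have om: "omod P" "omod Q" using PQ by (auto simp: prime_id_def)
      have xO: "x \<in> O_K" using x PQ by (auto simp: prime_id_def)
      have "red x \<in> P" using red_in[OF om(1) prime_id_PO(1)[OF PQ(1,2)] xO] x by simp
      then have "red x \<in> Q" using PQ(5) red_Res[OF xO] by blast
      then show "x \<in> Q" using red_in[OF om(2) prime_id_PO(1)[OF PQ(3,4)] xO] by simp
    qed
    show "P = Q" using sub[of P Q] sub[of Q P] PQ by auto
  qed
  moreover have "finite ((\<lambda>P. P \<inter> Res) ` {P. prime_id P \<and> of_nat p \<in> P})"
    by (rule finite_subset[of _ "Pow Res"]) auto
  ultimately show ?thesis by (rule finite_imageD[rotated])
qed

lemma ideal_prod_integer_ring: "ideal_prod (integer_ring K) I J = prd I J"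
proof (intro equalityI subsetI)
  fix x assume "x \<in> ideal_prod (integer_ring K) I J"
  then show "x \<in> prd I J"
    by (induction rule: ideal_prod.induct) (auto simp: integer_ring_ops intro: prd_prod prd_sum)
next
  have "prd I J \<subseteq> ideal_prod (integer_ring K) I J"
    using ideal_prod.prod[of _ I _ J "integer_ring K"] ideal_prod.sum[of _ "integer_ring K" I J]
    by (intro prd_subset) (auto simp: integer_ring_ops)
  then show "x \<in> prd I J \<Longrightarrow> x \<in> ideal_prod (integer_ring K) I J" for x by blast
qed

text \<open>Distinct primes above \<open>p\<close> are comaximal, so products are intersections.
  Intersecting with \<open>O_K\<close> covers the empty family, whose intersection is the whole
  type.\<close>

lemma finprod_prime_ids:
  assumes "finite F" "F \<subseteq> {P. prime_id P \<and> of_nat p \<in> P}"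
  shows "finprod (ideals_set (integer_ring K)) (\<lambda>P. P) F = O_K \<inter> \<Inter>F"
  using assms
proof (induction F rule: finite_induct)
  case empty
  interpret comm_monoid "ideals_set (integer_ring K)"
    using cring.ideals_set_is_comm_monoid[OF cring_integer_ring] .
  show ?case unfolding finprod_empty by (simp add: ideals_set_def carrier_integer_ring)
next
  case (insert Q F)
  interpret comm_monoid "ideals_set (integer_ring K)"
    using cring.ideals_set_is_comm_monoid[OF cring_integer_ring] .
  have Q: "prime_id Q" "of_nat p \<in> Q" using insert.prems by auto
  have ic: "P \<in> carrier (ideals_set (integer_ring K))" if "P \<in> insert Q F" for P
    using insert.prems that by (auto simp: ideals_set_def ideal_iff prime_id_def)
  have "finprod (ideals_set (integer_ring K)) (\<lambda>P. P) (insert Q F) =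
    Q \<otimes>\<^bsub>ideals_set (integer_ring K)\<^esub> finprod (ideals_set (integer_ring K)) (\<lambda>P. P) F"
    using insert.hyps ic by (intro finprod_insert) auto
  also have "\<dots> = prd Q (O_K \<inter> \<Inter>F)"
    using insert by (simp add: ideals_set_def ideal_prod_integer_ring)
  also have "\<dots> = O_K \<inter> \<Inter>(insert Q F)"
  proof
    have omF: "omod P \<and> P \<subseteq> O_K" if "P \<in> insert Q F" for P using insert.prems that by (auto simp: prime_id_def)
    show "prd Q (O_K \<inter> \<Inter>F) \<subseteq> O_K \<inter> \<Inter>(insert Q F)"
    proof (rule prd_subset)
      fix x y assume x: "x \<in> Q" and y: "y \<in> O_K \<inter> \<Inter>F"
      have xO: "x \<in> O_K" using x omF by auto
      have "x * y \<in> P" if "P \<in> F" for P using omF[of P] omod_mult[of P x y] xO y that by auto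
      moreover have "x * y \<in> Q" using omF[of Q] omod_mult'[of Q y x] x y by auto
      ultimately show "x * y \<in> O_K \<inter> \<Inter>(insert Q F)" using xO y O_mult by auto
    next
      fix x y assume xy: "x \<in> O_K \<inter> \<Inter>(insert Q F)" "y \<in> O_K \<inter> \<Inter>(insert Q F)"
      have "x + y \<in> P" if "P \<in> insert Q F" for P using omF[OF that] omod_add[of P x y] xy that by blast
      then show "x + y \<in> O_K \<inter> \<Inter>(insert Q F)" using xy O_add by blast
    qed
    show "O_K \<inter> \<Inter>(insert Q F) \<subseteq> prd Q (O_K \<inter> \<Inter>F)"
    proof
      fix x assume x: "x \<in> O_K \<inter> \<Inter>(insert Q F)"
      have "\<exists>y. y \<in> P \<and> y \<notin> Q" if P: "P \<in> F" for P
        using prime_id_subset_eq[of P Q] insert P by blast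
      then obtain f where f: "\<And>P. P \<in> F \<Longrightarrow> f P \<in> P \<and> f P \<notin> Q" by metis
      have fO: "f P \<in> O_K" if "P \<in> F" for P using f[OF that] omF that by blast
      \<comment> \<open>\<open>y\<close> lies in every member of \<open>F\<close> but not in
        \<open>Q\<close>; with \<open>1 - y * z\<close> in \<open>Q\<close>, split \<open>x\<close>
        as \<open>(1 - y * z) * x + x * (y * z)\<close>.\<close>
      define y where "y = (\<Prod>P\<in>F. f P)"
      have yO: "y \<in> O_K" unfolding y_def by (rule O_prod) (rule fO)
      have yQ: "y \<notin> Q" using prime_id_prod[OF Q(1) insert.hyps(1), of f] fO f by (auto simp: y_def)
      have yF: "y \<in> P" if P: "P \<in> F" for P
      proof -
        have "y = f P * (\<Prod>P\<in>F - {P}. f P)" unfolding y_def by (rule prod.remove[OF insert.hyps(1) P])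
        moreover have "(\<Prod>P\<in>F - {P}. f P) \<in> O_K" by (rule O_prod) (use fO in blast)
        ultimately show ?thesis using omod_mult'[of P _ "f P"] omF[of P] f[OF P] P by simp
      qed
      obtain z where z: "z \<in> O_K" "1 - y * z \<in> Q" using prime_id_maximal[OF Q yO yQ] by blast
      have "(1 - y * z) * x \<in> prd Q (O_K \<inter> \<Inter>F)" using z x by (intro prd_prod) auto
      moreover have "x * (y * z) \<in> prd Q (O_K \<inter> \<Inter>F)"
      proof (rule prd_prod)
        have "y * z \<in> P" if "P \<in> F" for P using omod_mult'[of P z y] omF[of P] yF z that by auto
        then show "y * z \<in> O_K \<inter> \<Inter>F" using yO z O_mult by auto
      qed (use x in auto)
      ultimately have "(1 - y * z) * x + x * (y * z) \<in> prd Q (O_K \<inter> \<Inter>F)" by (rule prd_sum)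
      then show "x \<in> prd Q (O_K \<inter> \<Inter>F)" by (simp add: algebra_simps)
    qed
  qed
  finally show ?case .
qed

text \<open>The conjugates of a single \<open>P\<close> already cut the intersection down to
  \<open>rad\<close>.\<close>

lemma Inter_prime_ids:
  assumes P: "prime_id P" "of_nat p \<in> P"
  shows "O_K \<inter> \<Inter>{P. prime_id P \<and> of_nat p \<in> P} = rad"
proof
  show "rad \<subseteq> O_K \<inter> \<Inter>{P. prime_id P \<and> of_nat p \<in> P}"
    using prime_id_PO(2) rad_O by blast
  have "O_K \<inter> \<Inter>{P. prime_id P \<and> of_nat p \<in> P} \<subseteq> {x \<in> O_K. \<forall>g\<in>gal K. g x \<in> P}"
  proof
    fix x assume x: "x \<in> O_K \<inter> \<Inter>{P. prime_id P \<and> of_nat p \<in> P}"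
    have "g x \<in> P" if g: "g \<in> gal K" for g
    proof -
      have "of_nat p \<in> {x \<in> O_K. g x \<in> P}" using P g_of_nat[OF g] by simp
      then have "x \<in> {x \<in> O_K. g x \<in> P}" using x prime_id_conj(1)[OF P(1) g] by blast
      then show ?thesis by simp
    qed
    then show "x \<in> {x \<in> O_K. \<forall>g\<in>gal K. g x \<in> P}" using x by blast
  qed
  then show "O_K \<inter> \<Inter>{P. prime_id P \<and> of_nat p \<in> P} \<subseteq> rad" using conj_Inter_rad[OF P] by blast
qed

end

context galois_ext
begin

text \<open>The primes of norm \<open>q\<close> are either absent or exactly the primes above one
  \<open>p\<close>: these are conjugate and so share the norm, whereas a prime above another
  \<open>r\<close> has a norm different from 1 that divides a power of \<open>r\<close>.\<close>

lemma norm_ideal_cases: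
  assumes q: "0 < q"
  shows "norm_ideal K q = O_K \<or> (\<exists>p. Factorial_Ring.prime p \<and> norm_ideal K q = galois_prime.rad K p)"
proof (cases "{P. primeideal P (integer_ring K) \<and> absolute_norm K P = q} = {}")
  case True
  interpret comm_monoid "ideals_set (integer_ring K)"
    using cring.ideals_set_is_comm_monoid[OF cring_integer_ring] .
  have "norm_ideal K q = finprod (ideals_set (integer_ring K)) (\<lambda>P. P) {}"
    unfolding norm_ideal_def True ..
  then show ?thesis unfolding finprod_empty by (simp add: ideals_set_def carrier_integer_ring)
next
  case False
  then obtain P where P: "prime_id P" "absolute_norm K P = q" by (auto simp: prime_id_iff)
  then obtain p where pp: "Factorial_Ring.prime p" "of_nat p \<in> P" using prime_id_contains_prime[OF P(1)] q by auto
  interpret galois_prime K p by unfold_locales (rule pp(1))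
  have eq: "{P. primeideal P (integer_ring K) \<and> absolute_norm K P = q} = {P. prime_id P \<and> of_nat p \<in> P}"
  proof (intro equalityI subsetI)
    fix Q assume "Q \<in> {P. prime_id P \<and> of_nat p \<in> P}"
    then have Q: "prime_id Q" "of_nat p \<in> Q" by auto
    then obtain g where "g \<in> gal K" "Q = {x \<in> O_K. g x \<in> P}" using prime_ids_conjugate[OF P(1) pp(2)] by blast
    then show "Q \<in> {P. primeideal P (integer_ring K) \<and> absolute_norm K P = q}"
      using prime_id_conj(2)[OF P(1)] P(2) Q by (simp add: prime_id_iff)
  next
    fix Q assume "Q \<in> {P. primeideal P (integer_ring K) \<and> absolute_norm K P = q}"
    then have Q: "prime_id Q" "absolute_norm K Q = q" by (auto simp: prime_id_iff)
    then obtain r where r: "Factorial_Ring.prime r" "of_nat r \<in> Q" using prime_id_contains_prime[OF Q(1)] q by auto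
    interpret r: galois_prime K r by unfold_locales (rule r(1))
    have "q dvd p ^ deg" "q \<noteq> 1" using norm_dvd_power[OF P(1) pp(2)] P(2) by auto
    moreover have "q dvd r ^ deg" using r.norm_dvd_power[OF Q(1) r(2)] Q(2) by auto
    ultimately obtain s where s: "Factorial_Ring.prime s" "s dvd p ^ deg" "s dvd r ^ deg"
      using prime_factor_nat[of q] dvd_trans by metis
    then have "s dvd p" "s dvd r" using prime_dvd_power by blast+
    then have "p = r" using s pp r by (metis primes_dvd_imp_eq)
    then show "Q \<in> {P. prime_id P \<and> of_nat p \<in> P}" using Q r by simp
  qed
  have "norm_ideal K q = rad"
    unfolding norm_ideal_def eq finprod_prime_ids[OF finite_prime_ids subset_refl]
    by (rule Inter_prime_ids[OF P(1) pp(2)])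
  then show ?thesis using pp by blast
qed

text \<open>Where \<open>p\<close> does not divide the discriminant, \<open>ram_bound\<close> forces
  ramification index 1 and the class of \<open>rad\<close> is trivial, so finitely many generators
  remain. The indices are hidden behind an existential because the final estimate uses only their
  size.\<close>

lemma card_polya_group:
  "\<exists>e. card (polya_group K) \<le> (\<Prod>p\<in>{p. Factorial_Ring.prime p \<and> int p dvd discriminant K}. e p) \<and>
     (\<forall>p. Factorial_Ring.prime p \<longrightarrow> 0 < e p \<and> 2 ^ (e p - 1) \<le> p ^ multiplicity (int p) (discriminant K))"
proof -
  define Ps where "Ps = {p. Factorial_Ring.prime p \<and> int p dvd discriminant K}"
  define e where "e p = galois_prime.ram K p" for p
  define x where "x p = cls (galois_prime.rad K p)" for p
  have loc: "galois_prime K p" if "Factorial_Ring.prime p" for p by unfold_locales (rule that)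
  have "finite Ps"
  proof (rule finite_subset[of _ "{..nat \<bar>discriminant K\<bar>}"])
    show "Ps \<subseteq> {..nat \<bar>discriminant K\<bar>}"
    proof
      fix p assume "p \<in> Ps"
      then have "\<bar>int p\<bar> \<le> \<bar>discriminant K\<bar>"
        using discriminant_nonzero by (intro dvd_imp_le_int) (auto simp: Ps_def)
      then show "p \<in> {..nat \<bar>discriminant K\<bar>}" by simp
    qed
  qed simp
  have e: "0 < e p \<and> x p [^]\<^bsub>class_group K\<^esub> e p = \<one>\<^bsub>class_group K\<^esub>" "x p \<in> carrier (class_group K)"
    "2 ^ (e p - 1) \<le> p ^ multiplicity (int p) (discriminant K)" if p: "Factorial_Ring.prime p" for p
  proof -
    interpret galois_prime K p by (rule loc[OF p])
    show "0 < e p \<and> x p [^]\<^bsub>class_group K\<^esub> e p = \<one>\<^bsub>class_group K\<^esub>" "x p \<in> carrier (class_group K)"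
       "2 ^ (e p - 1) \<le> p ^ multiplicity (int p) (discriminant K)"
      unfolding e_def x_def using ram_pos cls_rad_order cls_rad_carrier ram_bound by auto
  qed
  have one: "x p = \<one>\<^bsub>class_group K\<^esub>" if p: "Factorial_Ring.prime p" "\<not> int p dvd discriminant K" for p
  proof -
    have "2 ^ (e p - 1) \<le> (1 :: nat)"
      using e(3)[OF p(1)] not_dvd_imp_multiplicity_0[OF p(2)] by simp
    then have "e p = 1" using e(1)[OF p(1)] power_le_one_iff[of "2 :: nat" "e p - 1"]
      by (metis One_nat_def Suc_pred le_antisym not_less_eq_eq numeral_2_eq_2 le_zero_eq less_exp less_one order_less_le_trans)
    then show ?thesis using e[OF p(1)] comm_monoid.axioms(1)[OF comm_monoid_class_group]
      by (metis monoid.nat_pow_eone)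
  qed
  have "{ideal_class K (norm_ideal K q) | q. 0 < q} \<subseteq> insert \<one>\<^bsub>class_group K\<^esub> (x ` Ps)"
  proof
    fix z assume "z \<in> {ideal_class K (norm_ideal K q) | q. 0 < q}"
    then obtain q where q: "0 < q" "z = ideal_class K (norm_ideal K q)" by blast
    show "z \<in> insert \<one>\<^bsub>class_group K\<^esub> (x ` Ps)"
      using norm_ideal_cases[OF q(1)]
    proof
      assume "norm_ideal K q = O_K"
      then show ?thesis using q ideal_class_eq_cls[OF omod_O] by (simp add: class_group_one)
    next
      assume "\<exists>p. Factorial_Ring.prime p \<and> norm_ideal K q = galois_prime.rad K p"
      then obtain p where pp: "Factorial_Ring.prime p" "norm_ideal K q = galois_prime.rad K p" by blast
      interpret galois_prime K p by (rule loc[OF pp(1)])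
      have "z = x p" using q pp ideal_class_eq_cls[OF omod_rad] by (simp add: x_def)
      then show ?thesis using one pp by (cases "int p dvd discriminant K") (auto simp: Ps_def)
    qed
  qed
  then have "card (polya_group K) \<le> (\<Prod>p\<in>Ps. e p)"
    unfolding polya_group_def
    using generate_subset_finite[OF comm_monoid_class_group \<open>finite Ps\<close>, of x e] e by (auto simp: Ps_def)
  then show ?thesis using e unfolding Ps_def by blast
qed

end

section \<open>Cyclotomic fields\<close>

definition zeta :: "nat \<Rightarrow> complex" where "zeta m = cis (2 * pi / real m)"

lemma zeta_power: "zeta m ^ k = cis (2 * pi * real k / real m)"
  by (simp add: zeta_def DeMoivre mult_ac)

lemma zeta_power_self: "0 < m \<Longrightarrow> zeta m ^ m = 1"
  by (simp add: zeta_power)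

lemma zeta_power_mod: assumes "0 < m" shows "zeta m ^ (k mod m) = zeta m ^ k"
proof -
  have "zeta m ^ k = zeta m ^ (m * (k div m) + k mod m)" by simp
  also have "\<dots> = (zeta m ^ m) ^ (k div m) * zeta m ^ (k mod m)" by (simp only: power_add power_mult)
  finally show ?thesis using zeta_power_self[OF assms] by simp
qed

lemma root_of_unity_ex: assumes "0 < m" "z ^ m = 1" shows "\<exists>k<m. z = zeta m ^ k"
proof -
  have "z \<in> (\<lambda>k. cis (2 * pi * real k / real m)) ` {..<m}"
    using bij_betw_roots_unity[OF assms(1)] assms(2) unfolding bij_betw_def by blast
  then show ?thesis by (auto simp: zeta_power)
qed

lemma zeta_power_eq_iff: assumes "0 < m" shows "zeta m ^ a = zeta m ^ b \<longleftrightarrow> a mod m = b mod m"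
proof
  assume "zeta m ^ a = zeta m ^ b"
  then have "zeta m ^ (a mod m) = zeta m ^ (b mod m)" using zeta_power_mod[OF assms] by simp
  moreover have "inj_on (\<lambda>k. zeta m ^ k) {..<m}"
    using bij_betw_roots_unity[OF assms] unfolding bij_betw_def zeta_power by blast
  ultimately show "a mod m = b mod m" using assms unfolding inj_on_def by auto
next
  assume "a mod m = b mod m"
  then show "zeta m ^ a = zeta m ^ b" using zeta_power_mod[OF assms] by metis
qed

lemma zeta_power_eq_1_iff: "0 < m \<Longrightarrow> zeta m ^ a = 1 \<longleftrightarrow> m dvd a"
  using zeta_power_eq_iff[of m a 0] by auto

lemma zeta_power_dvd: assumes "0 < a" shows "zeta (a * b) ^ a = zeta b"
  using assms by (simp add: zeta_power) (simp add: zeta_def)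

lemma zeta_nonzero [simp]: "zeta m \<noteq> 0" by (simp add: zeta_def)

lemma algebraic_int_zeta: assumes "0 < m" shows "algebraic_int (zeta m)"
proof -
  have "algebraic_int (zeta m ^ m)" using zeta_power_self[OF assms] by simp
  then show ?thesis
    using algebraic_int_root[of "zeta m ^ m" "monom 1 m" "zeta m"] assms
    by (auto simp: poly_monom degree_monom_eq)
qed

text \<open>Both sides are the value at 1 of \<open>1 + X + ... + X ^ (m - 1)\<close>, once expanded
  and once factored at its \<open>m - 1\<close> roots.\<close>

lemma prod_one_minus_zeta: assumes "0 < m" shows "(\<Prod>a\<in>{1..<m}. 1 - zeta m ^ a) = of_nat m"
proof -
  define Q :: "complex poly" where "Q = (\<Sum>i<m. monom 1 i)"
  define R where "R = (\<Prod>a\<in>{1..<m}. [:- (zeta m ^ a), 1:])"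
  have inj: "inj_on (\<lambda>a. zeta m ^ a) {1..<m}"
    using zeta_power_eq_iff[OF assms] by (auto simp: inj_on_def)
  have cQ: "coeff Q i = (if i < m then 1 else 0)" for i by (simp add: Q_def coeff_sum)
  have cm: "coeff Q (m - 1) = coeff R (m - 1)"
  proof -
    have "degree R = m - 1" unfolding R_def by (subst degree_prod_eq_sum_degree) auto
    moreover have "lead_coeff R = 1" unfolding R_def by (subst lead_coeff_prod) auto
    ultimately show ?thesis using assms by (simp add: cQ)
  qed
  have "Q = R"
  proof (rule poly_eqI_degree_lead_coeff[OF cm, of "(\<lambda>a. zeta m ^ a) ` {1..<m}"])
    show "m - 1 \<le> card ((\<lambda>a. zeta m ^ a) ` {1..<m})" using card_image[OF inj] by simp
    show "degree Q \<le> m - 1" by (rule degree_le) (use assms in \<open>auto simp: cQ\<close>)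
    show "degree R \<le> m - 1" unfolding R_def by (subst degree_prod_eq_sum_degree) auto
    fix z assume "z \<in> (\<lambda>a. zeta m ^ a) ` {1..<m}"
    then obtain a where a: "1 \<le> a" "a < m" "z = zeta m ^ a" by auto
    have "poly R z = 0" unfolding R_def poly_prod using a by (auto intro!: prod_zero bexI[of _ a])
    moreover have "poly Q z = 0"
    proof -
      have "z \<noteq> 1" using a zeta_power_eq_1_iff[OF assms, of a] by (auto dest: dvd_imp_le)
      moreover have "z ^ m = 1" using a zeta_power_self[OF assms] by (simp flip: power_mult add: mult.commute[of a]) (simp add: power_mult)
      moreover have "poly Q z = (\<Sum>i<m. z ^ i)" by (simp add: Q_def poly_sum poly_monom)
      ultimately show ?thesis using geometric_sum[of z m] by simp
    qed
    ultimately show "poly Q z = poly R z" by simp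
  qed
  then have "poly Q 1 = poly R 1" by simp
  then show ?thesis by (simp add: Q_def R_def poly_sum poly_monom poly_prod)
qed

text \<open>Stated for a bare set \<open>K\<close>, because the cyclotomic field is not yet known to
  be an instance of \<open>galois_ext\<close>. With the identity for \<open>f\<close>, the second
  part gives closure under rational polynomials.\<close>

lemma hom_poly_Rats:
  fixes f :: "complex \<Rightarrow> complex"
  assumes K: "1 \<in> K" "\<And>x y. x \<in> K \<Longrightarrow> y \<in> K \<Longrightarrow> x + y \<in> K" "\<And>x y. x \<in> K \<Longrightarrow> y \<in> K \<Longrightarrow> x * y \<in> K" "\<rat> \<subseteq> K"
    and f: "\<And>x y. x \<in> K \<Longrightarrow> y \<in> K \<Longrightarrow> f (x + y) = f x + f y"
      "\<And>x y. x \<in> K \<Longrightarrow> y \<in> K \<Longrightarrow> f (x * y) = f x * f y" "\<And>q. q \<in> \<rat> \<Longrightarrow> f q = q"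
    and P: "\<And>i. coeff P i \<in> \<rat>" and x: "x \<in> K"
  shows "f (poly P x) = poly P (f x)" "poly P x \<in> K"
proof -
  have K0: "0 \<in> K" using K(4) by auto
  have "poly P x \<in> K \<and> f (poly P x) = poly P (f x)" using P
  proof (induction P rule: pCons_induct)
    case 0
    then show ?case using K0 f(3)[of 0] by simp
  next
    case (pCons a P)
    have aQ: "a \<in> \<rat>" using pCons.prems[of 0] by simp
    have "coeff P i \<in> \<rat>" for i using pCons.prems[of "Suc i"] by simp
    then have IH: "poly P x \<in> K" "f (poly P x) = poly P (f x)" using pCons.IH by blast+
    have xP: "x * poly P x \<in> K" using K(3)[OF x IH(1)] .
    have "f (a + x * poly P x) = a + f x * poly P (f x)"
      using f(1)[OF _ xP] f(2)[OF x IH(1)] f(3)[OF aQ] aQ K(4) IH(2) by auto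
    moreover have "a + x * poly P x \<in> K" using K(2)[OF _ xP] aQ K(4) by blast
    ultimately show ?case by simp
  qed
  then show "f (poly P x) = poly P (f x)" "poly P x \<in> K" by blast+
qed

section \<open>Rational polynomials and the structure of cyclotomic fields\<close>

definition rat_polys :: "complex poly set" where "rat_polys = {P. \<forall>i. coeff P i \<in> \<rat>}"

lemma rat_polys_closed:
  "0 \<in> rat_polys" "1 \<in> rat_polys"
  "P \<in> rat_polys \<Longrightarrow> Q \<in> rat_polys \<Longrightarrow> P + Q \<in> rat_polys"
  "P \<in> rat_polys \<Longrightarrow> Q \<in> rat_polys \<Longrightarrow> P - Q \<in> rat_polys"
  "P \<in> rat_polys \<Longrightarrow> Q \<in> rat_polys \<Longrightarrow> P * Q \<in> rat_polys"
  "P \<in> rat_polys \<Longrightarrow> - P \<in> rat_polys" "q \<in> \<rat> \<Longrightarrow> [:q:] \<in> rat_polys" "q \<in> \<rat> \<Longrightarrow> monom q k \<in> rat_polys"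
  by (auto simp: rat_polys_def coeff_mult coeff_1 coeff_pCons split: nat.splits intro!: Rats_sum)

lemma rat_polys_iff: "P \<in> rat_polys \<longleftrightarrow> (\<exists>Q :: rat poly. P = map_poly of_rat Q)"
proof
  assume P: "P \<in> rat_polys"
  define h where "h z = (SOME q. of_rat q = z)" for z :: complex
  have h: "of_rat (h z) = z" if "z \<in> \<rat>" for z
    using that unfolding h_def by (metis (mono_tags, lifting) Rats_cases someI_ex)
  have h0: "h 0 = 0" using h[of 0] by simp
  have "P = map_poly of_rat (map_poly h P)"
    by (rule poly_eqI) (use P h h0 in \<open>auto simp: coeff_map_poly rat_polys_def\<close>)
  then show "\<exists>Q :: rat poly. P = map_poly of_rat Q" by blast
qed (auto simp: rat_polys_def coeff_map_poly)

text \<open>Division with remainder and Bezout are available for polynomials over the type of rationals; the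
  statement transfers them along \<open>of_rat\<close>.\<close>

lemma ex_min_rat_poly:
  fixes z :: complex
  assumes "\<exists>P\<in>rat_polys. P \<noteq> 0 \<and> poly P z = 0"
  shows "\<exists>f\<in>rat_polys. f \<noteq> 0 \<and> poly f z = 0 \<and> (\<forall>P\<in>rat_polys. poly P z = 0 \<longrightarrow> (\<exists>Q\<in>rat_polys. P = f * Q)) \<and>
     (\<forall>P\<in>rat_polys. \<exists>R\<in>rat_polys. degree R < degree f \<and> poly R z = poly P z) \<and>
     (\<forall>P\<in>rat_polys. poly P z \<noteq> 0 \<longrightarrow> (\<exists>Q\<in>rat_polys. poly Q z * poly P z = 1))"
proof -
  let ?r = "map_poly (of_rat :: rat \<Rightarrow> complex)"
  have hm: "?r (P * Q) = ?r P * ?r Q" "?r (P + Q) = ?r P + ?r Q" for P Q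
    by (rule poly_eqI; simp add: coeff_map_poly coeff_mult of_rat_sum of_rat_mult of_rat_add)+
  have h0: "?r P = 0 \<longleftrightarrow> P = 0" for P by (metis coeff_0 coeff_map_poly of_rat_0 of_rat_eq_0_iff poly_eqI)
  have dr: "degree (?r P) = degree P" for P by (simp add: degree_map_poly)
  have hc: "?r [:q:] = [:of_rat q:]" for q
    by (rule poly_eqI) (auto simp: coeff_map_poly coeff_pCons split: nat.splits)
  define Z where "Z P \<longleftrightarrow> P \<noteq> 0 \<and> poly (?r P) z = 0" for P
  have "\<exists>P. Z P" using assms unfolding rat_polys_iff Z_def by (metis (no_types, lifting) h0 rat_polys_iff)
  then obtain f where f: "Z f" "\<And>P. Z P \<Longrightarrow> degree f \<le> degree P"
    using ex_has_least_nat[of Z _ degree] by metis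
  have f0: "f \<noteq> 0" "poly (?r f) z = 0" using f(1) by (auto simp: Z_def)
  have df: "degree f \<noteq> 0"
  proof
    assume "degree f = 0"
    then obtain a where "f = [:a:]" by (rule degree_eq_zeroE)
    then show False using f0 by (simp add: hc)
  qed
  have modf: "poly (?r (P mod f)) z = poly (?r P) z" for P
  proof -
    have "?r P = ?r (P div f) * ?r f + ?r (P mod f)" unfolding hm[symmetric] by simp
    then show ?thesis using f0 by simp
  qed
  have degmod: "degree (P mod f) < degree f" for P
    using degree_mod_less[OF f0(1), of P] df by auto
  have dvdf: "f dvd P" if "poly (?r P) z = 0" for P
  proof (rule ccontr)
    assume "\<not> f dvd P"
    then have "Z (P mod f)" using that modf by (simp add: Z_def mod_eq_0_iff_dvd)
    then show False using f(2) degmod[of P] by fastforce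
  qed
  have inv: "\<exists>Q. poly (?r Q) z * poly (?r P) z = 1" if P: "poly (?r P) z \<noteq> 0" for P
  proof -
    define g where "g = gcd P f"
    obtain a b where ab: "a * P + b * f = g" unfolding g_def using bezout_coefficients_fst_snd by blast
    have "g \<noteq> 0" using f0 by (simp add: g_def)
    obtain c where c: "P = g * c" using gcd_dvd1[of P f] unfolding g_def by (elim dvdE)
    have gz: "poly (?r g) z \<noteq> 0"
    proof
      assume "poly (?r g) z = 0"
      then have "poly (?r (g * c)) z = 0" unfolding hm by simp
      then show False using P c by simp
    qed
    obtain h where h: "f = g * h" using gcd_dvd2[of P f] unfolding g_def by (elim dvdE)
    then have "poly (?r g) z * poly (?r h) z = 0" using f0 hm(1)[of g h] by simp
    then have "poly (?r h) z = 0" using gz by simp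
    moreover have "h \<noteq> 0" using h f0 by auto
    ultimately have "degree f \<le> degree h" using f(2) by (simp add: Z_def)
    moreover have "degree f = degree g + degree h" using h \<open>g \<noteq> 0\<close> \<open>h \<noteq> 0\<close> by (simp add: degree_mult_eq)
    ultimately have "degree g = 0" by simp
    then obtain q where q: "g = [:q:]" by (rule degree_eq_zeroE)
    then have q0: "q \<noteq> 0" using \<open>g \<noteq> 0\<close> by simp
    have "poly (?r (a * P + b * f)) z = of_rat q" unfolding ab q by (simp add: hc)
    then have "poly (?r a) z * poly (?r P) z = of_rat q" unfolding hm using f0 by simp
    moreover have "poly (?r ([:1 / q:] * a)) z = of_rat (1 / q) * poly (?r a) z"
      unfolding hm by (simp add: hc)
    ultimately have "poly (?r ([:1 / q:] * a)) z * poly (?r P) z = of_rat (1 / q) * of_rat q" by (simp add: mult.assoc)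
    also have "\<dots> = 1" using q0 by (simp add: of_rat_divide)
    finally show ?thesis by blast
  qed
  have rin: "?r P \<in> rat_polys" for P by (auto simp: rat_polys_iff)
  show ?thesis
  proof (rule bexI[of _ "?r f"], intro conjI ballI impI)
    fix P assume "P \<in> rat_polys" and Pz: "poly P z = 0"
    then obtain P0 where P0: "P = ?r P0" by (auto simp: rat_polys_iff)
    have "f dvd P0" using dvdf[of P0] Pz P0 by simp
    then obtain c where "P0 = f * c" by (elim dvdE)
    then show "\<exists>Q\<in>rat_polys. P = ?r f * Q" using P0 hm(1) rin by blast
  next
    fix P assume "P \<in> rat_polys"
    then obtain P0 where P0: "P = ?r P0" by (auto simp: rat_polys_iff)
    show "\<exists>R\<in>rat_polys. degree R < degree (?r f) \<and> poly R z = poly P z"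
      using degmod[of P0] modf[of P0] P0 dr rin by metis
  next
    fix P assume "P \<in> rat_polys" and Pz: "poly P z \<noteq> 0"
    then obtain P0 where P0: "P = ?r P0" by (auto simp: rat_polys_iff)
    show "\<exists>Q\<in>rat_polys. poly Q z * poly P z = 1"
      using inv[of P0] Pz P0 rin by blast
  qed (use f0 h0 rin in auto)
qed

lemma complex_ring_simps:
  "\<one>\<^bsub>complex_ring\<^esub> = 1" "\<zero>\<^bsub>complex_ring\<^esub> = 0" "x \<oplus>\<^bsub>complex_ring\<^esub> y = x + y" "x \<otimes>\<^bsub>complex_ring\<^esub> y = x * y"
  "carrier complex_ring = UNIV"
  by (simp_all add: ring_of_type_algebra_def)

lemma complex_ring_minus: "\<ominus>\<^bsub>complex_ring\<^esub> x = - x"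
proof -
  interpret ring complex_ring by (rule ring_from_type_algebra)
  show ?thesis by (rule minus_equality) (simp_all add: complex_ring_simps)
qed

lemma complex_ring_inv: "x \<noteq> 0 \<Longrightarrow> inv\<^bsub>complex_ring\<^esub> x = inverse x"
proof -
  assume "x \<noteq> 0"
  interpret cring complex_ring by (rule cring_from_type_algebra)
  show ?thesis by (rule comm_inv_char) (use \<open>x \<noteq> 0\<close> in \<open>simp_all add: complex_ring_simps\<close>)
qed

text \<open>Separability by counting: \<open>X ^ m - 1 = f * h\<close> has \<open>m\<close> distinct
  roots, and \<open>h\<close> accounts for at most \<open>degree h\<close> of them, so
  \<open>f\<close> has as many roots as its degree. The clauses before that collect the properties
  of a minimal polynomial.\<close>

lemma zeta_min_poly:
  assumes m: "0 < m"
  obtains f where "f \<in> rat_polys" "f \<noteq> 0" "poly f (zeta m) = 0"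
    "\<forall>P\<in>rat_polys. poly P (zeta m) = 0 \<longrightarrow> (\<exists>Q\<in>rat_polys. P = f * Q)"
    "\<forall>P\<in>rat_polys. \<exists>R\<in>rat_polys. degree R < degree f \<and> poly R (zeta m) = poly P (zeta m)"
    "\<forall>P\<in>rat_polys. poly P (zeta m) \<noteq> 0 \<longrightarrow> (\<exists>Q\<in>rat_polys. poly Q (zeta m) * poly P (zeta m) = 1)"
    "card {r. poly f r = 0} = degree f" "\<forall>r. poly f r = 0 \<longrightarrow> r ^ m = 1"
proof -
  define u :: "complex poly" where "u = monom 1 m - 1"
  have u: "u \<in> rat_polys" unfolding u_def by (intro rat_polys_closed) auto
  have pu: "poly u r = r ^ m - 1" for r by (simp add: u_def poly_monom)
  have "coeff u m = 1" using m by (simp add: u_def coeff_1)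
  then have u0: "u \<noteq> 0" by auto
  have du: "degree u \<le> m" unfolding u_def by (intro degree_diff_le) (auto simp: degree_monom_le)
  have ex: "\<exists>P\<in>rat_polys. P \<noteq> 0 \<and> poly P (zeta m) = 0"
    using u u0 pu zeta_power_self[OF m] by (intro bexI[of _ u]) auto
  obtain f where f: "f \<in> rat_polys" "f \<noteq> 0" "poly f (zeta m) = 0"
    "\<And>P. P \<in> rat_polys \<Longrightarrow> poly P (zeta m) = 0 \<Longrightarrow> \<exists>Q\<in>rat_polys. P = f * Q"
    "\<And>P. P \<in> rat_polys \<Longrightarrow> \<exists>R\<in>rat_polys. degree R < degree f \<and> poly R (zeta m) = poly P (zeta m)"
    "\<And>P. P \<in> rat_polys \<Longrightarrow> poly P (zeta m) \<noteq> 0 \<Longrightarrow> \<exists>Q\<in>rat_polys. poly Q (zeta m) * poly P (zeta m) = 1"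
    using ex_min_rat_poly[OF ex] by blast
  obtain h where h: "u = f * h" using f(4)[OF u] pu zeta_power_self[OF m] by auto
  have h0: "h \<noteq> 0" using h u0 by auto
  have "{r. poly u r = 0} = {r. poly f r = 0} \<union> {r. poly h r = 0}" using h by auto
  then have "card {r. poly u r = 0} \<le> card {r. poly f r = 0} + card {r. poly h r = 0}"
    by (metis card_Un_le)
  moreover have "card {r. poly u r = 0} = m"
    using card_roots_unity_eq[OF m] by (simp add: pu)
  moreover have "card {r. poly h r = 0} \<le> degree h" by (rule card_poly_roots_bound[OF h0])
  moreover have "degree u = degree f + degree h" using h f(2) h0 by (simp add: degree_mult_eq)
  ultimately have "degree f \<le> card {r. poly f r = 0}" using du by linarith
  then have "card {r. poly f r = 0} = degree f" using card_poly_roots_bound[OF f(2)] by (intro antisym)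
  moreover have "r ^ m = 1" if "poly f r = 0" for r
  proof -
    have "poly u r = 0" using h that by simp
    then show ?thesis using pu by simp
  qed
  ultimately show thesis using that[OF f(1-3)] f(4-6) by simp
qed

text \<open>Inverses of nonzero polynomial values are polynomial values again, so the generated ring
  is already the field.\<close>

lemma cyclotomic_field_eq:
  assumes m: "0 < m"
  shows "cyclotomic_field m = (\<lambda>P. poly P (zeta m)) ` rat_polys"
proof
  obtain f where "\<forall>P\<in>rat_polys. poly P (zeta m) \<noteq> 0 \<longrightarrow> (\<exists>Q\<in>rat_polys. poly Q (zeta m) * poly P (zeta m) = 1)"
    by (rule zeta_min_poly[OF m])
  note inv = this[rule_format]
  let ?S = "(\<lambda>P. poly P (zeta m)) ` rat_polys"
  have G: "cyclotomic_field m = generate_field complex_ring (\<rat> \<union> {zeta m})"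
    by (simp add: cyclotomic_field_def zeta_def)
  show "cyclotomic_field m \<subseteq> ?S"
  proof
    fix x assume "x \<in> cyclotomic_field m"
    then show "x \<in> ?S" unfolding G
    proof (induction rule: generate_field.induct)
      case one
      show ?case by (rule image_eqI[of _ _ 1]) (auto simp: complex_ring_simps rat_polys_closed)
    next
      case (incl h)
      have "monom 1 1 \<in> rat_polys" by (intro rat_polys_closed) simp
      then have "zeta m \<in> ?S" by (intro image_eqI[of _ _ "monom 1 1"]) (auto simp: poly_monom)
      moreover have "h \<in> ?S" if "h \<in> \<rat>" using that by (intro image_eqI[of _ _ "[:h:]"]) (auto intro: rat_polys_closed)
      ultimately show ?case using incl by auto
    next
      case (a_inv h)
      then obtain P where "P \<in> rat_polys" "h = poly P (zeta m)" by auto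
      then show ?case by (intro image_eqI[of _ _ "- P"]) (auto simp: complex_ring_minus rat_polys_closed)
    next
      case (m_inv h)
      then obtain P where P: "P \<in> rat_polys" "h = poly P (zeta m)" by auto
      moreover have h0: "h \<noteq> 0" using m_inv by (simp add: complex_ring_simps)
      ultimately obtain Q where "Q \<in> rat_polys" "poly Q (zeta m) * h = 1" using inv by blast
      then show ?case using h0 by (intro image_eqI[of _ _ Q]) (auto simp: complex_ring_inv inverse_eq_divide field_simps)
    next
      case (eng_add a b)
      then obtain P Q where "P \<in> rat_polys" "a = poly P (zeta m)" "Q \<in> rat_polys" "b = poly Q (zeta m)" by auto
      then show ?case by (intro image_eqI[of _ _ "P + Q"]) (auto simp: complex_ring_simps rat_polys_closed)
    next
      case (eng_mult a b)
      then obtain P Q where "P \<in> rat_polys" "a = poly P (zeta m)" "Q \<in> rat_polys" "b = poly Q (zeta m)" by auto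
      then show ?case by (intro image_eqI[of _ _ "P * Q"]) (auto simp: complex_ring_simps rat_polys_closed)
    qed
  qed
  show "?S \<subseteq> cyclotomic_field m"
  proof
    fix x assume "x \<in> ?S"
    then obtain P where P: "P \<in> rat_polys" "x = poly P (zeta m)" by auto
    show "x \<in> cyclotomic_field m" unfolding P(2)
    proof (rule hom_poly_Rats(2)[of _ "\<lambda>x. x"])
      show "1 \<in> cyclotomic_field m" using generate_field.one[of complex_ring] by (simp add: G complex_ring_simps)
      show "x + y \<in> cyclotomic_field m" if "x \<in> cyclotomic_field m" "y \<in> cyclotomic_field m" for x y
        using generate_field.eng_add[of x complex_ring _ y] that by (simp add: G complex_ring_simps)
      show "x * y \<in> cyclotomic_field m" if "x \<in> cyclotomic_field m" "y \<in> cyclotomic_field m" for x y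
        using generate_field.eng_mult[of x complex_ring _ y] that by (simp add: G complex_ring_simps)
      show "\<rat> \<subseteq> cyclotomic_field m" "zeta m \<in> cyclotomic_field m"
        unfolding G by (auto intro: generate_field.incl)
    qed (use P in \<open>auto simp: rat_polys_def\<close>)
  qed
qed

text \<open>Sending \<open>zeta m\<close> to any root of its minimal polynomial \<open>f\<close> is
  well defined and yields an automorphism. A fixed element is the value of a polynomial of smaller
  degree than \<open>f\<close>, which then takes the same value at all roots of \<open>f\<close> and
  hence is constant.\<close>

lemma cyclotomic_galois_ext:
  assumes m: "0 < m"
  shows "galois_ext (cyclotomic_field m)"
proof -
  let ?L = "cyclotomic_field m"
  obtain f where f': "f \<in> rat_polys" "f \<noteq> 0" "poly f (zeta m) = 0"
    "\<forall>P\<in>rat_polys. poly P (zeta m) = 0 \<longrightarrow> (\<exists>Q\<in>rat_polys. P = f * Q)"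
    "\<forall>P\<in>rat_polys. \<exists>R\<in>rat_polys. degree R < degree f \<and> poly R (zeta m) = poly P (zeta m)"
    "\<forall>P\<in>rat_polys. poly P (zeta m) \<noteq> 0 \<longrightarrow> (\<exists>Q\<in>rat_polys. poly Q (zeta m) * poly P (zeta m) = 1)"
    "card {r. poly f r = 0} = degree f" "\<forall>r. poly f r = 0 \<longrightarrow> r ^ m = 1"
    by (rule zeta_min_poly[OF m])
  note f = f'(1-3) f'(4)[rule_format] f'(5)[rule_format] f'(6)[rule_format] f'(7) f'(8)[rule_format]
  note eq = cyclotomic_field_eq[OF m]
  have memI: "poly P (zeta m) \<in> ?L" if "P \<in> rat_polys" for P using that by (auto simp: eq)
  have memE: "\<exists>P\<in>rat_polys. x = poly P (zeta m)" if "x \<in> ?L" for x using that by (auto simp: eq)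
  have L: "1 \<in> ?L" "\<And>x y. x \<in> ?L \<Longrightarrow> y \<in> ?L \<Longrightarrow> x + y \<in> ?L" "\<And>x y. x \<in> ?L \<Longrightarrow> y \<in> ?L \<Longrightarrow> x * y \<in> ?L" "\<rat> \<subseteq> ?L"
    "\<And>x. x \<in> ?L \<Longrightarrow> - x \<in> ?L" "\<And>x. x \<in> ?L \<Longrightarrow> inverse x \<in> ?L"
  proof -
    show "1 \<in> ?L" using memI[of 1] rat_polys_closed by simp
    show "x + y \<in> ?L" if "x \<in> ?L" "y \<in> ?L" for x y
      using memE[OF that(1)] memE[OF that(2)] memI[OF rat_polys_closed(3)] by (metis poly_add)
    show "x * y \<in> ?L" if "x \<in> ?L" "y \<in> ?L" for x y
      using memE[OF that(1)] memE[OF that(2)] memI[OF rat_polys_closed(5)] by (metis poly_mult)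
    show "\<rat> \<subseteq> ?L" using memI[OF rat_polys_closed(7)] by auto
    show "- x \<in> ?L" if "x \<in> ?L" for x
      using memE[OF that] memI[OF rat_polys_closed(6)] by (metis poly_minus)
    show "inverse x \<in> ?L" if x: "x \<in> ?L" for x
    proof (cases "x = 0")
      case False
      obtain P where "P \<in> rat_polys" "x = poly P (zeta m)" using memE[OF x] by blast
      then obtain Q where Q: "Q \<in> rat_polys" "poly Q (zeta m) * x = 1" using f(6) False by blast
      then have "inverse x = poly Q (zeta m)" using False by (simp add: field_simps inverse_eq_divide)
      then show ?thesis using memI Q by simp
    qed (use x in auto)
  qed
  have zL: "zeta m \<in> ?L"
    using memI[OF rat_polys_closed(8)[of 1 1]] by (simp add: poly_monom)
  have hom: "\<sigma> (poly P (zeta m)) = poly P (\<sigma> (zeta m))" if "\<sigma> \<in> gal ?L" "P \<in> rat_polys" for \<sigma> P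
    by (rule hom_poly_Rats(1)[OF L(1-4)]) (use that zL in \<open>auto simp: gal_iff rat_polys_def\<close>)
  have fin: "finite (gal ?L)"
  proof (rule finite_imageD)
    have "\<sigma> (zeta m) ^ m = 1" if "\<sigma> \<in> gal ?L" for \<sigma>
    proof -
      have "\<sigma> (poly f (zeta m)) = poly f (\<sigma> (zeta m))" by (rule hom[OF that f(1)])
      moreover have "\<sigma> 0 = 0" using that by (auto simp: gal_iff)
      ultimately show ?thesis using f(3,8) by simp
    qed
    then have "(\<lambda>\<sigma>. \<sigma> (zeta m)) ` gal ?L \<subseteq> {z. z ^ m = 1}" by auto
    then show "finite ((\<lambda>\<sigma>. \<sigma> (zeta m)) ` gal ?L)" using finite_roots_unity[of m] m finite_subset by (metis One_nat_def Suc_leI)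
    show "inj_on (\<lambda>\<sigma>. \<sigma> (zeta m)) (gal ?L)"
    proof (rule inj_onI)
      fix \<sigma> \<tau> assume st: "\<sigma> \<in> gal ?L" "\<tau> \<in> gal ?L" "\<sigma> (zeta m) = \<tau> (zeta m)"
      have "\<sigma> x = \<tau> x" if "x \<in> ?L" for x using memE[OF that] hom st by metis
      then show "\<sigma> = \<tau>" using st by (meson extensionalityI gal_iff)
    qed
  qed
  have aut: "\<exists>\<sigma>\<in>gal ?L. \<forall>P\<in>rat_polys. \<sigma> (poly P (zeta m)) = poly P r" if r: "poly f r = 0" for r
  proof -
    have wd: "poly P r = poly Q r" if "P \<in> rat_polys" "Q \<in> rat_polys" "poly P (zeta m) = poly Q (zeta m)" for P Q
    proof -
      have "\<exists>h\<in>rat_polys. P - Q = f * h" using that by (intro f(4) rat_polys_closed) auto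
      then obtain h where "P - Q = f * h" by blast
      then have "poly (P - Q) r = 0" using r by simp
      then show ?thesis by simp
    qed
    define \<sigma> where "\<sigma> = restrict (\<lambda>x. poly (SOME P. P \<in> rat_polys \<and> x = poly P (zeta m)) r) ?L"
    have s: "\<sigma> (poly P (zeta m)) = poly P r" if P: "P \<in> rat_polys" for P
    proof -
      define Q where "Q = (SOME Q. Q \<in> rat_polys \<and> poly P (zeta m) = poly Q (zeta m))"
      have "Q \<in> rat_polys \<and> poly P (zeta m) = poly Q (zeta m)"
        unfolding Q_def
        by (rule someI[of "\<lambda>Q. Q \<in> rat_polys \<and> poly P (zeta m) = poly Q (zeta m)" P]) (use P in simp)
      then have "poly Q r = poly P r" using wd[of Q P] P by simp
      then show ?thesis using memI[OF P] by (simp add: \<sigma>_def Q_def)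
    qed
    have s0: "\<sigma> x = 0 \<longleftrightarrow> x = 0" if x: "x \<in> ?L" for x
    proof
      assume "\<sigma> x = 0"
      obtain P where P: "P \<in> rat_polys" "x = poly P (zeta m)" using memE[OF x] by blast
      show "x = 0"
      proof (rule ccontr)
        assume "x \<noteq> 0"
        then obtain Q where Q: "Q \<in> rat_polys" "poly Q (zeta m) * poly P (zeta m) = 1" using f(6) P by blast
        then have "\<sigma> (poly (Q * P) (zeta m)) = poly Q r * poly P r" using P s rat_polys_closed(5) by (metis poly_mult)
        moreover have "\<sigma> 1 = 1" using s[of 1] rat_polys_closed by simp
        ultimately have "poly Q r * poly P r = 1" using Q by simp
        then show False using \<open>\<sigma> x = 0\<close> s P by simp
      qed
    qed (use s[of 0] rat_polys_closed in simp)
    have sadd: "\<sigma> (x + y) = \<sigma> x + \<sigma> y \<and> \<sigma> (x * y) = \<sigma> x * \<sigma> y" if xy: "x \<in> ?L" "y \<in> ?L" for x y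
    proof -
      obtain P Q where PQ: "P \<in> rat_polys" "x = poly P (zeta m)" "Q \<in> rat_polys" "y = poly Q (zeta m)"
        using memE xy by meson
      then show ?thesis using s[OF rat_polys_closed(3)[OF PQ(1,3)]] s[OF rat_polys_closed(5)[OF PQ(1,3)]] s by simp
    qed
    have sQ: "\<sigma> q = q" if "q \<in> \<rat>" for q using s[OF rat_polys_closed(7)[OF that]] by simp
    obtain a where a: "r = zeta m ^ a" using root_of_unity_ex[OF m f(8)[OF r]] by blast
    have rL: "r \<in> ?L" using memI[OF rat_polys_closed(8)[of 1 a]] a by (simp add: poly_monom)
    have sL: "\<sigma> x \<in> ?L" if x: "x \<in> ?L" for x
    proof -
      obtain P where P: "P \<in> rat_polys" "x = poly P (zeta m)" using memE[OF x] by blast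
      then have "\<sigma> x = poly P r" using s by simp
      also have "\<dots> \<in> ?L" by (rule hom_poly_Rats(2)[OF L(1-4), of "\<lambda>x. x"]) (use P rL in \<open>auto simp: rat_polys_def\<close>)
      finally show ?thesis .
    qed
    have smin: "\<sigma> (- x) = - \<sigma> x" if "x \<in> ?L" for x
      using sadd[OF that L(5)[OF that]] sQ[of 0] by (simp add: add_eq_0_iff)
    have inj: "inj_on \<sigma> ?L"
    proof (rule inj_onI)
      fix x y assume xy: "x \<in> ?L" "y \<in> ?L" "\<sigma> x = \<sigma> y"
      have "\<sigma> (x + - y) = 0" using sadd[OF xy(1) L(5)[OF xy(2)]] smin[OF xy(2)] xy(3) by simp
      then have "x + - y = 0" using s0[of "x + - y"] L(2)[OF xy(1) L(5)[OF xy(2)]] by simp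
      then show "x = y" by simp
    qed
    \<comment> \<open>\<open>\<sigma>\<close> permutes the finitely many roots of \<open>f\<close>,
      one of which is \<open>zeta m\<close>; the image thus contains a generator.\<close>
    have surj: "\<sigma> ` ?L = ?L"
    proof
      define R where "R = {r. poly f r = 0}"
      have "finite R" unfolding R_def by (rule poly_roots_finite[OF f(2)])
      have RL: "R \<subseteq> ?L"
      proof
        fix t assume "t \<in> R"
        then obtain a where a: "t = zeta m ^ a" using root_of_unity_ex[OF m f(8)] by (auto simp: R_def)
        then show "t \<in> ?L" using memI[OF rat_polys_closed(8)[of 1 a]] by (simp add: poly_monom)
      qed
      have "\<sigma> ` R \<subseteq> R"
      proof
        fix t assume "t \<in> \<sigma> ` R"
        then obtain u where u: "u \<in> R" "t = \<sigma> u" by blast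
        have "\<sigma> (poly f u) = poly f (\<sigma> u)"
          by (rule hom_poly_Rats(1)[OF L(1-4)]) (use sadd sQ u RL f(1) in \<open>auto simp: rat_polys_def\<close>)
        then show "t \<in> R" using u sQ[of 0] by (simp add: R_def)
      qed
      moreover have "inj_on \<sigma> R" using inj RL by (rule inj_on_subset)
      ultimately have "\<sigma> ` R = R" using \<open>finite R\<close> by (intro endo_inj_surj)
      moreover have "zeta m \<in> R" using f(3) by (simp add: R_def)
      ultimately have "zeta m \<in> \<sigma> ` R" by simp
      then obtain t where t: "t \<in> ?L" "\<sigma> t = zeta m" using RL by (metis imageE subsetD)
      show "?L \<subseteq> \<sigma> ` ?L"
      proof
        fix x assume "x \<in> ?L"
        then obtain P where P: "P \<in> rat_polys" "x = poly P (zeta m)" using memE by blast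
        have Pc: "coeff P i \<in> \<rat>" for i using P by (simp add: rat_polys_def)
        have "poly P t \<in> ?L"
          by (rule hom_poly_Rats(2)[OF L(1-4), of "\<lambda>x. x"]) (use t Pc in auto)
        moreover have "\<sigma> (poly P t) = poly P (\<sigma> t)"
          by (rule hom_poly_Rats(1)[OF L(1-4)]) (use sadd sQ t Pc in auto)
        ultimately show "x \<in> \<sigma> ` ?L" using P t by (metis imageI)
      qed
    qed (use sL in auto)
    have "\<sigma> \<in> gal ?L" unfolding gal_iff
      using inj surj sadd sQ by (auto simp: bij_betw_def \<sigma>_def)
    then show ?thesis using s by blast
  qed
  have fixed: "x \<in> \<rat>" if x: "x \<in> ?L" and fx: "\<And>g. g \<in> gal ?L \<Longrightarrow> g x = x" for x
  proof -
    obtain P where P: "P \<in> rat_polys" "x = poly P (zeta m)" using memE[OF x] by blast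
    obtain R where R: "R \<in> rat_polys" "degree R < degree f" "poly R (zeta m) = x" using f(5)[OF P(1)] P(2) by metis
    have "R = [:x:]"
    proof (rule poly_eqI_degree[of "{r. poly f r = 0}"])
      fix r assume "r \<in> {r. poly f r = 0}"
      then obtain \<sigma> where "\<sigma> \<in> gal ?L" "\<forall>P\<in>rat_polys. \<sigma> (poly P (zeta m)) = poly P r" using aut by blast
      then show "poly R r = poly [:x:] r" using R fx by (metis mult_zero_right poly_0 poly_pCons add.right_neutral)
    qed (use f(7) R in auto)
    then have "x = coeff R 0" by simp
    then show ?thesis using R(1) by (simp add: rat_polys_def)
  qed
  show ?thesis
    by unfold_locales (use L fin fixed in auto)
qed

section \<open>Frobenius modulo p and inertia\<close>

context galois_prime
begin

lemma PO_power_cong: "x \<in> O_K \<Longrightarrow> y \<in> O_K \<Longrightarrow> x - y \<in> PO \<Longrightarrow> x ^ n - y ^ n \<in> PO"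
proof -
  assume xy: "x \<in> O_K" "y \<in> O_K" "x - y \<in> PO"
  have "x ^ n - y ^ n = (\<Sum>i<n. y ^ (n - Suc i) * x ^ i) * (x - y)"
    using power_diff_sumr2[of x n y] by (simp add: mult.commute)
  also have "\<dots> \<in> PO" by (intro omod_mult[OF omod_PO] O_sum O_mult O_power xy)
  finally show ?thesis .
qed

lemma frob_add: assumes "x \<in> O_K" "y \<in> O_K" shows "(x + y) ^ p - (x ^ p + y ^ p) \<in> PO"
proof -
  have set: "{..p} = insert 0 (insert p {1..<p})" using p_gt1 by auto
  have "(x + y) ^ p - (x ^ p + y ^ p) = (\<Sum>k\<in>{1..<p}. of_nat (p choose k) * x ^ k * y ^ (p - k))"
    unfolding binomial_ring set using p_gt1 by (simp add: algebra_simps)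
  also have "\<dots> \<in> PO"
  proof (rule omod_sum[OF omod_PO])
    fix k assume k: "k \<in> {1..<p}"
    then have "p dvd p choose k" using p by (intro dvd_choose_prime) auto
    then have "int p dvd int (p choose k)" by simp
    then have "of_int (int (p choose k)) \<in> PO" unfolding PO_Ints .
    then have "of_nat (p choose k) \<in> PO" by simp
    then show "of_nat (p choose k) * x ^ k * y ^ (p - k) \<in> PO"
      by (intro omod_mult'[OF omod_PO] O_power assms)
  qed
  finally show ?thesis .
qed

lemma frob_nat: "of_nat n ^ p - of_nat n \<in> PO"
proof (induction n)
  case 0
  then show ?case using p_gt1 omod_0[OF omod_PO] by (simp add: power_0_left)
next
  case (Suc n)
  have "((of_nat n + 1) ^ p - (of_nat n ^ p + 1 ^ p)) + (of_nat n ^ p - of_nat n) \<in> PO"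
    by (rule omod_add[OF omod_PO frob_add Suc]) simp_all
  then show ?case by (simp add: algebra_simps)
qed

lemma frob_int: "of_int c ^ p - of_int c \<in> PO"
proof -
  define r where "r = nat (c mod int p)"
  have "int p dvd c - int r" using p_gt1 by (simp add: r_def)
  then have d: "of_int c - of_nat r \<in> PO" using PO_Ints[of "c - int r"] by simp
  have "of_int c ^ p - of_nat r ^ p \<in> PO" by (rule PO_power_cong[OF _ _ d]) simp_all
  from omod_diff[OF omod_PO omod_add[OF omod_PO this frob_nat[of r]] d]
  show ?thesis by simp
qed

text \<open>Modulo \<open>p\<close> the Frobenius map leaves the integer coefficients alone and only
  raises the elements to the power \<open>p\<close>. This congruence is behind both
  \<open>frobenius_prime\<close> and \<open>unramified\<close>.\<close>

lemma frob_sum: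
  assumes "finite A" "\<And>a. a \<in> A \<Longrightarrow> x a \<in> O_K"
  shows "(\<Sum>a\<in>A. of_int (c a) * x a) ^ p - (\<Sum>a\<in>A. of_int (c a) * x a ^ p) \<in> PO"
  using assms
proof (induction A rule: finite_induct)
  case empty
  then show ?case using p_gt1 omod_0[OF omod_PO] by (simp add: power_0_left)
next
  case (insert b A)
  let ?S = "\<Sum>a\<in>A. of_int (c a) * x a" and ?T = "\<Sum>a\<in>A. of_int (c a) * x a ^ p"
  have SO: "?S \<in> O_K" by (intro O_sum O_mult) (use insert in auto)
  have xb: "x b \<in> O_K" using insert by simp
  have "((of_int (c b) * x b + ?S) ^ p - ((of_int (c b) * x b) ^ p + ?S ^ p)) + (?S ^ p - ?T) +
     (of_int (c b) ^ p - of_int (c b)) * x b ^ p \<in> PO"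
    by (intro omod_add[OF omod_PO] frob_add omod_mult'[OF omod_PO _ frob_int] O_power) (use insert SO xb in \<open>auto intro: O_mult\<close>)
  then show ?case using insert.hyps by (simp add: algebra_simps power_mult_distrib)
qed

text \<open>If \<open>rad = PO\<close>, the residue ring is reduced, so the Frobenius map is
  injective on the finite set of residues and therefore onto.\<close>

lemma frob_surj: 
  assumes red: "rad = PO" and x: "x \<in> O_K"
  shows "\<exists>y\<in>O_K. x - y ^ p \<in> PO"
proof -
  have inj: "inj_on (\<lambda>y. red (y ^ p)) Res"
  proof (rule inj_onI)
    fix a b assume ab: "a \<in> Res" "b \<in> Res" "red (a ^ p) = red (b ^ p)"
    have O: "a \<in> O_K" "b \<in> O_K" using ab Res_O by auto
    have 1: "a ^ p - b ^ p \<in> PO"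
      using ab(3) red_eq_iff[OF O_power[OF O(1)] O_power[OF O(2)]] by simp
    have 2: "((a - b) + b) ^ p - ((a - b) ^ p + b ^ p) \<in> PO" by (intro frob_add O_diff O)
    have "(a ^ p - b ^ p) - (((a - b) + b) ^ p - ((a - b) ^ p + b ^ p)) \<in> PO" by (rule omod_diff[OF omod_PO 1 2])
    then have "(a - b) ^ p \<in> PO" by simp
    then have "a - b \<in> rad" using O O_diff by (auto simp: rad_def)
    then show "a = b" using red ab Res_unique by simp
  qed
  have "(\<lambda>y. red (y ^ p)) ` Res \<subseteq> Res" using red_Res Res_O O_power by auto
  then have "(\<lambda>y. red (y ^ p)) ` Res = Res" using inj endo_inj_surj[OF finite_Res] by blast
  then have "red x \<in> (\<lambda>y. red (y ^ p)) ` Res" using red_Res[OF x] by simp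
  then obtain y where y: "y \<in> Res" "red x = red (y ^ p)" by blast
  then have "x - y ^ p \<in> PO" using red_eq_iff[OF x O_power[OF Res_O[OF y(1)]]] by simp
  then show ?thesis using y Res_O by blast
qed

text \<open>If \<open>p\<close> were unramified, \<open>x = y ^ p + p z\<close> would push the congruence
  \<open>\<tau> x = x\<close> from modulus \<open>p ^ t\<close> to \<open>p ^ (t + 1)\<close> for ever.\<close>

lemma inertia_ramified:
  assumes \<tau>: "\<tau> \<in> gal K" and nid: "x0 \<in> K" "\<tau> x0 \<noteq> x0" and tr: "\<And>x. x \<in> O_K \<Longrightarrow> \<tau> x - x \<in> rad"
  shows "rad \<noteq> PO"
proof
  assume red: "rad = PO"
  have div: "(\<tau> x - x) / of_nat p ^ t \<in> O_K" if x: "x \<in> O_K" and t: "1 \<le> t" for x t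
    using t x
  proof (induction t arbitrary: x rule: dec_induct)
    case base
    then show ?case using tr red by (auto simp: PO_iff)
  next
    case (step t)
    obtain y where y: "y \<in> O_K" "x - y ^ p \<in> PO" using frob_surj[OF red step.prems] by blast
    then obtain z where z: "z \<in> O_K" "x - y ^ p = of_nat p * z" by (auto simp: PO_def)
    have xeq: "x = y ^ p + of_nat p * z" using z by (simp add: algebra_simps)
    have yK: "y \<in> K" "z \<in> K" using y z O_K_sub by auto
    have \<tau>x: "\<tau> x = \<tau> y ^ p + of_nat p * \<tau> z"
      unfolding xeq using yK by (simp add: g_add[OF \<tau>] g_mult[OF \<tau>] g_power[OF \<tau>] g_of_nat[OF \<tau>] K_mult K_power)
    have \<tau>y: "\<tau> y \<in> O_K" by (rule g_O[OF \<tau> y(1)])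
    have d1: "(\<tau> y - y) / of_nat p ^ t \<in> O_K" by (rule step.IH[OF y(1)])
    \<comment> \<open>Modulo \<open>p\<close> the sum becomes \<open>p\<close> copies of
      \<open>y ^ (p - 1)\<close>; this is the extra factor \<open>p\<close> that raises the
      exponent.\<close>
    have d2: "(\<Sum>i<p. y ^ (p - Suc i) * \<tau> y ^ i) / of_nat p \<in> O_K"
    proof -
      have "\<tau> y - y \<in> PO" using tr[OF y(1)] red by simp
      then have c: "\<tau> y ^ i - y ^ i \<in> PO" for i by (rule PO_power_cong[OF \<tau>y y(1)])
      have "(\<Sum>i<p. y ^ (p - Suc i) * (\<tau> y ^ i - y ^ i)) + of_nat p * y ^ (p - 1) \<in> PO"
        by (intro omod_add[OF omod_PO] omod_sum[OF omod_PO] omod_mult[OF omod_PO] omod_mult'[OF omod_PO _ p_in_PO] c O_power y)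
      moreover have "(\<Sum>i<p. y ^ (p - Suc i) * y ^ i) = of_nat p * y ^ (p - 1)"
        by (simp flip: power_add)
      ultimately have "(\<Sum>i<p. y ^ (p - Suc i) * \<tau> y ^ i) \<in> PO"
        by (simp add: right_diff_distrib sum_subtractf)
      then show ?thesis by (simp add: PO_iff)
    qed
    have d3: "(\<tau> z - z) / of_nat p ^ t \<in> O_K" by (rule step.IH[OF z(1)])
    have "\<tau> x - x = (\<tau> y ^ p + of_nat p * \<tau> z) - (y ^ p + of_nat p * z)"
      by (rule arg_cong2[OF \<tau>x xeq])
    also have "\<dots> = (\<tau> y ^ p - y ^ p) + of_nat p * (\<tau> z - z)" by (simp add: algebra_simps)
    finally have "\<tau> x - x = (\<tau> y - y) * (\<Sum>i<p. y ^ (p - Suc i) * \<tau> y ^ i) + of_nat p * (\<tau> z - z)"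
      by (simp only: power_diff_sumr2)
    moreover have "(U * S + P * W) / P ^ Suc t = U / P ^ t * (S / P) + W / P ^ t" if "P \<noteq> 0" for U S P W :: complex
      using that by (simp add: field_simps)
    ultimately have "(\<tau> x - x) / of_nat p ^ Suc t =
       (\<tau> y - y) / of_nat p ^ t * ((\<Sum>i<p. y ^ (p - Suc i) * \<tau> y ^ i) / of_nat p) + (\<tau> z - z) / of_nat p ^ t"
      using p_nz by (simp only: not_False_eq_True)
    also have "\<dots> \<in> O_K" by (intro O_add O_mult d1 d2 d3)
    finally show ?case .
  qed
  obtain D :: int where D: "D \<noteq> 0" "of_int D * x0 \<in> O_K" using integral_multiple[OF nid(1)] by blast
  define u where "u = \<tau> (of_int D * x0) - of_int D * x0"
  have "u = of_int D * (\<tau> x0 - x0)"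
    using nid by (simp add: u_def g_mult[OF \<tau>] g_of_int[OF \<tau>] right_diff_distrib)
  then have u0: "u \<noteq> 0" using D nid by simp
  have uO: "u \<in> O_K" unfolding u_def by (intro O_diff g_O[OF \<tau>] D)
  obtain N :: int where N: "of_int N = (\<Prod>g\<in>gal K. g u)" using norm_Ints[OF uO] by (metis Ints_cases)
  have "of_int N \<noteq> (0 :: complex)" unfolding N using u0 g_eq_0[OF _ O_K_sub[OF uO]] by simp
  then have N0: "N \<noteq> 0" by simp
  \<comment> \<open>The norm of \<open>u = p ^ t * v\<close> is \<open>(p ^ t) ^ deg\<close> times
    the norm of the integral element \<open>v\<close>.\<close>
  have dv: "int p ^ t dvd N" if t: "1 \<le> t" for t
  proof -
    have vO: "u / of_nat p ^ t \<in> O_K" unfolding u_def by (rule div[OF D(2) t])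
    define v where "v = u / of_nat p ^ t"
    have uv: "u = of_int (int p ^ t) * v" using p_nz by (simp add: v_def)
    obtain N' :: int where N': "of_int N' = (\<Prod>g\<in>gal K. g v)" using norm_Ints[OF vO] unfolding v_def by (metis Ints_cases)
    have "(of_int N :: complex) = (\<Prod>g\<in>gal K. of_int (int p ^ t) * g v)"
      unfolding N
    proof (rule prod.cong)
      fix g assume g: "g \<in> gal K"
      show "g u = of_int (int p ^ t) * g v"
        unfolding uv
        by (subst g_mult[OF g K_of_int]) (simp_all only: g_of_int[OF g] v_def O_K_sub[OF vO])
    qed simp
    also have "\<dots> = of_int ((int p ^ t) ^ deg * N')" by (simp add: prod.distrib N' deg_def)
    finally have "N = (int p ^ t) ^ deg * N'" by (simp only: of_int_eq_iff)
    then show ?thesis using deg_pos by (metis dvd_mult2 dvd_power)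
  qed
  \<comment> \<open>With this exponent \<open>p ^ t\<close> exceeds \<open>\<bar>N\<bar>\<close>, so
    it cannot divide the nonzero \<open>N\<close>.\<close>
  define t where "t = Suc (nat \<bar>N\<bar>)"
  have "int p ^ t dvd N" by (rule dv) (simp add: t_def)
  then have "\<bar>int p ^ t\<bar> \<le> \<bar>N\<bar>" using N0 by (rule dvd_imp_le_int[rotated])
  moreover have "int t < int p ^ t"
  proof -
    have "t < 2 ^ t" by (rule less_exp)
    also have "2 ^ t \<le> p ^ t" using p_gt1 by (intro power_mono) auto
    finally show ?thesis by (metis of_nat_less_iff of_nat_power)
  qed
  ultimately show False by (simp add: t_def)
qed

end

section \<open>Automorphisms and integers of cyclotomic fields\<close>

locale cyclotomic =
  fixes m :: nat
  assumes m_pos: "0 < m"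

sublocale cyclotomic \<subseteq> galois_ext "cyclotomic_field m"
  by (rule cyclotomic_galois_ext[OF m_pos])

context cyclotomic
begin

abbreviation z :: complex where "z \<equiv> zeta m"

lemma z_L: "z \<in> cyclotomic_field m"
  unfolding cyclotomic_field_eq[OF m_pos] by (rule image_eqI[of _ _ "monom 1 1"]) (auto simp: poly_monom rat_polys_closed)

lemma z_O: "z \<in> O_K" using z_L algebraic_int_zeta[OF m_pos] by (simp add: O_K_def)

lemma L_repr: assumes "x \<in> cyclotomic_field m" obtains P where "P \<in> rat_polys" "x = poly P z"
  using assms unfolding cyclotomic_field_eq[OF m_pos] by blast

lemma gal_zeta_power: "g \<in> gal (cyclotomic_field m) \<Longrightarrow> \<exists>a<m. g z = z ^ a"
proof -
  assume g: "g \<in> gal (cyclotomic_field m)"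
  have "g z ^ m = g (z ^ m)" using g_power[OF g z_L] by simp
  then have "g z ^ m = 1" using zeta_power_self[OF m_pos] g_1[OF g] by simp
  then show ?thesis by (rule root_of_unity_ex[OF m_pos])
qed

lemma gal_eq_zeta:
  assumes "g \<in> gal (cyclotomic_field m)" "h \<in> gal (cyclotomic_field m)" "g z = h z"
  shows "g = h"
proof (rule gal_eqI[OF assms(1,2)])
  fix x assume "x \<in> cyclotomic_field m"
  then obtain P where P: "P \<in> rat_polys" "x = poly P z" by (rule L_repr)
  then show "g x = h x" using g_poly_Rats[OF assms(1) _ z_L] g_poly_Rats[OF assms(2) _ z_L] assms(3)
    by (simp add: rat_polys_def)
qed

text \<open>Up to a root of unity the difference is one factor \<open>1 - z ^ c\<close> of the
  product that equals \<open>m\<close>.\<close>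

lemma zeta_diff_dvd:
  assumes "z ^ a \<noteq> z ^ b" shows "of_nat m / (z ^ a - z ^ b) \<in> O_K"
proof -
  \<comment> \<open>The exponent \<open>b - a\<close> modulo \<open>m\<close>, with
    \<open>(m - 1) * a\<close> in place of the negative.\<close>
  define c where "c = (b + (m - 1) * a) mod m"
  have zc: "z ^ a * z ^ c = z ^ b"
  proof -
    have "z ^ c = z ^ (b + (m - 1) * a)" unfolding c_def by (rule zeta_power_mod[OF m_pos])
    then have "z ^ a * z ^ c = z ^ (a + (b + (m - 1) * a))" by (simp only: power_add)
    also have "a + (b + (m - 1) * a) = b + m * a" using m_pos by (cases m) auto
    also have "z ^ (b + m * a) = z ^ b" by (simp add: power_add power_mult zeta_power_self[OF m_pos])
    finally show ?thesis .
  qed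
  have c: "c \<in> {1..<m}"
  proof -
    have "c \<noteq> 0" using zc assms by (intro notI) simp
    moreover have "c < m" using m_pos by (simp add: c_def)
    ultimately show ?thesis by simp
  qed
  have zz: "z ^ a * z ^ ((m - 1) * a) = 1"
  proof -
    have "z ^ a * z ^ ((m - 1) * a) = z ^ (a + (m - 1) * a)" by (simp only: power_add)
    also have "a + (m - 1) * a = m * a" using m_pos by (cases m) auto
    finally show ?thesis by (simp add: power_mult zeta_power_self[OF m_pos])
  qed
  have "of_nat m = (1 - z ^ c) * (\<Prod>k\<in>{1..<m} - {c}. 1 - z ^ k)"
    unfolding prod_one_minus_zeta[OF m_pos, symmetric] by (rule prod.remove) (use c in auto)
  also have "\<dots> = (z ^ a * z ^ ((m - 1) * a)) * (1 - z ^ c) * (\<Prod>k\<in>{1..<m} - {c}. 1 - z ^ k)"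
    by (simp only: zz mult_1_left)
  also have "\<dots> = (z ^ a - z ^ a * z ^ c) * (z ^ ((m - 1) * a) * (\<Prod>k\<in>{1..<m} - {c}. 1 - z ^ k))"
  proof -
    have "A * B * (1 - C) * D = (A - A * C) * (B * D)" for A B C D :: complex by (simp add: algebra_simps)
    then show ?thesis .
  qed
  finally have "of_nat m = (z ^ a - z ^ b) * (z ^ ((m - 1) * a) * (\<Prod>k\<in>{1..<m} - {c}. 1 - z ^ k))"
    unfolding zc .
  then have "of_nat m / (z ^ a - z ^ b) = z ^ ((m - 1) * a) * (\<Prod>k\<in>{1..<m} - {c}. 1 - z ^ k)"
    using assms by (metis nonzero_mult_div_cancel_left right_minus_eq)
  also have "\<dots> \<in> O_K" by (intro O_mult O_prod O_diff O_power z_O O_1)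
  finally show ?thesis .
qed

text \<open>Were \<open>z ^ r\<close> not conjugate to \<open>z\<close>, its value under the
  characteristic polynomial \<open>?F\<close> of \<open>z\<close> would be a product of nonzero
  differences of roots of unity and so divide a power of \<open>m\<close>. But this value is
  congruent modulo \<open>r\<close> to the \<open>r\<close>-th power of the value at
  \<open>z\<close>, which is 0, so \<open>r\<close> would divide \<open>m\<close>. This amounts to
  the irreducibility of the cyclotomic polynomial.\<close>

lemma frobenius_prime:
  assumes r: "Factorial_Ring.prime r" "\<not> r dvd m"
  shows "\<exists>g\<in>gal (cyclotomic_field m). g z = z ^ r"
proof (rule ccontr)
  assume neg: "\<not> ?thesis"
  interpret galois_prime "cyclotomic_field m" r by unfold_locales (rule r(1))
  let ?F = "char_pol z"
  have "\<forall>i. \<exists>k :: int. coeff ?F i = of_int k"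
    using coeff_char_pol_Ints[OF z_O] by (meson Ints_cases)
  then obtain c :: "nat \<Rightarrow> int" where c: "\<And>i. coeff ?F i = of_int (c i)" by metis
  have pF: "poly ?F y = (\<Sum>i\<le>deg. of_int (c i) * y ^ i)" for y
    using degree_char_pol(1)[of z] by (simp add: poly_altdef c deg_def)
  have "(\<Sum>i\<le>deg. of_int (c i) * z ^ i) ^ r - (\<Sum>i\<le>deg. of_int (c i) * (z ^ i) ^ r) \<in> PO"
    by (rule frob_sum) (auto intro: O_power z_O)
  then have "poly ?F z ^ r - poly ?F (z ^ r) \<in> PO" unfolding pF by (simp add: power_mult[symmetric] mult.commute)
  then have "- poly ?F (z ^ r) \<in> PO" using char_pol_self[OF z_L] p_pos by (simp add: power_0_left)
  then have FP: "poly ?F (z ^ r) \<in> PO" using omod_minus[OF omod_PO] by (metis minus_minus)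
  have "of_nat m ^ deg = poly ?F (z ^ r) * (\<Prod>g\<in>gal (cyclotomic_field m). of_nat m / (z ^ r - g z))"
  proof -
    have "poly ?F (z ^ r) = (\<Prod>g\<in>gal (cyclotomic_field m). z ^ r - g z)" by (simp add: char_pol_def poly_prod)
    then have "poly ?F (z ^ r) * (\<Prod>g\<in>gal (cyclotomic_field m). of_nat m / (z ^ r - g z)) =
       (\<Prod>g\<in>gal (cyclotomic_field m). (z ^ r - g z) * (of_nat m / (z ^ r - g z)))" by (simp only: prod.distrib)
    also have "\<dots> = (\<Prod>g\<in>gal (cyclotomic_field m). of_nat m)"
      by (rule prod.cong) (use neg in auto)
    finally show ?thesis by (simp add: deg_def)
  qed
  moreover have "(\<Prod>g\<in>gal (cyclotomic_field m). of_nat m / (z ^ r - g z)) \<in> O_K"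
  proof (rule O_prod)
    fix g assume g: "g \<in> gal (cyclotomic_field m)"
    then obtain a where "g z = z ^ a" using gal_zeta_power by blast
    then show "of_nat m / (z ^ r - g z) \<in> O_K" using zeta_diff_dvd[of r a] neg g by metis
  qed
  ultimately have "of_nat m ^ deg \<in> PO" using omod_mult'[OF omod_PO _ FP] by simp
  then have "of_int (int (m ^ deg)) \<in> PO" by simp
  then have "int r dvd int (m ^ deg)" unfolding PO_Ints .
  then have "r dvd m ^ deg" by (simp only: int_dvd_int_iff)
  then show False using r prime_dvd_power by blast
qed

text \<open>Compose the automorphisms belonging to the prime factors of \<open>a\<close>.\<close>

lemma gal_zeta_coprime:
  assumes "Rings.coprime a m" "0 < a"
  shows "\<exists>g\<in>gal (cyclotomic_field m). g z = z ^ a"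
  using assms
proof (induction a rule: less_induct)
  case (less a)
  show ?case
  proof (cases "a = 1")
    case True
    then show ?thesis using gal_id z_L by (intro bexI[of _ "restrict (\<lambda>x. x) (cyclotomic_field m)"]) auto
  next
    case False
    then obtain r where r: "Factorial_Ring.prime r" "r dvd a" using prime_factor_nat by blast
    then obtain b where b: "a = r * b" by (elim dvdE)
    have b0: "0 < b" "b < a" using b less.prems prime_gt_1_nat[OF r(1)] by auto
    have "Rings.coprime b m" "Rings.coprime r m" using less.prems b by auto
    then have "\<not> r dvd m" using r(1) by (metis coprime_absorb_left not_prime_unit)
    then obtain g where g: "g \<in> gal (cyclotomic_field m)" "g z = z ^ r" using frobenius_prime[OF r(1)] by blast
    obtain h where h: "h \<in> gal (cyclotomic_field m)" "h z = z ^ b"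
      using less.IH[OF b0(2) \<open>Rings.coprime b m\<close> b0(1)] by blast
    have "compose (cyclotomic_field m) g h z = z ^ a"
      using z_L h g g_power[OF g(1) z_L] by (simp add: b power_mult)
    then show ?thesis using gal_compose[OF g(1) h(1)] by blast
  qed
qed

text \<open>The coefficient of \<open>z ^ i\<close> is the trace of \<open>y * z ^ (- i)\<close>,
  with \<open>(m - 1) * i\<close> standing for \<open>- i\<close>. For \<open>g\<close> other than
  the identity the powers of \<open>z / g z\<close> sum to zero over a full period, so only
  \<open>m * y\<close> survives.\<close>

lemma trace_expansion:
  assumes y: "y \<in> O_K"
  shows "\<exists>t :: nat \<Rightarrow> int. of_nat m * y = (\<Sum>i<m. of_int (t i) * z ^ i)"
proof -
  let ?G = "gal (cyclotomic_field m)" and ?id = "restrict (\<lambda>x. x) (cyclotomic_field m)"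
  define s where "s i = y * z ^ ((m - 1) * i)" for i
  have sO: "s i \<in> O_K" for i unfolding s_def by (intro O_mult O_power y z_O)
  have gs: "g (s i) = g y * (g z ^ (m - 1)) ^ i" if g: "g \<in> ?G" for g i
    using g_mult[OF g O_K_sub[OF y] K_power[OF z_L]] g_power[OF g z_L] by (simp add: s_def flip: power_mult)
  have geo: "(\<Sum>i<m. (g z ^ (m - 1) * z) ^ i) = (if g = ?id then of_nat m else 0)" if g: "g \<in> ?G" for g
  proof -
    let ?c = "g z ^ (m - 1) * z"
    have gm: "g z ^ m = 1" using g_power[OF g z_L, of m] zeta_power_self[OF m_pos] g_1[OF g] by simp
    have gc: "g z * ?c = z" using gm m_pos by (metis mult.assoc mult_1 power_minus_mult mult.commute)
    have cm: "?c ^ m = 1"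
    proof -
      have "(g z ^ (m - 1)) ^ m = (g z ^ m) ^ (m - 1)" by (simp only: power_mult[symmetric] mult.commute)
      then show ?thesis using gm zeta_power_self[OF m_pos] by (simp only: power_mult_distrib) simp
    qed
    have "?c = 1 \<longleftrightarrow> g = ?id"
    proof
      assume "?c = 1"
      then have "g z = ?id z" using gc z_L by simp
      then show "g = ?id" by (rule gal_eq_zeta[OF g gal_id])
    next
      assume "g = ?id"
      then have "g z = z" using z_L by simp
      then show "?c = 1" using gc by simp
    qed
    then show ?thesis using geometric_sum[of ?c m] cm by auto
  qed
  have "(\<Sum>i<m. of_int (tr (s i)) * z ^ i) = (\<Sum>i<m. \<Sum>g\<in>?G. g y * ((g z ^ (m - 1) * z) ^ i))"
  proof (rule sum.cong)
    fix i assume "i \<in> {..<m}"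
    have "of_int (tr (s i)) * z ^ i = (\<Sum>g\<in>?G. g (s i) * z ^ i)"
      by (simp add: of_int_tr[OF sO] sum_distrib_right)
    also have "\<dots> = (\<Sum>g\<in>?G. g y * ((g z ^ (m - 1) * z) ^ i))"
      by (rule sum.cong) (simp_all add: gs power_mult_distrib)
    finally show "of_int (tr (s i)) * z ^ i = (\<Sum>g\<in>?G. g y * ((g z ^ (m - 1) * z) ^ i))" .
  qed simp
  also have "\<dots> = (\<Sum>g\<in>?G. g y * (\<Sum>i<m. (g z ^ (m - 1) * z) ^ i))"
    by (subst sum.swap) (simp add: sum_distrib_left)
  also have "\<dots> = (\<Sum>g\<in>?G. if g = ?id then g y * of_nat m else 0)"
  proof (rule sum.cong)
    fix g assume g: "g \<in> ?G"
    show "g y * (\<Sum>i<m. (g z ^ (m - 1) * z) ^ i) = (if g = ?id then g y * of_nat m else 0)"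
      unfolding geo[OF g] by (cases "g = ?id") (simp_all only: simp_thms if_True if_False mult_zero_right)
  qed simp
  also have "\<dots> = ?id y * of_nat m" using gal_id by (simp add: sum.delta del: restrict_apply)
  also have "\<dots> = of_nat m * y" using O_K_sub[OF y] by simp
  finally show ?thesis by metis
qed

text \<open>It suffices that \<open>y ^ r\<close> in \<open>PO\<close> forces \<open>y\<close> into
  \<open>PO\<close>. Let \<open>\<phi>\<close> raise \<open>z\<close> to the power \<open>r\<close>.
  Expanding \<open>m * y\<close> in powers of \<open>z\<close> shows that
  \<open>\<phi> (m * y)\<close> is congruent to \<open>(m * y) ^ r\<close>, hence lies in
  \<open>PO\<close>; now \<open>m\<close> is invertible modulo \<open>r\<close>, and the inverse of
  \<open>\<phi>\<close> preserves \<open>PO\<close>.\<close>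

lemma unramified:
  assumes r: "Factorial_Ring.prime r" "\<not> r dvd m"
  shows "galois_prime.rad (cyclotomic_field m) r = galois_prime.PO (cyclotomic_field m) r"
proof -
  interpret galois_prime "cyclotomic_field m" r by unfold_locales (rule r(1))
  obtain \<phi> where \<phi>: "\<phi> \<in> gal (cyclotomic_field m)" "\<phi> z = z ^ r" using frobenius_prime[OF r] by blast
  obtain \<psi> where \<psi>: "\<psi> \<in> gal (cyclotomic_field m)" "\<And>x. x \<in> cyclotomic_field m \<Longrightarrow> \<psi> (\<phi> x) = x"
    using gal_inverse_ex[OF \<phi>(1)] by blast
  have one: "y \<in> PO" if y: "y \<in> O_K" and yr: "y ^ r \<in> PO" for y
  proof -
    obtain t :: "nat \<Rightarrow> int" where t: "of_nat m * y = (\<Sum>i<m. of_int (t i) * z ^ i)" using trace_expansion[OF y] by blast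
    have zi: "of_int (t i) * z ^ i \<in> cyclotomic_field m" for i by (intro K_mult K_power z_L) simp
    have "\<phi> (of_nat m * y) = (\<Sum>i<m. of_int (t i) * (z ^ i) ^ r)"
      unfolding t using z_L by (simp add: g_sum[OF \<phi>(1) zi] g_mult[OF \<phi>(1)] K_power g_power[OF \<phi>(1)] \<phi>(2)
        g_of_int[OF \<phi>(1)] power_mult[symmetric] mult.commute)
    moreover have "(\<Sum>i<m. of_int (t i) * z ^ i) ^ r - (\<Sum>i<m. of_int (t i) * (z ^ i) ^ r) \<in> PO"
      by (rule frob_sum) (auto intro: O_power z_O)
    ultimately have 1: "(of_nat m * y) ^ r - \<phi> (of_nat m * y) \<in> PO" by (simp only: t)
    have "of_nat m ^ r * y ^ r \<in> PO" by (intro omod_mult[OF omod_PO _ yr] O_power) simp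
    then have "of_nat m ^ r * y ^ r - ((of_nat m * y) ^ r - \<phi> (of_nat m * y)) \<in> PO" using 1 by (rule omod_diff[OF omod_PO])
    then have "\<phi> (of_nat m * y) \<in> PO" by (simp add: power_mult_distrib)
    then have 2: "of_nat m * \<phi> y \<in> PO" using g_mult[OF \<phi>(1) K_of_nat O_K_sub[OF y]] g_of_nat[OF \<phi>(1)] by simp
    have "Rings.coprime (int r) (int m)" using r by (simp add: prime_imp_coprime)
    then obtain a b where ab: "a * int r + b * int m = 1" using bezout_int by (metis coprime_imp_gcd_eq_1)
    have \<phi>y: "\<phi> y \<in> O_K" by (rule g_O[OF \<phi>(1) y])
    have "(of_int a * of_nat r + of_int b * of_nat m :: complex) = of_int (a * int r + b * int m)" by simp
    also have "\<dots> = 1" using ab by simp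
    finally have ab': "(of_int a * of_nat r + of_int b * of_nat m :: complex) = 1" .
    have "of_int a * \<phi> y * of_nat r + of_int b * (of_nat m * \<phi> y) \<in> PO"
      by (intro omod_add[OF omod_PO] omod_mult[OF omod_PO _ p_in_PO] omod_mult[OF omod_PO _ 2] O_mult \<phi>y) simp_all
    moreover have "of_int a * \<phi> y * of_nat r + of_int b * (of_nat m * \<phi> y) =
       (of_int a * of_nat r + of_int b * of_nat m) * \<phi> y" by (simp add: algebra_simps)
    ultimately have "\<phi> y \<in> PO" using ab' by simp
    then have "\<psi> (\<phi> y) \<in> PO" using gstable_PO \<psi>(1) by (simp add: gstable_def)
    then show ?thesis using \<psi>(2)[OF O_K_sub[OF y]] by simp
  qed
  have pw: "y \<in> PO" if "y \<in> O_K" "y ^ (r ^ t) \<in> PO" for y t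
    using that
  proof (induction t arbitrary: y)
    case (Suc t)
    have "(y ^ r ^ t) ^ r \<in> PO" using Suc.prems by (simp add: power_mult[symmetric] mult.commute)
    then show ?case using one[of "y ^ r ^ t"] Suc O_power by blast
  qed simp
  have "rad \<subseteq> PO"
  proof
    fix y assume "y \<in> rad"
    then obtain k where y: "y \<in> O_K" "y ^ k \<in> PO" by (auto simp: rad_def)
    have "k \<le> r ^ k" using power_gt_expt[of r k] p_gt1 by simp
    then show "y \<in> PO" using pw[OF y(1), of k] PO_power_ge[OF y] by blast
  qed
  then show ?thesis using PO_rad by blast
qed

end

section \<open>Total ramification at p\<close>

lemma cyclotomic_field_mono: "0 < a \<Longrightarrow> 0 < b \<Longrightarrow> cyclotomic_field b \<subseteq> cyclotomic_field (a * b)"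
proof
  fix x assume a: "0 < a" and b: "0 < b" and x: "x \<in> cyclotomic_field b"
  interpret B: cyclotomic b by unfold_locales (rule b)
  interpret L: cyclotomic "a * b" by unfold_locales (use a b in simp)
  obtain P where P: "P \<in> rat_polys" "x = poly P (zeta b)" by (rule B.L_repr[OF x])
  have "zeta b = zeta (a * b) ^ a" using zeta_power_dvd[OF a] by simp
  then have "zeta b \<in> cyclotomic_field (a * b)" using L.K_power[OF L.z_L] by simp
  then show "x \<in> cyclotomic_field (a * b)"
    unfolding P(2) using P(1) L.K_Rats by (intro L.K_poly) (auto simp: rat_polys_def)
qed

text \<open>The product over all exponents is \<open>p ^ k\<close>; those divisible by
  \<open>p\<close> contribute the corresponding product for \<open>p ^ (k - 1)\<close>, so the rest
  is \<open>p\<close>.\<close>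

lemma prod_one_minus_zeta_units:
  assumes p: "Factorial_Ring.prime p" and k: "1 \<le> k"
  shows "(\<Prod>a\<in>{a\<in>{1..<p ^ k}. \<not> p dvd a}. 1 - zeta (p ^ k) ^ a) = of_nat p"
proof -
  have p0: "0 < p" using p by (rule prime_gt_0_nat)
  define N where "N = p ^ (k - 1)"
  have N0: "0 < N" using p0 by (simp add: N_def)
  have pk: "p ^ k = p * N" using k by (simp add: N_def flip: power_Suc)
  define U where "U = {a\<in>{1..<p ^ k}. \<not> p dvd a}"
  have split: "{1..<p ^ k} = U \<union> (\<lambda>b. p * b) ` {1..<N}"
  proof (intro equalityI subsetI)
    fix a assume a: "a \<in> {1..<p ^ k}"
    show "a \<in> U \<union> (\<lambda>b. p * b) ` {1..<N}"
    proof (cases "p dvd a")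
      case True
      then obtain b where "a = p * b" by (elim dvdE)
      then show ?thesis using a p0 by (auto simp: pk)
    qed (use a in \<open>auto simp: U_def\<close>)
  next
    fix a assume "a \<in> U \<union> (\<lambda>b. p * b) ` {1..<N}"
    then show "a \<in> {1..<p ^ k}" using p0 by (auto simp: U_def pk)
  qed
  have "(\<Prod>a\<in>{1..<p ^ k}. 1 - zeta (p ^ k) ^ a) =
     (\<Prod>a\<in>U. 1 - zeta (p ^ k) ^ a) * (\<Prod>a\<in>(\<lambda>b. p * b) ` {1..<N}. 1 - zeta (p ^ k) ^ a)"
    unfolding split by (rule prod.union_disjoint) (auto simp: U_def)
  also have "(\<Prod>a\<in>(\<lambda>b. p * b) ` {1..<N}. 1 - zeta (p ^ k) ^ a) = (\<Prod>b\<in>{1..<N}. 1 - zeta N ^ b)"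
    using p0 by (subst prod.reindex) (auto simp: inj_on_def power_mult pk zeta_power_dvd)
  also have "\<dots> = of_nat N" by (rule prod_one_minus_zeta[OF N0])
  also have "(\<Prod>a\<in>{1..<p ^ k}. 1 - zeta (p ^ k) ^ a) = of_nat (p * N)"
    unfolding pk by (rule prod_one_minus_zeta) (use p0 N0 in simp)
  finally have "of_nat p * of_nat N = (\<Prod>a\<in>U. 1 - zeta (p ^ k) ^ a) * of_nat N" by simp
  moreover have "(of_nat N :: complex) \<noteq> 0" using N0 by simp
  ultimately have "of_nat p = (\<Prod>a\<in>U. 1 - zeta (p ^ k) ^ a)" by (metis mult_right_cancel)
  then show ?thesis by (simp add: U_def)
qed

text \<open>The prime \<open>p\<close> ramifies totally in the extension obtained by adjoining the roots of unity of
  order \<open>p ^ k\<close>; in this form: residues modulo \<open>1 - zeta (p ^ k)\<close> come from the subfield.\<close>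

lemma cyclotomic_inertia:
  assumes m': "0 < m'" and pp: "Factorial_Ring.prime p" "\<not> p dvd m'" and k: "1 \<le> k"
    and m: "m = m' * p ^ k"
    and \<sigma>: "\<sigma> \<in> gal (cyclotomic_field m)" "\<sigma> (zeta m') = zeta m'"
    and x: "x \<in> cyclotomic_field m" "algebraic_int x"
  shows "\<sigma> x - x \<in> galois_prime.rad (cyclotomic_field m) p"
proof -
  have p0: "0 < p" using pp(1) by (rule prime_gt_0_nat)
  have m0: "0 < m" using m m' p0 by simp
  let ?L = "cyclotomic_field m" and ?M = "cyclotomic_field m'"
  interpret L: cyclotomic m by unfold_locales (rule m0)
  interpret M: cyclotomic m' by unfold_locales (rule m')
  interpret Lp: galois_prime ?L p by unfold_locales (rule pp(1))
  interpret Mp: galois_prime ?M p by unfold_locales (rule pp(1))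
  have M_sub: "y \<in> ?L" if "y \<in> ?M" for y
    using cyclotomic_field_mono[of "p ^ k" m'] m' p0 m that by (auto simp: mult.commute)
  have MOL: "y \<in> L.O_K" if "y \<in> M.O_K" for y using M_sub that by (simp add: L.O_K_def M.O_K_def)
  define \<eta> where "\<eta> = zeta (p ^ k)"
  have \<eta>z: "\<eta> = zeta m ^ m'" unfolding \<eta>_def m using zeta_power_dvd[OF m'] by simp
  have m'z: "zeta m' = zeta m ^ (p ^ k)" unfolding m using zeta_power_dvd[of "p ^ k" m'] p0 by (simp add: mult.commute)
  have \<eta>O: "\<eta> \<in> L.O_K" unfolding \<eta>z by (rule L.O_power[OF L.z_O])
  have pk0: "0 < p ^ k" using p0 by simp
  define U where "U = {a\<in>{1..<p ^ k}. \<not> p dvd a}"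
  have finU: "finite U" by (simp add: U_def)
  define \<phi> where "\<phi> = card U"
  have "1 \<in> U"
  proof -
    have "1 < p ^ k" using prime_gt_1_nat[OF pp(1)] k by (intro one_less_power) auto
    then show ?thesis using prime_gt_1_nat[OF pp(1)] by (auto simp: U_def)
  qed
  then have \<phi>0: "0 < \<phi>" using finU by (auto simp: \<phi>_def card_gt_0_iff)
  \<comment> \<open>The uniformizer: the factors \<open>1 - \<eta> ^ a\<close> with \<open>a\<close>
    in \<open>U\<close> are unit multiples of \<open>lam\<close> and their product is
    \<open>p\<close>, so \<open>lam ^ \<phi>\<close> and \<open>p\<close> differ by a unit.\<close>
  define lam where "lam = 1 - \<eta>"
  have lamO: "lam \<in> L.O_K" unfolding lam_def by (intro L.O_diff L.O_1 \<eta>O)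
  have nz: "1 - \<eta> ^ a \<noteq> 0" if "a \<in> U" for a
  proof -
    have "\<not> p ^ k dvd a" using that by (auto simp: U_def dest: dvd_imp_le)
    then show ?thesis using zeta_power_eq_1_iff[OF pk0, of a] by (simp add: \<eta>_def)
  qed
  have lam0: "lam \<noteq> 0" using nz[OF \<open>1 \<in> U\<close>] by (simp add: lam_def)
  have quo: "(1 - \<eta> ^ a) / lam \<in> L.O_K" for a
  proof -
    have "1 - \<eta> ^ a = lam * (\<Sum>i<a. \<eta> ^ i)" using one_diff_power_eq[of \<eta> a] by (simp add: lam_def)
    then have "(1 - \<eta> ^ a) / lam = (\<Sum>i<a. \<eta> ^ i)" using lam0 by simp
    also have "\<dots> \<in> L.O_K" by (intro L.O_sum L.O_power \<eta>O)
    finally show ?thesis .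
  qed
  have quo': "lam / (1 - \<eta> ^ a) \<in> L.O_K" if a: "a \<in> U" for a
  proof -
    have "Rings.coprime a (p ^ k)" 
      using a prime_imp_coprime[OF pp(1), of a] by (simp add: U_def coprime_commute[of a])
    from cong_solve_coprime_nat[OF this] obtain b where b: "[a * b = 1] (mod p ^ k)" by auto
    have "\<eta> ^ (a * b) = \<eta> ^ 1" unfolding \<eta>_def zeta_power_eq_iff[OF pk0] using b by (simp only: unique_euclidean_semiring_class.cong_def)
    then have "lam = 1 - (\<eta> ^ a) ^ b" by (simp add: lam_def power_mult)
    also have "\<dots> = (1 - \<eta> ^ a) * (\<Sum>i<b. (\<eta> ^ a) ^ i)" by (rule one_diff_power_eq)
    finally have "lam / (1 - \<eta> ^ a) = (\<Sum>i<b. (\<eta> ^ a) ^ i)" using nz[OF a] by simp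
    also have "\<dots> \<in> L.O_K" by (intro L.O_sum L.O_power \<eta>O)
    finally show ?thesis .
  qed
  have pU: "(\<Prod>a\<in>U. 1 - \<eta> ^ a) = of_nat p"
    unfolding U_def \<eta>_def by (rule prod_one_minus_zeta_units[OF pp(1) k])
  have l1: "of_nat p / lam ^ \<phi> \<in> L.O_K"
  proof -
    have "of_nat p / lam ^ \<phi> = (\<Prod>a\<in>U. (1 - \<eta> ^ a) / lam)" by (simp add: pU[symmetric] prod_dividef \<phi>_def)
    then show ?thesis using L.O_prod[of U "\<lambda>a. (1 - \<eta> ^ a) / lam"] quo by simp
  qed
  have l2: "lam ^ \<phi> / of_nat p \<in> L.O_K"
  proof -
    have "lam ^ \<phi> / of_nat p = (\<Prod>a\<in>U. lam / (1 - \<eta> ^ a))" by (simp add: pU[symmetric] prod_dividef \<phi>_def)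
    then show ?thesis using L.O_prod[of U "\<lambda>a. lam / (1 - \<eta> ^ a)"] quo' by simp
  qed
  have g\<eta>: "\<exists>a\<in>U. g \<eta> = \<eta> ^ a" if g: "g \<in> gal ?L" for g
  proof -
    have \<eta>L: "\<eta> \<in> ?L" using L.O_K_sub[OF \<eta>O] .
    have "g \<eta> ^ (p ^ k) = g (\<eta> ^ (p ^ k))" using L.g_power[OF g \<eta>L] by simp
    then have "g \<eta> ^ (p ^ k) = 1" using zeta_power_self[OF pk0] L.g_1[OF g] by (simp add: \<eta>_def)
    then obtain a where a: "a < p ^ k" "g \<eta> = \<eta> ^ a" using root_of_unity_ex[OF pk0] by (auto simp: \<eta>_def)
    have "\<not> p dvd a"
    proof
      assume "p dvd a"
      then obtain b where b: "a = p * b" by (elim dvdE)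
      have kk: "p * p ^ (k - 1) = p ^ k" using k by (simp flip: power_Suc)
      have "g (\<eta> ^ (p ^ (k - 1))) = (\<eta> ^ (p * b)) ^ (p ^ (k - 1))" using L.g_power[OF g \<eta>L] a b by simp
      also have "\<dots> = (\<eta> ^ (p ^ k)) ^ b" unfolding kk[symmetric] by (simp only: power_mult[symmetric] mult_ac)
      also have "\<dots> = 1" using zeta_power_self[OF pk0] by (simp add: \<eta>_def)
      finally have "g (\<eta> ^ (p ^ (k - 1))) = g 1" using L.g_1[OF g] by simp
      then have "\<eta> ^ (p ^ (k - 1)) = 1" using L.g_inj[OF g L.K_power[OF \<eta>L] L.K_1] by simp
      then have "p ^ k dvd p ^ (k - 1)" unfolding \<eta>_def zeta_power_eq_1_iff[OF pk0] .
      then have "p ^ k \<le> p ^ (k - 1)" using p0 by (intro dvd_imp_le) auto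
      then have "k \<le> k - 1" using prime_gt_1_nat[OF pp(1)] by (rule power_le_imp_le_exp[rotated])
      then show False using k by simp
    qed
    then have "a \<in> U" using a by (cases "a = 0") (auto simp: U_def)
    then show ?thesis using a by blast
  qed
  \<comment> \<open>An automorphism is determined by its effect on the roots of unity of orders
    \<open>m'\<close> and \<open>p ^ k\<close>. This upper bound for the degree will make the
    injection of \<open>C\<close> into the residues onto.\<close>
  have degLM: "L.deg \<le> M.deg * \<phi>"
  proof -
    define F where "F g = (restrict g ?M, g \<eta>)" for g :: "complex \<Rightarrow> complex"
    have "Rings.coprime (p ^ k) m'" using pp by (simp add: prime_imp_coprime)
    from cong_solve_coprime_nat[OF this] obtain u where u: "[p ^ k * u = 1] (mod m')" by auto
    have "Rings.coprime m' (p ^ k)"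
      using prime_imp_coprime[OF pp(1,2)] by (simp add: coprime_commute[of m'])
    from cong_solve_coprime_nat[OF this] obtain v where v: "[m' * v = 1] (mod p ^ k)" by auto
    have "[p ^ k * u + m' * v = 1] (mod m')" using u by (simp add: unique_euclidean_semiring_class.cong_def)
    moreover have "[p ^ k * u + m' * v = 1] (mod p ^ k)" using v by (simp add: unique_euclidean_semiring_class.cong_def)
    ultimately have "[p ^ k * u + m' * v = 1] (mod m)"
      unfolding m using \<open>Rings.coprime m' (p ^ k)\<close> by (intro coprime_cong_mult_nat)
    then have "zeta m ^ (p ^ k * u + m' * v) = zeta m ^ 1"
      unfolding zeta_power_eq_iff[OF m0] by (simp only: unique_euclidean_semiring_class.cong_def)
    then have zz: "zeta m = zeta m' ^ u * \<eta> ^ v" by (simp add: power_add power_mult m'z \<eta>z)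
    have \<eta>L: "\<eta> \<in> ?L" using L.O_K_sub[OF \<eta>O] .
    have "inj_on F (gal ?L)"
    proof (rule inj_onI)
      fix g h assume gh: "g \<in> gal ?L" "h \<in> gal ?L" "F g = F h"
      then have r: "restrict g ?M = restrict h ?M" and e: "g \<eta> = h \<eta>" by (auto simp: F_def)
      have "g (zeta m') = h (zeta m')" using fun_cong[OF r, of "zeta m'"] M.z_L by simp
      then have "g (zeta m) = h (zeta m)"
        unfolding zz using e gh \<eta>L M_sub[OF M.z_L]
        by (simp add: L.g_mult[OF gh(1)] L.g_mult[OF gh(2)] L.g_power[OF gh(1)] L.g_power[OF gh(2)] L.K_power)
      then show "g = h" by (rule L.gal_eq_zeta[OF gh(1,2)])
    qed
    moreover have "F ` gal ?L \<subseteq> gal ?M \<times> (\<lambda>a. \<eta> ^ a) ` U"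
    proof
      fix y assume "y \<in> F ` gal ?L"
      then obtain g where g: "g \<in> gal ?L" "y = F g" by blast
      have "restrict g ?M \<in> gal ?M"
        by (rule M.hom_restrict_gal) (use M_sub L.g_add[OF g(1)] L.g_mult[OF g(1)] L.g_Rats[OF g(1)] in auto)
      then show "y \<in> gal ?M \<times> (\<lambda>a. \<eta> ^ a) ` U" using g\<eta>[OF g(1)] g(2) by (auto simp: F_def)
    qed
    ultimately have "card (gal ?L) \<le> card (gal ?M \<times> (\<lambda>a. \<eta> ^ a) ` U)"
      by (intro card_inj_on_le) (use finU in auto)
    also have "\<dots> \<le> card (gal ?M) * \<phi>"
      using card_image_le[OF finU, of "\<lambda>a. \<eta> ^ a"] by (simp add: card_cartesian_product \<phi>_def)
    finally show ?thesis by (simp add: L.deg_def M.deg_def)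
  qed
  \<comment> \<open>Digit expansions in powers of \<open>lam\<close> below \<open>\<phi>\<close>,
    with residues of the smaller field as digits.\<close>
  define C where "C = PiE {..<\<phi>} (\<lambda>_. Mp.Res)"
  define S where "S c = (\<Sum>i<\<phi>. c i * lam ^ i)" for c
  have cO: "c i \<in> M.O_K" if "c \<in> C" "i < \<phi>" for c i
    by (rule Mp.Res_O, rule PiE_mem[of c "{..<\<phi>}" "\<lambda>_. Mp.Res"]) (use that in \<open>simp_all add: C_def\<close>)
  have SO: "S c \<in> L.O_K" if "c \<in> C" for c
    unfolding S_def by (intro L.O_sum L.O_mult L.O_power MOL cO[OF that] lamO) simp
  \<comment> \<open>At the first index where the digits differ, their difference
    \<open>\<delta>\<close> is divisible by \<open>lam\<close>, because \<open>p\<close> is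
    divisible by \<open>lam ^ \<phi>\<close>. Then \<open>\<delta> ^ \<phi>\<close> is divisible by
    \<open>p\<close> and, since \<open>p\<close> is unramified in the smaller field, so is
    \<open>\<delta>\<close>; but the digits are distinct residues.\<close>
  have inj: "inj_on (\<lambda>c. Lp.red (S c)) C"
  proof (rule inj_onI, rule ccontr)
    fix c d assume c: "c \<in> C" and d: "d \<in> C" and eq: "Lp.red (S c) = Lp.red (S d)" and ne: "c \<noteq> d"
    have "\<exists>i. i < \<phi> \<and> c i \<noteq> d i" using ne c d PiE_ext[of c "{..<\<phi>}" "\<lambda>_. Mp.Res" d] by (auto simp: C_def)
    then have least: "(LEAST i. i < \<phi> \<and> c i \<noteq> d i) < \<phi> \<and> c (LEAST i. i < \<phi> \<and> c i \<noteq> d i) \<noteq> d (LEAST i. i < \<phi> \<and> c i \<noteq> d i)"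
      by (rule LeastI_ex)
    define i0 where "i0 = (LEAST i. i < \<phi> \<and> c i \<noteq> d i)"
    have i0: "i0 < \<phi>" "c i0 \<noteq> d i0" using least by (simp_all add: i0_def)
    moreover have "c i = d i" if "i < i0" for i
      using not_less_Least[of i "\<lambda>i. i < \<phi> \<and> c i \<noteq> d i"] that i0(1) unfolding i0_def by simp
    ultimately have i0: "i0 < \<phi>" "c i0 \<noteq> d i0" "\<And>i. i < i0 \<Longrightarrow> c i = d i" by blast+
    define \<delta> where "\<delta> = c i0 - d i0"
    have \<delta>M: "\<delta> \<in> M.O_K" unfolding \<delta>_def by (intro M.O_diff cO c d i0)
    have "S c - S d \<in> Lp.PO" using eq Lp.red_eq_iff[OF SO[OF c] SO[OF d]] by simp
    then have yO: "(S c - S d) / of_nat p \<in> L.O_K" by (simp add: Lp.PO_iff)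
    define y where "y = (S c - S d) / of_nat p"
    have Scd: "S c - S d = of_nat p * y" using Lp.p_nz by (simp add: y_def)
    define T where "T = (\<Sum>i\<in>{i0<..<\<phi>}. (c i - d i) * lam ^ (i - Suc i0))"
    have TO: "T \<in> L.O_K" unfolding T_def
      by (intro L.O_sum L.O_mult L.O_power MOL M.O_diff cO[OF c] cO[OF d] lamO) simp_all
    have "S c - S d = (\<Sum>i<\<phi>. (c i - d i) * lam ^ i)" by (simp add: S_def left_diff_distrib sum_subtractf)
    also have "\<dots> = (\<Sum>i\<in>insert i0 {i0<..<\<phi>}. (c i - d i) * lam ^ i)"
      by (rule sum.mono_neutral_right) (use i0 in \<open>auto simp: not_less le_less\<close>)
    also have "\<dots> = \<delta> * lam ^ i0 + (\<Sum>i\<in>{i0<..<\<phi>}. (c i - d i) * lam ^ i)" by (simp add: \<delta>_def)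
    also have "(\<Sum>i\<in>{i0<..<\<phi>}. (c i - d i) * lam ^ i) = lam ^ Suc i0 * T"
      unfolding T_def sum_distrib_left
    proof (rule sum.cong)
      fix i assume "i \<in> {i0<..<\<phi>}"
      then have "Suc i0 + (i - Suc i0) = i" by auto
      then have "lam ^ i = lam ^ Suc i0 * lam ^ (i - Suc i0)" by (metis power_add)
      then show "(c i - d i) * lam ^ i = lam ^ Suc i0 * ((c i - d i) * lam ^ (i - Suc i0))" by (simp only: mult_ac)
    qed simp
    finally have e1: "of_nat p * y = \<delta> * lam ^ i0 + lam ^ Suc i0 * T" using Scd by simp
    have "Suc i0 + (\<phi> - Suc i0) = \<phi>" using i0(1) by simp
    then have lp: "lam ^ \<phi> = lam ^ Suc i0 * lam ^ (\<phi> - Suc i0)" by (metis power_add)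
    have "\<delta> / lam = (of_nat p / lam ^ \<phi>) * lam ^ (\<phi> - Suc i0) * y - T"
    proof -
      have "(of_nat p / lam ^ \<phi>) * lam ^ (\<phi> - Suc i0) * y = of_nat p * y / lam ^ Suc i0"
      proof -
        have "P / (A * B) * B * y = P * y / A" if "B \<noteq> 0" for P A B :: complex using that by simp
        then show ?thesis unfolding lp using lam0 by simp
      qed
      also have "\<dots> = \<delta> / lam + T"
        unfolding e1 add_divide_distrib using lam0 by simp
      finally show ?thesis by simp
    qed
    also have "\<dots> \<in> L.O_K" using l1 lamO yO TO by (intro L.O_diff L.O_mult L.O_power) (auto simp: y_def)
    finally have dl: "\<delta> / lam \<in> L.O_K" .
    have "\<delta> ^ \<phi> / of_nat p = (\<delta> / lam) ^ \<phi> * (lam ^ \<phi> / of_nat p)" using lam0 by (simp add: power_divide)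
    also have "\<dots> \<in> L.O_K" by (intro L.O_mult L.O_power dl l2)
    finally have "algebraic_int (\<delta> ^ \<phi> / of_nat p)" by (simp add: L.O_K_def)
    moreover have "\<delta> ^ \<phi> / of_nat p \<in> ?M" using M.O_K_sub[OF \<delta>M] by (intro M.K_divide M.K_power) auto
    ultimately have "\<delta> ^ \<phi> \<in> Mp.PO" by (simp add: Mp.PO_iff M.O_K_def)
    then have "\<delta> \<in> Mp.rad" using \<delta>M by (auto simp: Mp.rad_def)
    then have "\<delta> \<in> Mp.PO" using M.unramified[OF pp] by simp
    moreover have "c i0 \<in> Mp.Res" "d i0 \<in> Mp.Res" using c d i0 by (auto simp: C_def)
    ultimately show False using Mp.Res_unique i0(2) by (simp add: \<delta>_def)
  qed
  have "(\<lambda>c. Lp.red (S c)) ` C = Lp.Res"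
  proof (rule card_seteq)
    show "(\<lambda>c. Lp.red (S c)) ` C \<subseteq> Lp.Res" using SO Lp.red_Res by auto
    have "card Lp.Res = p ^ L.deg" by (rule Lp.card_Res)
    also have "\<dots> \<le> p ^ (M.deg * \<phi>)" using degLM prime_gt_1_nat[OF pp(1)] by (intro power_increasing) auto
    also have "\<dots> = card C" by (simp add: C_def card_PiE Mp.card_Res power_mult)
    also have "\<dots> = card ((\<lambda>c. Lp.red (S c)) ` C)" by (rule card_image[OF inj, symmetric])
    finally show "card Lp.Res \<le> card ((\<lambda>c. Lp.red (S c)) ` C)" .
  qed simp
  moreover have xO: "x \<in> L.O_K" using x by (simp add: L.O_K_def)
  ultimately have "Lp.red x \<in> (\<lambda>c. Lp.red (S c)) ` C" using Lp.red_Res by simp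
  then obtain c where c: "c \<in> C" "Lp.red x = Lp.red (S c)" by blast
  then have "x - S c \<in> Lp.PO" using Lp.red_eq_iff[OF xO SO[OF c(1)]] by simp
  then have yO: "(x - S c) / of_nat p \<in> L.O_K" by (simp add: Lp.PO_iff)
  define y where "y = (x - S c) / of_nat p"
  have yO': "y \<in> L.O_K" using yO by (simp add: y_def)
  have c0O: "c 0 \<in> M.O_K" by (rule cO[OF c(1) \<phi>0])
  \<comment> \<open>The lowest digit \<open>c 0\<close> lies in the smaller field and is fixed by
    \<open>\<sigma>\<close>. So only \<open>lam * w\<close> moves, and it stays divisible by
    \<open>lam\<close>.\<close>
  define w where "w = (x - c 0) / lam"
  have wO: "w \<in> L.O_K"
  proof -
    define T where "T = (\<Sum>i\<in>{0<..<\<phi>}. c i * lam ^ (i - 1))"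
    have TO: "T \<in> L.O_K" unfolding T_def
      by (intro L.O_sum L.O_mult L.O_power MOL cO[OF c(1)] lamO) simp
    have "S c = (\<Sum>i\<in>insert 0 {0<..<\<phi>}. c i * lam ^ i)" unfolding S_def using \<phi>0 by (intro sum.cong) auto
    also have "\<dots> = c 0 + (\<Sum>i\<in>{0<..<\<phi>}. c i * lam ^ i)" by simp
    also have "(\<Sum>i\<in>{0<..<\<phi>}. c i * lam ^ i) = lam * T"
      unfolding T_def sum_distrib_left
    proof (rule sum.cong)
      fix i assume "i \<in> {0<..<\<phi>}"
      then have "lam ^ i = lam * lam ^ (i - 1)" by (cases i) auto
      then show "c i * lam ^ i = lam * (c i * lam ^ (i - 1))" by (simp only: mult_ac)
    qed simp
    finally have "x - c 0 = of_nat p * y + lam * T" using Lp.p_nz by (simp add: y_def)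
    moreover have "lam ^ \<phi> = lam * lam ^ (\<phi> - 1)" using \<phi>0 by (cases \<phi>) auto
    moreover have "(P * y + l * T) / l = P / (l * B) * B * y + T" if "l \<noteq> 0" "B \<noteq> 0" for P l B :: complex
      using that by (simp add: add_divide_distrib)
    ultimately have "w = (of_nat p / lam ^ \<phi>) * lam ^ (\<phi> - 1) * y + T"
      unfolding w_def using lam0 by simp
    also have "\<dots> \<in> L.O_K" by (intro L.O_add L.O_mult L.O_power l1 lamO yO' TO)
    finally show ?thesis .
  qed
  have xw: "x = c 0 + lam * w" using lam0 by (simp add: w_def)
  have "\<sigma> (c 0) = c 0"
  proof -
    obtain P where P: "P \<in> rat_polys" "c 0 = poly P (zeta m')" by (rule M.L_repr[OF M.O_K_sub[OF c0O]])
    then show ?thesis using L.g_poly_Rats[OF \<sigma>(1), of P "zeta m'"] M_sub[OF M.z_L] \<sigma>(2) by (simp add: rat_polys_def)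
  qed
  moreover have "\<sigma> x = \<sigma> (c 0) + \<sigma> lam * \<sigma> w"
    unfolding xw using M_sub[OF M.O_K_sub[OF c0O]] L.O_K_sub[OF lamO] L.O_K_sub[OF wO]
    by (simp add: L.g_add[OF \<sigma>(1)] L.g_mult[OF \<sigma>(1)] L.K_mult)
  ultimately have e2: "\<sigma> x - x = \<sigma> lam * \<sigma> w - lam * w" using xw by simp
  obtain a where a: "\<sigma> \<eta> = \<eta> ^ a" using g\<eta>[OF \<sigma>(1)] by blast
  have "\<sigma> lam = 1 - \<eta> ^ a"
    unfolding lam_def using L.g_diff[OF \<sigma>(1) L.K_1 L.O_K_sub[OF \<eta>O]] L.g_1[OF \<sigma>(1)] a by simp
  moreover have "(A * B - lam * w) / lam = A / lam * B - w" for A B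
    using lam0 by (simp add: diff_divide_distrib)
  ultimately have "(\<sigma> x - x) / lam = (1 - \<eta> ^ a) / lam * \<sigma> w - w" unfolding e2 by simp
  also have "\<dots> \<in> L.O_K" by (intro L.O_diff L.O_mult quo L.g_O[OF \<sigma>(1)] wO)
  finally have dO: "(\<sigma> x - x) / lam \<in> L.O_K" .
  have "(\<sigma> x - x) ^ \<phi> / of_nat p = ((\<sigma> x - x) / lam) ^ \<phi> * (lam ^ \<phi> / of_nat p)" using lam0 by (simp add: power_divide)
  also have "\<dots> \<in> L.O_K" by (intro L.O_mult L.O_power dO l2)
  finally have "(\<sigma> x - x) ^ \<phi> \<in> Lp.PO" by (simp add: Lp.PO_iff)
  then show ?thesis using L.O_diff[OF L.g_O[OF \<sigma>(1) xO] xO] by (auto simp: Lp.rad_def)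
qed

section \<open>Conductor and discriminant\<close>

text \<open>Finiteness of the group is inherited from \<open>L\<close>: an element separating more
  than \<open>card (gal L)\<close> automorphisms of \<open>K\<close> would have too many images, all
  of them roots of its characteristic polynomial formed in \<open>L\<close>.\<close>

lemma subfield_galois_ext:
  assumes K: "subfield K complex_ring" and KL: "K \<subseteq> L" and L: "galois_ext L"
    and fixed: "\<And>x. x \<in> K \<Longrightarrow> (\<And>g. g \<in> gal K \<Longrightarrow> g x = x) \<Longrightarrow> x \<in> \<rat>"
  shows "galois_ext K"
proof -
  interpret L: galois_ext L by fact
  interpret R: ring complex_ring by (rule ring_from_type_algebra)
  interpret S: subfield K complex_ring by fact
  have K1: "1 \<in> K" using subringE(3)[OF S.subring_axioms] by (simp add: complex_ring_simps)
  have K0: "0 \<in> K" using subringE(2)[OF S.subring_axioms] by (simp add: complex_ring_simps)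
  have Kadd: "x + y \<in> K" if "x \<in> K" "y \<in> K" for x y
    using subringE(7)[OF S.subring_axioms that] by (simp add: complex_ring_simps)
  have Kmult: "x * y \<in> K" if "x \<in> K" "y \<in> K" for x y
    using subringE(6)[OF S.subring_axioms that] by (simp add: complex_ring_simps)
  have Kminus: "- x \<in> K" if "x \<in> K" for x
    using subringE(5)[OF S.subring_axioms that] by (simp add: complex_ring_minus)
  have Kinv: "inverse x \<in> K" if "x \<in> K" for x
  proof (cases "x = 0")
    case False
    have "field complex_ring" by (rule field_from_type_algebra)
    then have "inv\<^bsub>complex_ring\<^esub> x \<in> K"
      using R.subfield_m_inv(1)[OF K, of x] False that by (simp add: complex_ring_simps)
    then show ?thesis using complex_ring_inv[OF False] by simp
  qed (use K0 in simp)
  have Kn: "of_nat n \<in> K" for n :: nat by (induction n) (auto intro: Kadd K0 K1)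
  have Ki: "of_int n \<in> K" for n :: int by (cases n rule: int_cases2) (auto intro: Kminus Kn)
  have KQ: "\<rat> \<subseteq> K"
  proof
    fix q :: complex assume "q \<in> \<rat>"
    then obtain a b where "q = of_int a / of_int b" by (elim Rats_cases') auto
    then show "q \<in> K" using Kmult[OF Ki Kinv[OF Ki]] by (simp add: divide_inverse)
  qed
  have fin: "finite (gal K)"
  proof (rule ccontr)
    assume "infinite (gal K)"
    then obtain F where F: "F \<subseteq> gal K" "finite F" "card F = Suc (card (gal L))"
      using infinite_arbitrarily_large by blast
    define H where "H = (\<lambda>(g, h) x. g x - h x) ` {(g, h) \<in> F \<times> F. g \<noteq> h}"
    have "finite H" unfolding H_def
      by (intro finite_imageI finite_subset[OF _ finite_cartesian_product[OF F(2) F(2)]]) auto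
    moreover have "f (x + y) = f x + f y" if "f \<in> H" "x \<in> K" "y \<in> K" for f x y
    proof -
      from that obtain g h where "g \<in> gal K" "h \<in> gal K" "f = (\<lambda>x. g x - h x)" using F(1) by (auto simp: H_def)
      then show ?thesis using that by (simp add: gal_iff)
    qed
    moreover have "\<exists>x\<in>K. f x \<noteq> 0" if "f \<in> H" for f
    proof -
      from that obtain g h where gh: "g \<in> gal K" "h \<in> gal K" "g \<noteq> h" "f = (\<lambda>x. g x - h x)" using F(1) by (auto simp: H_def)
      then have "g \<in> extensional K" "h \<in> extensional K" by (auto simp: gal_iff)
      then obtain x where "x \<in> K" "g x \<noteq> h x" using gh(3) extensionalityI[of g K h] by blast
      then show ?thesis using gh(4) by auto
    qed
    ultimately obtain \<theta> where \<theta>: "\<theta> \<in> K" "\<forall>f\<in>H. f \<theta> \<noteq> 0"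
      using ex_avoiding_zeros[of H K] Kadd K0 by auto
    have inj: "inj_on (\<lambda>g. g \<theta>) F"
    proof (rule inj_onI, rule ccontr)
      fix g h assume gh: "g \<in> F" "h \<in> F" "g \<theta> = h \<theta>" "g \<noteq> h"
      then have "(\<lambda>x. g x - h x) \<in> H" by (auto simp: H_def intro!: image_eqI[of _ _ "(g, h)"])
      then show False using \<theta> gh(3) by auto
    qed
    have \<theta>L: "\<theta> \<in> L" using \<theta> KL by auto
    have nz: "L.char_pol \<theta> \<noteq> 0" using L.degree_char_pol(2)[of \<theta>] by auto
    have "(\<lambda>g. g \<theta>) ` F \<subseteq> {r. poly (L.char_pol \<theta>) r = 0}"
    proof
      fix r assume "r \<in> (\<lambda>g. g \<theta>) ` F"
      then obtain g where g: "g \<in> gal K" "r = g \<theta>" using F(1) by blast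
      have "g (poly (L.char_pol \<theta>) \<theta>) = poly (L.char_pol \<theta>) (g \<theta>)"
        by (rule hom_poly_Rats(1)[OF K1 Kadd Kmult KQ])
          (use g \<theta> L.coeff_char_pol_Rats[OF \<theta>L] in \<open>auto simp: gal_iff\<close>)
      moreover have "g 0 = 0" using g by (auto simp: gal_iff)
      ultimately show "r \<in> {r. poly (L.char_pol \<theta>) r = 0}" using g L.char_pol_self[OF \<theta>L] by simp
    qed
    then have "card ((\<lambda>g. g \<theta>) ` F) \<le> card {r. poly (L.char_pol \<theta>) r = 0}"
      by (intro card_mono poly_roots_finite[OF nz])
    also have "\<dots> \<le> card (gal L)" using card_poly_roots_bound[OF nz] L.degree_char_pol(1)[of \<theta>] by simp
    finally show False using F(3) card_image[OF inj] by simp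
  qed
  show ?thesis
    by unfold_locales (use K0 K1 Kadd Kmult Kminus Kinv fin fixed in auto)
qed

lemma conductor_prime_ramified:
  assumes K: "galois_ext K" and KL: "K \<subseteq> cyclotomic_field m" and m0: "0 < m"
    and pp: "Factorial_Ring.prime p" "p dvd m" and nK: "\<not> K \<subseteq> cyclotomic_field (m div p)"
  shows "galois_prime.rad K p \<noteq> galois_prime.PO K p"
proof -
  interpret L: cyclotomic m by unfold_locales (rule m0)
  interpret K: galois_ext K by fact
  interpret Kp: galois_prime K p by unfold_locales (rule pp(1))
  interpret Lp: galois_prime "cyclotomic_field m" p by unfold_locales (rule pp(1))
  have p0: "0 < p" using pp(1) by (rule prime_gt_0_nat)
  obtain n where n: "m = p * n" using pp(2) by (elim dvdE)
  have n0: "0 < n" using n m0 by (cases n) auto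
  have mn: "m div p = n" using n p0 by simp
  have zn: "zeta n = zeta m ^ p" unfolding n using zeta_power_dvd[OF p0] by simp
  obtain x where x: "x \<in> K" "x \<notin> cyclotomic_field n" using nK mn by auto
  \<comment> \<open>Otherwise interpolation would write \<open>x\<close> as a rational polynomial in
    \<open>zeta n\<close>.\<close>
  have "\<exists>\<sigma>\<in>gal (cyclotomic_field m). \<sigma> (zeta n) = zeta n \<and> \<sigma> x \<noteq> x"
  proof (rule ccontr)
    assume neg: "\<not> ?thesis"
    have "\<exists>v. (\<forall>g\<in>gal (cyclotomic_field m). v (g (zeta n)) = g x) \<and>
       poly (lagrange_poly (L.conjugates (zeta n)) v) (zeta n) = x \<and>
       (\<forall>i. coeff (lagrange_poly (L.conjugates (zeta n)) v) i \<in> \<rat>)"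
      by (rule L.interpolation) (use neg x KL zn L.K_power[OF L.z_L] in auto)
    then obtain P where "P \<in> rat_polys" "x = poly P (zeta n)" by (auto simp: rat_polys_def)
    then show False using x cyclotomic_field_eq[OF n0] by blast
  qed
  then obtain \<sigma> where \<sigma>: "\<sigma> \<in> gal (cyclotomic_field m)" "\<sigma> (zeta n) = zeta n" "\<sigma> x \<noteq> x" by blast
  define k where "k = multiplicity p m"
  obtain m' where m': "m = p ^ k * m'" "\<not> p dvd m'"
    using multiplicity_decompose'[of m p] m0 pp(1) unfolding k_def by (metis not_gr0 not_prime_unit)
  have k1: "1 \<le> k" using pp m0 unfolding k_def by (metis One_nat_def Suc_leI multiplicity_gt_zero_iff not_gr0 not_prime_unit)
  have m'0: "0 < m'" using m' m0 by (cases m') auto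
  have "n = p ^ (k - 1) * m'"
  proof -
    have "p * n = p * (p ^ (k - 1) * m')" using n m'(1) k1 by (simp add: mult.assoc[symmetric] flip: power_Suc)
    then show ?thesis using p0 by simp
  qed
  then have zm': "zeta m' = zeta n ^ (p ^ (k - 1))" using zeta_power_dvd[of "p ^ (k - 1)" m'] p0 by simp
  have "\<sigma> (zeta m') = zeta m'"
    unfolding zm' using L.g_power[OF \<sigma>(1), of "zeta n"] zn L.K_power[OF L.z_L] \<sigma>(2) by simp
  note inert = cyclotomic_inertia[OF m'0 pp(1) m'(2) k1 _ \<sigma>(1) this]
  define \<tau> where "\<tau> = restrict \<sigma> K"
  have \<tau>: "\<tau> \<in> gal K" unfolding \<tau>_def
    by (rule K.hom_restrict_gal) (simp_all add: subsetD[OF KL] L.g_add[OF \<sigma>(1)] L.g_mult[OF \<sigma>(1)] L.g_Rats[OF \<sigma>(1)])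
  show ?thesis
  proof (rule Kp.inertia_ramified[OF \<tau> x(1)])
    show "\<tau> x \<noteq> x" using \<sigma>(3) x by (simp add: \<tau>_def)
    fix y assume y: "y \<in> K.O_K"
    have yK: "y \<in> K" "algebraic_int y" using y by (auto simp: K.O_K_def)
    have \<tau>y: "\<tau> y = \<sigma> y" using yK by (simp add: \<tau>_def)
    \<comment> \<open>Nilpotency modulo \<open>p\<close> in the large field passes to
      \<open>K\<close>, because an element of \<open>K\<close> whose quotient by \<open>p\<close> is
      integral has that quotient in \<open>K\<close> as well.\<close>
    have "\<sigma> y - y \<in> Lp.rad" using inert[of y] yK KL m'(1) by (auto simp: mult.commute)
    then obtain j where j: "(\<sigma> y - y) ^ j \<in> Lp.PO" by (auto simp: Lp.rad_def)
    have dO: "\<tau> y - y \<in> K.O_K" using K.g_O[OF \<tau> y] y K.O_diff by blast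
    have "(\<tau> y - y) ^ j / of_nat p \<in> K" using K.O_K_sub[OF dO] by (intro K.K_divide K.K_power) auto
    then have "(\<tau> y - y) ^ j \<in> Kp.PO" using j \<tau>y by (simp add: Kp.PO_iff Lp.PO_iff K.O_K_def L.O_K_def)
    then show "\<tau> y - y \<in> Kp.rad" using dO by (auto simp: Kp.rad_def)
  qed
qed

lemma power_one_plus_cong: "[(1 + B) ^ N = 1 + N * B] (mod B\<^sup>2)" for B N :: nat
proof (induction N)
  case (Suc N)
  have "[(1 + B) ^ Suc N = (1 + B) * (1 + N * B)] (mod B\<^sup>2)"
    using cong_scalar_left[OF Suc, of "1 + B"] by simp
  moreover have "(1 + B) * (1 + N * B) = 1 + Suc N * B + B\<^sup>2 * N" by (simp add: algebra_simps power2_eq_square)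
  moreover have "[1 + Suc N * B + B\<^sup>2 * N = 1 + Suc N * B] (mod B\<^sup>2)"
    by (simp add: unique_euclidean_semiring_class.cong_def)
  ultimately show ?case using cong_trans by metis
qed simp

text \<open>Let \<open>p\<close> divide \<open>m\<close> exactly \<open>k\<close> times and the
  degree \<open>n\<close> exactly \<open>a\<close> times, and suppose
  \<open>k \<ge> 2 * a + 2\<close>. The powers of \<open>zeta m \<mapsto> zeta m ^ (1 + Y)\<close>
  with exponent a multiple of \<open>n\<close> are trivial on \<open>K\<close>, whose group has
  order \<open>n\<close>; yet they exhaust the automorphisms fixing the roots of unity of order
  \<open>m / p\<close>. So \<open>K\<close> would lie in the smaller cyclotomic field.\<close>

lemma conductor_multiplicity:
  assumes K: "galois_ext K" and KL: "K \<subseteq> cyclotomic_field m" and m0: "0 < m"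
    and G: "Group.group (galois_group K)"
    and pp: "Factorial_Ring.prime p" "p dvd m" and nK: "\<not> K \<subseteq> cyclotomic_field (m div p)"
  shows "multiplicity p m \<le> 2 * multiplicity p (card (gal K)) + 1"
proof (rule ccontr)
  assume neg: "\<not> ?thesis"
  interpret L: cyclotomic m by unfold_locales (rule m0)
  interpret K: galois_ext K by fact
  have p0: "0 < p" using pp(1) by (rule prime_gt_0_nat)
  define n where "n = card (gal K)"
  have n0: "0 < n" using K.card_gal_pos by (simp add: n_def)
  define k where "k = multiplicity p m"
  define a where "a = multiplicity p n"
  have ka: "2 * a + 2 \<le> k" using neg by (simp add: k_def a_def n_def)
  obtain m' where m': "m = p ^ k * m'" "\<not> p dvd m'"
    using multiplicity_decompose'[of m p] m0 pp(1) unfolding k_def by (metis not_gr0 not_prime_unit)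
  obtain c where c: "n = p ^ a * c" "\<not> p dvd c"
    using multiplicity_decompose'[of n p] n0 pp(1) unfolding a_def by (metis not_gr0 not_prime_unit)
  have m'0: "0 < m'" using m' m0 by (cases m') auto
  \<comment> \<open>Chosen so that \<open>n * Y\<close> is \<open>q = m / p\<close> times the part
    \<open>c\<close> of \<open>n\<close> prime to \<open>p\<close>. The assumption on
    \<open>k\<close> gives \<open>2 * j \<ge> k\<close>, whence \<open>m\<close> divides
    \<open>Y\<^sup>2\<close> and powers of \<open>1 + Y\<close> are linear in the exponent modulo
    \<open>m\<close>.\<close>
  define j where "j = k - 1 - a"
  have j1: "1 \<le> j" and j2: "k \<le> 2 * j" and aj: "a + j = k - 1" using ka by (auto simp: j_def)
  define q where "q = p ^ (k - 1) * m'"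
  have mq: "m = p * q" using m'(1) ka by (simp add: q_def mult.assoc[symmetric] flip: power_Suc)
  have mdq: "m div p = q" using mq p0 by simp
  have q0: "0 < q" using mq m0 by (cases q) auto
  have pq: "p dvd q" unfolding q_def using ka by (intro dvd_mult2 dvd_power) auto
  define Y where "Y = m' * p ^ j"
  define w where "w = 1 + Y"
  have cw: "Rings.coprime w m"
  proof -
    have "Rings.coprime (1 + Y) d" if "d dvd Y" for d
      by (rule coprimeI) (metis dvd_trans that dvd_add_left_iff)
    then have "Rings.coprime w m'" "Rings.coprime w p"
      unfolding w_def using j1 by (auto simp: Y_def intro!: dvd_mult dvd_power)
    then show ?thesis unfolding m'(1) by simp
  qed
  obtain g where g: "g \<in> gal (cyclotomic_field m)" "g (zeta m) = zeta m ^ w"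
    using L.gal_zeta_coprime[OF cw] by (auto simp: w_def)
  have mY: "m dvd Y\<^sup>2"
  proof -
    have "Y\<^sup>2 = m' * m' * p ^ (2 * j)" by (simp add: Y_def power_mult_distrib power2_eq_square flip: power_add mult_2)
    moreover have "p ^ k dvd p ^ (2 * j)" by (rule le_imp_power_dvd[OF j2])
    ultimately show ?thesis unfolding m'(1) by (metis dvd_triv_left mult.commute mult_dvd_mono)
  qed
  have wN: "[w ^ (n * s) = 1 + c * s * q] (mod m)" for s
  proof -
    have "[w ^ (n * s) = 1 + (n * s) * Y] (mod m)"
      using cong_dvd_modulus_nat[OF power_one_plus_cong[of Y "n * s"] mY] unfolding w_def by blast
    moreover have "(n * s) * Y = c * s * q"
    proof -
      have "(n * s) * Y = c * s * (p ^ (a + j) * m')" unfolding c(1) Y_def by (simp add: power_add mult_ac)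
      then show ?thesis unfolding aj q_def .
    qed
    ultimately show ?thesis by simp
  qed
  have iter: "\<exists>h\<in>gal (cyclotomic_field m). h (zeta m) = zeta m ^ (w ^ i) \<and> (\<forall>x\<in>cyclotomic_field m. h x = (g ^^ i) x)" for i
  proof (induction i)
    case 0
    then show ?case using L.gal_id L.z_L
      by (intro bexI[of _ "restrict (\<lambda>x. x) (cyclotomic_field m)"]) auto
  next
    case (Suc i)
    then obtain h where h: "h \<in> gal (cyclotomic_field m)" "h (zeta m) = zeta m ^ (w ^ i)"
      "\<forall>x\<in>cyclotomic_field m. h x = (g ^^ i) x" by blast
    have "compose (cyclotomic_field m) g h (zeta m) = zeta m ^ (w ^ Suc i)"
      using L.z_L h(2) L.g_power[OF g(1) L.z_L] g(2) by (simp add: power_mult)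
    moreover have "\<forall>x\<in>cyclotomic_field m. compose (cyclotomic_field m) g h x = (g ^^ Suc i) x" using h(3) by simp
    ultimately show ?case using L.gal_compose[OF g(1) h(1)] by blast
  qed
  define s where "s = restrict g K"
  have s: "s \<in> gal K" unfolding s_def
    by (rule K.hom_restrict_gal) (simp_all add: subsetD[OF KL] L.g_add[OF g(1)] L.g_mult[OF g(1)] L.g_Rats[OF g(1)])
  interpret G: Group.group "galois_group K" by fact
  have spow: "s [^]\<^bsub>galois_group K\<^esub> i \<in> gal K \<and> (\<forall>x\<in>K. (s [^]\<^bsub>galois_group K\<^esub> i) x = (g ^^ i) x)" for i :: nat
  proof (induction i)
    case 0
    have one: "\<one>\<^bsub>galois_group K\<^esub> = restrict (\<lambda>x. x) K" by (simp add: galois_group_def BijGroup_def)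
    show ?case unfolding G.nat_pow_0 one by (intro conjI ballI, rule K.gal_id, simp)
  next
    case (Suc i)
    let ?t = "s [^]\<^bsub>galois_group K\<^esub> i"
    have t: "?t \<in> gal K" "\<And>x. x \<in> K \<Longrightarrow> ?t x = (g ^^ i) x" using Suc by blast+
    have "?t \<in> Bij K" "s \<in> Bij K" using t(1) s by (auto simp: galois_group_def)
    moreover have "x \<otimes>\<^bsub>galois_group K\<^esub> y = (\<lambda>g\<in>Bij K. \<lambda>f\<in>Bij K. compose K g f) x y" for x y
      by (simp add: galois_group_def BijGroup_def)
    ultimately have "s [^]\<^bsub>galois_group K\<^esub> Suc i = compose K ?t s"
      unfolding G.nat_pow_Suc by (simp only: restrict_apply')
    moreover have "compose K ?t s \<in> gal K" by (rule K.gal_compose[OF t(1) s])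
    moreover have "compose K ?t s x = (g ^^ Suc i) x" if "x \<in> K" for x
      using that t(2) K.g_in[OF s that] by (simp add: s_def funpow_swap1)
    ultimately show ?case by simp
  qed
  have gn: "(g ^^ n) x = x" if x: "x \<in> K" for x
  proof -
    have "s [^]\<^bsub>galois_group K\<^esub> n = \<one>\<^bsub>galois_group K\<^esub>"
      using G.pow_order_eq_1[OF s] by (simp add: n_def Coset.order_def)
    moreover have "\<one>\<^bsub>galois_group K\<^esub> = restrict (\<lambda>x. x) K" by (simp add: galois_group_def BijGroup_def)
    ultimately show ?thesis using spow[of n] x by simp
  qed
  have gns: "(g ^^ (n * s)) x = x" if x: "x \<in> K" for x s
    by (induction s) (simp_all add: funpow_add gn[OF x])
  have "x \<in> cyclotomic_field q" if x: "x \<in> K" for x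
  proof -
    have zq: "zeta q = zeta m ^ p" unfolding mq using zeta_power_dvd[OF p0] by simp
    have "\<rho> x = x" if \<rho>: "\<rho> \<in> gal (cyclotomic_field m)" "\<rho> (zeta q) = zeta q" for \<rho>
    proof -
      obtain b where b: "\<rho> (zeta m) = zeta m ^ b" using L.gal_zeta_power[OF \<rho>(1)] by blast
      have "zeta m ^ (b * p) = zeta m ^ (1 * p)"
        using \<rho>(2) L.g_power[OF \<rho>(1) L.z_L] b zq by (simp add: power_mult)
      then have "(b * p) mod m = (1 * p) mod m" unfolding zeta_power_eq_iff[OF m0] .
      moreover have "m = q * p" using mq by simp
      ultimately have "(b * p) mod (q * p) = (1 * p) mod (q * p)" by simp
      then have "b mod q = 1 mod q" using p0 by (simp add: mod_mult_mult2)
      moreover have "1 < q" using pq q0 prime_gt_1_nat[OF pp(1)] by (meson dvd_imp_le less_le_trans)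
      ultimately have "b = 1 + (b div q) * q" by (metis mod_less mod_div_mult_eq)
      moreover define t where "t = b div q"
      ultimately have bt: "b = 1 + t * q" by simp
      \<comment> \<open>Since \<open>c\<close> is invertible modulo \<open>p\<close>, some multiple
        of \<open>n\<close> is an exponent for which the iterate of \<open>g\<close> equals
        \<open>\<rho>\<close>.\<close>
      have "Rings.coprime c p" using prime_imp_coprime[OF pp(1) c(2)] by (simp add: coprime_commute[of c])
      from cong_solve_coprime_nat[OF this] obtain d where d: "[c * d = 1] (mod p)" by auto
      have "[c * (d * t) = t] (mod p)" using cong_scalar_right[OF d, of t] by (simp add: mult.assoc)
      then have "[c * (d * t) * q = t * q] (mod p * q)"
        using p0 q0 by (simp add: unique_euclidean_semiring_class.cong_def mod_mult_mult2)
      then have "[1 + c * (d * t) * q = b] (mod m)" unfolding bt mq by (intro cong_add) auto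
      then have "[w ^ (n * (d * t)) = b] (mod m)" using wN cong_trans by blast
      then have "zeta m ^ (w ^ (n * (d * t))) = zeta m ^ b"
        unfolding zeta_power_eq_iff[OF m0] by (simp only: unique_euclidean_semiring_class.cong_def)
      moreover obtain h where h: "h \<in> gal (cyclotomic_field m)" "h (zeta m) = zeta m ^ (w ^ (n * (d * t)))"
        "\<forall>x\<in>cyclotomic_field m. h x = (g ^^ (n * (d * t))) x" using iter by blast
      ultimately have "h = \<rho>" using b by (intro L.gal_eq_zeta[OF h(1) \<rho>(1)]) simp
      then have "\<rho> x = (g ^^ (n * (d * t))) x" using h(3) x KL by auto
      then show ?thesis using gns[OF x] by simp
    qed
    note fx = this
    have "\<exists>v. (\<forall>g\<in>gal (cyclotomic_field m). v (g (zeta q)) = g x) \<and>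
       poly (lagrange_poly (L.conjugates (zeta q)) v) (zeta q) = x \<and>
       (\<forall>i. coeff (lagrange_poly (L.conjugates (zeta q)) v) i \<in> \<rat>)"
      by (rule L.interpolation) (use fx x KL zq L.K_power[OF L.z_L] in auto)
    then obtain P where "P \<in> rat_polys" "x = poly P (zeta q)" by (auto simp: rat_polys_def)
    then show ?thesis using cyclotomic_field_eq[OF q0] by blast
  qed
  then show False using nK mdq by auto
qed

text \<open>If \<open>K\<close> lay in no cyclotomic field, its conductor would be the junk value \<open>LEAST m. False\<close>. Excluding
  this one value makes the Kronecker-Weber theorem unnecessary.\<close>

lemma conductor_bound:
  assumes ab: "abelian_number_field K" and c: "(LEAST m :: nat. False) < conductor K"
  shows "galois_ext K" "conductor K \<le> nat \<bar>discriminant K\<bar> * ((nat \<bar>discriminant K\<bar>) ^ (Suc (nat \<bar>discriminant K\<bar>)))\<^sup>2"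
proof -
  define m where "m = conductor K"
  have ex: "\<exists>m. 0 < m \<and> K \<subseteq> cyclotomic_field m"
  proof (rule ccontr)
    assume "\<not> ?thesis"
    then have "(\<lambda>m. 0 < m \<and> K \<subseteq> cyclotomic_field m) = (\<lambda>m. False)" by (intro ext) blast
    then show False using c by (simp add: conductor_def)
  qed
  have m: "0 < m" "K \<subseteq> cyclotomic_field m" using LeastI_ex[OF ex] by (auto simp: m_def conductor_def)
  have mmin: "\<not> K \<subseteq> cyclotomic_field l" if "0 < l" "l < m" for l
    using not_less_Least[of l "\<lambda>m. 0 < m \<and> K \<subseteq> cyclotomic_field m"] that by (simp add: m_def conductor_def)
  have grp: "Group.group (galois_group K)" using ab by (simp add: abelian_number_field_def comm_group_def)
  have sub: "subfield K complex_ring" and fx: "{x \<in> K. \<forall>\<sigma>\<in>gal K. \<sigma> x = x} = \<rat>"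
    using ab by (auto simp: abelian_number_field_def galois_number_field_def number_field_def)
  show gf: "galois_ext K"
    by (rule subfield_galois_ext[OF sub m(2) cyclotomic_galois_ext[OF m(1)]]) (use fx in blast)
  interpret K: galois_ext K by (rule gf)
  define d where "d = nat \<bar>discriminant K\<bar>"
  have d0: "0 < d" using K.discriminant_nonzero by (simp add: d_def)
  have nKp: "\<not> K \<subseteq> cyclotomic_field (m div p)" if p: "Factorial_Ring.prime p" "p dvd m" for p
  proof (rule mmin)
    show "0 < m div p" using p m(1) by (simp add: dvd_imp_le div_greater_zero_iff prime_gt_0_nat)
    show "m div p < m" using m(1) prime_gt_1_nat[OF p(1)] by simp
  qed
  \<comment> \<open>Ramification makes \<open>nu rad\<close> at least 2, which forces
    \<open>p\<close> into the discriminant; the bound on \<open>p ^ K.deg\<close> uses that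
    \<open>nu rad\<close> is at most \<open>d\<close>.\<close>
  have dd: "p dvd d" and nb: "p ^ K.deg \<le> d ^ Suc d" if p: "Factorial_Ring.prime p" "p dvd m" for p
  proof -
    interpret Kp: galois_prime K p by unfold_locales (rule p(1))
    have ne: "Kp.rad \<noteq> Kp.PO" by (rule conductor_prime_ramified[OF gf m(2,1) p nKp[OF p]])
    then have "Kp.ram \<noteq> 1" using Kp.ram_eq_1_iff by blast
    then have "2 \<le> Kp.ram" using Kp.ram_pos by linarith
    then have "(2 :: nat) ^ 1 \<le> 2 ^ (Kp.ram - 1)" by (intro power_increasing) auto
    then have nu2: "2 \<le> Kp.nu Kp.rad" using Kp.ram_le_nu by simp
    have le: "Kp.nu Kp.rad \<le> p ^ multiplicity (int p) (discriminant K)" by (rule Kp.nu_rad_le)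
    have "multiplicity (int p) (discriminant K) \<noteq> 0" using nu2 le by (intro notI) simp
    then have "int p dvd discriminant K" by (metis not_dvd_imp_multiplicity_0)
    then have "int p dvd int d" by (simp add: d_def)
    then show "p dvd d" by (simp only: int_dvd_int_iff)
    have "int p ^ multiplicity (int p) (discriminant K) dvd discriminant K" by (rule multiplicity_dvd)
    then have "\<bar>int p ^ multiplicity (int p) (discriminant K)\<bar> \<le> \<bar>discriminant K\<bar>"
      using K.discriminant_nonzero by (rule dvd_imp_le_int[rotated])
    then have "int (p ^ multiplicity (int p) (discriminant K)) \<le> int d" by (simp add: d_def)
    then have "p ^ multiplicity (int p) (discriminant K) \<le> d" by (simp only: of_nat_le_iff)
    then have sd: "Kp.nu Kp.rad \<le> d" using le by linarith
    have "p ^ K.deg \<le> Kp.nu Kp.rad ^ Kp.nu Kp.rad * Kp.nu Kp.rad" by (rule Kp.deg_bound_nu[OF ne])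
    also have "\<dots> \<le> d ^ Kp.nu Kp.rad * d" using sd by (intro mult_mono power_mono) auto
    also have "\<dots> \<le> d ^ d * d" using sd d0 by (intro mult_right_mono power_increasing) auto
    finally show "p ^ K.deg \<le> d ^ Suc d" by (simp add: mult.commute)
  qed
  have "m dvd d * K.deg\<^sup>2"
  proof (rule multiplicity_le_imp_dvd)
    show "m \<noteq> 0" using m by simp
    fix p :: nat assume p: "Factorial_Ring.prime p"
    have pe: "prime_elem p" using p by simp
    have nz: "d \<noteq> 0" "K.deg\<^sup>2 \<noteq> 0" using d0 K.deg_pos by auto
    have mm: "multiplicity p (d * K.deg\<^sup>2) = multiplicity p d + 2 * multiplicity p K.deg"
      using nz K.deg_pos by (simp add: prime_elem_multiplicity_mult_distrib[OF pe] prime_elem_multiplicity_power_distrib[OF pe])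
    show "multiplicity p m \<le> multiplicity p (d * K.deg\<^sup>2)"
    proof (cases "p dvd m")
      case True
      \<comment> \<open>The exponent exceeds twice that of the degree by at most one, and
        \<open>p dvd d\<close> supplies this one.\<close>
      have "multiplicity p m \<le> 2 * multiplicity p K.deg + 1"
        using conductor_multiplicity[OF gf m(2,1) grp p True nKp[OF p True]] by (simp add: K.deg_def)
      moreover have "1 \<le> multiplicity p d"
        using dd[OF p True] d0 p by (intro multiplicity_geI) auto
      ultimately show ?thesis using mm by linarith
    next
      case False
      then show ?thesis by (simp add: not_dvd_imp_multiplicity_0)
    qed
  qed
  then have le: "m \<le> d * K.deg\<^sup>2" using d0 K.deg_pos by (intro dvd_imp_le) auto
  show "conductor K \<le> nat \<bar>discriminant K\<bar> * ((nat \<bar>discriminant K\<bar>) ^ (Suc (nat \<bar>discriminant K\<bar>)))\<^sup>2"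
  \<comment> \<open>For \<open>m = 1\<close> there is no prime divisor from which to bound the
    degree, but the claim is then trivial.\<close>
  proof (cases "m = 1")
    case True
    have "1 \<le> d * (d ^ Suc d)\<^sup>2" using d0 by simp
    then show ?thesis using True by (simp add: m_def d_def)
  next
    case False
    then obtain p where p: "Factorial_Ring.prime p" "p dvd m" using prime_factor_nat by blast
    have "K.deg < p ^ K.deg" using prime_gt_1_nat[OF p(1)] by (intro power_gt_expt) simp
    then have "K.deg \<le> d ^ Suc d" using nb[OF p] by linarith
    then have "d * K.deg\<^sup>2 \<le> d * (d ^ Suc d)\<^sup>2" by (intro mult_left_mono power_mono) auto
    then have "m \<le> d * (d ^ Suc d)\<^sup>2" using le by linarith
    then show ?thesis by (simp only: m_def d_def)
  qed
qed

section \<open>Growth of products over prime powers\<close>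

lemma multiplicity_int_nat_abs: "multiplicity (int p) d = multiplicity p (nat \<bar>d\<bar>)"
proof -
  have "int p ^ n dvd d \<longleftrightarrow> p ^ n dvd nat \<bar>d\<bar>" for n
  proof -
    have "p ^ n dvd nat \<bar>d\<bar> \<longleftrightarrow> int (p ^ n) dvd int (nat \<bar>d\<bar>)" by (simp only: int_dvd_int_iff)
    then show ?thesis by simp
  qed
  then show ?thesis by (simp add: multiplicity_def)
qed

text \<open>The usual argument for the divisor bound: factors with \<open>y p \<ge> B\<close> are at
  most the fourth root of \<open>y p\<close>, and the others belong to primes below
  \<open>B1\<close>, at most \<open>B1\<close> in number, each costing the constant factor
  \<open>c\<close>. Any exponent below 1/2 in place of 1/4 would serve the limit.\<close>

lemma prod_log_bound:
  "\<exists>C > 0. \<forall>d e. d \<noteq> 0 \<longrightarrow> (\<forall>p. Factorial_Ring.prime p \<longrightarrow> 0 < e p \<and> 2 ^ (e p - 1) \<le> p ^ multiplicity (int p) d) \<longrightarrow>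
     real (\<Prod>p\<in>{p. Factorial_Ring.prime p \<and> int p dvd d}. e p :: nat) \<le> C * \<bar>real_of_int d\<bar> powr (1/4)"
proof -
  have "eventually (\<lambda>x :: real. 1 + log 2 x \<le> x powr (1/4)) at_top" by real_asymp
  then obtain B where B: "\<And>x. B \<le> x \<Longrightarrow> 1 + log 2 x \<le> x powr (1/4)" unfolding eventually_at_top_linorder by blast
  define B1 where "B1 = nat \<lceil>max B 1\<rceil>"
  have B1: "max B 1 \<le> real B1" by (simp add: B1_def real_nat_ceiling_ge)
  define c where "c = 1 + log 2 B1"
  have c1: "1 \<le> c" using B1 by (simp add: c_def)
  define C where "C = c ^ B1"
  have "real (\<Prod>p\<in>{p. Factorial_Ring.prime p \<and> int p dvd d}. e p :: nat) \<le> C * \<bar>real_of_int d\<bar> powr (1/4)"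
    if d: "d \<noteq> 0" and e: "\<And>p. Factorial_Ring.prime p \<Longrightarrow> 0 < e p \<and> 2 ^ (e p - 1) \<le> p ^ multiplicity (int p) d" for d e
  proof -
    define Ps where "Ps = {p. Factorial_Ring.prime p \<and> int p dvd d}"
    define y where "y p = p ^ multiplicity (int p) d" for p
    have finP: "finite Ps"
    proof (rule finite_subset[of _ "{..nat \<bar>d\<bar>}"])
      show "Ps \<subseteq> {..nat \<bar>d\<bar>}"
      proof
        fix p assume "p \<in> Ps"
        then have "\<bar>int p\<bar> \<le> \<bar>d\<bar>" using d by (intro dvd_imp_le_int) (auto simp: Ps_def)
        then show "p \<in> {..nat \<bar>d\<bar>}" by simp
      qed
    qed simp
    have ely: "real (e p) \<le> 1 + log 2 (real (y p))" if "p \<in> Ps" for p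
    proof -
      have pp: "Factorial_Ring.prime p" using that by (simp add: Ps_def)
      have "real (e p - 1) = log 2 (2 ^ (e p - 1))" by simp
      also have "\<dots> \<le> log 2 (real (y p))"
      proof -
        have "(2 :: real) ^ (e p - 1) \<le> real (y p)"
          using e[OF pp] unfolding y_def by (metis of_nat_le_iff of_nat_numeral of_nat_power)
        then show ?thesis by (intro log_mono) auto
      qed
      finally show ?thesis using e[OF pp] by (simp add: of_nat_diff Suc_leI)
    qed
    have y1: "1 \<le> y p" if "p \<in> Ps" for p using that by (auto simp: Ps_def y_def prime_gt_0_nat Suc_leI)
    have fac: "real (e p) \<le> (if p < B1 then c else 1) * real (y p) powr (1/4)" if p: "p \<in> Ps" for p
    proof (cases "B \<le> real (y p)")
      case True
      then have "real (e p) \<le> real (y p) powr (1/4)" using ely[OF p] B[OF True] by linarith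
      moreover have "real (y p) powr (1/4) \<le> (if p < B1 then c else 1) * real (y p) powr (1/4)"
        using c1 mult_right_mono[of 1 c "real (y p) powr (1/4)"] by simp
      ultimately show ?thesis by linarith
    next
      case False
      have "p \<le> y p"
      proof -
        have "1 \<le> multiplicity (int p) d"
          using p d prime_gt_1_nat[of p] by (intro multiplicity_geI) (auto simp: Ps_def)
        then show ?thesis using p by (auto simp: y_def Ps_def prime_ge_1_nat[unfolded One_nat_def] intro!: self_le_power)
      qed
      moreover have yB: "real (y p) < real B1" using False B1 by linarith
      ultimately have "p < B1" by linarith
      have "real (e p) \<le> c"
      proof -
        have "log 2 (real (y p)) \<le> log 2 (real B1)" using yB y1[OF p] by (intro log_mono) auto
        then show ?thesis using ely[OF p] by (simp add: c_def)
      qed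
      moreover have "1 \<le> real (y p) powr (1/4)" using y1[OF p] by (intro ge_one_powr_ge_zero) auto
      then have "c * 1 \<le> c * real (y p) powr (1/4)" using c1 by (intro mult_left_mono) auto
      ultimately show ?thesis using \<open>p < B1\<close> by simp
    qed
    have "real (\<Prod>p\<in>Ps. e p) = (\<Prod>p\<in>Ps. real (e p))" by simp
    also have "\<dots> \<le> (\<Prod>p\<in>Ps. (if p < B1 then c else 1) * real (y p) powr (1/4))"
      using fac by (intro prod_mono) auto
    also have "\<dots> = (\<Prod>p\<in>Ps. if p < B1 then c else 1) * (\<Prod>p\<in>Ps. real (y p) powr (1/4))" by (rule prod.distrib)
    also have "(\<Prod>p\<in>Ps. real (y p) powr (1/4)) = \<bar>real_of_int d\<bar> powr (1/4)"
    proof -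
      have "(\<Prod>p\<in>Ps. y p) = nat \<bar>d\<bar>"
      proof -
        have Pf: "Ps = prime_factors (nat \<bar>d\<bar>)"
          using d by (auto simp: Ps_def in_prime_factors_iff nat_abs_dvd_iff dvd_nat_abs_iff)
        have "y p = p ^ multiplicity p (nat \<bar>d\<bar>)" if "p \<in> Ps" for p
        proof -
          have "multiplicity (int p) d = multiplicity p (nat \<bar>d\<bar>)"
            by (rule multiplicity_int_nat_abs)
          then show ?thesis by (simp add: y_def)
        qed
        then have "(\<Prod>p\<in>Ps. y p) = (\<Prod>p\<in>prime_factors (nat \<bar>d\<bar>). p ^ multiplicity p (nat \<bar>d\<bar>))"
          unfolding Pf[symmetric] by (rule prod.cong[OF refl])
        also have "\<dots> = nat \<bar>d\<bar>" using d by (subst prime_factorization_nat[symmetric]) auto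
        finally show ?thesis .
      qed
      then have "\<bar>real_of_int d\<bar> = real (\<Prod>p\<in>Ps. y p)" by simp
      then show ?thesis by (simp add: prod_powr_distrib)
    qed
    also have "(\<Prod>p\<in>Ps. if p < B1 then c else 1) \<le> C"
    proof -
      have "(\<Prod>p\<in>Ps. if p < B1 then c else 1) = (\<Prod>p\<in>Ps \<inter> {..<B1}. c)"
        using finP by (simp add: prod.If_cases) (simp add: lessThan_def)
      also have "\<dots> = c ^ card (Ps \<inter> {..<B1})" by simp
      also have "\<dots> \<le> c ^ B1"
      proof (rule power_increasing[OF _ c1])
        have "card (Ps \<inter> {..<B1}) \<le> card {..<B1}" by (intro card_mono) auto
        then show "card (Ps \<inter> {..<B1}) \<le> B1" by simp
      qed
      finally show ?thesis by (simp add: C_def)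
    qed
    then have "(\<Prod>p\<in>Ps. if p < B1 then c else 1) * \<bar>real_of_int d\<bar> powr (1/4) \<le> C * \<bar>real_of_int d\<bar> powr (1/4)"
      by (intro mult_right_mono) auto
    finally show ?thesis by (simp add: Ps_def)
  qed
  moreover have "0 < C" using c1 by (simp add: C_def)
  ultimately show ?thesis by blast
qed

theorem theorem3p14:
  fixes K :: "nat \<Rightarrow> complex set"
  assumes "\<And>j. abelian_number_field (K j)"
    and "filterlim (\<lambda>j. conductor (K j)) at_top sequentially"
  shows "(\<lambda>j. real (card (polya_group (K j))) / sqrt \<bar>real_of_int (discriminant (K j))\<bar>)
           \<longlonglongrightarrow> 0"
proof -
  define D where "D j = nat \<bar>discriminant (K j)\<bar>" for j
  have cond_gt: "\<forall>\<^sub>F j in sequentially. c < conductor (K j)" for c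
    using filterlim_at_top[THEN iffD1, OF assms(2), rule_format, of "Suc c"]
    by (rule eventually_mono) simp
  \<comment> \<open>Eventually the conductor exceeds the default value of \<open>LEAST\<close> on
    the empty predicate, so \<open>conductor_bound\<close> applies.\<close>
  note large = cond_gt[of "LEAST m :: nat. False"]
  have gf: "\<forall>\<^sub>F j in sequentially. galois_ext (K j)"
    using large by eventually_elim (rule conductor_bound(1)[OF assms(1)])
  \<comment> \<open>The bound for the conductor is monotone in \<open>D j\<close>, so
    \<open>D j < N\<close> would keep the conductor below a constant depending only on
    \<open>N\<close>.\<close>
  have Dinf: "filterlim D at_top sequentially"
    unfolding filterlim_at_top
  proof
    fix N :: nat
    show "\<forall>\<^sub>F j in sequentially. N \<le> D j"
      using cond_gt[of "N * (N ^ Suc N)\<^sup>2"] large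
    proof eventually_elim
      case (elim j)
      have le: "conductor (K j) \<le> D j * (D j ^ Suc (D j))\<^sup>2"
        using conductor_bound(2)[OF assms(1) elim(2)] by (simp add: D_def)
      show "N \<le> D j"
      proof (rule ccontr)
        assume "\<not> N \<le> D j"
        then have DN: "D j \<le> N" "0 < N" by auto
        have "D j ^ Suc (D j) \<le> N ^ Suc (D j)" using DN by (intro power_mono) auto
        also have "\<dots> \<le> N ^ Suc N" using DN by (intro power_increasing) auto
        finally have "D j * (D j ^ Suc (D j))\<^sup>2 \<le> N * (N ^ Suc N)\<^sup>2"
          using DN by (intro mult_mono power_mono) auto
        then show False using le elim(1) by linarith
      qed
    qed
  qed
  obtain C :: real where C0: "0 < C" and C: "\<forall>d e. d \<noteq> 0 \<longrightarrow>
     (\<forall>p. Factorial_Ring.prime p \<longrightarrow> 0 < e p \<and> 2 ^ (e p - 1) \<le> p ^ multiplicity (int p) d) \<longrightarrow>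
     real (\<Prod>p\<in>{p. Factorial_Ring.prime p \<and> int p dvd d}. e p :: nat) \<le> C * \<bar>real_of_int d\<bar> powr (1/4)"
    using prod_log_bound by (elim exE conjE)
  \<comment> \<open>The exponent is \<open>1/4 - 1/2\<close>: the size of the Polya group against
    the square root of the discriminant.\<close>
  have bound: "\<forall>\<^sub>F j in sequentially. real (card (polya_group (K j))) / sqrt \<bar>real_of_int (discriminant (K j))\<bar>
      \<le> C * real (D j) powr (- 1/4)"
    using gf
  proof eventually_elim
    case (elim j)
    interpret K: galois_ext "K j" by fact
    define d where "d = discriminant (K j)"
    have d0: "d \<noteq> 0" using K.discriminant_nonzero by (simp add: d_def)
    obtain e where e: "card (polya_group (K j)) \<le> (\<Prod>p\<in>{p. Factorial_Ring.prime p \<and> int p dvd d}. e p)"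
      "\<forall>p. Factorial_Ring.prime p \<longrightarrow> 0 < e p \<and> 2 ^ (e p - 1) \<le> p ^ multiplicity (int p) d"
      using K.card_polya_group unfolding d_def by blast
    have "real (card (polya_group (K j))) \<le> real (\<Prod>p\<in>{p. Factorial_Ring.prime p \<and> int p dvd d}. e p)"
      using e(1) by (simp only: of_nat_le_iff)
    also have "\<dots> \<le> C * \<bar>real_of_int d\<bar> powr (1/4)" 
      by (rule C[THEN spec, THEN spec, THEN mp, THEN mp, OF d0 e(2)])
    finally have 1: "real (card (polya_group (K j))) \<le> C * real (D j) powr (1/4)" by (simp add: D_def d_def)
    have Dd: "\<bar>real_of_int d\<bar> = real (D j)" by (simp add: D_def d_def)
    have Dpos: "0 < real (D j)" using d0 by (simp add: D_def d_def)
    have "real (card (polya_group (K j))) / sqrt \<bar>real_of_int d\<bar> \<le> C * real (D j) powr (1/4) / real (D j) powr (1/2)"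
      unfolding Dd using 1 Dpos by (simp add: powr_half_sqrt divide_right_mono)
    also have "\<dots> = C * real (D j) powr (1/4 - 1/2)" by (simp only: powr_diff times_divide_eq_right)
    finally show ?case by (simp add: d_def)
  qed
  have "((\<lambda>x :: real. C * x powr (- 1/4)) \<longlongrightarrow> 0) at_top" by real_asymp
  moreover have "filterlim (\<lambda>j. real (D j)) at_top sequentially"
    by (rule filterlim_compose[OF filterlim_real_sequentially Dinf])
  ultimately have lim: "(\<lambda>j. C * real (D j) powr (- 1/4)) \<longlonglongrightarrow> 0" by (rule filterlim_compose)
  show ?thesis
    by (rule tendsto_sandwich[OF _ bound tendsto_const lim]) simp
qed

end
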